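(* Assume (A1)--(A2) and (B1)--(B2). Let $W$ be a viscosity subsolution and $V$ a viscosity supersolution of (HJB), and suppose there exists a constant $\Lambda>0$ such that for all $(t,x),(s,y)\in[0,T]\times\mathcal D$, $$|W(t,x)|\vee|V(t,x)|\le \Lambda(1+|x(0)|+|x|_H)$$ and $$|W(t,x)-W(s,y)|\vee|V(t,x)-V(s,y)|\le \Lambda(1+|x(0)|+|x|_H+|y(0)|+|y|_H)\Big(|x(0)-y(0)|+|s-t|^{1/2}+\sup_{l\in[-\tau,0]}\Big|\int_l^0 (x(\theta)-y(\theta))\,d\theta\Big|\Big).$$ Then $W\le V$ on $[0,T]\times\mathcal D$.
   Context: **Spaces.** Fix $T>0$, $\tau>0$, $d\ge1$ and a metric space $U$. $H=L^2([-\tau,0];\mathbb R^d)$ with inner product $(\cdot,\cdot)_H$ and norm $|\cdot|_H$. $\mathcal D$ is the Banach space of bounded right-continuous functions $[-\tau,0]\to\mathbb R^d$ with norm $|\omega|_{\mathcal D}=\sup_\theta|\omega(\theta)|$; $\mathcal D^*$ is its dual. **Assumptions.** (A1) $F:[0,T]\times\mathbb R^d\times\mathbb R\times U\to\mathbb R^d$ is measurable and there is $L>0$ with $|F(t,x,u)|\le L(1+|x|)$ and $|F(t,x,u)-F(s,y,u)|\le L(|s-t|+|x-y|)$ for all $t,s\in[0,T]$, $x,y\in\mathbb R^d\times\mathbb R$, $u\in U$. (A2) $a\in W^{1,2}([-\tau,0];\mathbb R^d)$ with $a(-\tau)=0$, $b\in W^{1,2}([0,T];\mathbb R^{d\times d})$,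 and there is $L>0$ with $|b(s)-b(t)|\le L|s-t|$ for all $s,t\in[0,T]$. (B1) $q:[0,T]\times\mathbb R^d\times U\to\mathbb R$ and $\phi:\mathbb R^d\to\mathbb R$ are measurable and there is $L>0$ with $|q(t,x,u)|+|\phi(x)|\le L(1+|x|)$ for all $t,x,u$. (B2) There are $L>0$ and a local modulus of continuity $\rho$ (a continuous function $[0,\infty)^2\to[0,\infty)$, nondecreasing in each argument, with $\rho(0,r)=0$ for all $r$) such that $|q(t,x,u)-q(s,y,u)|+|\phi(x)-\phi(y)|\le L|x-y|+\rho(|s-t|,|x|\vee|y|)$ for all $t,s\in[0,T]$, $x,y\in\mathbb R^d$, $u\in U$. **Operator $\mathcal S$ and test functions.** For $x\in\mathcal D$ let $\widehat x(s)=x(s)$ for $s\in[-\tau,0)$, $\widehat x(s)=x(0)$ for $s\ge0$, and $\widehat x_h(\theta)=\widehat x(h+\theta)$, $\theta\in[-\tau,0]$. For Borel $f:\mathcal D\to\mathbb R$, $\mathcal S(f)(x)=\lim_{h\to0^+}\frac1h[f(\widehat x_h)-f(x)]$; $\widehat D(\mathcal S)$ is the set of $f$ for which this limit exists for all $x\in\mathcal D$. $D(\mathcal S)$ is the set of $g:[0,T]\times\mathcal D\to\mathbb R$ with $g(t,\cdot)\in\widehat D(\mathcal S)$ for all $t$, and $\mathcal S(g)(t,x)=\mathcal S(g(t,\cdot))(x)$. $\Phi$ is the set of $\varphi\in C^1([0,T]\times\mathcal D)\cap D(\mathcal S)$ for which there is $\varphi_0\in C^1([0,T]\times\mathbb R^d\times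 H)$ with $\varphi(t,x)=\varphi_0(t,x(0),x)$ for all $(t,x)\in[0,T]\times\mathcal D$. $\nabla_x\varphi(t,x)\in\mathcal D^*$ is the derivative in $x\in\mathcal D$, and $\varphi_t$ the time derivative. **HJB equation.** (HJB): $\frac{\partial}{\partial t}V(t,x)+\mathcal S(V)(t,x)+\mathbf H(t,x,\nabla_xV(t,x))=0$ for $t\in[0,T]$, $x\in\mathcal D$, with $V(T,x)=\phi(x(0))$, where for $(t,x,p)\in[0,T]\times\mathcal D\times\mathcal D^*$ $$\mathbf H(t,x,p)=\inf_{u\in U}\big[\langle[F(t,x(0),(a,x)_H,u)+b(t)x(-\tau)]1_0,\,p\rangle+q(t,x(0),u)\big],$$ $1_0:[-\tau,0]\to\mathbb R$ is the indicator function of $\{0\}$, and $\langle\cdot,\cdot\rangle$ is the duality pairing of $\mathcal D$ and $\mathcal D^*$. **Viscosity sub/supersolutions.** For open $Q\subset\mathbb R^d$, $\mathcal D_{\bar Q}=\{\omega\in\mathcal D:\omega(\theta)\in\bar Q\ \forall\theta\in[-\tau,0]\}$. For $0\le t\le\bar t\le T$ and $\omega,\bar\omega\in\mathcal D$, $(t,\omega)\otimes(\bar t,\bar\omega)=(\bar t,\tilde\omega)$ with $\tilde\omega(\theta)=\bar\omega(\theta)$ if $t-\bar t\le\theta\le0$ and $\tilde\omega(\theta)=\omega(\bar t-t+\theta)$ if $-\tau\le\theta<t-\bar t$. $w\in C([0,T]\times\mathcal D)$ is a viscosity subsolution (resp. supersolution) of (HJB) if $w(T,x)\le\phi(x(0))$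 (resp. $\ge$) for all $x$, and for every bounded open $Q\subset\mathbb R^d$, every $\varphi\in\Phi$ and every $(s,z)\in[0,T)\times\mathcal D_{\bar Q}$ with $z(0)\in Q$: whenever $(w-\varphi)(s,z)=\sup_{(t,x)\in[s,T]\times\mathcal D_{\bar Q}}(w-\varphi)((s,z)\otimes(t,x))$ (resp. $(w+\varphi)(s,z)=\inf_{(t,x)\in[s,T]\times\mathcal D_{\bar Q}}(w+\varphi)((s,z)\otimes(t,x))$), one has $\varphi_t(s,z)+\mathcal S(\varphi)(s,z)+\mathbf H(s,z,\nabla_x\varphi(s,z))\ge0$ (resp. $-\varphi_t(s,z)-\mathcal S(\varphi)(s,z)+\mathbf H(s,z,-\nabla_x\varphi(s,z))\le0$). *)

theory Defs
  imports "HOL-Analysis.Analysis" "HOL-Library.Function_Algebras"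
begin

section \<open>Calculus on a seminormed carrier\<close>

text \<open>
  The spaces \<open>\<D>\<close> and \<open>H\<close> depend on the real number \<open>\<tau>\<close>, so they are not types. They are
  represented by linear subspaces \<open>X\<close> of function spaces, with the norm \<open>N\<close> as a parameter. In the
  case of \<open>H\<close>, \<open>N\<close> is only a seminorm because classes modulo null sets are not formed. A function
  that is continuous with respect to a seminorm, and a functional that is bounded with respect to it,
  take equal values at points at distance zero, so the notions below are those of the quotient space.
  The topology that the library puts on function types is never used.
\<close>

instantiation "fun" :: (type, real_vector) real_vector
begin
definition scaleR_fun :: "real \<Rightarrow> ('a \<Rightarrow> 'b) \<Rightarrow> 'a \<Rightarrow> 'b"
  where "scaleR_fun c f = (\<lambda>x. c *\<^sub>R f x)"
instance
  by standard (simp_all add: scaleR_fun_def fun_eq_iff scaleR_add_right scaleR_add_left)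
end

definition dual_on :: "'a::real_vector set \<Rightarrow> ('a \<Rightarrow> real) \<Rightarrow> ('a \<Rightarrow> real) set" where
  "dual_on X N = {p. (\<forall>x\<in>X. \<forall>y\<in>X. p (x + y) = p x + p y) \<and>
                     (\<forall>c. \<forall>x\<in>X. p (c *\<^sub>R x) = c * p x) \<and>
                     (\<exists>C. \<forall>x\<in>X. \<bar>p x\<bar> \<le> C * N x)}"

definition dual_norm_on :: "'a::real_vector set \<Rightarrow> ('a \<Rightarrow> real) \<Rightarrow> ('a \<Rightarrow> real) \<Rightarrow> real" where
  "dual_norm_on X N p = (SUP x\<in>{x\<in>X. N x \<le> 1}. \<bar>p x\<bar>)"

definition has_frechet_on ::
  "'a::real_vector set \<Rightarrow> ('a \<Rightarrow> real) \<Rightarrow> ('a \<Rightarrow> real) \<Rightarrow> 'a \<Rightarrow> ('a \<Rightarrow> real) \<Rightarrow> bool" where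
  "has_frechet_on X N f x p \<longleftrightarrow> p \<in> dual_on X N \<and>
     (\<forall>e>0. \<exists>d>0. \<forall>y\<in>X. N (y - x) < d \<longrightarrow> \<bar>f y - f x - p (y - x)\<bar> \<le> e * N (y - x))"

text \<open>The values of the derivative are uniquely determined on \<open>X\<close> and are only used there.\<close>

definition frechet_on :: "'a::real_vector set \<Rightarrow> ('a \<Rightarrow> real) \<Rightarrow> ('a \<Rightarrow> real) \<Rightarrow> 'a \<Rightarrow> 'a \<Rightarrow> real" where
  "frechet_on X N f x = (SOME p. has_frechet_on X N f x p)"

definition time_deriv :: "real \<Rightarrow> (real \<Rightarrow> 'a \<Rightarrow> real) \<Rightarrow> real \<Rightarrow> 'a \<Rightarrow> real" where
  "time_deriv T g t x = vector_derivative (\<lambda>r. g r x) (at t within {0..T})"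

text \<open>The neighbourhood filter of \<open>(t, x)\<close> in \<open>[0,T] \<times> X\<close>.\<close>

definition nhds_on :: "real \<Rightarrow> 'a::real_vector set \<Rightarrow> ('a \<Rightarrow> real) \<Rightarrow> real \<Rightarrow> 'a \<Rightarrow> (real \<times> 'a) filter" where
  "nhds_on T X N t x =
     (INF e\<in>{0<..}. principal {(s, y). s \<in> {0..T} \<and> y \<in> X \<and> \<bar>s - t\<bar> < e \<and> N (y - x) < e})"

definition C0_on :: "real \<Rightarrow> 'a::real_vector set \<Rightarrow> ('a \<Rightarrow> real) \<Rightarrow> (real \<Rightarrow> 'a \<Rightarrow> real) set" where
  "C0_on T X N = {g. \<forall>t\<in>{0..T}. \<forall>x\<in>X. ((\<lambda>(s, y). g s y) \<longlongrightarrow> g t x) (nhds_on T X N t x)}"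

definition C1_on :: "real \<Rightarrow> 'a::real_vector set \<Rightarrow> ('a \<Rightarrow> real) \<Rightarrow> (real \<Rightarrow> 'a \<Rightarrow> real) set" where
  "C1_on T X N = {g. g \<in> C0_on T X N \<and>
     (\<forall>t\<in>{0..T}. \<forall>x\<in>X. (\<lambda>r. g r x) differentiable (at t within {0..T})) \<and>
     time_deriv T g \<in> C0_on T X N \<and>
     (\<forall>t\<in>{0..T}. \<forall>x\<in>X. \<exists>p. has_frechet_on X N (g t) x p) \<and>
     (\<forall>t\<in>{0..T}. \<forall>x\<in>X.
        ((\<lambda>(s, y). dual_norm_on X N (frechet_on X N (g s) y - frechet_on X N (g t) x)) \<longlongrightarrow> 0)
          (nhds_on T X N t x))}"

section \<open>The spaces \<open>\<D>\<close>, \<open>H\<close> and \<open>W\<close>\<close>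

text \<open>
  A function on \<open>[-\<tau>,0]\<close> in \<open>\<D>\<close> is identified with its extension by \<open>0\<close> to \<open>\<real>\<close>, which makes
  equality in \<open>\<D>\<close> equality of functions. At \<open>\<theta> = 0\<close> right-continuity within \<open>[-\<tau>,0]\<close> is
  vacuous, and so is the limit condition below.
\<close>

type_synonym 'd path = "real \<Rightarrow> real ^ 'd"

definition Dspace :: "real \<Rightarrow> ('d::finite) path set" where
  "Dspace \<tau> = {x. bounded (x ` {-\<tau>..0}) \<and>
                  (\<forall>\<theta>\<in>{-\<tau>..0}. (x \<longlongrightarrow> x \<theta>) (at \<theta> within {\<theta><..0})) \<and>
                  (\<forall>\<theta>. \<theta> \<notin> {-\<tau>..0} \<longrightarrow> x \<theta> = 0)}"

definition normD :: "real \<Rightarrow> ('d::finite) path \<Rightarrow> real" where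
  "normD \<tau> x = (SUP \<theta>\<in>{-\<tau>..0}. norm (x \<theta>))"

definition L2 :: "real \<Rightarrow> real \<Rightarrow> (real \<Rightarrow> 'a::euclidean_space) set" where
  "L2 \<alpha> \<beta> = {f \<in> borel_measurable (lebesgue_on {\<alpha>..\<beta>}).
               integrable (lebesgue_on {\<alpha>..\<beta>}) (\<lambda>t. (norm (f t))\<^sup>2)}"

definition Hspace :: "real \<Rightarrow> ('d::finite) path set" where
  "Hspace \<tau> = L2 (-\<tau>) 0"

definition innerH :: "real \<Rightarrow> ('d::finite) path \<Rightarrow> 'd path \<Rightarrow> real" where
  "innerH \<tau> x y = (LINT \<theta>|lebesgue_on {-\<tau>..0}. x \<theta> \<bullet> y \<theta>)"

definition normH :: "real \<Rightarrow> ('d::finite) path \<Rightarrow> real" where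
  "normH \<tau> x = sqrt (innerH \<tau> x x)"

definition norm_RdH :: "real \<Rightarrow> (real ^ 'd::finite) \<times> 'd path \<Rightarrow> real" where
  "norm_RdH \<tau> = (\<lambda>(v, h). sqrt ((norm v)\<^sup>2 + (normH \<tau> h)\<^sup>2))"

text \<open>
  Functions in \<open>W\<^sup>1\<^sup>,\<^sup>2\<close> have pointwise values, so they are the continuous representatives; \<open>g\<close> is
  the weak derivative, tested against \<open>C\<^sup>1\<close> functions with compact support in the open interval.
\<close>

definition W12 :: "real \<Rightarrow> real \<Rightarrow> (real \<Rightarrow> 'a::euclidean_space) set" where
  "W12 \<alpha> \<beta> = {f. continuous_on {\<alpha>..\<beta>} f \<and> f \<in> L2 \<alpha> \<beta> \<and>
     (\<exists>g\<in>L2 \<alpha> \<beta>. \<forall>\<psi> \<psi>' c d.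
        (\<forall>t. (\<psi> has_real_derivative \<psi>' t) (at t)) \<and> continuous_on UNIV \<psi>' \<and>
        \<alpha> < c \<and> c \<le> d \<and> d < \<beta> \<and> (\<forall>t. t \<notin> {c..d} \<longrightarrow> \<psi> t = 0) \<longrightarrow>
        (LINT t|lebesgue_on {\<alpha>..\<beta>}. \<psi>' t *\<^sub>R f t) =
          - (LINT t|lebesgue_on {\<alpha>..\<beta>}. \<psi> t *\<^sub>R g t))}"

section \<open>Standing assumptions\<close>

definition assm_A1 ::
  "real \<Rightarrow> (real \<Rightarrow> (real ^ 'd::finite) \<times> real \<Rightarrow> 'u::metric_space \<Rightarrow> real ^ 'd) \<Rightarrow> bool" where
  "assm_A1 T F \<longleftrightarrow>
     (\<lambda>(t, x, u). F t x u) \<in> borel_measurable (restrict_space borel ({0..T} \<times> UNIV)) \<and>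
     (\<exists>L>0. (\<forall>t\<in>{0..T}. \<forall>x u. norm (F t x u) \<le> L * (1 + norm x)) \<and>
            (\<forall>t\<in>{0..T}. \<forall>s\<in>{0..T}. \<forall>x y u.
               norm (F t x u - F s y u) \<le> L * (\<bar>s - t\<bar> + norm (x - y))))"

definition assm_A2 ::
  "real \<Rightarrow> real \<Rightarrow> ('d::finite) path \<Rightarrow> (real \<Rightarrow> real ^ 'd ^ 'd) \<Rightarrow> bool" where
  "assm_A2 T \<tau> a b \<longleftrightarrow> a \<in> W12 (-\<tau>) 0 \<and> a (-\<tau>) = 0 \<and> b \<in> W12 0 T \<and>
     (\<exists>L>0. \<forall>t\<in>{0..T}. \<forall>s\<in>{0..T}. norm (b s - b t) \<le> L * \<bar>s - t\<bar>)"

definition assm_B1 ::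
  "real \<Rightarrow> (real \<Rightarrow> real ^ 'd::finite \<Rightarrow> 'u::metric_space \<Rightarrow> real) \<Rightarrow> (real ^ 'd \<Rightarrow> real) \<Rightarrow> bool" where
  "assm_B1 T q \<phi> \<longleftrightarrow>
     (\<lambda>(t, x, u). q t x u) \<in> borel_measurable (restrict_space borel ({0..T} \<times> UNIV)) \<and>
     \<phi> \<in> borel_measurable borel \<and>
     (\<exists>L>0. \<forall>t\<in>{0..T}. \<forall>x u. \<bar>q t x u\<bar> + \<bar>\<phi> x\<bar> \<le> L * (1 + norm x))"

definition local_modulus :: "(real \<Rightarrow> real \<Rightarrow> real) \<Rightarrow> bool" where
  "local_modulus \<rho> \<longleftrightarrow>
     continuous_on ({0..} \<times> {0..}) (\<lambda>(s, r). \<rho> s r) \<and>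
     (\<forall>s\<ge>0. \<forall>r\<ge>0. 0 \<le> \<rho> s r) \<and>
     (\<forall>r\<ge>0. mono_on {0..} (\<lambda>s. \<rho> s r)) \<and>
     (\<forall>s\<ge>0. mono_on {0..} (\<rho> s)) \<and>
     (\<forall>r\<ge>0. \<rho> 0 r = 0)"

definition assm_B2 ::
  "real \<Rightarrow> (real \<Rightarrow> real ^ 'd::finite \<Rightarrow> 'u::metric_space \<Rightarrow> real) \<Rightarrow> (real ^ 'd \<Rightarrow> real) \<Rightarrow> bool" where
  "assm_B2 T q \<phi> \<longleftrightarrow>
     (\<exists>L>0. \<exists>\<rho>. local_modulus \<rho> \<and>
        (\<forall>t\<in>{0..T}. \<forall>s\<in>{0..T}. \<forall>x y u.
           \<bar>q t x u - q s y u\<bar> + \<bar>\<phi> x - \<phi> y\<bar>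
             \<le> L * norm (x - y) + \<rho> \<bar>s - t\<bar> (max (norm x) (norm y))))"

section \<open>The operator \<open>\<S>\<close> and the test functions\<close>

definition borelD :: "real \<Rightarrow> ('d::finite) path measure" where
  "borelD \<tau> = sigma (Dspace \<tau>)
     {A. A \<subseteq> Dspace \<tau> \<and>
         (\<forall>x\<in>A. \<exists>e>0. \<forall>y\<in>Dspace \<tau>. normD \<tau> (y - x) < e \<longrightarrow> y \<in> A)}"

text \<open>\<open>hat_shift \<tau> h x\<close> is the path \<open>\<theta> \<mapsto> x\<close>-hat \<open>(h + \<theta>)\<close>, for \<open>h \<ge> 0\<close>.\<close>

definition hat_shift :: "real \<Rightarrow> real \<Rightarrow> ('d::finite) path \<Rightarrow> 'd path" where
  "hat_shift \<tau> h x = (\<lambda>\<theta>. if \<theta> \<in> {-\<tau>..0} then if h + \<theta> < 0 then x (h + \<theta>) else x 0 else 0)"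

definition S_op :: "real \<Rightarrow> (('d::finite) path \<Rightarrow> real) \<Rightarrow> 'd path \<Rightarrow> real" where
  "S_op \<tau> f x = Lim (at_right 0) (\<lambda>h. (f (hat_shift \<tau> h x) - f x) / h)"

definition Dhat_S :: "real \<Rightarrow> (('d::finite) path \<Rightarrow> real) set" where
  "Dhat_S \<tau> = {f \<in> borel_measurable (borelD \<tau>).
     \<forall>x\<in>Dspace \<tau>. \<exists>l. ((\<lambda>h. (f (hat_shift \<tau> h x) - f x) / h) \<longlongrightarrow> l) (at_right 0)}"

definition D_S :: "real \<Rightarrow> real \<Rightarrow> (real \<Rightarrow> ('d::finite) path \<Rightarrow> real) set" where
  "D_S T \<tau> = {g. \<forall>t\<in>{0..T}. g t \<in> Dhat_S \<tau>}"

definition test_functions :: "real \<Rightarrow> real \<Rightarrow> (real \<Rightarrow> ('d::finite) path \<Rightarrow> real) set" where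
  "test_functions T \<tau> = {\<phi> \<in> C1_on T (Dspace \<tau>) (normD \<tau>) \<inter> D_S T \<tau>.
     \<exists>\<phi>\<^sub>0 \<in> C1_on T (UNIV \<times> Hspace \<tau>) (norm_RdH \<tau>).
       \<forall>t\<in>{0..T}. \<forall>x\<in>Dspace \<tau>. \<phi> t x = \<phi>\<^sub>0 t (x 0, x)}"

abbreviation grad :: "real \<Rightarrow> (real \<Rightarrow> ('d::finite) path \<Rightarrow> real) \<Rightarrow> real \<Rightarrow> 'd path \<Rightarrow> 'd path \<Rightarrow> real" where
  "grad \<tau> \<phi> t x \<equiv> frechet_on (Dspace \<tau>) (normD \<tau>) (\<phi> t) x"

section \<open>Hamiltonian and viscosity solutions\<close>

definition at_zero :: "real ^ 'd::finite \<Rightarrow> 'd path" where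
  "at_zero v = (\<lambda>\<theta>. if \<theta> = 0 then v else 0)"

definition Hamiltonian ::
  "real \<Rightarrow> ('d::finite) path \<Rightarrow> (real \<Rightarrow> real ^ 'd ^ 'd) \<Rightarrow>
   (real \<Rightarrow> (real ^ 'd) \<times> real \<Rightarrow> 'u::metric_space \<Rightarrow> real ^ 'd) \<Rightarrow>
   (real \<Rightarrow> real ^ 'd \<Rightarrow> 'u \<Rightarrow> real) \<Rightarrow>
   real \<Rightarrow> 'd path \<Rightarrow> ('d path \<Rightarrow> real) \<Rightarrow> real" where
  "Hamiltonian \<tau> a b F q t x p =
     (INF u. p (at_zero (F t (x 0, innerH \<tau> a x) u + b t *v x (-\<tau>))) + q t (x 0) u)"

definition Dbar :: "real \<Rightarrow> (real ^ 'd::finite) set \<Rightarrow> 'd path set" where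
  "Dbar \<tau> Q = {\<omega> \<in> Dspace \<tau>. \<forall>\<theta>\<in>{-\<tau>..0}. \<omega> \<theta> \<in> closure Q}"

text \<open>The path component of \<open>(t, \<omega>) \<otimes> (t', \<omega>')\<close>, whose time component is \<open>t'\<close>.\<close>

definition concat_path :: "real \<Rightarrow> real \<Rightarrow> ('d::finite) path \<Rightarrow> real \<Rightarrow> 'd path \<Rightarrow> 'd path" where
  "concat_path \<tau> t \<omega> t' \<omega>' =
     (\<lambda>\<theta>. if \<theta> \<in> {-\<tau>..0} then if t - t' \<le> \<theta> then \<omega>' \<theta> else \<omega> (t' - t + \<theta>) else 0)"

text \<open>
  The supremum and infimum are taken in the extended reals, since a real-valued supremum has no
  meaning on an unbounded set.
\<close>

definition viscosity_subsolution ::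
  "real \<Rightarrow> real \<Rightarrow> ('d::finite) path \<Rightarrow> (real \<Rightarrow> real ^ 'd ^ 'd) \<Rightarrow>
   (real \<Rightarrow> (real ^ 'd) \<times> real \<Rightarrow> 'u::metric_space \<Rightarrow> real ^ 'd) \<Rightarrow>
   (real \<Rightarrow> real ^ 'd \<Rightarrow> 'u \<Rightarrow> real) \<Rightarrow> (real ^ 'd \<Rightarrow> real) \<Rightarrow>
   (real \<Rightarrow> 'd path \<Rightarrow> real) \<Rightarrow> bool" where
  "viscosity_subsolution T \<tau> a b F q \<phi> w \<longleftrightarrow>
     w \<in> C0_on T (Dspace \<tau>) (normD \<tau>) \<and>
     (\<forall>x\<in>Dspace \<tau>. w T x \<le> \<phi> (x 0)) \<and>
     (\<forall>Q \<psi> s z.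
        open Q \<and> bounded Q \<and> \<psi> \<in> test_functions T \<tau> \<and>
        s \<in> {0..<T} \<and> z \<in> Dbar \<tau> Q \<and> z 0 \<in> Q \<and>
        ereal (w s z - \<psi> s z) =
          (SUP (t, x)\<in>{s..T} \<times> Dbar \<tau> Q.
             ereal (w t (concat_path \<tau> s z t x) - \<psi> t (concat_path \<tau> s z t x))) \<longrightarrow>
        time_deriv T \<psi> s z + S_op \<tau> (\<psi> s) z + Hamiltonian \<tau> a b F q s z (grad \<tau> \<psi> s z) \<ge> 0)"

definition viscosity_supersolution ::
  "real \<Rightarrow> real \<Rightarrow> ('d::finite) path \<Rightarrow> (real \<Rightarrow> real ^ 'd ^ 'd) \<Rightarrow>
   (real \<Rightarrow> (real ^ 'd) \<times> real \<Rightarrow> 'u::metric_space \<Rightarrow> real ^ 'd) \<Rightarrow>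
   (real \<Rightarrow> real ^ 'd \<Rightarrow> 'u \<Rightarrow> real) \<Rightarrow> (real ^ 'd \<Rightarrow> real) \<Rightarrow>
   (real \<Rightarrow> 'd path \<Rightarrow> real) \<Rightarrow> bool" where
  "viscosity_supersolution T \<tau> a b F q \<phi> w \<longleftrightarrow>
     w \<in> C0_on T (Dspace \<tau>) (normD \<tau>) \<and>
     (\<forall>x\<in>Dspace \<tau>. w T x \<ge> \<phi> (x 0)) \<and>
     (\<forall>Q \<psi> s z.
        open Q \<and> bounded Q \<and> \<psi> \<in> test_functions T \<tau> \<and>
        s \<in> {0..<T} \<and> z \<in> Dbar \<tau> Q \<and> z 0 \<in> Q \<and>
        ereal (w s z + \<psi> s z) =
          (INF (t, x)\<in>{s..T} \<times> Dbar \<tau> Q.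
             ereal (w t (concat_path \<tau> s z t x) + \<psi> t (concat_path \<tau> s z t x))) \<longrightarrow>
        - time_deriv T \<psi> s z - S_op \<tau> (\<psi> s) z
          + Hamiltonian \<tau> a b F q s z (- grad \<tau> \<psi> s z) \<le> 0)"

end

(* Doubling of variables, adapted to paths. Maximizing over extensions of frozen pasts needs no
   variational principle: along a chain of extensions the paths are restrictions of one function of
   absolute time, so a Brezis-Browder ordering argument gives exact maximum points.

   The discrete delay b(t) x(-tau) cannot be controlled by a weak norm. It is removed by penalizing
   x(0) + B(t) (integral of x) with a C^1 approximation B of b, whose derivative along the dynamics
   contains no x(-tau) up to |b - B|. The rest of the path is coupled by the squared L^2 norm of the
   primitive l |-> integral of x - y over [l,0]; its derivative along the shift produces
   -|integral of x - y|^2, which absorbs the remaining terms, and (a, x - y) is controlled because a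
   is absolutely continuous and vanishes at -tau. The weight of (t - s)^2 is sent to infinity first:
   its two time derivatives cancel. *)

theory Submission
  imports Defs
begin

section \<open>Differentiable functions on seminormed spaces\<close>

text \<open>Maximizing over extensions compares a point only with its own continuations, and the
  diagonal pairs, which bound the penalty in the classical argument, are not among them. The search
  therefore starts \<epsilon>-close to the supremum over all pairs. The penalty controls an L2 norm
  of the primitive of x - y, whereas the continuity of W and V is expressed by its supremum; paths
  with values in a ball of radius R have Lipschitz primitives, and interpolation bridges the gap.
  The radius is fixed in advance by the penalty \<alpha> exp(- C t) (1 + |x(0)|^2 + |x|^2), which
  beats linear growth and places the present values inside the ball. Along the dynamics its last
  term yields - |x(-\<tau>)|^2, exactly what Young's inequality asks for the delay term, and C
  absorbs the rest. The terms \<kappa> (T - t) provide the strict sign that is finally contradicted.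
  Replacing b by B with error \<eta> = 1/\<beta>^2 costs a multiple of \<beta> |D| \<eta>, where D
  is the difference of the compensated values. The weight of (t - s)^2 depends on the modulus of
  continuity of B', so it is chosen after \<beta> and B.\<close>

locale seminormed_space =
  fixes X :: "'a::real_vector set" and N :: "'a \<Rightarrow> real"
  assumes zero_mem: "0 \<in> X"
    and add_mem: "\<And>x y. x \<in> X \<Longrightarrow> y \<in> X \<Longrightarrow> x + y \<in> X"
    and scale_mem: "\<And>c x. x \<in> X \<Longrightarrow> c *\<^sub>R x \<in> X"
    and norm_scale: "\<And>c x. x \<in> X \<Longrightarrow> N (c *\<^sub>R x) = \<bar>c\<bar> * N x"
    and norm_add: "\<And>x y. x \<in> X \<Longrightarrow> y \<in> X \<Longrightarrow> N (x + y) \<le> N x + N y"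
begin

lemma minus_mem: "x \<in> X \<Longrightarrow> - x \<in> X"
  using scale_mem[of x "-1"] by simp

lemma diff_mem: "x \<in> X \<Longrightarrow> y \<in> X \<Longrightarrow> x - y \<in> X"
  using add_mem[of x "- y"] minus_mem by simp

lemma norm_zero: "N 0 = 0"
  using norm_scale[OF zero_mem, of 0] by simp

lemma norm_minus: "x \<in> X \<Longrightarrow> N (- x) = N x"
  using norm_scale[of x "-1"] by simp

lemma norm_nonneg: "x \<in> X \<Longrightarrow> 0 \<le> N x"
  using norm_add[of x "- x"] norm_minus[of x] minus_mem[of x] norm_zero by simp

end

lemma eventually_nhds_on:
  "eventually P (nhds_on T X N t x) \<longleftrightarrow>
    (\<exists>e>0. \<forall>s\<in>{0..T}. \<forall>y\<in>X. \<bar>s - t\<bar> < e \<longrightarrow> N (y - x) < e \<longrightarrow> P (s, y))"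
proof -
  let ?A = "\<lambda>e. {(s, y). s \<in> {0..T} \<and> y \<in> X \<and> \<bar>s - t\<bar> < e \<and> N (y - x) < e}"
  have "eventually P (nhds_on T X N t x) \<longleftrightarrow> (\<exists>e\<in>{0<..}. eventually P (principal (?A e)))"
    unfolding nhds_on_def
  proof (rule eventually_INF_base)
    show "\<exists>c\<in>{0<..}. principal (?A c) \<le> inf (principal (?A a)) (principal (?A b))"
      if "a \<in> {0<..}" "b \<in> {0<..}" for a b
      using that by (intro bexI[of _ "min a b"]) (auto simp: inf_principal)
  qed auto
  also have "\<dots> \<longleftrightarrow> (\<exists>e>0. \<forall>s\<in>{0..T}. \<forall>y\<in>X. \<bar>s - t\<bar> < e \<longrightarrow> N (y - x) < e \<longrightarrow> P (s, y))"
    unfolding eventually_principal Bex_def by blast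
  finally show ?thesis .
qed

text \<open>The spatial counterpart of \<open>nhds_on\<close> at a fixed time. With it the remainder
  of a derivative becomes a null function times \<open>N (y - x)\<close>, so remainders of sums and
  products are handled by limit rules instead of nested epsilons.\<close>

definition nbhd_on :: "'a::real_vector set \<Rightarrow> ('a \<Rightarrow> real) \<Rightarrow> 'a \<Rightarrow> 'a filter" where
  "nbhd_on X N x = (INF e\<in>{0<..}. principal {y \<in> X. N (y - x) < e})"

lemma eventually_nbhd_on:
  "eventually P (nbhd_on X N x) \<longleftrightarrow> (\<exists>e>0. \<forall>y\<in>X. N (y - x) < e \<longrightarrow> P y)"
  unfolding nbhd_on_def
proof (subst eventually_INF_base, goal_cases)
  case (2 a b)
  then show ?case
    by (intro bexI[of _ "min a b"]) (auto simp: inf_principal)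
qed (auto simp: eventually_principal)


lemma eventually_nhds_on_mem:
  "\<forall>\<^sub>F z in nhds_on T X N t x. fst z \<in> {0..T} \<and> snd z \<in> X"
  unfolding eventually_nhds_on by (intro exI[of _ 1]) auto

context seminormed_space
begin

lemma tendsto_norm_nbhd_on: "x \<in> X \<Longrightarrow> ((\<lambda>y. N (y - x)) \<longlongrightarrow> 0) (nbhd_on X N x)"
  unfolding tendsto_iff eventually_nbhd_on
  by (auto simp: dist_real_def diff_mem norm_nonneg)

lemma tendsto_norm_nhds_on: "x \<in> X \<Longrightarrow> ((\<lambda>z. N (snd z - x)) \<longlongrightarrow> 0) (nhds_on T X N t x)"
  unfolding tendsto_iff eventually_nhds_on
  by (auto simp: dist_real_def diff_mem norm_nonneg)


section \<open>Frechet derivatives with null remainders: uniqueness, sums, products\<close>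

lemma has_frechet_onD:
  assumes "has_frechet_on X N f x p" "x \<in> X"
  obtains K where "(K \<longlongrightarrow> 0) (nbhd_on X N x)"
    "\<forall>\<^sub>F y in nbhd_on X N x. \<bar>f y - f x - p (y - x)\<bar> \<le> K y * N (y - x)"
proof
  \<comment> \<open>Where \<open>N (y - x) = 0\<close> the defining estimate makes the remainder
    vanish, so the default 0 loses nothing; the estimate with e = 1 near \<open>x\<close> settles
    this case below.\<close>
  let ?K = "\<lambda>y. if N (y - x) = 0 then 0 else \<bar>f y - f x - p (y - x)\<bar> / N (y - x)"
  have *: "\<forall>e>0. \<exists>d>0. \<forall>y\<in>X. N (y - x) < d \<longrightarrow> \<bar>f y - f x - p (y - x)\<bar> \<le> e * N (y - x)"
    using assms(1) by (auto simp: has_frechet_on_def)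
  show "(?K \<longlongrightarrow> 0) (nbhd_on X N x)"
    unfolding tendsto_iff eventually_nbhd_on
  proof (intro allI impI)
    fix e :: real assume "e > 0"
    then have "e / 2 > 0" by simp
    with * obtain d where d: "d > 0" "\<And>y. y\<in>X \<Longrightarrow> N (y - x) < d \<Longrightarrow>
        \<bar>f y - f x - p (y - x)\<bar> \<le> e / 2 * N (y - x)" by meson
    have "dist (?K y) 0 < e" if "y \<in> X" "N (y - x) < d" for y
    proof (cases "N (y - x) = 0")
      case False
      then have pos: "N (y - x) > 0" using norm_nonneg[of "y - x"] diff_mem that assms(2) by fastforce
      have "?K y \<le> e / 2" using d(2)[OF that] pos by (simp add: divide_simps)
      also have "\<dots> < e" using \<open>e > 0\<close> by simp
      finally show ?thesis using pos by (simp add: dist_real_def)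
    qed (use \<open>e > 0\<close> in auto)
    then show "\<exists>d>0. \<forall>y\<in>X. N (y - x) < d \<longrightarrow> dist (?K y) 0 < e" using d(1) by blast
  qed
  obtain d where d: "d > 0" "\<And>y. y\<in>X \<Longrightarrow> N (y - x) < d \<Longrightarrow>
        \<bar>f y - f x - p (y - x)\<bar> \<le> 1 * N (y - x)" using * zero_less_one by blast
  show "\<forall>\<^sub>F y in nbhd_on X N x. \<bar>f y - f x - p (y - x)\<bar> \<le> ?K y * N (y - x)"
    unfolding eventually_nbhd_on
    by (rule exI[of _ d]) (use d in fastforce)
qed

lemma has_frechet_onI:
  assumes "p \<in> dual_on X N" "x \<in> X" "(K \<longlongrightarrow> 0) (nbhd_on X N x)"
    "\<forall>\<^sub>F y in nbhd_on X N x. \<bar>f y - f x - p (y - x)\<bar> \<le> K y * N (y - x)"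
  shows "has_frechet_on X N f x p"
  unfolding has_frechet_on_def
proof (intro conjI allI impI assms)
  fix e :: real assume "e > 0"
  with assms(3) have "\<forall>\<^sub>F y in nbhd_on X N x. \<bar>K y\<bar> < e" by (auto simp: tendsto_iff)
  with assms(4) have "\<forall>\<^sub>F y in nbhd_on X N x. \<bar>K y\<bar> < e \<and> \<bar>f y - f x - p (y - x)\<bar> \<le> K y * N (y - x)"
    by eventually_elim auto
  then obtain d where d: "d > 0" "\<And>y. y\<in>X \<Longrightarrow> N (y - x) < d \<Longrightarrow>
        \<bar>K y\<bar> < e \<and> \<bar>f y - f x - p (y - x)\<bar> \<le> K y * N (y - x)"
    unfolding eventually_nbhd_on by blast
  have "\<bar>f y - f x - p (y - x)\<bar> \<le> e * N (y - x)" if "y \<in> X" "N (y - x) < d" for y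
  proof -
    have "K y * N (y - x) \<le> e * N (y - x)"
      using d(2)[OF that] norm_nonneg[of "y - x"] diff_mem that assms(2) by (intro mult_right_mono) auto
    then show ?thesis using d(2)[OF that] by linarith
  qed
  then show "\<exists>d>0. \<forall>y\<in>X. N (y - x) < d \<longrightarrow> \<bar>f y - f x - p (y - x)\<bar> \<le> e * N (y - x)"
    using d(1) by blast
qed

lemma has_frechet_on_unique:
  assumes p: "has_frechet_on X N f x p" and q: "has_frechet_on X N f x q" and x: "x \<in> X" and v: "v \<in> X"
  shows "p v = q v"
proof -
  have le: "\<bar>p v - q v\<bar> \<le> e * (2 * N v)" if e: "e > 0" for e
  proof -
    obtain d1 where d1: "d1 > 0" "\<And>y. y\<in>X \<Longrightarrow> N (y - x) < d1 \<Longrightarrow> \<bar>f y - f x - p (y - x)\<bar> \<le> e * N (y - x)"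
      using p e unfolding has_frechet_on_def by meson
    obtain d2 where d2: "d2 > 0" "\<And>y. y\<in>X \<Longrightarrow> N (y - x) < d2 \<Longrightarrow> \<bar>f y - f x - q (y - x)\<bar> \<le> e * N (y - x)"
      using q e unfolding has_frechet_on_def by meson
    \<comment> \<open>The \<open>+ 1\<close> covers directions with \<open>N v = 0\<close>; the
      point \<open>x + c *\<^sub>R v\<close> lies within both radii, and homogeneity then cancels
      \<open>c\<close>.\<close>
    define c where "c = min d1 d2 / (N v + 1)"
    have Nv: "N v \<ge> 0" using norm_nonneg v by simp
    have c: "c > 0" using d1(1) d2(1) Nv by (simp add: c_def)
    have "c * N v < min d1 d2"
    proof -
      have "c * N v < c * (N v + 1)" using c by simp
      also have "\<dots> = min d1 d2" using Nv by (simp add: c_def)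
      finally show ?thesis .
    qed
    then have lt: "N ((x + c *\<^sub>R v) - x) < min d1 d2" using c v by (simp add: norm_scale)
    have mem: "x + c *\<^sub>R v \<in> X" using x v add_mem scale_mem by simp
    have pc: "p (c *\<^sub>R v) = c * p v" "q (c *\<^sub>R v) = c * q v"
      using p q v by (auto simp: has_frechet_on_def dual_on_def)
    have Nc: "N (c *\<^sub>R v) = c * N v" using c v by (simp add: norm_scale)
    have "\<bar>c * p v - c * q v\<bar> \<le> 2 * (e * (c * N v))"
      using d1(2)[OF mem] d2(2)[OF mem] lt pc Nc by simp
    also have "\<bar>c * p v - c * q v\<bar> = c * \<bar>p v - q v\<bar>"
      using c by (simp add: right_diff_distrib[symmetric] abs_mult)
    also have "2 * (e * (c * N v)) = c * (e * (2 * N v))" by simp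
    finally show ?thesis using c by simp
  qed
  have "((\<lambda>e. e * (2 * N v)) \<longlongrightarrow> 0 * (2 * N v)) (at_right 0)" by (intro tendsto_intros)
  moreover have "\<forall>\<^sub>F e in at_right (0::real). \<bar>p v - q v\<bar> \<le> e * (2 * N v)"
    using eventually_at_right_less[of "0::real"] by eventually_elim (rule le)
  ultimately have "\<bar>p v - q v\<bar> \<le> 0 * (2 * N v)" by (rule tendsto_lowerbound) auto
  then show ?thesis by simp
qed

lemma dual_on_add: "p \<in> dual_on X N \<Longrightarrow> q \<in> dual_on X N \<Longrightarrow> (\<lambda>v. p v + q v) \<in> dual_on X N"
  unfolding dual_on_def
proof (safe, goal_cases)
  case (3 C D)
  then have "\<bar>p x + q x\<bar> \<le> (C + D) * N x" if "x \<in> X" for x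
    using that by (smt (verit, best) distrib_right)
  then show ?case by blast
qed (auto simp: algebra_simps)

lemma dual_on_scale: "p \<in> dual_on X N \<Longrightarrow> (\<lambda>v. c * p v) \<in> dual_on X N"
  unfolding dual_on_def
proof (safe, goal_cases)
  case (3 C)
  then have "\<bar>c * p x\<bar> \<le> (\<bar>c\<bar> * C) * N x" if "x \<in> X" for x
    using that mult_left_mono[of "\<bar>p x\<bar>" "C * N x" "\<bar>c\<bar>"] by (simp add: abs_mult mult.assoc)
  then show ?case by blast
qed (auto simp: algebra_simps)

lemma dual_on_bound:
  assumes "p \<in> dual_on X N"
  obtains C where "C \<ge> 0" "\<And>x. x \<in> X \<Longrightarrow> \<bar>p x\<bar> \<le> C * N x"
proof -
  obtain C where C: "\<forall>x\<in>X. \<bar>p x\<bar> \<le> C * N x" using assms by (auto simp: dual_on_def)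
  have "\<bar>p x\<bar> \<le> max C 0 * N x" if "x \<in> X" for x
    using C that norm_nonneg[OF that] mult_right_mono[of C "max C 0" "N x"] by force
  then show ?thesis using that[of "max C 0"] by simp
qed

lemma has_frechet_on_mult:
  assumes f: "has_frechet_on X N f x p" and g: "has_frechet_on X N g x q" and x: "x \<in> X"
  shows "has_frechet_on X N (\<lambda>y. f y * g y) x (\<lambda>v. f x * q v + g x * p v)"
proof -
  obtain K where K: "(K \<longlongrightarrow> 0) (nbhd_on X N x)"
    "\<forall>\<^sub>F y in nbhd_on X N x. \<bar>f y - f x - p (y - x)\<bar> \<le> K y * N (y - x)"
    by (rule has_frechet_onD[OF f x])
  obtain J where J: "(J \<longlongrightarrow> 0) (nbhd_on X N x)"
    "\<forall>\<^sub>F y in nbhd_on X N x. \<bar>g y - g x - q (y - x)\<bar> \<le> J y * N (y - x)"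
    by (rule has_frechet_onD[OF g x])
  have pq: "p \<in> dual_on X N" "q \<in> dual_on X N" using f g by (auto simp: has_frechet_on_def)
  obtain C where C: "C \<ge> 0" "\<And>v. v \<in> X \<Longrightarrow> \<bar>p v\<bar> \<le> C * N v" using dual_on_bound pq(1) by metis
  obtain D where D: "D \<ge> 0" "\<And>v. v \<in> X \<Longrightarrow> \<bar>q v\<bar> \<le> D * N v" using dual_on_bound pq(2) by metis
  \<comment> \<open>The first two summands come from the remainders of \<open>g\<close> and
    \<open>f\<close>, the last one from the product of the two increments, each of order
    \<open>N (y - x)\<close>.\<close>
  let ?M = "\<lambda>y. \<bar>f x\<bar> * J y + \<bar>g x\<bar> * K y + ((C + K y) * (D + J y)) * N (y - x)"
  show ?thesis
  proof (rule has_frechet_onI[OF dual_on_add[OF dual_on_scale dual_on_scale] x])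
    have "(?M \<longlongrightarrow> \<bar>f x\<bar> * 0 + \<bar>g x\<bar> * 0 + ((C + 0) * (D + 0)) * 0) (nbhd_on X N x)"
      by (intro tendsto_intros K J tendsto_norm_nbhd_on x)
    then show "(?M \<longlongrightarrow> 0) (nbhd_on X N x)" by simp
    have "\<forall>\<^sub>F y in nbhd_on X N x. y \<in> X" unfolding eventually_nbhd_on using zero_less_one by blast
    with K(2) J(2)
    show "\<forall>\<^sub>F y in nbhd_on X N x. \<bar>f y * g y - f x * g x - (f x * q (y - x) + g x * p (y - x))\<bar> \<le> ?M y *
        N (y - x)"
    proof eventually_elim
      case (elim y)
      let ?h = "y - x"
      have h: "?h \<in> X" using diff_mem elim x by simp
      have n: "N ?h \<ge> 0" using norm_nonneg h by simp
      have "\<bar>f y - f x\<bar> \<le> (C + K y) * N ?h" using C(2)[OF h] elim by (simp add: algebra_simps)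
      moreover have "\<bar>g y - g x\<bar> \<le> (D + J y) * N ?h" using D(2)[OF h] elim by (simp add: algebra_simps)
      ultimately have "\<bar>(f y - f x) * (g y - g x)\<bar> \<le> ((C + K y) * N ?h) * ((D + J y) * N ?h)"
        unfolding abs_mult by (intro mult_mono) auto
      moreover have "\<bar>f x * (g y - g x - q ?h)\<bar> \<le> \<bar>f x\<bar> * (J y * N ?h)"
        unfolding abs_mult by (intro mult_left_mono elim) auto
      moreover have "\<bar>g x * (f y - f x - p ?h)\<bar> \<le> \<bar>g x\<bar> * (K y * N ?h)"
        unfolding abs_mult by (intro mult_left_mono elim) auto
      moreover have "f y * g y - f x * g x - (f x * q ?h + g x * p ?h) =
        f x * (g y - g x - q ?h) + g x * (f y - f x - p ?h) + (f y - f x) * (g y - g x)"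
        by (simp add: algebra_simps)
      ultimately show ?case by (simp add: algebra_simps)
    qed
  qed (use pq in auto)
qed

lemma has_frechet_on_add:
  assumes f: "has_frechet_on X N f x p" and g: "has_frechet_on X N g x q" and x: "x \<in> X"
  shows "has_frechet_on X N (\<lambda>y. f y + g y) x (\<lambda>v. p v + q v)"
proof -
  obtain K where K: "(K \<longlongrightarrow> 0) (nbhd_on X N x)"
    "\<forall>\<^sub>F y in nbhd_on X N x. \<bar>f y - f x - p (y - x)\<bar> \<le> K y * N (y - x)"
    by (rule has_frechet_onD[OF f x])
  obtain J where J: "(J \<longlongrightarrow> 0) (nbhd_on X N x)"
    "\<forall>\<^sub>F y in nbhd_on X N x. \<bar>g y - g x - q (y - x)\<bar> \<le> J y * N (y - x)"
    by (rule has_frechet_onD[OF g x])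
  show ?thesis
  proof (rule has_frechet_onI[OF dual_on_add x])
    have "((\<lambda>y. K y + J y) \<longlongrightarrow> 0 + 0) (nbhd_on X N x)" by (intro tendsto_intros K J)
    then show "((\<lambda>y. K y + J y) \<longlongrightarrow> 0) (nbhd_on X N x)" by simp
    show "\<forall>\<^sub>F y in nbhd_on X N x. \<bar>f y + g y - (f x + g x) - (p (y - x) + q (y - x))\<bar> \<le> (K y + J y) * N
        (y - x)"
      using K(2) J(2) by eventually_elim (simp add: algebra_simps)
  qed (use f g in \<open>auto simp: has_frechet_on_def\<close>)
qed

end

text \<open>\<open>C1_on\<close> speaks of derivatives picked by \<open>SOME\<close> and of a
  supremum of functionals. Here the derivatives are explicit candidates, and continuity of the
  gradient is expressed by a null factor \<open>K\<close> in front of \<open>N v\<close>, uniformly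
  in the direction. This form is closed under sums, products and bounded linear substitutions;
  \<open>C1_witness_C1_on\<close> returns to \<open>C1_on\<close>.\<close>

definition C1_witness ::
  "real \<Rightarrow> 'a::real_vector set \<Rightarrow> ('a \<Rightarrow> real) \<Rightarrow> (real \<Rightarrow> 'a \<Rightarrow> real) \<Rightarrow> (real \<Rightarrow> 'a \<Rightarrow> real) \<Rightarrow>
    (real \<Rightarrow> 'a \<Rightarrow> 'a \<Rightarrow> real) \<Rightarrow> bool" where
  "C1_witness T X N g g' p \<longleftrightarrow> (\<forall>t\<in>{0..T}. \<forall>x\<in>X.
     ((\<lambda>z. g (fst z) (snd z)) \<longlongrightarrow> g t x) (nhds_on T X N t x) \<and>
     ((\<lambda>r. g r x) has_real_derivative g' t x) (at t within {0..T}) \<and>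
     ((\<lambda>z. g' (fst z) (snd z)) \<longlongrightarrow> g' t x) (nhds_on T X N t x) \<and>
     has_frechet_on X N (g t) x (p t x) \<and>
     (\<exists>K. (K \<longlongrightarrow> 0) (nhds_on T X N t x) \<and>
        (\<forall>\<^sub>F z in nhds_on T X N t x. \<forall>v\<in>X. \<bar>p (fst z) (snd z) v - p t x v\<bar> \<le> K z * N v)))"

lemma C1_witness_gradient:
  assumes "C1_witness T X N g g' p" "t \<in> {0..T}" "x \<in> X"
  shows "\<exists>K. (K \<longlongrightarrow> 0) (nhds_on T X N t x) \<and>
        (\<forall>\<^sub>F z in nhds_on T X N t x. \<forall>v\<in>X. \<bar>p (fst z) (snd z) v - p t x v\<bar> \<le> K z * N v)"
  using assms unfolding C1_witness_def by blast

context seminormed_space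
begin

lemma C1_witness_add:
  assumes "C1_witness T X N f f' p" "C1_witness T X N g g' q"
  shows "C1_witness T X N (\<lambda>t x. f t x + g t x) (\<lambda>t x. f' t x + g' t x) (\<lambda>t x v. p t x v + q t x v)"
  unfolding C1_witness_def
proof (intro ballI conjI)
  fix t x assume tx: "t \<in> {0..T}" "x \<in> X"
  let ?F = "nhds_on T X N t x"
  obtain K where K: "(K \<longlongrightarrow> 0) ?F" "\<forall>\<^sub>F z in ?F. \<forall>v\<in>X. \<bar>p (fst z) (snd z) v - p t x v\<bar> \<le> K z * N v"
    using C1_witness_gradient[OF assms(1) tx] by blast
  obtain J where J: "(J \<longlongrightarrow> 0) ?F" "\<forall>\<^sub>F z in ?F. \<forall>v\<in>X. \<bar>q (fst z) (snd z) v - q t x v\<bar> \<le> J z * N v"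
    using C1_witness_gradient[OF assms(2) tx] by blast
  show "\<exists>K. (K \<longlongrightarrow> 0) ?F \<and> (\<forall>\<^sub>F z in ?F. \<forall>v\<in>X. \<bar>p (fst z) (snd z) v + q (fst z) (snd z) v - (p t x v + q t
      x v)\<bar> \<le> K z * N v)"
  proof (intro exI[of _ "\<lambda>z. K z + J z"] conjI)
    show "((\<lambda>z. K z + J z) \<longlongrightarrow> 0) ?F" using tendsto_add[OF K(1) J(1)] by simp
    show "\<forall>\<^sub>F z in ?F. \<forall>v\<in>X. \<bar>p (fst z) (snd z) v + q (fst z) (snd z) v - (p t x v + q t x v)\<bar> \<le> (K z +
        J z) * N v"
      using K(2) J(2) by eventually_elim (smt (verit, best) distrib_right)
  qed
qed (use assms in \<open>auto simp: C1_witness_def intro!: tendsto_intros derivative_eq_intros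
    has_frechet_on_add\<close>)

lemma C1_witness_mult:
  assumes "C1_witness T X N f f' p" "C1_witness T X N g g' q"
  shows "C1_witness T X N (\<lambda>t x. f t x * g t x) (\<lambda>t x. f t x * g' t x + g t x * f' t x)
     (\<lambda>t x v. f t x * q t x v + g t x * p t x v)"
  unfolding C1_witness_def
proof (intro ballI conjI)
  fix t x assume tx: "t \<in> {0..T}" "x \<in> X"
  let ?F = "nhds_on T X N t x"
  obtain K where K: "(K \<longlongrightarrow> 0) ?F" "\<forall>\<^sub>F z in ?F. \<forall>v\<in>X. \<bar>p (fst z) (snd z) v - p t x v\<bar> \<le> K z * N v"
    using C1_witness_gradient[OF assms(1) tx] by blast
  obtain J where J: "(J \<longlongrightarrow> 0) ?F" "\<forall>\<^sub>F z in ?F. \<forall>v\<in>X. \<bar>q (fst z) (snd z) v - q t x v\<bar> \<le> J z * N v"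
    using C1_witness_gradient[OF assms(2) tx] by blast
  have f: "((\<lambda>z. f (fst z) (snd z)) \<longlongrightarrow> f t x) ?F" and g: "((\<lambda>z. g (fst z) (snd z)) \<longlongrightarrow> g t x) ?F"
    and pq: "p t x \<in> dual_on X N" "q t x \<in> dual_on X N"
    using assms tx by (auto simp: C1_witness_def has_frechet_on_def)
  obtain C where C: "C \<ge> 0" "\<And>v. v \<in> X \<Longrightarrow> \<bar>p t x v\<bar> \<le> C * N v" using dual_on_bound pq(1) by metis
  obtain D where D: "D \<ge> 0" "\<And>v. v \<in> X \<Longrightarrow> \<bar>q t x v\<bar> \<le> D * N v" using dual_on_bound pq(2) by metis
  let ?M = "\<lambda>z. \<bar>f (fst z) (snd z)\<bar> * J z + \<bar>f (fst z) (snd z) - f t x\<bar> * D +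
              (\<bar>g (fst z) (snd z)\<bar> * K z + \<bar>g (fst z) (snd z) - g t x\<bar> * C)"
  show "\<exists>K. (K \<longlongrightarrow> 0) ?F \<and> (\<forall>\<^sub>F z in ?F. \<forall>v\<in>X. \<bar>f (fst z) (snd z) * q (fst z) (snd z) v + g (fst z) (snd
      z) * p (fst z) (snd z) v
     - (f t x * q t x v + g t x * p t x v)\<bar> \<le> K z * N v)"
  proof (intro exI[of _ ?M] conjI)
    have "(?M \<longlongrightarrow> \<bar>f t x\<bar> * 0 + \<bar>f t x - f t x\<bar> * D + (\<bar>g t x\<bar> * 0 + \<bar>g t x - g t x\<bar> * C)) ?F"
      by (intro tendsto_intros f g K J)
    then show "(?M \<longlongrightarrow> 0) ?F" by simp
    show "\<forall>\<^sub>F z in ?F. \<forall>v\<in>X. \<bar>f (fst z) (snd z) * q (fst z) (snd z) v + g (fst z) (snd z) * p (fst z)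
        (snd z) v
       - (f t x * q t x v + g t x * p t x v)\<bar> \<le> ?M z * N v"
      using K(2) J(2)
    proof (eventually_elim, intro ballI, goal_cases)
      case (1 z v)
      have aux: "\<bar>a * b - c * d\<bar> \<le> \<bar>a\<bar> * (j * n) + \<bar>a - c\<bar> * (e * n)"
        if "\<bar>b - d\<bar> \<le> j * n" "\<bar>d\<bar> \<le> e * n" for a b c d j e n :: real
      proof -
        have "\<bar>a * (b - d)\<bar> \<le> \<bar>a\<bar> * (j * n)" unfolding abs_mult by (intro mult_left_mono that) auto
        moreover have "\<bar>(a - c) * d\<bar> \<le> \<bar>a - c\<bar> * (e * n)" unfolding abs_mult by (intro mult_left_mono
            that) auto
        moreover have "a * b - c * d = a * (b - d) + (a - c) * d" by (simp add: algebra_simps)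
        ultimately show ?thesis by linarith
      qed
      have "\<bar>f (fst z) (snd z) * q (fst z) (snd z) v - f t x * q t x v\<bar> \<le>
         \<bar>f (fst z) (snd z)\<bar> * (J z * N v) + \<bar>f (fst z) (snd z) - f t x\<bar> * (D * N v)"
        by (rule aux) (use 1 D in auto)
      moreover have "\<bar>g (fst z) (snd z) * p (fst z) (snd z) v - g t x * p t x v\<bar> \<le>
         \<bar>g (fst z) (snd z)\<bar> * (K z * N v) + \<bar>g (fst z) (snd z) - g t x\<bar> * (C * N v)"
        by (rule aux) (use 1 C in auto)
      ultimately have "\<bar>f (fst z) (snd z) * q (fst z) (snd z) v + g (fst z) (snd z) * p (fst z) (snd z) v
         - (f t x * q t x v + g t x * p t x v)\<bar> \<le>
         (\<bar>f (fst z) (snd z)\<bar> * (J z * N v) + \<bar>f (fst z) (snd z) - f t x\<bar> * (D * N v)) +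
         (\<bar>g (fst z) (snd z)\<bar> * (K z * N v) + \<bar>g (fst z) (snd z) - g t x\<bar> * (C * N v))"
        by linarith
      then show ?case by (simp add: algebra_simps)
    qed
  qed
  show "((\<lambda>r. f r x * g r x) has_real_derivative f t x * g' t x + g t x * f' t x) (at t within {0..T})"
    using assms tx by (auto simp: C1_witness_def intro!: derivative_eq_intros)
qed (use assms in \<open>auto simp: C1_witness_def intro!: tendsto_intros has_frechet_on_mult\<close>)

section \<open>Building blocks: functions of time, quadratic and linear forms, substitutions\<close>

lemma C1_witness_time:
  assumes "\<And>t. t \<in> {0..T} \<Longrightarrow> (k has_real_derivative k' t) (at t within {0..T})" "continuous_on {0..T} k'"
  shows "C1_witness T X N (\<lambda>t x. k t) (\<lambda>t x. k' t) (\<lambda>t x v. 0)"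
  unfolding C1_witness_def
proof (intro ballI conjI)
  fix t x assume tx: "t \<in> {0..T}" "x \<in> X"
  have *: "((\<lambda>z. f (fst z)) \<longlongrightarrow> f t) (nhds_on T X N t x)" if cont: "continuous_on {0..T} f" for f :: "real
      \<Rightarrow> real"
    unfolding tendsto_iff
  proof (intro allI impI)
    fix e :: real assume "e > 0"
    then obtain d where "d > 0" "\<And>s. s \<in> {0..T} \<Longrightarrow> dist s t < d \<Longrightarrow> dist (f s) (f t) < e"
      using cont[unfolded continuous_on_iff, rule_format, OF tx(1) \<open>e > 0\<close>] by blast
    then show "\<forall>\<^sub>F z in nhds_on T X N t x. dist (f (fst z)) (f t) < e"
      unfolding eventually_nhds_on by (intro exI[of _ d]) (auto simp: dist_real_def)
  qed
  show "((\<lambda>z. k (fst z)) \<longlongrightarrow> k t) (nhds_on T X N t x)"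
    by (rule *) (use assms(1) DERIV_continuous_on in blast)
  show "((\<lambda>z. k' (fst z)) \<longlongrightarrow> k' t) (nhds_on T X N t x)" by (rule *) fact
  show "(k has_real_derivative k' t) (at t within {0..T})" using assms tx by simp
  show "has_frechet_on X N (\<lambda>x. k t) x (\<lambda>v. 0)"
    using norm_nonneg diff_mem tx by (auto simp: has_frechet_on_def dual_on_def intro!: exI[of _ 0]
        exI[of _ 1])
  show "\<exists>K. (K \<longlongrightarrow> 0) (nhds_on T X N t x) \<and>
               (\<forall>\<^sub>F z in nhds_on T X N t x. \<forall>v\<in>X. \<bar>(0::real) - 0\<bar> \<le> K z * N v)"
    by (intro exI[of _ "\<lambda>_. 0"]) auto
qed

lemma C1_witness_const: "C1_witness T X N (\<lambda>t x. c) (\<lambda>t x. 0) (\<lambda>t x v. 0)"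
  by (rule C1_witness_time) auto

lemma C1_witness_quadratic:
  assumes add: "\<And>x y z. x \<in> X \<Longrightarrow> y \<in> X \<Longrightarrow> z \<in> X \<Longrightarrow> B (x + y) z = B x z + B y z"
    and scale: "\<And>c x y. x \<in> X \<Longrightarrow> y \<in> X \<Longrightarrow> B (c *\<^sub>R x) y = c * B x y"
    and sym: "\<And>x y. x \<in> X \<Longrightarrow> y \<in> X \<Longrightarrow> B x y = B y x"
    and bound: "\<And>x y. x \<in> X \<Longrightarrow> y \<in> X \<Longrightarrow> \<bar>B x y\<bar> \<le> K * N x * N y"
    and w: "w \<in> X"
  shows "C1_witness T X N (\<lambda>t x. B (x - w) (x - w)) (\<lambda>t x. 0) (\<lambda>t x v. 2 * B (x - w) v)"
proof -
  have add2: "B x (y + z) = B x y + B x z" if "x \<in> X" "y \<in> X" "z \<in> X" for x y z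
    using that add[of y z x] sym[of x] add_mem by simp
  have scale2: "B x (c *\<^sub>R y) = c * B x y" if "x \<in> X" "y \<in> X" for x y c
    using that scale[of y x c] sym[of x] scale_mem by simp
  define M where "M = max K 0"
  have bd: "\<bar>B x y\<bar> \<le> M * N x * N y" if "x \<in> X" "y \<in> X" for x y
  proof -
    have "K * (N x * N y) \<le> M * (N x * N y)"
      by (intro mult_right_mono) (auto simp: M_def norm_nonneg that)
    then show ?thesis using bound[OF that] by (simp add: mult.assoc)
  qed
  have M: "M \<ge> 0" by (simp add: M_def)
  have expand: "B (y - w) (y - w) - B (x - w) (x - w) - 2 * B (x - w) (y - x) = B (y - x) (y - x)"
    if "x \<in> X" "y \<in> X" for x y
  proof -
    let ?u = "x - w" and ?h = "y - x"
    have "y - w = ?u + ?h" by simp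
    moreover have "B (?u + ?h) (?u + ?h) = B ?u ?u + B ?u ?h + (B ?u ?h + B ?h ?h)"
      using that w by (simp only: add add2 add_mem diff_mem sym[of ?h ?u])
    ultimately show ?thesis by simp
  qed
  have diff1: "B x z - B y z = B (x - y) z" if "x \<in> X" "y \<in> X" "z \<in> X" for x y z
    using add[of "x - y" y z] that diff_mem by simp
  show ?thesis
    unfolding C1_witness_def
  proof (intro ballI conjI)
    fix t x assume tx: "t \<in> {0..T}" "x \<in> X"
    let ?F = "nhds_on T X N t x"
    have dual: "(\<lambda>v. 2 * B (x - w) v) \<in> dual_on X N"
    proof -
      have "\<bar>2 * B (x - w) v\<bar> \<le> (2 * M * N (x - w)) * N v" if "v \<in> X" for v
        using bd[of "x - w" v] tx w that diff_mem by simp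
      then show ?thesis
        unfolding dual_on_def using add2 scale2 tx w diff_mem
        by (auto simp: algebra_simps intro!: exI[of _ "2 * M * N (x - w)"])
    qed
    show "has_frechet_on X N (\<lambda>x. B (x - w) (x - w)) x (\<lambda>v. 2 * B (x - w) v)"
    proof (rule has_frechet_onI[OF dual tx(2)])
      show "((\<lambda>y. M * N (y - x)) \<longlongrightarrow> 0) (nbhd_on X N x)"
        using tendsto_mult_left[OF tendsto_norm_nbhd_on[OF tx(2)], of M] by simp
      show "\<forall>\<^sub>F y in nbhd_on X N x. \<bar>B (y - w) (y - w) - B (x - w) (x - w) - 2 * B (x - w) (y - x)\<bar>
                 \<le> M * N (y - x) * N (y - x)"
        unfolding eventually_nbhd_on
        by (intro exI[of _ 1]) (use expand bd diff_mem tx in auto)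
    qed
    let ?G = "\<lambda>z. 2 * (M * N (x - w)) * N (snd z - x) + M * N (snd z - x) * N (snd z - x)"
    show "((\<lambda>z. B (snd z - w) (snd z - w)) \<longlongrightarrow> B (x - w) (x - w)) ?F"
    proof (rule LIM_zero_cancel, rule Lim_null_comparison)
      have "(?G \<longlongrightarrow> 2 * (M * N (x - w)) * 0 + M * 0 * 0) ?F"
        by (intro tendsto_intros tendsto_norm_nhds_on tx)
      then show "(?G \<longlongrightarrow> 0) ?F" by simp
      show "\<forall>\<^sub>F z in ?F. norm (B (snd z - w) (snd z - w) - B (x - w) (x - w)) \<le> ?G z"
        using eventually_nhds_on_mem[of T X N t x]
      proof eventually_elim
        case (elim z)
        then have z: "snd z \<in> X" by simp
        show ?case using expand[OF tx(2) z] bd[of "snd z - x" "snd z - x"] bd[of "x - w" "snd z - x"]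
          diff_mem z tx w by simp
      qed
    qed
    show "\<exists>K. (K \<longlongrightarrow> 0) ?F \<and> (\<forall>\<^sub>F z in ?F. \<forall>v\<in>X. \<bar>2 * B (snd z - w) v - 2 * B (x - w) v\<bar> \<le> K z * N v)"
    proof (intro exI[of _ "\<lambda>z. (2 * M) * N (snd z - x)"] conjI)
      show "((\<lambda>z. (2 * M) * N (snd z - x)) \<longlongrightarrow> 0) ?F"
        using tendsto_mult_left[OF tendsto_norm_nhds_on[OF tx(2)], of "2 * M"] by simp
      show "\<forall>\<^sub>F z in ?F. \<forall>v\<in>X. \<bar>2 * B (snd z - w) v - 2 * B (x - w) v\<bar> \<le> ((2 * M) * N (snd z - x)) * N v"
        using eventually_nhds_on_mem[of T X N t x]
      proof (eventually_elim, intro ballI, goal_cases)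
        case (1 z v)
        then show ?case using diff1[of "snd z - w" "x - w" v] bd[of "snd z - x" v] diff_mem tx w by simp
      qed
    qed
  qed auto
qed

lemma C1_witness_linear:
  assumes l: "l \<in> dual_on X N"
  shows "C1_witness T X N (\<lambda>t x. l x) (\<lambda>t x. 0) (\<lambda>t x v. l v)"
  unfolding C1_witness_def
proof (intro ballI conjI)
  fix t x assume tx: "t \<in> {0..T}" "x \<in> X"
  have l_diff: "l y - l x = l (y - x)" if "y \<in> X" for y
  proof -
    have "l ((y - x) + x) = l (y - x) + l x"
      using l that tx diff_mem unfolding dual_on_def by blast
    then show ?thesis by simp
  qed
  obtain C where C: "C \<ge> 0" "\<And>v. v \<in> X \<Longrightarrow> \<bar>l v\<bar> \<le> C * N v" using dual_on_bound l by metis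
  show "((\<lambda>z. l (snd z)) \<longlongrightarrow> l x) (nhds_on T X N t x)"
  proof (rule LIM_zero_cancel, rule Lim_null_comparison)
    show "((\<lambda>z. C * N (snd z - x)) \<longlongrightarrow> 0) (nhds_on T X N t x)"
      using tendsto_mult_left[OF tendsto_norm_nhds_on[OF tx(2)], of C] by simp
    show "\<forall>\<^sub>F z in nhds_on T X N t x. norm (l (snd z) - l x) \<le> C * N (snd z - x)"
      using eventually_nhds_on_mem by eventually_elim (use l_diff C diff_mem tx in auto)
  qed
  show "has_frechet_on X N l x l"
    by (rule has_frechet_onI[OF l tx(2), of "\<lambda>_. 0"])
       (auto simp: eventually_nbhd_on l_diff intro!: exI[of _ 1])
  show "\<exists>K. (K \<longlongrightarrow> 0) (nhds_on T X N t x) \<and>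
               (\<forall>\<^sub>F z in nhds_on T X N t x. \<forall>v\<in>X. \<bar>l v - l v\<bar> \<le> K z * N v)"
    by (intro exI[of _ "\<lambda>_. 0"]) auto
qed auto

lemma C1_witness_sum:
  assumes "finite I" "\<And>i. i \<in> I \<Longrightarrow> C1_witness T X N (f i) (f' i) (p i)"
  shows "C1_witness T X N (\<lambda>t x. \<Sum>i\<in>I. f i t x) (\<lambda>t x. \<Sum>i\<in>I. f' i t x) (\<lambda>t x v. \<Sum>i\<in>I. p i t x v)"
  using assms
proof (induction I rule: finite_induct)
  case empty
  then show ?case using C1_witness_const[of _ 0] by simp
next
  case (insert i I)
  then show ?case using C1_witness_add[of T "f i" "f' i" "p i"] by simp
qed

text \<open>Applied with \<open>J x = (x 0, x)\<close>: the calculus is done once on the product of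
  R^d with H and carried over to the paths, the two representations that a member of
  \<open>test_functions\<close> must have.\<close>

lemma C1_witness_pullback:
  fixes Y :: "'b::real_vector set" and M and J :: "'a \<Rightarrow> 'b"
  assumes w: "C1_witness T Y M g g' p"
    and J: "\<And>x. x \<in> X \<Longrightarrow> J x \<in> Y"
    and J_diff: "\<And>x y. x \<in> X \<Longrightarrow> y \<in> X \<Longrightarrow> J (x - y) = J x - J y"
    and J_add: "\<And>x y. x \<in> X \<Longrightarrow> y \<in> X \<Longrightarrow> J (x + y) = J x + J y"
    and J_scale: "\<And>c x. x \<in> X \<Longrightarrow> J (c *\<^sub>R x) = c *\<^sub>R J x"
    and bd: "\<And>x. x \<in> X \<Longrightarrow> M (J x) \<le> C * N x"
    and Y: "seminormed_space Y M"
  shows "C1_witness T X N (\<lambda>t x. g t (J x)) (\<lambda>t x. g' t (J x)) (\<lambda>t x v. p t (J x) (J v))"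
proof -
  interpret Y: seminormed_space Y M by fact
  \<comment> \<open>A bound that is positive whatever the sign of \<open>C\<close>, so that radii
    can be divided by it.\<close>
  define D where "D = max C 1"
  have D: "D > 0" by (simp add: D_def)
  have bd': "M (J x) \<le> D * N x" if "x \<in> X" for x
    using bd[OF that] norm_nonneg[OF that] mult_right_mono[of C D "N x"] by (simp add: D_def)
  show ?thesis
    unfolding C1_witness_def
  proof (intro ballI conjI)
    fix t x assume tx: "t \<in> {0..T}" "x \<in> X"
    have lim: "LIM z nhds_on T X N t x. (fst z, J (snd z)) :> nhds_on T Y M t (J x)"
      unfolding filterlim_iff eventually_nhds_on
    proof safe
      fix P and e :: real assume e: "e > 0"
        and P: "\<forall>s\<in>{0..T}. \<forall>y\<in>Y. \<bar>s - t\<bar> < e \<longrightarrow> M (y - J x) < e \<longrightarrow> P (s, y)"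
      have "P (s, J y)" if s: "s \<in> {0..T}" "y \<in> X" "\<bar>s - t\<bar> < min e (e / D)" "N (y - x) < min e (e / D)"
          for s y
      proof -
        have "M (J y - J x) \<le> D * N (y - x)" using bd'[of "y - x"] J_diff tx s diff_mem by auto
        also have "\<dots> < e" using s(4) D by (simp add: field_simps)
        finally show ?thesis using P s J by auto
      qed
      then show "\<exists>e>0. \<forall>s\<in>{0..T}. \<forall>y\<in>X. \<bar>s - t\<bar> < e \<longrightarrow> N (y - x) < e \<longrightarrow> P (fst (s, y), J (snd (s, y)))"
        using e D by (intro exI[of _ "min e (e / D)"]) auto
    qed
    show "((\<lambda>z. g (fst z) (J (snd z))) \<longlongrightarrow> g t (J x)) (nhds_on T X N t x)"
      using filterlim_compose[OF _ lim, of "\<lambda>z. g (fst z) (snd z)"] w tx J by (auto simp: C1_witness_def)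
    show "((\<lambda>z. g' (fst z) (J (snd z))) \<longlongrightarrow> g' t (J x)) (nhds_on T X N t x)"
      using filterlim_compose[OF _ lim, of "\<lambda>z. g' (fst z) (snd z)"] w tx J by (auto simp: C1_witness_def)
    show "((\<lambda>r. g r (J x)) has_real_derivative g' t (J x)) (at t within {0..T})"
      using w tx J by (auto simp: C1_witness_def)
    obtain K where K: "(K \<longlongrightarrow> 0) (nhds_on T Y M t (J x))"
      "\<forall>\<^sub>F z in nhds_on T Y M t (J x). \<forall>v\<in>Y. \<bar>p (fst z) (snd z) v - p t (J x) v\<bar> \<le> K z * M v"
      using C1_witness_gradient[OF w tx(1) J[OF tx(2)]] by blast
    show "\<exists>K. (K \<longlongrightarrow> 0) (nhds_on T X N t x) \<and>
      (\<forall>\<^sub>F z in nhds_on T X N t x. \<forall>v\<in>X. \<bar>p (fst z) (J (snd z)) (J v) - p t (J x) (J v)\<bar> \<le> K z * N v)"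
    proof (intro exI[of _ "\<lambda>z. \<bar>K (fst z, J (snd z))\<bar> * D"] conjI)
      have "((\<lambda>z. \<bar>K (fst z, J (snd z))\<bar> * D) \<longlongrightarrow> \<bar>0\<bar> * D) (nhds_on T X N t x)"
        by (intro tendsto_intros filterlim_compose[OF K(1) lim])
      then show "((\<lambda>z. \<bar>K (fst z, J (snd z))\<bar> * D) \<longlongrightarrow> 0) (nhds_on T X N t x)" by simp
      show "\<forall>\<^sub>F z in nhds_on T X N t x. \<forall>v\<in>X. \<bar>p (fst z) (J (snd z)) (J v) - p t (J x) (J v)\<bar> \<le>
         (\<bar>K (fst z, J (snd z))\<bar> * D) * N v"
        using K(2)[THEN filterlim_iff[THEN iffD1, OF lim, rule_format]]
      proof (eventually_elim, intro ballI, goal_cases)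
        case (1 z v)
        then have "\<bar>p (fst z) (J (snd z)) (J v) - p t (J x) (J v)\<bar> \<le> K (fst z, J (snd z)) * M (J v)"
          using J by simp
        also have "\<dots> \<le> \<bar>K (fst z, J (snd z))\<bar> * M (J v)"
          using Y.norm_nonneg J 1 by (intro mult_right_mono) auto
        also have "\<dots> \<le> \<bar>K (fst z, J (snd z))\<bar> * (D * N v)"
          using bd' 1 by (intro mult_left_mono) auto
        finally show ?case by (simp add: mult.assoc)
      qed
    qed
    have fr: "has_frechet_on Y M (g t) (J x) (p t (J x))" using w tx J by (auto simp: C1_witness_def)
    show "has_frechet_on X N (\<lambda>x. g t (J x)) x (\<lambda>v. p t (J x) (J v))"
      unfolding has_frechet_on_def
    proof (intro conjI allI impI)
      have pd: "p t (J x) \<in> dual_on Y M" using fr by (simp add: has_frechet_on_def)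
      obtain B where B: "B \<ge> 0" "\<And>v. v \<in> Y \<Longrightarrow> \<bar>p t (J x) v\<bar> \<le> B * M v" using Y.dual_on_bound pd by metis
      have "\<bar>p t (J x) (J v)\<bar> \<le> (B * D) * N v" if "v \<in> X" for v
        using B(2)[of "J v"] J[OF that] mult_left_mono[OF bd'[OF that] B(1)] by (simp add: mult.assoc)
      then show "(\<lambda>v. p t (J x) (J v)) \<in> dual_on X N"
        using pd J J_add J_scale unfolding dual_on_def by auto
      fix e :: real assume "e > 0"
      then have "e / D > 0" using D by simp
      then obtain d where d: "d > 0" "\<And>y. y\<in>Y \<Longrightarrow> M (y - J x) < d \<Longrightarrow>
          \<bar>g t y - g t (J x) - p t (J x) (y - J x)\<bar> \<le> e / D * M (y - J x)"
        using fr unfolding has_frechet_on_def by meson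
      have "\<bar>g t (J y) - g t (J x) - p t (J x) (J (y - x))\<bar> \<le> e * N (y - x)"
        if y: "y \<in> X" "N (y - x) < d / D" for y
      proof -
        have b: "M (J y - J x) \<le> D * N (y - x)" using bd'[of "y - x"] J_diff tx y diff_mem by auto
        also have "\<dots> < d" using y D by (simp add: field_simps)
        finally have "\<bar>g t (J y) - g t (J x) - p t (J x) (J y - J x)\<bar> \<le> e / D * M (J y - J x)"
          using d J y by simp
        also have "\<dots> \<le> e / D * (D * N (y - x))" using b D \<open>e > 0\<close> by (intro mult_left_mono) auto
        finally show ?thesis using D J_diff y tx by simp
      qed
      then show "\<exists>d>0. \<forall>y\<in>X. N (y - x) < d \<longrightarrow> \<bar>g t (J y) - g t (J x) - p t (J x) (J (y - x))\<bar> \<le> e * N (y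
          - x)"
        using d(1) D by (intro exI[of _ "d / D"]) auto
    qed
  qed
qed

section \<open>Agreement of the candidates with \<open>time_deriv\<close>, \<open>frechet_on\<close>
  and \<open>C1_on\<close>\<close>

lemma C1_witness_time_deriv:
  assumes "C1_witness T X N g g' p" "T > 0" "t \<in> {0..T}" "x \<in> X"
  shows "time_deriv T g t x = g' t x"
  unfolding time_deriv_def using assms
  by (intro vector_derivative_within_closed_interval)
     (auto simp: C1_witness_def has_real_derivative_iff_has_vector_derivative)

lemma C1_witness_frechet:
  assumes "C1_witness T X N g g' p" "t \<in> {0..T}" "x \<in> X" "v \<in> X"
  shows "frechet_on X N (g t) x v = p t x v"
proof -
  have *: "has_frechet_on X N (g t) x (p t x)" using assms by (auto simp: C1_witness_def)
  then have "has_frechet_on X N (g t) x (frechet_on X N (g t) x)"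
    unfolding frechet_on_def by (rule someI[of "has_frechet_on X N (g t) x"])
  then show ?thesis using * has_frechet_on_unique assms by blast
qed

lemma C1_witness_C1_on:
  assumes w: "C1_witness T X N g g' p" and T: "T > 0"
  shows "g \<in> C1_on T X N"
proof -
  have g: "g \<in> C0_on T X N" using w by (simp add: C0_on_def C1_witness_def case_prod_unfold)
  have td: "time_deriv T g \<in> C0_on T X N"
    unfolding C0_on_def
  proof (clarify, goal_cases)
    case (1 t x)
    have "((\<lambda>z. g' (fst z) (snd z)) \<longlongrightarrow> g' t x) (nhds_on T X N t x)" using w 1 by (simp add: C1_witness_def)
    moreover have "\<forall>\<^sub>F z in nhds_on T X N t x. g' (fst z) (snd z) = time_deriv T g (fst z) (snd z)"
      using eventually_nhds_on_mem by eventually_elim (simp add: C1_witness_time_deriv[OF w T])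
    ultimately have "((\<lambda>z. time_deriv T g (fst z) (snd z)) \<longlongrightarrow> g' t x) (nhds_on T X N t x)"
      by (rule Lim_transform_eventually)
    then show ?case using C1_witness_time_deriv[OF w T, of t x] 1 by (simp add: case_prod_unfold)
  qed
  have gr: "((\<lambda>(s, y). dual_norm_on X N (frechet_on X N (g s) y - frechet_on X N (g t) x)) \<longlongrightarrow> 0) (nhds_on
      T X N t x)"
    if tx: "t \<in> {0..T}" "x \<in> X" for t x
  proof -
    obtain K where K: "(K \<longlongrightarrow> 0) (nhds_on T X N t x)"
      "\<forall>\<^sub>F z in nhds_on T X N t x. \<forall>v\<in>X. \<bar>p (fst z) (snd z) v - p t x v\<bar> \<le> K z * N v"
      using C1_witness_gradient[OF w tx] by blast
    show ?thesis
    proof (rule Lim_null_comparison)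
      show "((\<lambda>z. \<bar>K z\<bar>) \<longlongrightarrow> 0) (nhds_on T X N t x)" using tendsto_rabs[OF K(1)] by simp
      show "\<forall>\<^sub>F z in nhds_on T X N t x. norm (case z of (s, y) \<Rightarrow>
           dual_norm_on X N (frechet_on X N (g s) y - frechet_on X N (g t) x)) \<le> \<bar>K z\<bar>"
        using K(2) eventually_nhds_on_mem
      proof eventually_elim
        case (elim z)
        let ?q = "frechet_on X N (g (fst z)) (snd z) - frechet_on X N (g t) x"
        have le: "\<bar>?q v\<bar> \<le> \<bar>K z\<bar>" if "v \<in> X" "N v \<le> 1" for v
        proof -
          have "?q v = p (fst z) (snd z) v - p t x v"
            using C1_witness_frechet[OF w] elim tx that by (simp add: fun_diff_def)
          then have "\<bar>?q v\<bar> \<le> K z * N v" using elim that by simp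
          also have "\<dots> \<le> \<bar>K z\<bar> * 1" using that norm_nonneg by (intro mult_mono) auto
          finally show ?thesis by simp
        qed
        have ne: "{v \<in> X. N v \<le> 1} \<noteq> {}" using zero_mem norm_zero by force
        have up: "dual_norm_on X N ?q \<le> \<bar>K z\<bar>"
          unfolding dual_norm_on_def by (rule cSUP_least[OF ne]) (use le in auto)
        have bdd: "bdd_above ((\<lambda>v. \<bar>?q v\<bar>) ` {v \<in> X. N v \<le> 1})"
          using le by (intro bdd_aboveI[of _ "\<bar>K z\<bar>"]) auto
        \<comment> \<open>Evaluation at 0 shows that the supremum is nonnegative, which turns the
          upper bound into one for its absolute value.\<close>
        have "\<bar>?q 0\<bar> \<le> dual_norm_on X N ?q"
          unfolding dual_norm_on_def by (rule cSUP_upper[OF _ bdd]) (use zero_mem norm_zero in auto)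
        then have "0 \<le> dual_norm_on X N ?q" by linarith
        with up show ?case by (simp add: case_prod_unfold)
      qed
    qed
  qed
  show ?thesis
    unfolding C1_on_def
  proof (intro CollectI conjI ballI)
    fix t x assume "t \<in> {0..T}" "x \<in> X"
    then have "((\<lambda>r. g r x) has_real_derivative g' t x) (at t within {0..T})"
      "has_frechet_on X N (g t) x (p t x)" using w by (auto simp: C1_witness_def)
    then show "(\<lambda>r. g r x) differentiable (at t within {0..T})" "\<exists>p. has_frechet_on X N (g t) x p"
      by (auto simp: real_differentiable_def)
  qed (use g td gr in auto)
qed

end

section \<open>Semi-inner products\<close>

text \<open>The form may be degenerate and its laws are assumed on \<open>X\<close> only. The value
  of the form at \<open>x + c *\<^sub>R y\<close> is a nonnegative polynomial in \<open>c\<close>;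
  its vertex gives the bound, and if \<open>B y y = 0\<close> it must be constant.\<close>

lemma semi_inner_Cauchy_Schwarz:
  fixes B :: "'a::real_vector \<Rightarrow> 'a \<Rightarrow> real"
  assumes add: "\<And>x y z. x \<in> X \<Longrightarrow> y \<in> X \<Longrightarrow> z \<in> X \<Longrightarrow> B (x + y) z = B x z + B y z"
    and scale: "\<And>c x y. x \<in> X \<Longrightarrow> y \<in> X \<Longrightarrow> B (c *\<^sub>R x) y = c * B x y"
    and sym: "\<And>x y. x \<in> X \<Longrightarrow> y \<in> X \<Longrightarrow> B x y = B y x"
    and pos: "\<And>x. x \<in> X \<Longrightarrow> 0 \<le> B x x"
    and mem: "\<And>x y. x \<in> X \<Longrightarrow> y \<in> X \<Longrightarrow> x + y \<in> X" "\<And>c x. x \<in> X \<Longrightarrow> c *\<^sub>R x \<in> X"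
    and x: "x \<in> X" and y: "y \<in> X"
  shows "\<bar>B x y\<bar> \<le> sqrt (B x x) * sqrt (B y y)"
proof -
  have q: "0 \<le> B x x + 2 * c * B x y + c\<^sup>2 * B y y" for c
  proof -
    have "B (x + c *\<^sub>R y) (x + c *\<^sub>R y) = B x x + c * B y x + c * (B x y + c * B y y)"
      using x y by (simp add: add scale mem sym[of x "_ + _"] sym[of y "_ + _"])
    then show ?thesis using pos[of "x + c *\<^sub>R y"] x y mem
      by (simp add: sym[of y x] power2_eq_square algebra_simps)
  qed
  have "(B x y)\<^sup>2 \<le> B x x * B y y"
  proof (cases "B y y = 0")
    case True
    have "B x y = 0"
    proof (rule ccontr)
      assume ne: "B x y \<noteq> 0"
      \<comment> \<open>At this \<open>c\<close> the affine polynomial would take the value -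
        1.\<close>
      show False using q[of "- (B x x + 1) / (2 * B x y)"] True ne by (simp add: field_simps)
    qed
    then show ?thesis using True by simp
  next
    case False
    then have p: "B y y > 0" using pos[OF y] by simp
    have "0 \<le> B x x + 2 * (- B x y / B y y) * B x y + (- B x y / B y y)\<^sup>2 * B y y" by (rule q)
    also have "\<dots> = B x x - (B x y)\<^sup>2 / B y y"
      using p by (simp add: field_simps power2_eq_square)
    finally show ?thesis using p by (simp add: field_simps)
  qed
  then have "sqrt ((B x y)\<^sup>2) \<le> sqrt (B x x * B y y)" by (rule real_sqrt_le_mono)
  then show ?thesis by (simp add: real_sqrt_mult)
qed

lemma semi_inner_seminormed_space:
  fixes B :: "'a::real_vector \<Rightarrow> 'a \<Rightarrow> real"
  assumes add: "\<And>x y z. x \<in> X \<Longrightarrow> y \<in> X \<Longrightarrow> z \<in> X \<Longrightarrow> B (x + y) z = B x z + B y z"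
    and scale: "\<And>c x y. x \<in> X \<Longrightarrow> y \<in> X \<Longrightarrow> B (c *\<^sub>R x) y = c * B x y"
    and sym: "\<And>x y. x \<in> X \<Longrightarrow> y \<in> X \<Longrightarrow> B x y = B y x"
    and pos: "\<And>x. x \<in> X \<Longrightarrow> 0 \<le> B x x"
    and mem: "0 \<in> X" "\<And>x y. x \<in> X \<Longrightarrow> y \<in> X \<Longrightarrow> x + y \<in> X" "\<And>c x. x \<in> X \<Longrightarrow> c *\<^sub>R x \<in> X"
  shows "seminormed_space X (\<lambda>x. sqrt (B x x))"
proof
  fix x y c assume x: "x \<in> X" and y: "y \<in> X"
  have "B (c *\<^sub>R x) (c *\<^sub>R x) = c\<^sup>2 * B x x"
    using x by (simp add: scale mem sym[of x "c *\<^sub>R x"] power2_eq_square)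
  then show "sqrt (B (c *\<^sub>R x) (c *\<^sub>R x)) = \<bar>c\<bar> * sqrt (B x x)" by (simp add: real_sqrt_mult)
  have "B (x + y) (x + y) = B x x + 2 * B x y + B y y"
    using x y by (simp add: add mem sym[of x "_ + _"] sym[of y "_ + _"] sym[of y x])
  also have "\<dots> \<le> (sqrt (B x x))\<^sup>2 + 2 * (sqrt (B x x) * sqrt (B y y)) + (sqrt (B y y))\<^sup>2"
    using semi_inner_Cauchy_Schwarz[OF add scale sym pos mem(2,3) x y] pos x y by simp
  also have "\<dots> = (sqrt (B x x) + sqrt (B y y))\<^sup>2" by (simp add: power2_eq_square algebra_simps)
  finally show "sqrt (B (x + y) (x + y)) \<le> sqrt (B x x) + sqrt (B y y)"
    using pos x y by (intro real_le_lsqrt) auto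
qed (use mem in auto)

section \<open>Square-integrable functions on an interval\<close>


lemma L2_inner_integrable:
  assumes "f \<in> L2 a b" "g \<in> L2 a b"
  shows "integrable (lebesgue_on {a..b}) (\<lambda>t. f t \<bullet> g t)"
proof (rule Bochner_Integration.integrable_bound)
  show "integrable (lebesgue_on {a..b}) (\<lambda>t. (norm (f t))\<^sup>2 + (norm (g t))\<^sup>2)"
    using assms by (auto simp: L2_def)
  show "(\<lambda>t. f t \<bullet> g t) \<in> borel_measurable (lebesgue_on {a..b})"
    using assms by (auto simp: L2_def)
  have "\<bar>u \<bullet> v\<bar> \<le> (norm u)\<^sup>2 + (norm v)\<^sup>2" for u v :: 'a
  proof -
    have "0 \<le> (norm u - norm v)\<^sup>2 + ((norm u)\<^sup>2 + (norm v)\<^sup>2)" by simp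
    then have "norm u * norm v \<le> (norm u)\<^sup>2 + (norm v)\<^sup>2" by (simp add: power2_eq_square algebra_simps)
    then show ?thesis using Cauchy_Schwarz_ineq2[of u v] by linarith
  qed
  then show "AE t in lebesgue_on {a..b}. norm (f t \<bullet> g t) \<le> norm ((norm (f t))\<^sup>2 + (norm (g t))\<^sup>2)"
    by simp
qed

lemma L2_integrable:
  assumes "f \<in> L2 a b"
  shows "integrable (lebesgue_on {a..b}) f"
proof (rule Bochner_Integration.integrable_bound)
  have "integrable (lebesgue_on {a..b}) (\<lambda>t. 1::real)"
    by (rule absolutely_integrable_imp_integrable) auto
  then show "integrable (lebesgue_on {a..b}) (\<lambda>t. 1 + (norm (f t))\<^sup>2)"
    using assms by (auto simp: L2_def)
  show "f \<in> borel_measurable (lebesgue_on {a..b})" using assms by (auto simp: L2_def)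
  have "n \<le> 1 + n\<^sup>2" for n :: real
    using zero_le_power2[of "n - 1"] zero_le_power2[of n]
    unfolding power2_diff power_one mult_1_right by linarith
  then show "AE t in lebesgue_on {a..b}. norm (f t) \<le> norm (1 + (norm (f t))\<^sup>2)" by simp
qed

lemma L2_absolutely_integrable:
  fixes f :: "real \<Rightarrow> 'a::euclidean_space"
  assumes "f \<in> L2 a b"
  shows "f absolutely_integrable_on {a..b}"
  using L2_integrable[OF assms] by (simp add: set_integrable_def integrable_restrict_space)

lemma L2_integrable_on:
  fixes f :: "real \<Rightarrow> 'a::euclidean_space"
  assumes "f \<in> L2 a b" "a \<le> l"
  shows "f integrable_on {l..b}"
  using set_lebesgue_integral_eq_integral(1)[OF L2_absolutely_integrable[OF assms(1)]]
  by (rule integrable_on_subinterval) (use assms in auto)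

lemma L2_add: "f \<in> L2 a b \<Longrightarrow> g \<in> L2 a b \<Longrightarrow> f + g \<in> L2 a b"
proof -
  assume fg: "f \<in> L2 a b" "g \<in> L2 a b"
  have "integrable (lebesgue_on {a..b}) (\<lambda>t. (norm (f t))\<^sup>2 + 2 * (f t \<bullet> g t) + (norm (g t))\<^sup>2)"
    using fg L2_inner_integrable[OF fg] by (auto simp: L2_def)
  moreover have "(norm (f t))\<^sup>2 + 2 * (f t \<bullet> g t) + (norm (g t))\<^sup>2 = (norm ((f + g) t))\<^sup>2" for t
    by (simp add: plus_fun_apply power2_norm_eq_inner inner_add inner_commute)
  ultimately show ?thesis using fg by (auto simp: L2_def plus_fun_def)
qed

lemma L2_scale: "f \<in> L2 a b \<Longrightarrow> c *\<^sub>R f \<in> L2 a b"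
  by (auto simp: L2_def scaleR_fun_def power_mult_distrib)

lemma L2_zero: "0 \<in> L2 a b"
  by (simp add: L2_def zero_fun_def)


lemma L2_norm: "f \<in> L2 a b \<Longrightarrow> (\<lambda>t. norm (f t)) \<in> L2 a b"
  by (auto simp: L2_def)

text \<open>The inner product of H on an arbitrary interval and for values in any Euclidean space,
  so that one Cauchy-Schwarz inequality serves paths, their scalar norms and their
  primitives.\<close>

definition inner_L2 :: "real \<Rightarrow> real \<Rightarrow> (real \<Rightarrow> 'a::euclidean_space) \<Rightarrow> (real \<Rightarrow> 'a) \<Rightarrow> real" where
  "inner_L2 a b f g = (LINT t|lebesgue_on {a..b}. f t \<bullet> g t)"

lemma inner_L2_add:
  "f \<in> L2 a b \<Longrightarrow> g \<in> L2 a b \<Longrightarrow> h \<in> L2 a b \<Longrightarrow> inner_L2 a b (f + g) h = inner_L2 a b f h + inner_L2 a b g h"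
  by (simp add: inner_L2_def plus_fun_apply inner_add_left L2_inner_integrable)

lemma inner_L2_scale: "inner_L2 a b (c *\<^sub>R f) g = c * inner_L2 a b f g"
  by (simp add: inner_L2_def scaleR_fun_def)

lemma inner_L2_commute: "inner_L2 a b f g = inner_L2 a b g f"
  by (simp add: inner_L2_def inner_commute)

lemma inner_L2_nonneg: "0 \<le> inner_L2 a b f f"
  by (simp add: inner_L2_def)

lemma inner_L2_Cauchy_Schwarz:
  assumes "f \<in> L2 a b" "g \<in> L2 a b"
  shows "\<bar>inner_L2 a b f g\<bar> \<le> sqrt (inner_L2 a b f f) * sqrt (inner_L2 a b g g)"
  by (rule semi_inner_Cauchy_Schwarz[where B = "inner_L2 a b" and X = "L2 a b"])
     (simp_all add: inner_L2_add inner_L2_scale inner_L2_nonneg L2_add L2_scale assms, rule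
         inner_L2_commute)

lemma inner_L2_eq_integral:
  assumes "f \<in> L2 a b" "g \<in> L2 a b"
  shows "inner_L2 a b f g = integral {a..b} (\<lambda>t. f t \<bullet> g t)"
  unfolding inner_L2_def by (rule lebesgue_integral_eq_integral[OF L2_inner_integrable[OF assms]]) simp

lemma innerH_eq: "innerH \<tau> = inner_L2 (-\<tau>) 0"
  by (simp add: fun_eq_iff innerH_def inner_L2_def)

lemma normH_eq: "normH \<tau> h = sqrt (inner_L2 (-\<tau>) 0 h h)"
  by (simp add: normH_def innerH_eq)

lemma normH_nonneg: "0 \<le> normH \<tau> h"
  by (simp add: normH_eq inner_L2_nonneg)

lemma normH_power2: "(normH \<tau> h)\<^sup>2 = innerH \<tau> h h"
  by (simp add: normH_eq innerH_eq inner_L2_nonneg)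

text \<open>Cauchy-Schwarz against the constant function 1.\<close>

lemma L1_le_L2:
  fixes f :: "real \<Rightarrow> 'a::euclidean_space"
  assumes "f \<in> L2 a b" "a \<le> b"
  shows "integral {a..b} (\<lambda>t. norm (f t)) \<le> sqrt (b - a) * sqrt (inner_L2 a b f f)"
proof -
  let ?n = "\<lambda>t. norm (f t)" and ?o = "\<lambda>t. 1 :: real"
  have int1: "integrable (lebesgue_on {a..b}) ?o" by (rule absolutely_integrable_imp_integrable) auto
  then have o: "?o \<in> L2 a b" by (simp add: L2_def)
  have "integral {a..b} ?n = inner_L2 a b ?n ?o"
    using inner_L2_eq_integral[OF L2_norm[OF assms(1)] o] by simp
  also have "\<dots> \<le> sqrt (inner_L2 a b ?n ?n) * sqrt (inner_L2 a b ?o ?o)"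
    using inner_L2_Cauchy_Schwarz[OF L2_norm[OF assms(1)] o] by linarith
  also have "inner_L2 a b ?n ?n = inner_L2 a b f f"
    by (simp add: inner_L2_def power2_norm_eq_inner[symmetric] power2_eq_square)
  also have "inner_L2 a b ?o ?o = b - a"
    using inner_L2_eq_integral[OF o o] assms by simp
  finally show ?thesis by (simp add: mult.commute)
qed

section \<open>Tail integrals\<close>

text \<open>Up to sign the primitive of \<open>x\<close> vanishing at the present time. Its supremum
  norm is what the hypothesis on \<open>W\<close> and \<open>V\<close> uses to compare
  histories.\<close>

definition tail :: "(real \<Rightarrow> 'a::euclidean_space) \<Rightarrow> real \<Rightarrow> 'a" where
  "tail x l = integral {l..0} x"

text \<open>The inner product of the primitives, hence a form of negative order on paths. Its
  quadratic form is smooth, as a test function requires, unlike the supremum of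
  \<open>tail\<close>.\<close>

definition weak_inner :: "real \<Rightarrow> (real \<Rightarrow> 'a::euclidean_space) \<Rightarrow> (real \<Rightarrow> 'a) \<Rightarrow> real" where
  "weak_inner \<tau> x y = integral {-\<tau>..0} (\<lambda>l. tail x l \<bullet> tail y l)"

lemma tail_add:
  assumes "f \<in> L2 (-\<tau>) 0" "g \<in> L2 (-\<tau>) 0" "-\<tau> \<le> l"
  shows "tail (f + g) l = tail f l + tail g l"
  unfolding tail_def plus_fun_def
  by (rule Henstock_Kurzweil_Integration.integral_add) (rule L2_integrable_on[OF _ assms(3)], fact)+

lemma tail_scale: "tail (c *\<^sub>R f) l = c *\<^sub>R tail f l"
  by (simp add: tail_def scaleR_fun_def)

lemma tail_diff:
  assumes "f \<in> L2 (-\<tau>) 0" "g \<in> L2 (-\<tau>) 0" "-\<tau> \<le> l"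
  shows "tail (f - g) l = tail f l - tail g l"
  using tail_add[OF assms(1) L2_scale[OF assms(2), of "-1"] assms(3)] tail_scale[of "-1" g l] by simp

lemma tail_bound:
  fixes f :: "real \<Rightarrow> 'a::euclidean_space"
  assumes f: "f \<in> L2 (-\<tau>) 0" and l: "-\<tau> \<le> l" "l \<le> 0"
  shows "norm (tail f l) \<le> sqrt \<tau> * sqrt (inner_L2 (-\<tau>) 0 f f)"
proof -
  have n: "(\<lambda>t. norm (f t)) integrable_on {-\<tau>..0}" "(\<lambda>t. norm (f t)) integrable_on {l..0}"
    using L2_integrable_on[OF L2_norm[OF f]] l by auto
  have "norm (tail f l) \<le> integral {l..0} (\<lambda>t. norm (f t))"
    unfolding tail_def using L2_integrable_on[OF f l(1)] n by (intro integral_norm_bound_integral) auto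
  also have "\<dots> \<le> integral {-\<tau>..0} (\<lambda>t. norm (f t))"
    using n l by (intro integral_subset_le) auto
  also have "\<dots> \<le> sqrt \<tau> * sqrt (inner_L2 (-\<tau>) 0 f f)"
    using L1_le_L2[OF f] l by simp
  finally show ?thesis .
qed

lemma continuous_on_tail:
  assumes "f \<in> L2 (-\<tau>) 0"
  shows "continuous_on {-\<tau>..0} (tail f)"
proof -
  have "continuous_on {-\<tau>..0} (\<lambda>l. integral {l..0} f)"
    by (rule indefinite_integral_continuous_1') (use L2_integrable_on[OF assms, of "-\<tau>"] in simp)
  then show ?thesis by (simp add: tail_def[abs_def])
qed

lemma tail_inner_integrable:
  assumes "f \<in> L2 (-\<tau>) 0" "g \<in> L2 (-\<tau>) 0"
  shows "(\<lambda>l. tail f l \<bullet> tail g l) integrable_on {-\<tau>..0}"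
  by (intro integrable_continuous_real continuous_intros continuous_on_tail assms)

lemma weak_inner_add:
  assumes "f \<in> L2 (-\<tau>) 0" "g \<in> L2 (-\<tau>) 0" "h \<in> L2 (-\<tau>) 0"
  shows "weak_inner \<tau> (f + g) h = weak_inner \<tau> f h + weak_inner \<tau> g h"
proof -
  have "weak_inner \<tau> (f + g) h = integral {-\<tau>..0} (\<lambda>l. tail f l \<bullet> tail h l + tail g l \<bullet> tail h l)"
    unfolding weak_inner_def
    by (rule integral_cong) (simp add: tail_add[OF assms(1,2)] inner_add_left)
  also have "\<dots> = weak_inner \<tau> f h + weak_inner \<tau> g h"
    unfolding weak_inner_def
    by (rule Henstock_Kurzweil_Integration.integral_add) (rule tail_inner_integrable, fact, fact)+
  finally show ?thesis .
qed

lemma weak_inner_scale: "weak_inner \<tau> (c *\<^sub>R f) h = c * weak_inner \<tau> f h"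
  by (simp add: weak_inner_def tail_scale)

lemma weak_inner_commute: "weak_inner \<tau> f h = weak_inner \<tau> h f"
  by (simp add: weak_inner_def inner_commute)

lemma weak_inner_nonneg: "f \<in> L2 (-\<tau>) 0 \<Longrightarrow> 0 \<le> weak_inner \<tau> f f"
  unfolding weak_inner_def by (rule integral_nonneg) (auto intro: tail_inner_integrable)

lemma weak_inner_bound:
  assumes "f \<in> L2 (-\<tau>) 0" "g \<in> L2 (-\<tau>) 0" "0 \<le> \<tau>"
  shows "\<bar>weak_inner \<tau> f g\<bar> \<le> \<tau>\<^sup>2 * sqrt (inner_L2 (-\<tau>) 0 f f) * sqrt (inner_L2 (-\<tau>) 0 g g)"
proof -
  let ?c = "(sqrt \<tau> * sqrt (inner_L2 (-\<tau>) 0 f f)) * (sqrt \<tau> * sqrt (inner_L2 (-\<tau>) 0 g g))"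
  have "norm (tail f l \<bullet> tail g l) \<le> ?c" if "l \<in> {-\<tau>..0}" for l
  proof -
    have "\<bar>tail f l \<bullet> tail g l\<bar> \<le> norm (tail f l) * norm (tail g l)" by (rule Cauchy_Schwarz_ineq2)
    also have "\<dots> \<le> ?c" using that assms by (intro mult_mono tail_bound) (auto simp: inner_L2_nonneg)
    finally show ?thesis by simp
  qed
  then have "norm (integral {-\<tau>..0} (\<lambda>l. tail f l \<bullet> tail g l)) \<le> integral {-\<tau>..0} (\<lambda>l. ?c)"
    using tail_inner_integrable[OF assms(1,2)] by (intro integral_norm_bound_integral) auto
  also have "\<dots> = \<tau> * ?c" using assms by simp
  also have "\<dots> = \<tau>\<^sup>2 * sqrt (inner_L2 (-\<tau>) 0 f f) * sqrt (inner_L2 (-\<tau>) 0 g g)"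
    using assms by (simp add: power2_eq_square)
  finally show ?thesis by (simp add: weak_inner_def)
qed

section \<open>The product space\<close>

definition inner_RdH :: "real \<Rightarrow> (real ^ 'd::finite) \<times> 'd path \<Rightarrow> (real ^ 'd) \<times> 'd path \<Rightarrow> real" where
  "inner_RdH \<tau> = (\<lambda>z w. fst z \<bullet> fst w + innerH \<tau> (snd z) (snd w))"

lemma norm_RdH_eq: "norm_RdH \<tau> z = sqrt (inner_RdH \<tau> z z)"
  by (cases z) (simp add: norm_RdH_def inner_RdH_def normH_power2 power2_norm_eq_inner)

lemma seminormed_space_RdH: "seminormed_space (UNIV \<times> Hspace \<tau>) (norm_RdH \<tau>)"
proof -
  have "seminormed_space (UNIV \<times> Hspace \<tau>) (\<lambda>z. sqrt (inner_RdH \<tau> z z))"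
  proof (rule semi_inner_seminormed_space[where B = "inner_RdH \<tau>" and X = "UNIV \<times> Hspace \<tau>"])
    show "0 \<in> UNIV \<times> Hspace \<tau>" by (auto simp: zero_prod_def Hspace_def L2_zero)
    show "inner_RdH \<tau> z w = inner_RdH \<tau> w z" for z w
      by (simp add: inner_RdH_def innerH_eq inner_commute inner_L2_commute[of _ _ "snd z"])
    show "inner_RdH \<tau> (c *\<^sub>R z) w = c * inner_RdH \<tau> z w" for c z w
      by (simp add: inner_RdH_def innerH_eq inner_L2_scale distrib_left)
    show "0 \<le> inner_RdH \<tau> z z" for z
      by (simp add: inner_RdH_def innerH_eq inner_L2_nonneg)
    show "inner_RdH \<tau> (x + y) z = inner_RdH \<tau> x z + inner_RdH \<tau> y z"
      if "x \<in> UNIV \<times> Hspace \<tau>" "y \<in> UNIV \<times> Hspace \<tau>" "z \<in> UNIV \<times> Hspace \<tau>" for x y z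
      using that unfolding inner_RdH_def Hspace_def innerH_eq
      by (simp add: mem_Times_iff inner_L2_add inner_add_left)
    show "x + y \<in> UNIV \<times> Hspace \<tau>" if "x \<in> UNIV \<times> Hspace \<tau>" "y \<in> UNIV \<times> Hspace \<tau>" for x y
      using that by (simp add: mem_Times_iff Hspace_def L2_add)
    show "c *\<^sub>R x \<in> UNIV \<times> Hspace \<tau>" if "x \<in> UNIV \<times> Hspace \<tau>" for c x
      using that by (simp add: mem_Times_iff Hspace_def L2_scale)
  qed
  then show ?thesis by (simp add: norm_RdH_eq[abs_def])
qed

lemma fst_le_norm_RdH: "norm (fst z) \<le> norm_RdH \<tau> z"
  by (cases z) (auto simp: norm_RdH_def intro: real_le_rsqrt)

lemma snd_le_norm_RdH: "normH \<tau> (snd z) \<le> norm_RdH \<tau> z"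
  by (cases z) (auto simp: norm_RdH_def intro: real_le_rsqrt)


section \<open>Right-continuous paths\<close>

lemma Dspace_bound:
  assumes "x \<in> Dspace \<tau>"
  obtains R where "R \<ge> 0" "\<And>\<theta>. norm (x \<theta>) \<le> R"
proof -
  obtain R where R: "\<And>\<theta>. \<theta> \<in> {-\<tau>..0} \<Longrightarrow> norm (x \<theta>) \<le> R"
    using assms unfolding Dspace_def bounded_iff by blast
  have "norm (x \<theta>) \<le> max R 0" for \<theta>
    using R[of \<theta>] assms by (cases "\<theta> \<in> {-\<tau>..0}") (auto simp: Dspace_def)
  then show ?thesis using that[of "max R 0"] by simp
qed

lemma Dspace_outside: "x \<in> Dspace \<tau> \<Longrightarrow> \<theta> \<notin> {-\<tau>..0} \<Longrightarrow> x \<theta> = 0"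
  unfolding Dspace_def by blast

lemma at_within_Ioc: "\<theta> < (b::real) \<Longrightarrow> at \<theta> within {\<theta><..b} = at_right \<theta>"
  by (rule at_within_nhd[of _ "{..<b}"]) auto

lemma Dspace_right_continuous:
  assumes "x \<in> Dspace \<tau>" "-\<tau> \<le> \<theta>" "\<theta> < 0"
  shows "(x \<longlongrightarrow> x \<theta>) (at_right \<theta>)"
proof -
  have "(x \<longlongrightarrow> x \<theta>) (at \<theta> within {\<theta><..0})" using assms unfolding Dspace_def by simp
  then show ?thesis using at_within_Ioc[of \<theta> 0] assms(3) by simp
qed

text \<open>A right-continuous function is the pointwise limit of step functions that sample it at
  grid points to the right.\<close>

lemma Dspace_measurable:
  assumes x: "x \<in> Dspace \<tau>"
  shows "x \<in> borel_measurable borel"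
proof -
  \<comment> \<open>The first point of the grid with mesh \<open>1 / Suc n\<close> that lies
    strictly to the right of \<open>\<theta>\<close>; only limits from that side are
    available.\<close>
  define g where "g = (\<lambda>n \<theta>. (real_of_int \<lfloor>real (Suc n) * \<theta>\<rfloor> + 1) / real (Suc n))"
  have meas: "(\<lambda>\<theta>. indicat_real {-\<tau>..<0} \<theta> *\<^sub>R x (g n \<theta>)) \<in> borel_measurable borel" for n
  proof -
    have fl: "(\<lambda>\<theta>::real. \<lfloor>real (Suc n) * \<theta>\<rfloor>) \<in> measurable borel (count_space UNIV)" by measurable
    have "(\<lambda>k. x ((real_of_int k + 1) / real (Suc n))) \<in> measurable (count_space UNIV) borel" by simp
    from measurable_compose[OF fl this]
    have "(\<lambda>\<theta>. x (g n \<theta>)) \<in> borel_measurable borel" by (simp add: g_def)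
    then show ?thesis by (intro borel_measurable_scaleR) auto
  qed
  have lim: "(\<lambda>n. indicat_real {-\<tau>..<0} \<theta> *\<^sub>R x (g n \<theta>)) \<longlonglongrightarrow> indicat_real {-\<tau>..<0} \<theta> *\<^sub>R x \<theta>" for \<theta>
  proof (cases "\<theta> \<in> {-\<tau>..<0}")
    case True
    have gt: "g n \<theta> > \<theta>" and le: "g n \<theta> \<le> \<theta> + 1 / real (Suc n)" for n
    proof -
      have "real (Suc n) * \<theta> < real_of_int \<lfloor>real (Suc n) * \<theta>\<rfloor> + 1" by linarith
      then show "g n \<theta> > \<theta>" unfolding g_def by (simp add: pos_less_divide_eq mult.commute)
      have "real_of_int \<lfloor>real (Suc n) * \<theta>\<rfloor> + 1 \<le> real (Suc n) * \<theta> + 1" by linarith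
      then have "g n \<theta> \<le> (real (Suc n) * \<theta> + 1) / real (Suc n)" unfolding g_def by (rule
          divide_right_mono) simp
      also have "\<dots> = \<theta> + 1 / real (Suc n)" by (simp add: add_divide_distrib del: of_nat_Suc)
      finally show "g n \<theta> \<le> \<theta> + 1 / real (Suc n)" .
    qed
    have "(\<lambda>n. \<theta> + 1 / real (Suc n)) \<longlonglongrightarrow> \<theta> + 0"
      by (intro tendsto_intros LIMSEQ_inverse_real_of_nat[unfolded inverse_eq_divide])
    then have up: "(\<lambda>n. \<theta> + 1 / real (Suc n)) \<longlonglongrightarrow> \<theta>" by simp
    have "(\<lambda>n. g n \<theta>) \<longlonglongrightarrow> \<theta>"
      by (rule tendsto_sandwich[OF _ _ tendsto_const up])
         (use gt le in \<open>auto intro!: always_eventually less_imp_le\<close>)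
    then have "filterlim (\<lambda>n. g n \<theta>) (at_right \<theta>) sequentially"
      using gt by (auto simp: filterlim_at intro!: always_eventually) (metis less_irrefl)
    then have "(\<lambda>n. x (g n \<theta>)) \<longlonglongrightarrow> x \<theta>"
      using Dspace_right_continuous[OF x, of \<theta>] True by (auto intro: filterlim_compose)
    then show ?thesis using True by simp
  qed simp
  have "(\<lambda>\<theta>. indicat_real {-\<tau>..<0} \<theta> *\<^sub>R x \<theta>) \<in> borel_measurable borel"
    by (rule borel_measurable_LIMSEQ_metric[OF meas lim])
  \<comment> \<open>The time 0 is treated apart, because points to the right of it see only the
    extension by 0.\<close>
  moreover have "(\<lambda>\<theta>::real. indicat_real {0} \<theta> *\<^sub>R x 0) \<in> borel_measurable borel"
    by (intro borel_measurable_scaleR borel_measurable_indicator) auto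
  ultimately have "(\<lambda>\<theta>. indicat_real {-\<tau>..<0} \<theta> *\<^sub>R x \<theta> + indicat_real {0} \<theta> *\<^sub>R x 0) \<in> borel_measurable
      borel"
    by (rule borel_measurable_add)
  moreover have "indicat_real {-\<tau>..<0} \<theta> *\<^sub>R x \<theta> + indicat_real {0} \<theta> *\<^sub>R x 0 = x \<theta>" for \<theta>
    using Dspace_outside[OF x, of \<theta>] by (cases "\<theta> \<in> {-\<tau>..<0}"; cases "\<theta> = 0") auto
  ultimately show ?thesis by simp
qed

lemma bounded_borel_integrable_on:
  fixes f :: "real \<Rightarrow> 'a::euclidean_space"
  assumes "f \<in> borel_measurable borel" "\<And>t. t \<in> {a..b} \<Longrightarrow> norm (f t) \<le> R"
  shows "f integrable_on {a..b}"
proof (rule measurable_bounded_by_integrable_imp_integrable[where g = "\<lambda>_. R"])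
  show "f \<in> borel_measurable (lebesgue_on {a..b})"
    using assms(1) by (intro measurable_restrict_space1 measurable_completion) simp
qed (use assms in auto)

lemma bounded_borel_L2:
  fixes f :: "real \<Rightarrow> 'a::euclidean_space"
  assumes "f \<in> borel_measurable borel" "\<And>t. t \<in> {a..b} \<Longrightarrow> norm (f t) \<le> R"
  shows "f \<in> L2 a b"
proof -
  have m: "f \<in> borel_measurable (lebesgue_on {a..b})"
    using assms(1) by (intro measurable_restrict_space1 measurable_completion) simp
  have "(\<lambda>t. (norm (f t))\<^sup>2) integrable_on {a..b}"
    using assms by (intro bounded_borel_integrable_on[where R = "R\<^sup>2"]) (auto intro!: power_mono)
  then have "(\<lambda>t. (norm (f t))\<^sup>2) absolutely_integrable_on {a..b}"
    by (subst absolutely_integrable_on_iff_nonneg) auto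
  then show ?thesis using m by (simp add: L2_def absolutely_integrable_imp_integrable)
qed

lemma Dspace_L2: "x \<in> Dspace \<tau> \<Longrightarrow> x \<in> L2 a b"
  using Dspace_bound[of x \<tau>] Dspace_measurable[of x \<tau>] bounded_borel_L2[of x a b] by metis

lemma Dspace_Hspace: "x \<in> Dspace \<tau> \<Longrightarrow> x \<in> Hspace \<tau>"
  by (simp add: Hspace_def Dspace_L2)

lemma Dspace_integrable_on: "x \<in> Dspace \<tau> \<Longrightarrow> x integrable_on {a..b}"
  using Dspace_bound[of x \<tau>] Dspace_measurable[of x \<tau>] bounded_borel_integrable_on[of x a b] by metis

lemma Dspace_add:
  assumes "x \<in> Dspace \<tau>" "y \<in> Dspace \<tau>"
  shows "x + y \<in> Dspace \<tau>"
proof -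
  obtain R S where "\<And>\<theta>. norm (x \<theta>) \<le> R" "\<And>\<theta>. norm (y \<theta>) \<le> S"
    using Dspace_bound assms by metis
  then have "norm (x \<theta> + y \<theta>) \<le> R + S" for \<theta> by (meson norm_triangle_mono)
  then have "bounded ((\<lambda>\<theta>. x \<theta> + y \<theta>) ` {-\<tau>..0})" by (auto simp: bounded_iff)
  then show ?thesis using assms by (auto simp: Dspace_def plus_fun_def intro!: tendsto_intros)
qed

lemma Dspace_scale:
  assumes "x \<in> Dspace \<tau>"
  shows "c *\<^sub>R x \<in> Dspace \<tau>"
proof -
  obtain R where "\<And>\<theta>. norm (x \<theta>) \<le> R" using Dspace_bound assms by metis
  then have "norm (c *\<^sub>R x \<theta>) \<le> \<bar>c\<bar> * R" for \<theta> by (simp add: mult_left_mono)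
  then have "bounded ((\<lambda>\<theta>. c *\<^sub>R x \<theta>) ` {-\<tau>..0})" unfolding bounded_iff by blast
  then show ?thesis using assms by (auto simp: Dspace_def scaleR_fun_def intro!: tendsto_intros)
qed

lemma Dspace_zero: "0 \<in> Dspace \<tau>"
  by (auto simp: Dspace_def zero_fun_def bounded_iff)

lemma Dspace_diff: "x \<in> Dspace \<tau> \<Longrightarrow> y \<in> Dspace \<tau> \<Longrightarrow> x - y \<in> Dspace \<tau>"
  using Dspace_add[of x \<tau> "(-1) *\<^sub>R y"] Dspace_scale[of y \<tau> "-1"] by simp

lemma norm_le_normD:
  assumes "x \<in> Dspace \<tau>" "\<theta> \<in> {-\<tau>..0}"
  shows "norm (x \<theta>) \<le> normD \<tau> x"
  unfolding normD_def
proof (rule cSUP_upper[OF assms(2)])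
  obtain R where "\<And>\<theta>. norm (x \<theta>) \<le> R" using Dspace_bound assms by metis
  then show "bdd_above ((\<lambda>\<theta>. norm (x \<theta>)) ` {-\<tau>..0})" by (intro bdd_aboveI[of _ R]) auto
qed

lemma normD_le: "\<tau> \<ge> 0 \<Longrightarrow> (\<And>\<theta>. \<theta> \<in> {-\<tau>..0} \<Longrightarrow> norm (x \<theta>) \<le> R) \<Longrightarrow> normD \<tau> x \<le> R"
  unfolding normD_def by (rule cSUP_least) auto

lemma seminormed_space_D:
  assumes "\<tau> \<ge> 0"
  shows "seminormed_space (Dspace \<tau> :: ('d::finite) path set) (normD \<tau>)"
proof
  fix x y :: "'d path" and c :: real assume x: "x \<in> Dspace \<tau>" and y: "y \<in> Dspace \<tau>"
  show "normD \<tau> (x + y) \<le> normD \<tau> x + normD \<tau> y"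
    using x y assms
    by (intro normD_le) (auto simp: plus_fun_def intro!: norm_triangle_mono norm_le_normD)
  have le: "normD \<tau> (c *\<^sub>R x) \<le> \<bar>c\<bar> * normD \<tau> x" if "x \<in> Dspace \<tau>" for c and x :: "'d path"
    using that assms
    by (intro normD_le) (auto simp: scaleR_fun_def intro!: mult_left_mono norm_le_normD)
  show "normD \<tau> (c *\<^sub>R x) = \<bar>c\<bar> * normD \<tau> x"
  proof (cases "c = 0")
    case True
    have "0 \<le> normD \<tau> (c *\<^sub>R x)"
      using norm_le_normD[OF Dspace_scale[OF x, of c], of 0] assms by (auto intro: order_trans[OF
          norm_ge_zero])
    then show ?thesis using le[OF x, of c] True by simp
  next
    case False
    have "normD \<tau> (inverse c *\<^sub>R (c *\<^sub>R x)) \<le> \<bar>inverse c\<bar> * normD \<tau> (c *\<^sub>R x)"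
      by (rule le[OF Dspace_scale[OF x]])
    then have "\<bar>c\<bar> * normD \<tau> x \<le> normD \<tau> (c *\<^sub>R x)" using False by (simp add: field_simps abs_inverse)
    then show ?thesis using le[OF x, of c] by simp
  qed
qed (auto simp: Dspace_zero Dspace_add Dspace_scale)

lemma integral_le_sup_bound:
  fixes f :: "real \<Rightarrow> 'a::euclidean_space"
  assumes "f integrable_on {a..b}" "\<And>t. t \<in> {a..b} \<Longrightarrow> norm (f t) \<le> R" "a \<le> b"
  shows "norm (integral {a..b} f) \<le> R * (b - a)"
proof -
  have "norm (integral {a..b} f) \<le> integral {a..b} (\<lambda>_. R)"
    using assms by (intro integral_norm_bound_integral) auto
  then show ?thesis using assms(3) by (simp add: mult.commute)
qed

lemma innerH_le:
  assumes x: "x \<in> Dspace \<tau>" and R: "\<And>\<theta>. \<theta> \<in> {-\<tau>..0} \<Longrightarrow> norm (x \<theta>) \<le> R" and "\<tau> \<ge> 0"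
  shows "innerH \<tau> x x \<le> \<tau> * R\<^sup>2"
proof -
  have int: "(\<lambda>t. x t \<bullet> x t) integrable_on {-\<tau>..0}"
    using Dspace_measurable[OF x] R
    by (intro bounded_borel_integrable_on[where R = "R\<^sup>2"])
       (auto simp: power2_norm_eq_inner[symmetric] intro!: power_mono)
  have "innerH \<tau> x x = integral {-\<tau>..0} (\<lambda>t. x t \<bullet> x t)"
    by (simp add: innerH_eq inner_L2_eq_integral Dspace_L2[OF x])
  also have "\<dots> \<le> integral {-\<tau>..0} (\<lambda>t. R\<^sup>2)"
    using int R by (intro integral_le) (auto simp: power2_norm_eq_inner[symmetric] intro!: power_mono)
  also have "\<dots> = \<tau> * R\<^sup>2" using assms by simp
  finally show ?thesis .
qed

lemma norm_RdH_le_normD: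
  assumes x: "x \<in> Dspace \<tau>" and "\<tau> \<ge> 0"
  shows "norm_RdH \<tau> (x 0, x) \<le> sqrt (1 + \<tau>) * normD \<tau> x"
proof -
  have b: "\<And>\<theta>. \<theta> \<in> {-\<tau>..0} \<Longrightarrow> norm (x \<theta>) \<le> normD \<tau> x" using norm_le_normD[OF x] by simp
  have p: "0 \<le> normD \<tau> x" using b[of 0] assms(2) by (auto intro: order_trans[OF norm_ge_zero])
  have "(norm (x 0))\<^sup>2 + (normH \<tau> x)\<^sup>2 \<le> (normD \<tau> x)\<^sup>2 + \<tau> * (normD \<tau> x)\<^sup>2"
    using innerH_le[OF x b assms(2)] b[of 0] assms(2) by (intro add_mono) (auto simp: normH_power2
        intro!: power_mono)
  also have "\<dots> = (1 + \<tau>) * (normD \<tau> x)\<^sup>2" by (simp add: algebra_simps)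
  finally have "sqrt ((norm (x 0))\<^sup>2 + (normH \<tau> x)\<^sup>2) \<le> sqrt ((1 + \<tau>) * (normD \<tau> x)\<^sup>2)"
    by (rule real_sqrt_le_mono)
  then show ?thesis using p by (simp add: norm_RdH_def real_sqrt_mult)
qed

section \<open>Right derivatives along the shift\<close>

text \<open>The rules that transfer a derivative along an identity on a set ask the base point to
  belong to that set, hence the closed half-line.\<close>

lemma at_right_0_eq: "at_right (0::real) = at 0 within {0..}"
proof -
  have "{0<..} - {0} = {0..} - {0::real}" by auto
  then show ?thesis by (simp add: at_within_def)
qed

definition hat_path :: "'d path \<Rightarrow> real \<Rightarrow> real ^ 'd" where
  "hat_path x r = (if r < 0 then x r else x 0)"

lemma hat_shift_hat_path: "\<theta> \<in> {-\<tau>..0} \<Longrightarrow> hat_shift \<tau> h x \<theta> = hat_path x (h + \<theta>)"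
  by (simp add: hat_shift_def hat_path_def)

lemma hat_shift_0: "x \<in> Dspace \<tau> \<Longrightarrow> hat_shift \<tau> 0 x = x"
  using Dspace_outside[of x \<tau>] by (auto simp: hat_shift_def fun_eq_iff not_less)

lemma hat_shift_at_0: "\<tau> \<ge> 0 \<Longrightarrow> h \<ge> 0 \<Longrightarrow> hat_shift \<tau> h x 0 = x 0"
  by (simp add: hat_shift_def)

lemma hat_path_right_continuous:
  assumes x: "x \<in> Dspace \<tau>" and r: "-\<tau> \<le> r"
  shows "(hat_path x \<longlongrightarrow> hat_path x r) (at_right r)"
proof (cases "r < 0")
  case True
  have "\<forall>\<^sub>F s in at_right r. s < 0"
    using True by (auto simp: eventually_at_right_field)
  then have "\<forall>\<^sub>F s in at_right r. x s = hat_path x s" by eventually_elim (simp add: hat_path_def)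
  with Dspace_right_continuous[OF x r True] have "(hat_path x \<longlongrightarrow> x r) (at_right r)"
    by (rule Lim_transform_eventually)
  then show ?thesis using True by (simp add: hat_path_def)
next
  case False
  have "\<forall>\<^sub>F s in at_right r. x 0 = hat_path x s"
    using eventually_at_right_less[of r] by eventually_elim (use False in \<open>simp add: hat_path_def\<close>)
  then have "(hat_path x \<longlongrightarrow> x 0) (at_right r)" by (rule Lim_transform_eventually[OF tendsto_const])
  then show ?thesis using False by (simp add: hat_path_def)
qed

lemma hat_path_measurable: "x \<in> Dspace \<tau> \<Longrightarrow> hat_path x \<in> borel_measurable borel"
  unfolding hat_path_def[abs_def] using Dspace_measurable[of x \<tau>] by measurable

lemma hat_path_bound: "(\<And>\<theta>. norm (x \<theta>) \<le> R) \<Longrightarrow> norm (hat_path x r) \<le> R"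
  by (simp add: hat_path_def)

lemma hat_shift_Dspace:
  assumes x: "x \<in> Dspace \<tau>" and h: "h \<ge> 0"
  shows "hat_shift \<tau> h x \<in> Dspace \<tau>"
proof -
  obtain R where R: "\<And>\<theta>. norm (x \<theta>) \<le> R" using Dspace_bound x by metis
  have "bounded (hat_shift \<tau> h x ` {-\<tau>..0})"
    unfolding bounded_iff using R by (auto simp: hat_shift_def intro!: exI[of _ R])
  moreover have "(hat_shift \<tau> h x \<longlongrightarrow> hat_shift \<tau> h x \<theta>) (at \<theta> within {\<theta><..0})" if \<theta>: "\<theta> \<in> {-\<tau>..0}" for \<theta>
  proof (cases "\<theta> < 0")
    case True
    have "((\<lambda>s. hat_path x (h + s)) \<longlongrightarrow> hat_path x (h + \<theta>)) (at_right \<theta>)"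
    proof (rule filterlim_compose[OF hat_path_right_continuous[OF x]])
      show "-\<tau> \<le> h + \<theta>" using \<theta> h by simp
      show "filterlim (\<lambda>s. h + s) (at_right (h + \<theta>)) (at_right \<theta>)"
        by (auto simp: filterlim_at intro!: tendsto_intros intro: eventually_mono[OF
            eventually_at_right_less])
    qed
    moreover have "\<forall>\<^sub>F s in at_right \<theta>. s < 0"
      using True by (auto simp: eventually_at_right_field)
    then have "\<forall>\<^sub>F s in at_right \<theta>. hat_path x (h + s) = hat_shift \<tau> h x s"
      using eventually_at_right_less[of \<theta>] by eventually_elim (use \<theta> in \<open>simp add: hat_shift_hat_path\<close>)
    ultimately have "(hat_shift \<tau> h x \<longlongrightarrow> hat_path x (h + \<theta>)) (at_right \<theta>)"
      by (rule Lim_transform_eventually)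
    then show ?thesis using \<theta> True by (simp add: hat_shift_hat_path at_within_Ioc)
  qed (use \<theta> in auto)
  ultimately show ?thesis by (auto simp: Dspace_def hat_shift_def)
qed

lemma has_right_derivative_integral:
  fixes e :: "real \<Rightarrow> 'a::euclidean_space"
  assumes int: "\<And>a b. e integrable_on {a..b}" and lim: "(e \<longlongrightarrow> e l) (at_right l)"
  shows "((\<lambda>h. integral {l..l + h} e) has_vector_derivative e l) (at_right 0)"
proof -
  have "((\<lambda>u. integral {l..u} e) has_vector_derivative e l) (at l within ({l..l+1} - {}))"
    by (rule integral_has_vector_derivative_continuous_at)
       (use int lim in \<open>auto simp: continuous_within at_within_Icc_at_right\<close>)
  then have d: "((\<lambda>u. integral {l..u} e) has_vector_derivative e l) (at_right l)"
    by (simp add: at_within_Icc_at_right)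
  have "(\<lambda>h. l + h) ` {0<..} = {l<..}"
    by (auto simp: image_iff intro!: bexI[of _ "_ - l"])
  with d have "((\<lambda>u. integral {l..u} e) has_vector_derivative e l) (at (l + 0) within (\<lambda>h. l + h) ` {0<..})"
    by simp
  moreover have "((\<lambda>h. l + h) has_vector_derivative 1) (at_right 0)"
    by (auto intro!: derivative_eq_intros)
  ultimately have "((\<lambda>u. integral {l..u} e) \<circ> (\<lambda>h. l + h) has_vector_derivative 1 *\<^sub>R e l) (at_right 0)"
    by (intro vector_diff_chain_within) simp_all
  then show ?thesis by (simp add: o_def)
qed

lemma integral_shift_window:
  fixes e :: "real \<Rightarrow> 'a::euclidean_space"
  assumes int: "\<And>a b. e integrable_on {a..b}" and "h \<ge> 0" "l \<le> 0"
  shows "integral {l..0} (\<lambda>\<theta>. e (h + \<theta>)) = integral {l..0} e + integral {0..h} e - integral {l..l + h} e"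
proof -
  have "integral {l..0} (\<lambda>\<theta>. e (h + \<theta>)) = integral {l + h..h} e"
    using integral_shift_Icc_real[of l 0 e h] by (simp add: o_def)
  moreover have "integral {l..l+h} e + integral {l+h..h} e = integral {l..h} e"
    using assms by (intro Henstock_Kurzweil_Integration.integral_combine) auto
  moreover have "integral {l..0} e + integral {0..h} e = integral {l..h} e"
    using assms by (intro Henstock_Kurzweil_Integration.integral_combine) auto
  ultimately show ?thesis by (simp add: algebra_simps)
qed

text \<open>The moving window gains a piece at 0 and loses one at \<open>l\<close>. Right limits at
  these two points suffice, which matters because paths may jump.\<close>

lemma has_right_derivative_shift_integral:
  fixes e :: "real \<Rightarrow> 'a::euclidean_space"
  assumes int: "\<And>a b. e integrable_on {a..b}" and "l \<le> 0"
    and "(e \<longlongrightarrow> e l) (at_right l)" "(e \<longlongrightarrow> e 0) (at_right 0)"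
  shows "((\<lambda>h. integral {l..0} (\<lambda>\<theta>. e (h + \<theta>))) has_vector_derivative e 0 - e l) (at_right 0)"
proof -
  have "((\<lambda>h. integral {l..0} e + integral {0..0 + h} e - integral {l..l + h} e) has_vector_derivative 0
      + e 0 - e l) (at_right 0)"
    by (intro derivative_intros has_right_derivative_integral assms)
  then have *: "((\<lambda>h. integral {l..0} e + integral {0..h} e - integral {l..l + h} e)
      has_vector_derivative e 0 - e l) (at_right 0)"
    by simp
  show ?thesis
    unfolding at_right_0_eq
    by (rule has_vector_derivative_transform_within[OF *[unfolded at_right_0_eq], of 1])
       (use integral_shift_window[OF int] assms in auto)
qed

lemma tail_hat_shift:
  assumes "-\<tau> \<le> l" "l \<le> 0"
  shows "tail (hat_shift \<tau> h x) l = integral {l..0} (\<lambda>\<theta>. hat_path x (h + \<theta>))"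
  unfolding tail_def by (rule integral_cong) (use assms in \<open>auto simp: hat_shift_hat_path\<close>)

lemma hat_path_integrable_on: "x \<in> Dspace \<tau> \<Longrightarrow> hat_path x integrable_on {a..b}"
  using Dspace_bound[of x \<tau>] hat_path_measurable[of x \<tau>] bounded_borel_integrable_on[of "hat_path x" a
      b] hat_path_bound
  by metis

lemma tail_right_derivative:
  assumes x: "x \<in> Dspace \<tau>" and l: "-\<tau> \<le> l" "l \<le> 0"
  shows "((\<lambda>h. tail (hat_shift \<tau> h x) l) has_vector_derivative x 0 - x l) (at_right 0)"
proof -
  have "((\<lambda>h. integral {l..0} (\<lambda>\<theta>. hat_path x (h + \<theta>))) has_vector_derivative hat_path x 0 - hat_path x
      l) (at_right 0)"
    by (intro has_right_derivative_shift_integral hat_path_integrable_on[OF x]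
        hat_path_right_continuous[OF x])
       (use l in auto)
  moreover have "hat_path x 0 - hat_path x l = x 0 - x l" using l by (auto simp: hat_path_def)
  ultimately show ?thesis by (simp add: tail_hat_shift l)
qed

lemma tail_hat_shift_diff_bound:
  assumes x: "x \<in> Dspace \<tau>" and l: "-\<tau> \<le> l" "l \<le> 0" and R: "\<And>\<theta>. norm (x \<theta>) \<le> R" and h: "h \<ge> 0"
  shows "norm (tail (hat_shift \<tau> h x) l - tail x l) \<le> 2 * R * h"
proof -
  have "tail x l = integral {l..0} (hat_path x)"
    unfolding tail_def by (rule integral_cong) (auto simp: hat_path_def)
  then have "tail (hat_shift \<tau> h x) l - tail x l = integral {0..h} (hat_path x) - integral {l..l + h}
      (hat_path x)"
    using integral_shift_window[OF hat_path_integrable_on[OF x] h l(2)] tail_hat_shift[OF l, of h x] by simp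
  moreover have "norm (integral {0..h} (hat_path x)) \<le> R * (h - 0)" "norm (integral {l..l + h} (hat_path
      x)) \<le> R * (l + h - l)"
    by (intro integral_le_sup_bound hat_path_integrable_on[OF x] hat_path_bound R; use h in simp)+
  ultimately show ?thesis
    using norm_triangle_ineq4[of "integral {0..h} (hat_path x)" "integral {l..l + h} (hat_path x)"] by simp
qed

text \<open>The piece lost at the far end of the window gives minus the square of
  \<open>x (-\<tau>)\<close>, a favourable sign; it is spent on the discrete delay in
  \<open>dissipation\<close>.\<close>

lemma innerH_right_derivative:
  assumes x: "x \<in> Dspace \<tau>" and \<tau>: "\<tau> > 0"
  shows "((\<lambda>h. innerH \<tau> (hat_shift \<tau> h x) (hat_shift \<tau> h x)) has_real_derivative
     (norm (x 0))\<^sup>2 - (norm (x (-\<tau>)))\<^sup>2) (at_right 0)"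
proof -
  let ?e = "\<lambda>r. hat_path x r \<bullet> hat_path x r"
  obtain R where R: "\<And>\<theta>. norm (x \<theta>) \<le> R" using Dspace_bound x by metis
  have int: "?e integrable_on {a..b}" for a b
    using hat_path_measurable[OF x] hat_path_bound[of x R, OF R]
    by (intro bounded_borel_integrable_on[where R = "R\<^sup>2"])
       (auto simp: power2_norm_eq_inner[symmetric] intro!: power_mono)
  have "((\<lambda>h. integral {-\<tau>..0} (\<lambda>\<theta>. ?e (h + \<theta>))) has_vector_derivative ?e 0 - ?e (-\<tau>)) (at_right 0)"
    by (rule has_right_derivative_shift_integral[where e = ?e])
       (use int \<tau> in \<open>auto intro!: tendsto_intros hat_path_right_continuous[OF x]\<close>)
  then have "((\<lambda>h. integral {-\<tau>..0} (\<lambda>\<theta>. ?e (h + \<theta>))) has_real_derivative (norm (x 0))\<^sup>2 - (norm (x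
      (-\<tau>)))\<^sup>2) (at_right 0)"
    using \<tau> by (simp add: has_real_derivative_iff_has_vector_derivative power2_norm_eq_inner hat_path_def)
  then have d: "((\<lambda>h. integral {-\<tau>..0} (\<lambda>\<theta>. ?e (h + \<theta>))) has_real_derivative
      (norm (x 0))\<^sup>2 - (norm (x (-\<tau>)))\<^sup>2) (at 0 within {0..})"
    by (simp add: at_right_0_eq)
  have eq: "integral {-\<tau>..0} (\<lambda>\<theta>. ?e (h + \<theta>)) = innerH \<tau> (hat_shift \<tau> h x) (hat_shift \<tau> h x)"
    if "h \<in> {0..}" for h
  proof -
    have "innerH \<tau> (hat_shift \<tau> h x) (hat_shift \<tau> h x) =
        integral {-\<tau>..0} (\<lambda>\<theta>. hat_shift \<tau> h x \<theta> \<bullet> hat_shift \<tau> h x \<theta>)"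
      using that by (simp add: innerH_eq inner_L2_eq_integral Dspace_L2[OF hat_shift_Dspace[OF x]])
    also have "\<dots> = integral {-\<tau>..0} (\<lambda>\<theta>. ?e (h + \<theta>))"
      by (rule integral_cong) (simp add: hat_shift_hat_path)
    finally show ?thesis by simp
  qed
  show ?thesis
    unfolding at_right_0_eq
    by (rule has_field_derivative_transform_within[OF d, of 1]) (use eq in auto)
qed

text \<open>Differentiation under the integral over \<open>l\<close> by dominated convergence: each
  primitive has a right derivative at every \<open>l\<close>, and the difference quotients are
  bounded because shifting changes a primitive by at most \<open>2 * R * h\<close>.\<close>

lemma weak_inner_right_derivative:
  assumes x: "x \<in> Dspace \<tau>" and y: "y \<in> Dspace \<tau>" and \<tau>: "\<tau> > 0"
  shows "((\<lambda>h. weak_inner \<tau> (hat_shift \<tau> h x - y) (hat_shift \<tau> h x - y)) has_real_derivative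
     2 * integral {-\<tau>..0} (\<lambda>l. tail (x - y) l \<bullet> (x 0 - x l))) (at_right 0)"
proof -
  define u where "u = (\<lambda>h l. tail (hat_shift \<tau> h x) l - tail y l)"
  define g where "g = (\<lambda>l. 2 * (u 0 l \<bullet> (x 0 - x l)))"
  define q where "q = (\<lambda>h l. (u h l \<bullet> u h l - u 0 l \<bullet> u 0 l) / h)"
  obtain R where R: "R \<ge> 0" "\<And>\<theta>. norm (x \<theta>) \<le> R" using Dspace_bound x by metis
  have cont: "continuous_on {-\<tau>..0} (u h)" if "h \<ge> 0" for h
    unfolding u_def
    by (intro continuous_intros continuous_on_tail Dspace_L2[OF y] Dspace_L2[OF hat_shift_Dspace[OF x
        that]])
  have cont': "continuous_on {-\<tau>..0} (\<lambda>l. u h l \<bullet> u h l)" if "h \<ge> 0" for h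
    by (intro continuous_intros cont that)
  have eq: "tail (hat_shift \<tau> h x - y) l = u h l" if "h \<ge> 0" "l \<in> {-\<tau>..0}" for h l
    unfolding u_def using that tail_diff[of "hat_shift \<tau> h x" \<tau> y l] Dspace_L2[OF hat_shift_Dspace[OF
        x]] Dspace_L2[OF y] by simp
  have weak_eq: "weak_inner \<tau> (hat_shift \<tau> h x - y) (hat_shift \<tau> h x - y) = integral {-\<tau>..0} (\<lambda>l. u h l
      \<bullet> u h l)"
    if "h \<ge> 0" for h
    unfolding weak_inner_def by (rule integral_cong) (simp add: eq that)
  have "bounded (u 0 ` {-\<tau>..0})"
    by (intro compact_imp_bounded compact_continuous_image cont) auto
  then obtain M where M: "\<And>l. l \<in> {-\<tau>..0} \<Longrightarrow> norm (u 0 l) \<le> M" unfolding bounded_iff by blast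
  have M0: "M \<ge> 0" using M[of 0] \<tau> by (auto intro: order_trans[OF norm_ge_zero])
  have lim: "((\<lambda>h. (weak_inner \<tau> (hat_shift \<tau> h x - y) (hat_shift \<tau> h x - y) - weak_inner \<tau> (hat_shift \<tau>
      0 x - y) (hat_shift \<tau> 0 x - y)) / h)
      \<longlongrightarrow> integral {-\<tau>..0} g) (at_right 0)"
  proof (rule tendsto_at_right_sequentially[of 0 1])
    fix S :: "nat \<Rightarrow> real" assume S: "\<And>n. 0 < S n" "\<And>n. S n < 1" "S \<longlonglongrightarrow> 0"
    have "(\<lambda>n. integral {-\<tau>..0} (q (S n))) \<longlonglongrightarrow> integral {-\<tau>..0} g"
    \<comment> \<open>A difference of squares is the product of difference and sum: the first is at
      most \<open>2 * R * h\<close>, the second at most \<open>2 * M + 2 * R\<close> since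
      \<open>h < 1\<close>.\<close>
    proof (rule dominated_convergence(2)[where h = "\<lambda>_. 2 * R * (2 * M + 2 * R)"])
      show "q (S n) integrable_on {-\<tau>..0}" for n
        unfolding q_def using S(1)[of n]
        by (intro integrable_continuous_real continuous_intros cont) auto
      show "norm (q (S n) l) \<le> 2 * R * (2 * M + 2 * R)" if l: "l \<in> {-\<tau>..0}" for n l
      proof -
        let ?h = "S n"
        have d: "norm (u ?h l - u 0 l) \<le> 2 * R * ?h"
          using tail_hat_shift_diff_bound[where x = x and l = l and h = ?h and R = R, OF x _ _ R(2)] l
              S(1)[of n]
          by (simp add: u_def hat_shift_0[OF x])
        have "2 * R * ?h \<le> 2 * R * 1" using S(1,2)[of n] R by (intro mult_left_mono) auto
        then have "norm (u ?h l - u 0 l) \<le> 2 * R" using d by simp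
        moreover have "norm (u ?h l + u 0 l) \<le> norm (u ?h l - u 0 l) + norm (2 *\<^sub>R u 0 l)"
          using norm_triangle_ineq[of "u ?h l - u 0 l" "2 *\<^sub>R u 0 l"] by (simp add: scaleR_2 add.commute)
        ultimately have s: "norm (u ?h l + u 0 l) \<le> 2 * M + 2 * R" using M[OF l] by simp
        have "u ?h l \<bullet> u ?h l - u 0 l \<bullet> u 0 l = (u ?h l - u 0 l) \<bullet> (u ?h l + u 0 l)"
          by (simp add: inner_diff_left inner_add_right inner_diff_right inner_commute)
        then have "\<bar>u ?h l \<bullet> u ?h l - u 0 l \<bullet> u 0 l\<bar> \<le> (2 * R * ?h) * (2 * M + 2 * R)"
          using Cauchy_Schwarz_ineq2[of "u ?h l - u 0 l" "u ?h l + u 0 l"] d s M0 R S(1)[of n]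
          by (smt (verit) mult_mono norm_ge_zero)
        then show ?thesis using S(1)[of n] by (simp add: q_def divide_simps algebra_simps)
      qed
      show "(\<lambda>n. q (S n) l) \<longlonglongrightarrow> g l" if l: "l \<in> {-\<tau>..0}" for l
      proof -
        have "((\<lambda>h. u h l) has_vector_derivative (x 0 - x l) - 0) (at_right 0)"
          unfolding u_def by (intro derivative_intros tail_right_derivative[OF x]) (use l in auto)
        then have "((\<lambda>h. u h l \<bullet> u h l) has_vector_derivative u 0 l \<bullet> (x 0 - x l) + (x 0 - x l) \<bullet> u 0 l)
            (at_right 0)"
          using bounded_bilinear.has_vector_derivative[OF bounded_bilinear_inner, of "\<lambda>h. u h l" _ 0
              "{0<..}" "\<lambda>h. u h l"] by simp
        then have "((\<lambda>h. u h l \<bullet> u h l) has_real_derivative g l) (at_right 0)"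
          by (simp add: g_def has_real_derivative_iff_has_vector_derivative inner_commute)
        then have "((\<lambda>h. q h l) \<longlongrightarrow> g l) (at_right 0)"
          by (simp add: has_field_derivative_iff q_def)
        moreover have "filterlim S (at_right 0) sequentially"
          using S by (auto simp: filterlim_at intro!: always_eventually) (metis less_irrefl)
        ultimately show ?thesis by (rule filterlim_compose)
      qed
    qed auto
    moreover have "(weak_inner \<tau> (hat_shift \<tau> (S n) x - y) (hat_shift \<tau> (S n) x - y) - weak_inner \<tau>
        (hat_shift \<tau> 0 x - y) (hat_shift \<tau> 0 x - y)) / S n
      = integral {-\<tau>..0} (q (S n))" for n
      using S(1)[of n] unfolding q_def
      by (simp add: weak_eq Henstock_Kurzweil_Integration.integral_diff integrable_continuous_real cont')
    ultimately show "(\<lambda>n. (weak_inner \<tau> (hat_shift \<tau> (S n) x - y) (hat_shift \<tau> (S n) x - y) - weak_inner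
        \<tau> (hat_shift \<tau> 0 x - y) (hat_shift \<tau> 0 x - y)) / S n)
       \<longlonglongrightarrow> integral {-\<tau>..0} g" by simp
  qed auto
  have "integral {-\<tau>..0} g = 2 * integral {-\<tau>..0} (\<lambda>l. tail (x - y) l \<bullet> (x 0 - x l))"
  proof -
    have "integral {-\<tau>..0} g = integral {-\<tau>..0} (\<lambda>l. 2 * (tail (x - y) l \<bullet> (x 0 - x l)))"
      by (rule integral_cong) (use eq[of 0] in \<open>simp add: g_def hat_shift_0[OF x]\<close>)
    then show ?thesis by simp
  qed
  with lim show ?thesis by (simp add: has_field_derivative_iff)
qed

section \<open>The test functions\<close>

lemma C1_witness_eq:
  assumes "C1_witness T X N f f' p" "\<And>t z. g t z = f t z" "\<And>t z. g' t z = f' t z"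
    "\<And>t z w. q t z w = p t z w"
  shows "C1_witness T X N g g' q"
proof -
  have "g = f" "g' = f'" "q = p" using assms(2-) by (simp_all add: fun_eq_iff)
  then show ?thesis using assms(1) by simp
qed

definition quad_test_prod ::
  "real \<Rightarrow> real \<Rightarrow> (real \<Rightarrow> real ^ 'd ^ 'd) \<Rightarrow> real \<Rightarrow> real \<Rightarrow> real \<Rightarrow> real \<Rightarrow> real \<Rightarrow>
   real ^ 'd \<Rightarrow> ('d::finite) path \<Rightarrow> real \<Rightarrow> real \<Rightarrow> (real ^ 'd) \<times> 'd path \<Rightarrow> real" where
  "quad_test_prod T \<tau> B \<beta> \<gamma> \<alpha> C \<kappa> c y s t z =
     \<beta> * (norm (fst z + B t *v tail (snd z) (-\<tau>) - c))\<^sup>2 + \<beta> * weak_inner \<tau> (snd z - y) (snd z - y)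
     + \<gamma> * (t - s)\<^sup>2 + \<alpha> * exp (- C * t) * (1 + inner_RdH \<tau> z z) + \<kappa> * (T - t)"

definition quad_test ::
  "real \<Rightarrow> real \<Rightarrow> (real \<Rightarrow> real ^ 'd ^ 'd) \<Rightarrow> real \<Rightarrow> real \<Rightarrow> real \<Rightarrow> real \<Rightarrow> real \<Rightarrow>
   real ^ 'd \<Rightarrow> ('d::finite) path \<Rightarrow> real \<Rightarrow> real \<Rightarrow> 'd path \<Rightarrow> real" where
  "quad_test T \<tau> B \<beta> \<gamma> \<alpha> C \<kappa> c y s t x =
     \<beta> * (norm (x 0 + B t *v tail x (-\<tau>) - c))\<^sup>2 + \<beta> * weak_inner \<tau> (x - y) (x - y)
     + \<gamma> * (t - s)\<^sup>2 + \<alpha> * exp (- C * t) * (1 + (norm (x 0))\<^sup>2 + innerH \<tau> x x) + \<kappa> * (T - t)"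

lemma quad_test_eq: "quad_test T \<tau> B \<beta> \<gamma> \<alpha> C \<kappa> c y s t x = quad_test_prod T \<tau> B \<beta> \<gamma> \<alpha> C \<kappa> c y s t (x 0, x)"
  by (simp add: quad_test_def quad_test_prod_def inner_RdH_def power2_norm_eq_inner add.assoc)

section \<open>Smoothness and shift derivative of the test functions\<close>

context
  fixes T \<tau> :: real
  assumes T: "T > 0" and \<tau>: "\<tau> > 0"
begin

interpretation RdH: seminormed_space "UNIV \<times> Hspace \<tau> :: ((real ^ 'd::finite) \<times> 'd path) set" "norm_RdH \<tau>"
  by (rule seminormed_space_RdH)

interpretation D: seminormed_space "Dspace \<tau> :: ('d::finite) path set" "normD \<tau>"
  by (rule seminormed_space_D) (use \<tau> in simp)

lemma fst_dual: "(\<lambda>z. fst z $ i) \<in> dual_on (UNIV \<times> Hspace \<tau> :: ((real ^ 'd::finite) \<times> 'd path) set)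
    (norm_RdH \<tau>)"
  unfolding dual_on_def
  by (auto intro!: exI[of _ 1] order_trans[OF component_le_norm_cart fst_le_norm_RdH[of "(_, _)",
      simplified]])

lemma tail_dual:
  "(\<lambda>z. tail (snd z) (-\<tau>) $ i) \<in> dual_on (UNIV \<times> Hspace \<tau> :: ((real ^ 'd::finite) \<times> 'd path) set)
      (norm_RdH \<tau>)"
  unfolding dual_on_def
proof (intro CollectI conjI ballI allI exI)
  fix z w :: "(real ^ 'd) \<times> 'd path" and k assume z: "z \<in> UNIV \<times> Hspace \<tau>" and w: "w \<in> UNIV \<times> Hspace \<tau>"
  then show "tail (snd (z + w)) (-\<tau>) $ i = tail (snd z) (-\<tau>) $ i + tail (snd w) (-\<tau>) $ i"
    by (auto simp: Hspace_def tail_add)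
  show "tail (snd (k *\<^sub>R z)) (-\<tau>) $ i = k * tail (snd z) (-\<tau>) $ i" by (simp add: tail_scale)
  have "\<bar>tail (snd z) (-\<tau>) $ i\<bar> \<le> norm (tail (snd z) (-\<tau>))" by (rule component_le_norm_cart)
  also have "\<dots> \<le> sqrt \<tau> * normH \<tau> (snd z)"
    using tail_bound[of "snd z" \<tau> "-\<tau>"] z \<tau> by (auto simp: Hspace_def normH_eq)
  also have "\<dots> \<le> sqrt \<tau> * norm_RdH \<tau> z"
    by (intro mult_left_mono snd_le_norm_RdH) (use \<tau> in auto)
  finally show "\<bar>tail (snd z) (-\<tau>) $ i\<bar> \<le> sqrt \<tau> * norm_RdH \<tau> z" .
qed

lemma quad_test_prod_witness:
  fixes B B' :: "real \<Rightarrow> real ^ 'd::finite ^ 'd" and y :: "'d path"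
  assumes B: "\<And>t. t \<in> {0..T} \<Longrightarrow> (B has_vector_derivative B' t) (at t within {0..T})"
    and B': "continuous_on {0..T} B'" and y: "y \<in> Hspace \<tau>"
  shows "C1_witness T (UNIV \<times> Hspace \<tau>) (norm_RdH \<tau>) (quad_test_prod T \<tau> B \<beta> \<gamma> \<alpha> C \<kappa> c y s)
    (\<lambda>t z. 2 * \<beta> * ((fst z + B t *v tail (snd z) (-\<tau>) - c) \<bullet> (B' t *v tail (snd z) (-\<tau>)))
      + 2 * \<gamma> * (t - s) - \<alpha> * C * exp (- C * t) * (1 + inner_RdH \<tau> z z) - \<kappa>)
    (\<lambda>t z w. 2 * \<beta> * ((fst z + B t *v tail (snd z) (-\<tau>) - c) \<bullet> (fst w + B t *v tail (snd w) (-\<tau>)))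
      + 2 * \<beta> * weak_inner \<tau> (snd z - y) (snd w) + 2 * \<alpha> * exp (- C * t) * inner_RdH \<tau> z w)"
proof -
  let ?X = "UNIV \<times> Hspace \<tau> :: ((real ^ 'd::finite) \<times> 'd path) set" and ?N = "norm_RdH \<tau>"
  define m where "m = (\<lambda>z :: (real ^ 'd) \<times> 'd path. tail (snd z) (-\<tau>))"
  \<comment> \<open>The calculus of witnesses is scalar, so the vector inside the square is split
    into coordinates; each is built from entries of \<open>B t\<close> and bounded
    functionals.\<close>
  define g where "g = (\<lambda>i t z. (fst z $ i + (\<Sum>j\<in>UNIV. B t $ i $ j * m z $ j)) + (- c $ i))"
  have Bd: "((\<lambda>t. B t $ i $ j) has_real_derivative B' t $ i $ j) (at t within {0..T})" if "t \<in> {0..T}"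
      for t i j
    using bounded_linear.has_vector_derivative[OF bounded_linear_vec_nth
        bounded_linear.has_vector_derivative[OF bounded_linear_vec_nth B[OF that]], of i j]
    by (simp add: has_real_derivative_iff_has_vector_derivative)
  have B'c: "continuous_on {0..T} (\<lambda>t. B' t $ i $ j)" for i j by (intro continuous_intros B')
  have Bm: "C1_witness T ?X ?N (\<lambda>t z. B t $ i $ j * m z $ j) (\<lambda>t z. B t $ i $ j * 0 + m z $ j * B' t $ i
      $ j)
      (\<lambda>t z w. B t $ i $ j * m w $ j + m z $ j * 0)" for i j
    unfolding m_def
    by (rule RdH.C1_witness_mult[OF RdH.C1_witness_time[OF Bd B'c] RdH.C1_witness_linear[OF tail_dual]])
  have g: "C1_witness T ?X ?N (g i) (\<lambda>t z. (0 + (\<Sum>j\<in>UNIV. B t $ i $ j * 0 + m z $ j * B' t $ i $ j)) + 0)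
      (\<lambda>t z w. (fst w $ i + (\<Sum>j\<in>UNIV. B t $ i $ j * m w $ j + m z $ j * 0)) + 0)" for i
    unfolding g_def
    by (rule RdH.C1_witness_add[OF RdH.C1_witness_add[OF RdH.C1_witness_linear[OF fst_dual]
        RdH.C1_witness_sum[OF finite Bm]]
          RdH.C1_witness_const])
  have g_eq: "g i t z = (fst z + B t *v m z - c) $ i" for i t z
    by (simp add: g_def matrix_vector_mult_def)
  have gg: "C1_witness T ?X ?N (\<lambda>t z. \<Sum>i\<in>UNIV. g i t z * g i t z)
     (\<lambda>t z. \<Sum>i\<in>UNIV. g i t z * ((0 + (\<Sum>j\<in>UNIV. B t $ i $ j * 0 + m z $ j * B' t $ i $ j)) + 0)
        + g i t z * ((0 + (\<Sum>j\<in>UNIV. B t $ i $ j * 0 + m z $ j * B' t $ i $ j)) + 0))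
     (\<lambda>t z w. \<Sum>i\<in>UNIV. g i t z * ((fst w $ i + (\<Sum>j\<in>UNIV. B t $ i $ j * m w $ j + m z $ j * 0)) + 0)
        + g i t z * ((fst w $ i + (\<Sum>j\<in>UNIV. B t $ i $ j * m w $ j + m z $ j * 0)) + 0))"
    by (rule RdH.C1_witness_sum[OF finite RdH.C1_witness_mult[OF g g]])
  have w1: "C1_witness T ?X ?N (\<lambda>t z. (norm (fst z + B t *v m z - c))\<^sup>2)
     (\<lambda>t z. 2 * ((fst z + B t *v m z - c) \<bullet> (B' t *v m z)))
     (\<lambda>t z w. 2 * ((fst z + B t *v m z - c) \<bullet> (fst w + B t *v m w)))"
  proof -
    have "(norm (fst z + B t *v m z - c))\<^sup>2 = (\<Sum>i\<in>UNIV. g i t z * g i t z)" for t z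
      by (simp add: power2_norm_eq_inner inner_vec_def g_eq)
    moreover have "(\<Sum>i\<in>UNIV. g i t z * ((0 + (\<Sum>j\<in>UNIV. B t $ i $ j * 0 + m z $ j * B' t $ i $ j)) + 0)
        + g i t z * ((0 + (\<Sum>j\<in>UNIV. B t $ i $ j * 0 + m z $ j * B' t $ i $ j)) + 0))
        = 2 * ((fst z + B t *v m z - c) \<bullet> (B' t *v m z))" for t z
      by (simp add: inner_vec_def g_eq matrix_vector_mult_def sum_distrib_left mult.commute
          mult.left_commute
          flip: sum.distrib)
    moreover have "(\<Sum>i\<in>UNIV. g i t z * ((fst w $ i + (\<Sum>j\<in>UNIV. B t $ i $ j * m w $ j + m z $ j * 0)) + 0)
        + g i t z * ((fst w $ i + (\<Sum>j\<in>UNIV. B t $ i $ j * m w $ j + m z $ j * 0)) + 0))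
        = 2 * ((fst z + B t *v m z - c) \<bullet> (fst w + B t *v m w))" for t z w
      by (simp add: inner_vec_def g_eq matrix_vector_mult_def sum_distrib_left mult.commute
          mult.left_commute
          flip: sum.distrib)
    ultimately show ?thesis using gg by simp
  qed
  have w2: "C1_witness T ?X ?N (\<lambda>t z. weak_inner \<tau> (snd (z - (0, y))) (snd (z - (0, y)))) (\<lambda>t z. 0)
      (\<lambda>t z w. 2 * weak_inner \<tau> (snd (z - (0, y))) (snd w))"
  proof (rule RdH.C1_witness_quadratic[where B = "\<lambda>z w. weak_inner \<tau> (snd z) (snd w)" and K = "\<tau>\<^sup>2"])
    fix z w :: "(real ^ 'd) \<times> 'd path" assume zw: "z \<in> ?X" "w \<in> ?X"
    then have "\<bar>weak_inner \<tau> (snd z) (snd w)\<bar> \<le> \<tau>\<^sup>2 * (normH \<tau> (snd z) * normH \<tau> (snd w))"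
      using weak_inner_bound[of "snd z" \<tau> "snd w"] \<tau> by (auto simp: Hspace_def normH_eq mult.assoc)
    also have "\<dots> \<le> \<tau>\<^sup>2 * (?N z * ?N w)"
      by (intro mult_left_mono mult_mono snd_le_norm_RdH normH_nonneg order_trans[OF normH_nonneg
          snd_le_norm_RdH]) simp
    finally show "\<bar>weak_inner \<tau> (snd z) (snd w)\<bar> \<le> \<tau>\<^sup>2 * ?N z * ?N w" by (simp add: mult.assoc)
  next
    show "weak_inner \<tau> (snd z) (snd w) = weak_inner \<tau> (snd w) (snd z)" for z w :: "(real ^ 'd) \<times> 'd path"
      by (rule weak_inner_commute)
    show "weak_inner \<tau> (snd (k *\<^sub>R z)) (snd w) = k * weak_inner \<tau> (snd z) (snd w)" for k and z w ::
        "(real ^ 'd) \<times> 'd path"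
      by (simp add: weak_inner_scale)
    show "(0, y) \<in> ?X" using y by simp
  qed (auto simp: Hspace_def weak_inner_add)
  have w3: "C1_witness T ?X ?N (\<lambda>t z. inner_RdH \<tau> (z - 0) (z - 0)) (\<lambda>t z. 0) (\<lambda>t z w. 2 * inner_RdH \<tau> (z
      - 0) w)"
  proof (rule RdH.C1_witness_quadratic[where B = "inner_RdH \<tau>" and K = 1])
    show "inner_RdH \<tau> z w = inner_RdH \<tau> w z" for z w :: "(real ^ 'd) \<times> 'd path"
      by (simp add: inner_RdH_def innerH_eq inner_commute inner_L2_commute[of _ _ "snd z"])
    have add: "inner_RdH \<tau> (x + y) z = inner_RdH \<tau> x z + inner_RdH \<tau> y z"
      if "x \<in> ?X" "y \<in> ?X" "z \<in> ?X" for x y z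
      using that unfolding inner_RdH_def Hspace_def innerH_eq
      by (simp add: mem_Times_iff inner_L2_add inner_add_left)
    have scale: "inner_RdH \<tau> (c *\<^sub>R z) w = c * inner_RdH \<tau> z w" for c and z w :: "(real ^ 'd) \<times> 'd path"
      by (simp add: inner_RdH_def innerH_eq inner_L2_scale distrib_left)
    have com: "inner_RdH \<tau> z w = inner_RdH \<tau> w z" for z w :: "(real ^ 'd) \<times> 'd path"
      by (simp add: inner_RdH_def innerH_eq inner_commute inner_L2_commute[of _ _ "snd z"])
    have nn: "0 \<le> inner_RdH \<tau> z z" for z :: "(real ^ 'd) \<times> 'd path"
      by (simp add: inner_RdH_def innerH_eq inner_L2_nonneg)
    show "\<bar>inner_RdH \<tau> z w\<bar> \<le> 1 * ?N z * ?N w" if "z \<in> ?X" "w \<in> ?X" for z w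
      using semi_inner_Cauchy_Schwarz[where B = "inner_RdH \<tau>" and X = ?X, OF add scale com nn
          RdH.add_mem RdH.scale_mem that]
      by (simp add: norm_RdH_eq)
    show "inner_RdH \<tau> (x + y) z = inner_RdH \<tau> x z + inner_RdH \<tau> y z"
      if "x \<in> ?X" "y \<in> ?X" "z \<in> ?X" for x y z using add that .
    show "inner_RdH \<tau> (c *\<^sub>R z) w = c * inner_RdH \<tau> z w" for c and z w :: "(real ^ 'd) \<times> 'd path" by
        (rule scale)
    show "0 \<in> ?X" by (rule RdH.zero_mem)
  qed
  have w4: "C1_witness T ?X ?N (\<lambda>t z. \<gamma> * (t - s)\<^sup>2 + \<kappa> * (T - t)) (\<lambda>t z. 2 * \<gamma> * (t - s) - \<kappa>) (\<lambda>t z w. 0)"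
    by (rule RdH.C1_witness_time) (auto intro!: derivative_eq_intros continuous_intros)
  have w5: "C1_witness T ?X ?N (\<lambda>t z. \<alpha> * exp (- C * t)) (\<lambda>t z. - \<alpha> * C * exp (- C * t)) (\<lambda>t z w. 0)"
    by (rule RdH.C1_witness_time) (auto intro!: derivative_eq_intros continuous_intros)
  note w6 = RdH.C1_witness_mult[OF w5 RdH.C1_witness_add[OF RdH.C1_witness_const[of T 1] w3]]
  note b1 = RdH.C1_witness_mult[OF RdH.C1_witness_const[of T \<beta>] w1]
  note b2 = RdH.C1_witness_mult[OF RdH.C1_witness_const[of T \<beta>] w2]
  note w7 = RdH.C1_witness_add[OF RdH.C1_witness_add[OF b1 b2] RdH.C1_witness_add[OF w4 w6]]
  show ?thesis
    by (rule C1_witness_eq[OF w7]) (simp_all add: quad_test_prod_def m_def algebra_simps)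
qed

lemma quad_test_witness:
  fixes B B' :: "real \<Rightarrow> real ^ 'd::finite ^ 'd" and y :: "'d path"
  assumes B: "\<And>t. t \<in> {0..T} \<Longrightarrow> (B has_vector_derivative B' t) (at t within {0..T})"
    and B': "continuous_on {0..T} B'" and y: "y \<in> Hspace \<tau>"
  shows "C1_witness T (Dspace \<tau>) (normD \<tau>) (quad_test T \<tau> B \<beta> \<gamma> \<alpha> C \<kappa> c y s)
    (\<lambda>t x. 2 * \<beta> * ((x 0 + B t *v tail x (-\<tau>) - c) \<bullet> (B' t *v tail x (-\<tau>)))
      + 2 * \<gamma> * (t - s) - \<alpha> * C * exp (- C * t) * (1 + (norm (x 0))\<^sup>2 + innerH \<tau> x x) - \<kappa>)
    (\<lambda>t x w. 2 * \<beta> * ((x 0 + B t *v tail x (-\<tau>) - c) \<bullet> (w 0 + B t *v tail w (-\<tau>)))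
      + 2 * \<beta> * weak_inner \<tau> (x - y) w + 2 * \<alpha> * exp (- C * t) * (x 0 \<bullet> w 0 + innerH \<tau> x w))"
  by (rule C1_witness_eq[OF D.C1_witness_pullback[where J = "\<lambda>x. (x 0, x)" and C = "sqrt (1 + \<tau>)",
          OF quad_test_prod_witness[OF B B' y, of \<beta> \<gamma> \<alpha> C \<kappa> c s]]])
     (use \<tau> in \<open>simp_all add: Dspace_Hspace fun_diff_def plus_fun_def scaleR_fun_def quad_test_eq
        inner_RdH_def power2_norm_eq_inner norm_RdH_le_normD seminormed_space_RdH add.assoc\<close>)

text \<open>The shift keeps the present value \<open>x 0\<close>, so only the terms that contain an
  integral over the window contribute.\<close>

lemma quad_test_right_derivative:
  fixes x y :: "('d::finite) path"
  assumes x: "x \<in> Dspace \<tau>" and y: "y \<in> Dspace \<tau>"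
  shows "((\<lambda>h. quad_test T \<tau> B \<beta> \<gamma> \<alpha> C \<kappa> c y s t (hat_shift \<tau> h x)) has_real_derivative
      2 * \<beta> * ((x 0 + B t *v tail x (-\<tau>) - c) \<bullet> (B t *v (x 0 - x (-\<tau>))))
      + 2 * \<beta> * integral {-\<tau>..0} (\<lambda>l. tail (x - y) l \<bullet> (x 0 - x l))
      + \<alpha> * exp (- C * t) * ((norm (x 0))\<^sup>2 - (norm (x (-\<tau>)))\<^sup>2)) (at_right 0)"
proof -
  have v: "((\<lambda>h. x 0 + B t *v tail (hat_shift \<tau> h x) (-\<tau>) - c) has_vector_derivative
      0 + B t *v (x 0 - x (-\<tau>)) - 0) (at_right 0)"
    by (intro derivative_intros bounded_linear.has_vector_derivative[OF matrix_vector_mul_bounded_linear]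
        tail_right_derivative[OF x]) (use \<tau> in auto)
  have d: "((\<lambda>h. (norm (x 0 + B t *v tail (hat_shift \<tau> h x) (-\<tau>) - c))\<^sup>2) has_real_derivative
      2 * ((x 0 + B t *v tail x (-\<tau>) - c) \<bullet> (B t *v (x 0 - x (-\<tau>))))) (at_right 0)"
    using bounded_bilinear.has_vector_derivative[OF bounded_bilinear_inner v v]
    by (simp add: has_real_derivative_iff_has_vector_derivative power2_norm_eq_inner hat_shift_0[OF x]
        inner_commute)
  have "((\<lambda>h. \<beta> * (norm (x 0 + B t *v tail (hat_shift \<tau> h x) (-\<tau>) - c))\<^sup>2
      + \<beta> * weak_inner \<tau> (hat_shift \<tau> h x - y) (hat_shift \<tau> h x - y)
      + \<gamma> * (t - s)\<^sup>2 + \<alpha> * exp (- C * t) * (1 + (norm (x 0))\<^sup>2 + innerH \<tau> (hat_shift \<tau> h x) (hat_shift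
          \<tau> h x)) + \<kappa> * (T - t))
    has_real_derivative \<beta> * (2 * ((x 0 + B t *v tail x (-\<tau>) - c) \<bullet> (B t *v (x 0 - x (-\<tau>)))))
      + \<beta> * (2 * integral {-\<tau>..0} (\<lambda>l. tail (x - y) l \<bullet> (x 0 - x l)))
      + 0 + \<alpha> * exp (- C * t) * (0 + 0 + ((norm (x 0))\<^sup>2 - (norm (x (-\<tau>)))\<^sup>2)) + 0) (at_right 0)"
    by (intro DERIV_add DERIV_cmult DERIV_const d weak_inner_right_derivative innerH_right_derivative x y \<tau>)
  then show ?thesis
    unfolding quad_test_def at_right_0_eq
    by (elim has_field_derivative_transform_within[of _ _ _ _ 1, rotated 4, THEN DERIV_cong])
       (use \<tau> in \<open>auto simp: hat_shift_at_0\<close>)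
qed

text \<open>\<open>Dhat_S\<close> asks for Borel measurability; preimages of open sets under a
  continuous function are among the generators of \<open>borelD\<close>.\<close>

lemma C0_borelD_measurable:
  fixes g :: "real \<Rightarrow> ('d::finite) path \<Rightarrow> real"
  assumes g: "g \<in> C0_on T (Dspace \<tau>) (normD \<tau>)" and t: "t \<in> {0..T}"
  shows "g t \<in> borel_measurable (borelD \<tau>)"
proof (rule borel_measurableI)
  let ?G = "{A. A \<subseteq> Dspace \<tau> \<and> (\<forall>x\<in>A. \<exists>e>0. \<forall>y\<in>Dspace \<tau>. normD \<tau> (y - x) < e \<longrightarrow> y \<in> A)}"
  have G: "?G \<subseteq> Pow (Dspace \<tau>)" by auto
  fix S :: "real set" assume S: "open S"
  have "g t -` S \<inter> Dspace \<tau> \<in> ?G"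
  proof (intro CollectI conjI ballI)
    fix x assume x: "x \<in> g t -` S \<inter> Dspace \<tau>"
    then have "((\<lambda>(s, y). g s y) \<longlongrightarrow> g t x) (nhds_on T (Dspace \<tau>) (normD \<tau>) t x)"
      using g t by (auto simp: C0_on_def)
    then have "\<forall>\<^sub>F z in nhds_on T (Dspace \<tau>) (normD \<tau>) t x. (case z of (s, y) \<Rightarrow> g s y) \<in> S"
      using S x by (auto simp: tendsto_def)
    then obtain e where "e > 0" "\<forall>s\<in>{0..T}. \<forall>y\<in>Dspace \<tau>. \<bar>s - t\<bar> < e \<longrightarrow> normD \<tau> (y - x) < e \<longrightarrow> g s y \<in> S"
      unfolding eventually_nhds_on by auto
    then show "\<exists>e>0. \<forall>y\<in>Dspace \<tau>. normD \<tau> (y - x) < e \<longrightarrow> y \<in> g t -` S \<inter> Dspace \<tau>"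
      using t by (intro exI[of _ e]) auto
  qed auto
  then have "g t -` S \<inter> Dspace \<tau> \<in> sets (borelD \<tau>)"
    unfolding borelD_def sets_measure_of[OF G] by (rule sigma_sets.Basic)
  moreover have "space (borelD \<tau> :: 'd path measure) = Dspace \<tau>"
    unfolding borelD_def by (rule space_measure_of[OF G])
  ultimately show "g t -` S \<inter> space (borelD \<tau>) \<in> sets (borelD \<tau>)" by simp
qed

section \<open>The direction \<open>at_zero v\<close> that enters the Hamiltonian\<close>

lemma at_zero_Dspace: "at_zero v \<in> Dspace \<tau>"
proof -
  have "(at_zero v \<longlongrightarrow> at_zero v \<theta>) (at \<theta> within {\<theta><..0})" if "\<theta> \<le> 0" for \<theta>
  proof (cases "\<theta> = 0")
    case False
    then have "\<theta> < 0" using that by simp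
    then have "\<forall>\<^sub>F s in at_right \<theta>. s < 0" by (auto simp: eventually_at_right_field)
    then have "\<forall>\<^sub>F s in at_right \<theta>. 0 = at_zero v s" by eventually_elim (simp add: at_zero_def)
    then have "(at_zero v \<longlongrightarrow> 0) (at_right \<theta>)" by (rule Lim_transform_eventually[OF tendsto_const])
    then show ?thesis using \<open>\<theta> < 0\<close> by (simp add: at_within_Ioc at_zero_def)
  qed simp
  then show ?thesis
    using \<tau> by (auto simp: Dspace_def at_zero_def bounded_iff intro!: exI[of _ "norm v"])
qed

text \<open>Integrals ignore a single time. Hence the gradient in this direction retains only the
  dependence on \<open>x 0\<close>: the coupling by \<open>weak_inner\<close> and the H-part of the
  growth term do not meet the drift in the Hamiltonian.\<close>

lemma tail_at_zero: "tail (at_zero v) l = 0"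
  unfolding tail_def by (rule integral_unique[OF has_integral_spike_finite[of "{0}" _ _ "\<lambda>_. 0"]]) (auto
      simp: at_zero_def)

lemma weak_inner_at_zero: "weak_inner \<tau> x (at_zero v) = 0"
  by (simp add: weak_inner_def tail_at_zero)

lemma innerH_at_zero:
  assumes "x \<in> Hspace \<tau>"
  shows "innerH \<tau> x (at_zero v) = 0"
proof -
  have "integral {-\<tau>..0} (\<lambda>t. x t \<bullet> at_zero v t) = 0"
    by (rule integral_unique[OF has_integral_spike_finite[of "{0}" _ _ "\<lambda>_. 0"]]) (auto simp: at_zero_def)
  then show ?thesis
    using assms Dspace_L2[OF at_zero_Dspace, of v "-\<tau>" 0] inner_L2_eq_integral[of x "-\<tau>" 0 "at_zero v"]
    by (simp add: innerH_eq Hspace_def)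
qed

theorem quad_test_calculus:
  fixes B B' :: "real \<Rightarrow> real ^ 'd::finite ^ 'd" and x y :: "'d path"
    and \<beta> \<gamma> \<alpha> C \<kappa> s :: real and c :: "real ^ 'd"
  assumes B_deriv: "\<forall>t\<in>{0..T}. (B has_vector_derivative B' t) (at t within {0..T})"
    and B': "continuous_on {0..T} B'" and y: "y \<in> Dspace \<tau>"
  defines "\<psi> \<equiv> quad_test T \<tau> B \<beta> \<gamma> \<alpha> C \<kappa> c y s"
  shows "\<psi> \<in> test_functions T \<tau>"
    and "t \<in> {0..T} \<Longrightarrow> x \<in> Dspace \<tau> \<Longrightarrow> time_deriv T \<psi> t x =
      2 * \<beta> * ((x 0 + B t *v tail x (-\<tau>) - c) \<bullet> (B' t *v tail x (-\<tau>)))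
      + 2 * \<gamma> * (t - s) - \<alpha> * C * exp (- C * t) * (1 + (norm (x 0))\<^sup>2 + innerH \<tau> x x) - \<kappa>"
    and "x \<in> Dspace \<tau> \<Longrightarrow> S_op \<tau> (\<psi> t) x =
      2 * \<beta> * ((x 0 + B t *v tail x (-\<tau>) - c) \<bullet> (B t *v (x 0 - x (-\<tau>))))
      + 2 * \<beta> * integral {-\<tau>..0} (\<lambda>l. tail (x - y) l \<bullet> (x 0 - x l))
      + \<alpha> * exp (- C * t) * ((norm (x 0))\<^sup>2 - (norm (x (-\<tau>)))\<^sup>2)"
    and "t \<in> {0..T} \<Longrightarrow> x \<in> Dspace \<tau> \<Longrightarrow> grad \<tau> \<psi> t x (at_zero v) =
      (2 * \<beta>) * ((x 0 + B t *v tail x (-\<tau>) - c) \<bullet> v) + 2 * \<alpha> * exp (- C * t) * (x 0 \<bullet> v)"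
proof -
  have B: "(B has_vector_derivative B' t) (at t within {0..T})" if "t \<in> {0..T}" for t
    using B_deriv that by blast
  note w = quad_test_witness[OF B B' Dspace_Hspace[OF y], of \<beta> \<gamma> \<alpha> C \<kappa> c s, folded \<psi>_def]
  note w0 = quad_test_prod_witness[OF B B' Dspace_Hspace[OF y], of \<beta> \<gamma> \<alpha> C \<kappa> c s]
  have lim: "((\<lambda>h. (\<psi> t (hat_shift \<tau> h x) - \<psi> t x) / h) \<longlongrightarrow>
      2 * \<beta> * ((x 0 + B t *v tail x (-\<tau>) - c) \<bullet> (B t *v (x 0 - x (-\<tau>))))
      + 2 * \<beta> * integral {-\<tau>..0} (\<lambda>l. tail (x - y) l \<bullet> (x 0 - x l))
      + \<alpha> * exp (- C * t) * ((norm (x 0))\<^sup>2 - (norm (x (-\<tau>)))\<^sup>2)) (at_right 0)" if "x \<in> Dspace \<tau>" for x t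
    using quad_test_right_derivative[OF that y, of B \<beta> \<gamma> \<alpha> C \<kappa> c s t] hat_shift_0[OF that]
    unfolding \<psi>_def has_field_derivative_iff by simp
  have C1: "\<psi> \<in> C1_on T (Dspace \<tau>) (normD \<tau>)" by (rule D.C1_witness_C1_on[OF w T])
  then have C0: "\<psi> \<in> C0_on T (Dspace \<tau>) (normD \<tau>)" by (simp add: C1_on_def)
  have "\<psi> \<in> D_S T \<tau>"
    using C0_borelD_measurable[OF C0] lim by (auto simp: D_S_def Dhat_S_def)
  moreover have "quad_test_prod T \<tau> B \<beta> \<gamma> \<alpha> C \<kappa> c y s \<in> C1_on T (UNIV \<times> Hspace \<tau>) (norm_RdH \<tau>)"
    by (rule RdH.C1_witness_C1_on[OF w0 T])
  ultimately show "\<psi> \<in> test_functions T \<tau>"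
    using C1 unfolding test_functions_def \<psi>_def
    by (auto simp: quad_test_eq intro!: bexI[of _ "quad_test_prod T \<tau> B \<beta> \<gamma> \<alpha> C \<kappa> c y s"])
  show "time_deriv T \<psi> t x =
      2 * \<beta> * ((x 0 + B t *v tail x (-\<tau>) - c) \<bullet> (B' t *v tail x (-\<tau>)))
      + 2 * \<gamma> * (t - s) - \<alpha> * C * exp (- C * t) * (1 + (norm (x 0))\<^sup>2 + innerH \<tau> x x) - \<kappa>"
    if "t \<in> {0..T}" "x \<in> Dspace \<tau>"
    by (rule D.C1_witness_time_deriv[OF w T that])
  show "S_op \<tau> (\<psi> t) x =
      2 * \<beta> * ((x 0 + B t *v tail x (-\<tau>) - c) \<bullet> (B t *v (x 0 - x (-\<tau>))))
      + 2 * \<beta> * integral {-\<tau>..0} (\<lambda>l. tail (x - y) l \<bullet> (x 0 - x l))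
      + \<alpha> * exp (- C * t) * ((norm (x 0))\<^sup>2 - (norm (x (-\<tau>)))\<^sup>2)" if "x \<in> Dspace \<tau>"
    unfolding S_op_def by (rule tendsto_Lim[OF _ lim[OF that]]) simp
  show "grad \<tau> \<psi> t x (at_zero v) =
      (2 * \<beta>) * ((x 0 + B t *v tail x (-\<tau>) - c) \<bullet> v) + 2 * \<alpha> * exp (- C * t) * (x 0 \<bullet> v)"
    if "t \<in> {0..T}" "x \<in> Dspace \<tau>"
    using D.C1_witness_frechet[OF w that at_zero_Dspace] that(2)
    by (simp add: tail_at_zero weak_inner_at_zero innerH_at_zero Dspace_Hspace) (simp add: at_zero_def)
qed

end

section \<open>Maximization over extensions\<close>

text \<open>Dependent choice in place of compactness: every step closes at least half of the gap
  between the current value and the best value above it. An upper bound of the whole chain, supplied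
  by \<open>limit\<close>, then leaves no gap.\<close>

lemma ordering_principle:
  fixes f :: "'a \<Rightarrow> real"
  assumes refl: "\<And>p. p \<in> A \<Longrightarrow> le p p"
    and trans: "\<And>p q r. p \<in> A \<Longrightarrow> q \<in> A \<Longrightarrow> r \<in> A \<Longrightarrow> le p q \<Longrightarrow> le q r \<Longrightarrow> le p r"
    and bdd: "bdd_above (f ` A)"
    and limit: "\<And>p. (\<And>n. p n \<in> A) \<Longrightarrow> (\<And>n. le (p n) (p (Suc n))) \<Longrightarrow> (\<And>n. f (p n) \<le> f (p (Suc n))) \<Longrightarrow>
      \<exists>q\<in>A. \<forall>n::nat. le (p n) q \<and> f (p n) \<le> f q"
    and p0: "p0 \<in> A"
  obtains q where "q \<in> A" "le p0 q" "f p0 \<le> f q" "\<And>r. r \<in> A \<Longrightarrow> le q r \<Longrightarrow> f r \<le> f q"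
proof -
  define E where "E = (\<lambda>p. {r \<in> A. le p r \<and> f p \<le> f r})"
  have "\<exists>r\<in>E p. \<forall>r'\<in>E p. f r' - f r \<le> (f r' - f p) / 2" if p: "p \<in> A" for p
  proof -
    define M where "M = (SUP r\<in>E p. f r)"
    have bddE: "bdd_above (f ` E p)" using bdd by (rule bdd_above_mono) (auto simp: E_def)
    have up: "f r \<le> M" if "r \<in> E p" for r unfolding M_def by (rule cSUP_upper[OF that bddE])
    have pE: "p \<in> E p" using p refl by (simp add: E_def)
    show ?thesis
    proof (cases "M = f p")
      case True
      then show ?thesis using pE up by (intro bexI[of _ p]) (force simp: E_def)+
    next
      case False
      \<comment> \<open>After a value beyond this midpoint, any further gain is at most half of the
        gain measured from \<open>p\<close>.\<close>
      then have "(f p + M) / 2 < M" using up[OF pE] by simp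
      then obtain r where r: "r \<in> E p" "(f p + M) / 2 < f r"
        unfolding M_def using less_cSUP_iff[OF _ bddE] pE by blast
      have "f r' - f r \<le> (f r' - f p) / 2" if "r' \<in> E p" for r'
        using up[OF that] r(2) by (simp add: field_simps)
      then show ?thesis using r(1) by blast
    qed
  qed
  then obtain nx where nx: "\<And>p. p \<in> A \<Longrightarrow> nx p \<in> E p" "\<And>p r'. p \<in> A \<Longrightarrow> r' \<in> E p \<Longrightarrow> f r' - f (nx p) \<le> (f r' -
      f p) / 2"
    by metis
  define p where "p = (\<lambda>n. (nx ^^ n) p0)"
  have pA: "p n \<in> A" for n
    by (induction n) (use p0 nx(1) in \<open>auto simp: p_def E_def\<close>)
  have pS: "p (Suc n) = nx (p n)" for n by (simp add: p_def)
  have step: "le (p n) (p (Suc n))" "f (p n) \<le> f (p (Suc n))" for n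
    using nx(1)[OF pA[of n]] by (auto simp: pS E_def)
  obtain q where q: "q \<in> A" "\<And>n. le (p n) q" "\<And>n. f (p n) \<le> f q"
    using limit[of p, OF pA step] by blast
  have "f r \<le> f q" if r: "r \<in> A" "le q r" for r
  proof (rule ccontr)
    assume "\<not> f r \<le> f q"
    then have gt: "f r > f q" by simp
    \<comment> \<open>A better point above \<open>q\<close> would lie above the entire chain, so its
      lead over the chain would halve at every step although it stays at least
      \<open>f r - f q\<close>.\<close>
    have rE: "r \<in> E (p n)" for n
      using trans[OF pA q(1) r(1) q(2) r(2)] q(3)[of n] gt r by (auto simp: E_def)
    have bound: "f r - f (p n) \<le> (f r - f p0) / 2 ^ n" for n
    proof (induction n)
      case (Suc n)
      have "f r - f (p (Suc n)) \<le> (f r - f (p n)) / 2" using nx(2)[OF pA rE] by (simp add: pS)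
      also have "\<dots> \<le> (f r - f p0) / 2 ^ n / 2" using Suc by (intro divide_right_mono) auto
      finally show ?case by (simp add: mult.commute)
    qed (simp add: p_def)
    have "(\<lambda>n. (f r - f p0) * (1 / 2) ^ n) \<longlonglongrightarrow> (f r - f p0) * 0"
      by (intro tendsto_intros LIMSEQ_power_zero) auto
    then have "(\<lambda>n. (f r - f p0) / 2 ^ n) \<longlonglongrightarrow> 0" by (simp add: power_one_over)
    then have "f r - f q \<le> 0"
    proof (rule LIMSEQ_le_const, intro exI allI impI)
      show "f r - f q \<le> (f r - f p0) / 2 ^ n" for n using bound[of n] q(3)[of n] by linarith
    qed
    then show False using gt by simp
  qed
  moreover have "le p0 q" "f p0 \<le> f q" using q(2,3)[of 0] by (auto simp: p_def)
  ultimately show ?thesis using that q(1) by blast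
qed

section \<open>Extensions of a path and limits of increasing chains\<close>

lemma eventually_at_right_upper: "(a::real) < b \<Longrightarrow> \<forall>\<^sub>F r in at_right a. r < b"
  by (rule eventually_mono[OF eventually_at_right_real]) auto

text \<open>Read in absolute time: the new window repeats the old values strictly before time
  \<open>s\<close>. The value at \<open>s\<close> itself stays free, in agreement with
  \<open>concat_path\<close>, so even for \<open>t = s\<close> the present value may change.\<close>

definition extends :: "real \<Rightarrow> real \<Rightarrow> ('d::finite) path \<Rightarrow> real \<Rightarrow> 'd path \<Rightarrow> bool" where
  "extends \<tau> s z t x \<longleftrightarrow> s \<le> t \<and> (\<forall>\<theta>\<in>{-\<tau>..0}. \<theta> < s - t \<longrightarrow> x \<theta> = z (t - s + \<theta>))"

lemma extends_refl: "extends \<tau> s z s z"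
  by (simp add: extends_def)

lemma extends_trans:
  assumes "extends \<tau> s z t x" "extends \<tau> t x r y"
  shows "extends \<tau> s z r y"
  unfolding extends_def
proof (intro conjI ballI impI)
  show "s \<le> r" using assms by (auto simp: extends_def)
  fix \<theta> assume \<theta>: "\<theta> \<in> {-\<tau>..0}" "\<theta> < s - r"
  have st: "s \<le> t" "t \<le> r" using assms by (auto simp: extends_def)
  have "y \<theta> = x (r - t + \<theta>)" using assms(2) \<theta> st by (auto simp: extends_def)
  also have "\<dots> = z (t - s + (r - t + \<theta>))" using assms(1) \<theta> st by (auto simp: extends_def)
  also have "t - s + (r - t + \<theta>) = r - s + \<theta>" by simp
  finally show "y \<theta> = z (r - s + \<theta>)" .
qed

lemma Dbar_Dspace: "x \<in> Dbar \<tau> Q \<Longrightarrow> x \<in> Dspace \<tau>"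
  by (simp add: Dbar_def)

text \<open>Competitors in the viscosity definitions are extensions, so a point that is maximal
  among extensions is maximal there.\<close>

lemma extends_concat_path: "s \<le> t \<Longrightarrow> extends \<tau> s z t (concat_path \<tau> s z t x)"
  by (auto simp: extends_def concat_path_def)

lemma concat_path_self: "x \<in> Dspace \<tau> \<Longrightarrow> concat_path \<tau> s x s x = x"
  using Dspace_outside[of x \<tau>] by (auto simp: concat_path_def fun_eq_iff)

lemma concat_path_Dbar:
  assumes z: "z \<in> Dbar \<tau> Q" and x: "x \<in> Dbar \<tau> Q" and st: "s \<le> t"
  shows "concat_path \<tau> s z t x \<in> Dbar \<tau> Q"
proof -
  let ?w = "concat_path \<tau> s z t x"
  obtain R S where R: "\<And>\<theta>. norm (x \<theta>) \<le> R" and S: "\<And>\<theta>. norm (z \<theta>) \<le> S"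
    using Dspace_bound Dbar_Dspace x z by metis
  have "norm (?w \<theta>) \<le> max R S" if "\<theta> \<in> {-\<tau>..0}" for \<theta>
    using R S that by (auto simp: concat_path_def le_max_iff_disj)
  then have "bounded (?w ` {-\<tau>..0})" unfolding bounded_iff by blast
  moreover have "(?w \<longlongrightarrow> ?w \<theta>) (at \<theta> within {\<theta><..0})" if \<theta>: "\<theta> \<in> {-\<tau>..0}" for \<theta>
  proof (cases "\<theta> < 0")
    case True
    have neg: "\<forall>\<^sub>F r in at_right \<theta>. r < 0" using True by (auto simp: eventually_at_right_field)
    have "(?w \<longlongrightarrow> ?w \<theta>) (at_right \<theta>)"
    \<comment> \<open>The junction itself belongs to the new piece, so right-continuity there is
      that of \<open>x\<close>.\<close>
    proof (cases "s - t \<le> \<theta>")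
      case True
      have "\<forall>\<^sub>F r in at_right \<theta>. x r = ?w r"
        using neg eventually_at_right_less[of \<theta>]
        by eventually_elim (use True \<theta> in \<open>auto simp: concat_path_def\<close>)
      moreover have "(x \<longlongrightarrow> x \<theta>) (at_right \<theta>)"
        using Dspace_right_continuous[OF Dbar_Dspace[OF x]] \<theta> \<open>\<theta> < 0\<close> by simp
      ultimately have "(?w \<longlongrightarrow> x \<theta>) (at_right \<theta>)" by (rule Lim_transform_eventually[rotated])
      then show ?thesis using True \<theta> by (simp add: concat_path_def)
    next
      case False
      then have "\<forall>\<^sub>F r in at_right \<theta>. r < s - t" by (intro eventually_at_right_upper) simp
      then have ev: "\<forall>\<^sub>F r in at_right \<theta>. z (t - s + r) = ?w r"
        using neg eventually_at_right_less[of \<theta>]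
        by eventually_elim (use \<theta> in \<open>auto simp: concat_path_def\<close>)
      have "((\<lambda>r. z (t - s + r)) \<longlongrightarrow> z (t - s + \<theta>)) (at_right \<theta>)"
      proof (rule filterlim_compose[OF Dspace_right_continuous[OF Dbar_Dspace[OF z]]])
        show "filterlim (\<lambda>r. t - s + r) (at_right (t - s + \<theta>)) (at_right \<theta>)"
          by (auto simp: filterlim_at intro!: tendsto_intros intro: eventually_mono[OF
              eventually_at_right_less])
      qed (use \<theta> st False in auto)
      then have "(?w \<longlongrightarrow> z (t - s + \<theta>)) (at_right \<theta>)" using ev by (rule Lim_transform_eventually)
      then show ?thesis using False \<theta> by (simp add: concat_path_def)
    qed
    then show ?thesis using at_within_Ioc[OF \<open>\<theta> < 0\<close>] by simp
  qed (use \<theta> in auto)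
  ultimately have "?w \<in> Dspace \<tau>" by (auto simp: Dspace_def concat_path_def)
  moreover have "?w \<theta> \<in> closure Q" if "\<theta> \<in> {-\<tau>..0}" for \<theta>
    using that z x st by (auto simp: Dbar_def concat_path_def)
  ultimately show ?thesis by (simp add: Dbar_def)
qed

text \<open>The sequence may meet \<open>a\<close> itself, about which the right limit alone says
  nothing.\<close>

lemma tendsto_right_sequence:
  assumes "(f \<longlongrightarrow> f a) (at_right (a::real))" "s \<longlonglongrightarrow> a" "\<And>n. a \<le> s n"
  shows "(\<lambda>n. f (s n)) \<longlonglongrightarrow> f a"
proof (rule continuous_within_tendsto_compose[OF _ _ assms(2)])
  have "{a<..} - {a} = {a..} - {a}" by auto
  then have "at_right a = at a within {a..}" by (simp add: at_within_def)
  then show "continuous (at a within {a..}) f" using assms(1) by (simp add: continuous_within)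
qed (use assms(3) in auto)

text \<open>Along an extension chain all paths are restrictions of one function of absolute time, and the
  missing terminal value \<open>\<xi>\<close> may be prescribed. Since only right limits exist, the \<open>L\<^sup>1\<close> convergence
  comes from the right-continuity of the limit path after a change of variables.\<close>

lemma extension_chain_limit:
  fixes x :: "nat \<Rightarrow> ('d::finite) path"
  assumes \<tau>: "\<tau> > 0" and xQ: "\<And>n. x n \<in> Dbar \<tau> Q" and Q: "\<And>v. v \<in> closure Q \<Longrightarrow> norm v \<le> R"
    and ext: "\<And>n. extends \<tau> (t n) (x n) (t (Suc n)) (x (Suc n))"
    and lim: "t \<longlonglongrightarrow> t'" and \<xi>: "\<xi> \<in> closure Q"
  obtains x' where "x' \<in> Dbar \<tau> Q" "x' 0 = \<xi>" "\<And>n. extends \<tau> (t n) (x n) t' x'"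
    "(\<lambda>n. integral {-\<tau>..0} (\<lambda>\<theta>. norm (x n \<theta> - x' \<theta>))) \<longlonglongrightarrow> 0"
proof -
  have extm: "extends \<tau> (t n) (x n) (t m) (x m)" if "n \<le> m" for n m
    using that by (induction rule: dec_induct) (auto intro: extends_refl extends_trans ext)
  have inc: "incseq t" using ext by (auto simp: incseq_Suc_iff extends_def)
  have le: "t n \<le> t'" for n using incseq_le[OF inc lim] .
  have ex: "\<exists>n. t' + \<theta> < t n" if "\<theta> < 0" for \<theta>
    using order_tendstoD(1)[OF lim, of "t' + \<theta>"] that by (auto simp: eventually_sequentially)
  \<comment> \<open>A member of the chain whose window already reaches beyond the absolute time
    \<open>t' + \<theta>\<close>; it exists because \<open>t n\<close> tends to \<open>t'\<close>
    and \<open>\<theta> < 0\<close>.\<close>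
  define N where "N = (\<lambda>\<theta>. SOME n. t' + \<theta> < t n)"
  have N: "t' + \<theta> < t (N \<theta>)" if "\<theta> < 0" for \<theta>
    unfolding N_def by (rule someI_ex[OF ex[OF that]])
  define x' where "x' = (\<lambda>\<theta>. if \<theta> \<in> {-\<tau>..<0} then x (N \<theta>) (t' - t (N \<theta>) + \<theta>) else if \<theta> = 0 then \<xi> else 0)"
  \<comment> \<open>Later members repeat earlier ones, so the choice of the member does not affect
    the value.\<close>
  have x'_eq: "x' \<theta> = x n (t' - t n + \<theta>)" if \<theta>: "-\<tau> \<le> \<theta>" "\<theta> < 0" "t' + \<theta> < t n" for \<theta> n
  proof -
    have *: "x m (t' - t m + \<theta>) = x k (t' - t k + \<theta>)" if "k \<le> m" "t' + \<theta> < t k" for k m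
    proof -
      have "t' - t m + \<theta> \<in> {-\<tau>..0}" using \<theta> le[of m] that incseqD[OF inc that(1)] by auto
      then have "x m (t' - t m + \<theta>) = x k (t m - t k + (t' - t m + \<theta>))"
        using extm[OF that(1)] that by (auto simp: extends_def)
      also have "t m - t k + (t' - t m + \<theta>) = t' - t k + \<theta>" by simp
      finally show ?thesis .
    qed
    have "x (N \<theta>) (t' - t (N \<theta>) + \<theta>) = x n (t' - t n + \<theta>)"
      using *[of n "N \<theta>"] *[of "N \<theta>" n] \<theta> N[of \<theta>] by (cases "n \<le> N \<theta>") auto
    then show ?thesis using \<theta> by (simp add: x'_def)
  qed
  have mem: "x' \<theta> \<in> closure Q" if "\<theta> \<in> {-\<tau>..0}" for \<theta>
  proof (cases "\<theta> = 0")
    case False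
    then have \<theta>: "-\<tau> \<le> \<theta>" "\<theta> < 0" using that by auto
    have "t' - t (N \<theta>) + \<theta> \<in> {-\<tau>..0}" using le[of "N \<theta>"] N[OF \<theta>(2)] \<theta> by auto
    then show ?thesis using xQ[of "N \<theta>"] \<theta> by (auto simp: x'_def Dbar_def)
  qed (use \<tau> \<xi> in \<open>simp add: x'_def\<close>)
  have bd: "norm (x' \<theta>) \<le> R" if "\<theta> \<in> {-\<tau>..0}" for \<theta> using Q mem that by blast
  have "(x' \<longlongrightarrow> x' \<theta>) (at \<theta> within {\<theta><..0})" if \<theta>: "\<theta> \<in> {-\<tau>..0}" for \<theta>
  proof (cases "\<theta> < 0")
    case True
    obtain n where n: "t' + \<theta> < t n" using ex[OF True] by blast
    have "\<forall>\<^sub>F r in at_right \<theta>. r < min 0 (t n - t')" using True n by (intro eventually_at_right_upper) simp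
    then have ev: "\<forall>\<^sub>F r in at_right \<theta>. x n (t' - t n + r) = x' r"
      using eventually_at_right_less[of \<theta>]
      by eventually_elim (use \<theta> in \<open>auto simp: x'_eq[where n = n]\<close>)
    have "((\<lambda>r. x n (t' - t n + r)) \<longlongrightarrow> x n (t' - t n + \<theta>)) (at_right \<theta>)"
    proof (rule filterlim_compose[OF Dspace_right_continuous[OF Dbar_Dspace[OF xQ]]])
      show "filterlim (\<lambda>r. t' - t n + r) (at_right (t' - t n + \<theta>)) (at_right \<theta>)"
        by (auto simp: filterlim_at intro!: tendsto_intros intro: eventually_mono[OF
            eventually_at_right_less])
    qed (use \<theta> n le[of n] in auto)
    then have "(x' \<longlongrightarrow> x n (t' - t n + \<theta>)) (at_right \<theta>)" using ev by (rule Lim_transform_eventually)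
    then show ?thesis using x'_eq[of \<theta> n] \<theta> True n by (simp add: at_within_Ioc)
  qed (use \<theta> in auto)
  moreover have "bounded (x' ` {-\<tau>..0})" unfolding bounded_iff using bd by blast
  moreover have "x' \<theta> = 0" if "\<theta> \<notin> {-\<tau>..0}" for \<theta> using that \<tau> by (auto simp: x'_def)
  ultimately have D: "x' \<in> Dspace \<tau>" by (simp add: Dspace_def)
  have Q': "x' \<in> Dbar \<tau> Q" using D mem by (simp add: Dbar_def)
  have E: "extends \<tau> (t n) (x n) t' x'" for n
    using le[of n] by (auto simp: extends_def intro!: x'_eq)
  define h where "h = (\<lambda>n. t' - t n)"
  have h0: "h n \<ge> 0" for n using le[of n] by (simp add: h_def)
  have hlim: "h \<longlonglongrightarrow> 0" unfolding h_def using tendsto_diff[OF tendsto_const lim, of t'] by simp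
  have R0: "R \<ge> 0" using bd[of 0] \<tau> by (auto intro: order_trans[OF norm_ge_zero])
  have x'R: "norm (x' \<theta>) \<le> R" for \<theta>
    using bd[of \<theta>] Dspace_outside[OF D, of \<theta>] R0 by (cases "\<theta> \<in> {-\<tau>..0}") auto
  have xR: "norm (x n \<theta>) \<le> R" for n \<theta>
    using Q xQ[of n] Dspace_outside[OF Dbar_Dspace[OF xQ], of \<theta> n] R0
    by (cases "\<theta> \<in> {-\<tau>..0}") (auto simp: Dbar_def)
  \<comment> \<open>On the common part of the windows \<open>x n\<close> is \<open>x'\<close>
    translated by \<open>h n\<close>. After a change of variables the error becomes the translation
    error of \<open>x'\<close> itself, which tends to 0 pointwise by right-continuity.\<close>
  define e where "e = (\<lambda>n \<theta>. norm (x' \<theta> - hat_path x' (\<theta> + h n)))"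
  have e_meas: "e n \<in> borel_measurable borel" for n
    unfolding e_def using Dspace_measurable[OF D] hat_path_measurable[OF D] by measurable
  have e_bd: "norm (e n \<theta>) \<le> 2 * R" for n \<theta>
    using norm_triangle_ineq4[of "x' \<theta>" "hat_path x' (\<theta> + h n)"] x'R[of \<theta>] hat_path_bound[of x' R, OF
        x'R, of "\<theta> + h n"]
    by (simp add: e_def)
  have e_int: "e n integrable_on {a..b}" for n a b
    by (rule bounded_borel_integrable_on[where R = "2 * R", OF e_meas]) (rule e_bd)
  have "(\<lambda>n. integral {-\<tau>..0} (e n)) \<longlonglongrightarrow> integral {-\<tau>..0} (\<lambda>_. 0)"
  proof (rule dominated_convergence(2)[where h = "\<lambda>_. 2 * R"])
    show "(\<lambda>n. e n \<theta>) \<longlonglongrightarrow> 0" if \<theta>: "\<theta> \<in> {-\<tau>..0}" for \<theta>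
    proof -
      have "(\<lambda>n. \<theta> + h n) \<longlonglongrightarrow> \<theta> + 0" by (intro tendsto_intros hlim)
      then have "(\<lambda>n. hat_path x' (\<theta> + h n)) \<longlonglongrightarrow> hat_path x' \<theta>"
        using tendsto_right_sequence[of "hat_path x'" \<theta> "\<lambda>n. \<theta> + h n"] hat_path_right_continuous[OF D,
            of \<theta>] \<theta> h0 by simp
      moreover have "hat_path x' \<theta> = x' \<theta>" using \<theta> by (auto simp: hat_path_def)
      ultimately have "(\<lambda>n. norm (x' \<theta> - hat_path x' (\<theta> + h n))) \<longlonglongrightarrow> norm (x' \<theta> - x' \<theta>)"
        by (intro tendsto_intros) simp
      then show ?thesis by (simp add: e_def)
    qed
  qed (use e_int e_bd in auto)
  then have "(\<lambda>n. 2 * R * h n + integral {-\<tau>..0} (e n)) \<longlonglongrightarrow> 2 * R * 0 + 0"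
    by (intro tendsto_intros hlim) simp
  then have up: "(\<lambda>n. 2 * R * h n + integral {-\<tau>..0} (e n)) \<longlonglongrightarrow> 0" by simp
  have diff_meas: "(\<lambda>\<theta>. norm (x n \<theta> - x' \<theta>)) \<in> borel_measurable borel" for n
    using Dspace_measurable[OF D] Dspace_measurable[OF Dbar_Dspace[OF xQ], of n] by measurable
  have diff_bd: "norm (norm (x n \<theta> - x' \<theta>)) \<le> 2 * R" for n \<theta>
    using norm_triangle_ineq4[of "x n \<theta>" "x' \<theta>"] x'R[of \<theta>] xR[of n \<theta>] by simp
  have diff_int: "(\<lambda>\<theta>. norm (x n \<theta> - x' \<theta>)) integrable_on {a..b}" for n a b
    by (rule bounded_borel_integrable_on[where R = "2 * R", OF diff_meas]) (rule diff_bd)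
  have le_e: "integral {-\<tau>..0} (\<lambda>\<theta>. norm (x n \<theta> - x' \<theta>)) \<le> 2 * R * h n + integral {-\<tau>..0} (e n)"
    if hn: "h n < \<tau>" for n
  proof -
    let ?f = "\<lambda>\<theta>. norm (x n \<theta> - x' \<theta>)"
    \<comment> \<open>At the old end, over a length \<open>h n\<close>, the window of
      \<open>x n\<close> contains times that \<open>x'\<close> has dropped; there only the bound
      \<open>2 * R\<close> is available.\<close>
    have "integral {-\<tau>..0} ?f = integral {-\<tau>..-\<tau> + h n} ?f + integral {-\<tau> + h n..0} ?f"
      using hn h0[of n] diff_int by (intro Henstock_Kurzweil_Integration.integral_combine[symmetric]) auto
    moreover have "integral {-\<tau>..-\<tau> + h n} ?f \<le> 2 * R * h n"
      using integral_le_sup_bound[of ?f "-\<tau>" "-\<tau> + h n" "2 * R"] diff_int[of n] diff_bd[of n] h0[of n]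
          by simp
    moreover have "integral {-\<tau> + h n..0} ?f \<le> integral {-\<tau>..0} (e n)"
    proof -
      have "integral {-\<tau> + h n..0} ?f = integral {-\<tau> + h n..0} (\<lambda>\<theta>. e n (- h n + \<theta>))"
      proof (rule integral_spike[of "{0}"])
        fix \<theta> assume \<theta>: "\<theta> \<in> {-\<tau> + h n..0} - {0}"
        then have "x' (\<theta> - h n) = x n \<theta>"
          using x'_eq[of "\<theta> - h n" n] h0[of n] by (auto simp: h_def)
        then show "e n (- h n + \<theta>) = ?f \<theta>" using \<theta> by (simp add: e_def hat_path_def)
      qed auto
      also have "\<dots> = integral {-\<tau>..- h n} (e n)"
        using integral_shift_Icc_real[of "-\<tau> + h n" 0 "e n" "- h n"] by (simp add: o_def)
      also have "\<dots> \<le> integral {-\<tau>..0} (e n)"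
        using h0[of n] e_int by (intro integral_subset_le) (auto simp: e_def)
      finally show ?thesis .
    qed
    ultimately show ?thesis by linarith
  qed
  have "(\<lambda>n. integral {-\<tau>..0} (\<lambda>\<theta>. norm (x n \<theta> - x' \<theta>))) \<longlonglongrightarrow> 0"
  proof (rule tendsto_sandwich[OF _ _ tendsto_const up])
    show "\<forall>\<^sub>F n in sequentially. 0 \<le> integral {-\<tau>..0} (\<lambda>\<theta>. norm (x n \<theta> - x' \<theta>))"
      by (intro always_eventually allI Henstock_Kurzweil_Integration.integral_nonneg diff_int) auto
    show "\<forall>\<^sub>F n in sequentially. integral {-\<tau>..0} (\<lambda>\<theta>. norm (x n \<theta> - x' \<theta>)) \<le> 2 * R * h n + integral
        {-\<tau>..0} (e n)"
      using order_tendstoD(2)[OF hlim \<tau>] by eventually_elim (rule le_e)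
  qed
  moreover have "x' 0 = \<xi>" by (simp add: x'_def)
  ultimately show ?thesis using that Q' E by blast
qed

section \<open>Exchanging tail integrals\<close>

text \<open>Fubini on the triangle \<open>l \<le> \<theta>\<close>; the integrand is dominated by
  the product of the norms, which is integrable on the square.\<close>

lemma Fubini_triangle:
  fixes f g :: "real \<Rightarrow> 'a::euclidean_space"
  assumes f: "integrable (lebesgue_on {a..b}) f" and g: "integrable (lebesgue_on {a..b}) g"
  shows "(LINT l|lebesgue_on {a..b}. f l \<bullet> (LINT \<theta>|lebesgue_on {a..b}. indicat_real {l..} \<theta> *\<^sub>R g \<theta>)) =
         (LINT \<theta>|lebesgue_on {a..b}. (LINT l|lebesgue_on {a..b}. indicat_real {..\<theta>} l *\<^sub>R f l) \<bullet> g \<theta>)"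
proof -
  let ?M = "lebesgue_on {a..b}"
  interpret finite_measure ?M by (rule finite_measure_lebesgue_on) auto
  interpret P: pair_sigma_finite ?M ?M ..
  let ?h = "\<lambda>(l, \<theta>). if l \<le> \<theta> then f l \<bullet> g \<theta> else 0"
  have id: "(\<lambda>t. t) \<in> borel_measurable ?M" by (intro measurable_restrict_space1 measurable_completion) simp
  have fm: "f \<in> borel_measurable ?M" and gm: "g \<in> borel_measurable ?M" using f g by auto
  have 1: "(\<lambda>p. fst p) \<in> borel_measurable (?M \<Otimes>\<^sub>M ?M)" by (rule measurable_compose[OF measurable_fst id])
  have 2: "(\<lambda>p. snd p) \<in> borel_measurable (?M \<Otimes>\<^sub>M ?M)" by (rule measurable_compose[OF measurable_snd id])
  have 3: "(\<lambda>p. f (fst p)) \<in> borel_measurable (?M \<Otimes>\<^sub>M ?M)" by (rule measurable_compose[OF measurable_fst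
      fm])
  have 4: "(\<lambda>p. g (snd p)) \<in> borel_measurable (?M \<Otimes>\<^sub>M ?M)" by (rule measurable_compose[OF measurable_snd
      gm])
  have meas: "?h \<in> borel_measurable (?M \<Otimes>\<^sub>M ?M)"
    unfolding case_prod_unfold
    by (intro measurable_If borel_measurable_inner 3 4 borel_measurable_const)
       (use borel_measurable_le[OF 1 2] in \<open>simp add: space_pair_measure\<close>)
  have b: "norm (?h (l, \<theta>)) \<le> norm (f l) * norm (g \<theta>)" for l \<theta>
    using Cauchy_Schwarz_ineq2[of "f l" "g \<theta>"] by simp
  have fb: "integrable ?M (\<lambda>\<theta>. norm (f l) * norm (g \<theta>))" for l using g by simp
  have sec_meas: "(\<lambda>\<theta>. ?h (l, \<theta>)) \<in> borel_measurable ?M" if "l \<in> space ?M" for l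
    by (rule measurable_compose[OF measurable_Pair1'[OF that] meas])
  have sec: "integrable ?M (\<lambda>\<theta>. ?h (l, \<theta>))" if "l \<in> space ?M" for l
    by (rule Bochner_Integration.integrable_bound[OF fb[of l] sec_meas[OF that]]) (use b in auto)
  have int: "integrable (?M \<Otimes>\<^sub>M ?M) ?h"
  proof (rule P.Fubini_integrable[OF meas])
    show "integrable ?M (\<lambda>l. LINT \<theta>|?M. norm (?h (l, \<theta>)))"
    proof (rule Bochner_Integration.integrable_bound)
      show "integrable ?M (\<lambda>l. norm (f l) * (LINT \<theta>|?M. norm (g \<theta>)))" using f by simp
      show "(\<lambda>l. LINT \<theta>|?M. norm (?h (l, \<theta>))) \<in> borel_measurable ?M"
        by (rule borel_measurable_lebesgue_integral) (use meas in simp)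
      show "AE l in ?M. norm (LINT \<theta>|?M. norm (?h (l, \<theta>))) \<le> norm (norm (f l) * (LINT \<theta>|?M. norm (g \<theta>)))"
      proof (rule AE_I2)
        fix l assume l: "l \<in> space ?M"
        have "(LINT \<theta>|?M. norm (?h (l, \<theta>))) \<le> (LINT \<theta>|?M. norm (f l) * norm (g \<theta>))"
          by (intro integral_mono integrable_norm sec[OF l] fb b)
        then show "norm (LINT \<theta>|?M. norm (?h (l, \<theta>))) \<le> norm (norm (f l) * (LINT \<theta>|?M. norm (g \<theta>)))"
          by simp
      qed
    qed
    show "AE l in ?M. integrable ?M (\<lambda>\<theta>. ?h (l, \<theta>))" by (rule AE_I2[OF sec])
  qed
  have "(LINT \<theta>|?M. (LINT l|?M. ?h (l, \<theta>))) = (LINT l|?M. (LINT \<theta>|?M. ?h (l, \<theta>)))"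
    using P.Fubini_integral[of "\<lambda>l \<theta>. ?h (l, \<theta>)"] int by simp
  moreover have "(LINT \<theta>|?M. ?h (l, \<theta>)) = f l \<bullet> (LINT \<theta>|?M. indicat_real {l..} \<theta> *\<^sub>R g \<theta>)" for l
  proof -
    have "integrable ?M (\<lambda>\<theta>. indicat_real {l..} \<theta> *\<^sub>R g \<theta>)"
      by (rule Bochner_Integration.integrable_bound[OF g])
         (use gm id in \<open>auto simp: indicator_def\<close>)
    then have "f l \<bullet> (LINT \<theta>|?M. indicat_real {l..} \<theta> *\<^sub>R g \<theta>) = (LINT \<theta>|?M. f l \<bullet> (indicat_real {l..} \<theta>
        *\<^sub>R g \<theta>))"
      by (intro integral_inner_right[symmetric])
    also have "\<dots> = (LINT \<theta>|?M. ?h (l, \<theta>))" by (rule Bochner_Integration.integral_cong) (auto simp: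
        indicator_def)
    finally show ?thesis by simp
  qed
  moreover have "(LINT l|?M. ?h (l, \<theta>)) = (LINT l|?M. indicat_real {..\<theta>} l *\<^sub>R f l) \<bullet> g \<theta>" for \<theta>
  proof -
    have "integrable ?M (\<lambda>l. indicat_real {..\<theta>} l *\<^sub>R f l)"
      by (rule Bochner_Integration.integrable_bound[OF f])
         (use fm id in \<open>auto simp: indicator_def\<close>)
    then have "(LINT l|?M. indicat_real {..\<theta>} l *\<^sub>R f l) \<bullet> g \<theta> = (LINT l|?M. (indicat_real {..\<theta>} l *\<^sub>R f
        l) \<bullet> g \<theta>)"
      by (intro integral_inner_left[symmetric])
    also have "\<dots> = (LINT l|?M. ?h (l, \<theta>))" by (rule Bochner_Integration.integral_cong) (auto simp:
        indicator_def)
    finally show ?thesis by simp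
  qed
  ultimately show ?thesis by simp
qed

lemma integral_indicator_tail:
  fixes g :: "real \<Rightarrow> 'a::euclidean_space"
  assumes g: "g \<in> L2 a b" and I: "I \<in> sets borel"
  shows "(LINT \<theta>|lebesgue_on {a..b}. indicat_real I \<theta> *\<^sub>R g \<theta>) = integral (I \<inter> {a..b}) g"
proof -
  have id: "(\<lambda>t. t) \<in> borel_measurable (lebesgue_on {a..b})"
    by (intro measurable_restrict_space1 measurable_completion) simp
  have "integrable (lebesgue_on {a..b}) (\<lambda>\<theta>. indicat_real I \<theta> *\<^sub>R g \<theta>)"
  proof (rule Bochner_Integration.integrable_bound[OF L2_integrable[OF g]])
    have "indicat_real I \<in> borel_measurable (lebesgue_on {a..b})"
      using measurable_compose[OF id borel_measurable_indicator[OF I]] by simp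
    then show "(\<lambda>\<theta>. indicat_real I \<theta> *\<^sub>R g \<theta>) \<in> borel_measurable (lebesgue_on {a..b})"
      using g by (auto simp: L2_def)
  qed (auto simp: indicator_def)
  then have "(LINT \<theta>|lebesgue_on {a..b}. indicat_real I \<theta> *\<^sub>R g \<theta>) = integral {a..b} (\<lambda>\<theta>. indicat_real I
      \<theta> *\<^sub>R g \<theta>)"
    by (rule lebesgue_integral_eq_integral) simp
  also have "\<dots> = integral {a..b} (\<lambda>\<theta>. if \<theta> \<in> I then g \<theta> else 0)"
    by (rule integral_cong) (simp add: indicator_def)
  also have "\<dots> = integral (I \<inter> {a..b}) g" by (rule Henstock_Kurzweil_Integration.integral_restrict_Int)
  finally show ?thesis .
qed

text \<open>Integration by parts without derivatives: the primitive moves from \<open>g\<close>,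
  anchored at 0, to \<open>f\<close>, anchored at \<open>-\<tau>\<close>, so no boundary term
  appears.\<close>

lemma inner_tail_exchange:
  fixes f g :: "real \<Rightarrow> 'a::euclidean_space"
  assumes f: "f \<in> L2 (-\<tau>) 0" and g: "g \<in> L2 (-\<tau>) 0"
  shows "(LINT l|lebesgue_on {-\<tau>..0}. f l \<bullet> tail g l) = (LINT \<theta>|lebesgue_on {-\<tau>..0}. integral {-\<tau>..\<theta>} f
      \<bullet> g \<theta>)"
proof -
  have "(LINT l|lebesgue_on {-\<tau>..0}. f l \<bullet> tail g l) =
    (LINT l|lebesgue_on {-\<tau>..0}. f l \<bullet> (LINT \<theta>|lebesgue_on {-\<tau>..0}. indicat_real {l..} \<theta> *\<^sub>R g \<theta>))"
  proof (rule Bochner_Integration.integral_cong[OF refl])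
    fix l assume "l \<in> space (lebesgue_on {-\<tau>..0})"
    then have e: "{l..} \<inter> {-\<tau>..0} = {l..0}" by auto
    show "f l \<bullet> tail g l = f l \<bullet> (LINT \<theta>|lebesgue_on {-\<tau>..0}. indicat_real {l..} \<theta> *\<^sub>R g \<theta>)"
      using integral_indicator_tail[OF g, of "{l..}", unfolded e] by (simp add: tail_def)
  qed
  also have "\<dots> = (LINT \<theta>|lebesgue_on {-\<tau>..0}. (LINT l|lebesgue_on {-\<tau>..0}. indicat_real {..\<theta>} l *\<^sub>R f l)
      \<bullet> g \<theta>)"
    by (rule Fubini_triangle[OF L2_integrable[OF f] L2_integrable[OF g]])
  also have "\<dots> = (LINT \<theta>|lebesgue_on {-\<tau>..0}. integral {-\<tau>..\<theta>} f \<bullet> g \<theta>)"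
  proof (rule Bochner_Integration.integral_cong[OF refl])
    fix \<theta> assume "\<theta> \<in> space (lebesgue_on {-\<tau>..0})"
    then have e: "{..\<theta>} \<inter> {-\<tau>..0} = {-\<tau>..\<theta>}" by auto
    show "(LINT l|lebesgue_on {-\<tau>..0}. indicat_real {..\<theta>} l *\<^sub>R f l) \<bullet> g \<theta> = integral {-\<tau>..\<theta>} f \<bullet> g \<theta>"
      using integral_indicator_tail[OF f, of "{..\<theta>}", unfolded e] by simp
  qed
  finally show ?thesis .
qed

lemma continuous_imp_L2:
  fixes f :: "real \<Rightarrow> 'a::euclidean_space"
  assumes "continuous_on {a..b} f"
  shows "f \<in> L2 a b"
proof -
  have "f \<in> borel_measurable (lebesgue_on {a..b})"
    using assms by (intro continuous_imp_measurable_on_sets_lebesgue) auto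
  moreover have "(\<lambda>t. (norm (f t))\<^sup>2) absolutely_integrable_on {a..b}"
    by (intro absolutely_integrable_continuous_real continuous_intros assms)
  ultimately show ?thesis by (simp add: L2_def absolutely_integrable_imp_integrable)
qed

text \<open>Formally \<open>tail z\<close> has derivative \<open>- z\<close>, so twice the integrand
  is minus the derivative of the squared norm of \<open>tail z\<close>, which vanishes at 0. Since
  \<open>z\<close> is only square integrable, the exchange of integrals takes the place of this
  derivative.\<close>

lemma integral_tail_inner_self:
  fixes z :: "real \<Rightarrow> 'a::euclidean_space"
  assumes z: "z \<in> L2 (-\<tau>) 0"
  shows "2 * integral {-\<tau>..0} (\<lambda>l. tail z l \<bullet> z l) = (norm (tail z (-\<tau>)))\<^sup>2"
proof -
  let ?M = "lebesgue_on {-\<tau>..0}"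
  have t: "tail z \<in> L2 (-\<tau>) 0" by (rule continuous_imp_L2[OF continuous_on_tail[OF z]])
  let ?m = "tail z (-\<tau>)"
  have int: "integrable ?M (\<lambda>l. z l \<bullet> tail z l)" by (rule L2_inner_integrable[OF z t])
  have "(LINT l|?M. z l \<bullet> tail z l) = (LINT \<theta>|?M. integral {-\<tau>..\<theta>} z \<bullet> z \<theta>)"
    by (rule inner_tail_exchange[OF z z])
  \<comment> \<open>The primitives anchored at the two ends add up to the total integral, so the
    exchanged integral contains the original one with opposite sign.\<close>
  also have "\<dots> = (LINT \<theta>|?M. ?m \<bullet> z \<theta> - z \<theta> \<bullet> tail z \<theta>)"
  proof (rule Bochner_Integration.integral_cong[OF refl])
    fix \<theta> assume "\<theta> \<in> space ?M"
    then have "integral {-\<tau>..\<theta>} z + tail z \<theta> = ?m"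
      unfolding tail_def using L2_integrable_on[OF z, of "-\<tau>"]
      by (intro Henstock_Kurzweil_Integration.integral_combine) auto
    then have "integral {-\<tau>..\<theta>} z = ?m - tail z \<theta>" by (simp add: algebra_simps)
    then show "integral {-\<tau>..\<theta>} z \<bullet> z \<theta> = ?m \<bullet> z \<theta> - z \<theta> \<bullet> tail z \<theta>"
      by (simp add: inner_diff_left inner_diff_right inner_commute)
  qed
  also have "\<dots> = (LINT \<theta>|?M. ?m \<bullet> z \<theta>) - (LINT l|?M. z l \<bullet> tail z l)"
    using int L2_integrable[OF z] by (intro Bochner_Integration.integral_diff) auto
  also have "(LINT \<theta>|?M. ?m \<bullet> z \<theta>) = ?m \<bullet> (LINT \<theta>|?M. z \<theta>)"
    using L2_integrable[OF z] by (intro integral_inner_right) auto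
  also have "(LINT \<theta>|?M. z \<theta>) = ?m"
    unfolding tail_def by (rule lebesgue_integral_eq_integral[OF L2_integrable[OF z]]) simp
  finally have "2 * (LINT l|?M. z l \<bullet> tail z l) = (norm ?m)\<^sup>2" by (simp add: power2_norm_eq_inner)
  moreover have "(LINT l|?M. z l \<bullet> tail z l) = integral {-\<tau>..0} (\<lambda>l. z l \<bullet> tail z l)"
    by (rule lebesgue_integral_eq_integral[OF int]) simp
  ultimately show ?thesis by (simp add: inner_commute)
qed

section \<open>Absolute continuity of \<open>W\<^sup>1\<^sup>,\<^sup>2\<close> functions\<close>

text \<open>A \<open>C\<^sup>1\<close> step from \<open>0\<close> to \<open>1\<close>; differences of two rescaled copies are the test functions
  to which weak differentiability is applied.\<close>

definition ramp :: "real \<Rightarrow> real" where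
  "ramp u = 2 * (max 0 u)\<^sup>2 - 4 * (max 0 (u - 1/2))\<^sup>2 + 2 * (max 0 (u - 1))\<^sup>2"

text \<open>The derivative of \<open>ramp\<close>: a triangular kernel on the unit interval, of
  height 2 and mass 1.\<close>

definition tent :: "real \<Rightarrow> real" where
  "tent u = 4 * max 0 u - 8 * max 0 (u - 1/2) + 4 * max 0 (u - 1)"

lemma max_power2_derivative: "((\<lambda>u::real. (max 0 u)\<^sup>2) has_real_derivative 2 * max 0 u) (at u)"
proof -
  consider "u < 0" | "u > 0" | "u = 0" by linarith
  then show ?thesis
  proof cases
    case 1
    have "((\<lambda>u::real. 0) has_real_derivative 0) (at u)" by simp
    then have "((\<lambda>u::real. (max 0 u)\<^sup>2) has_real_derivative 0) (at u)"
      by (rule has_field_derivative_transform_within_open[where S = "{..<0}"]) (use 1 in auto)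
    then show ?thesis using 1 by simp
  next
    case 2
    have "((\<lambda>u::real. u\<^sup>2) has_real_derivative 2 * u) (at u)" by (auto intro!: derivative_eq_intros)
    then have "((\<lambda>u::real. (max 0 u)\<^sup>2) has_real_derivative 2 * u) (at u)"
      by (rule has_field_derivative_transform_within_open[where S = "{0<..}"]) (use 2 in auto)
    then show ?thesis using 2 by simp
  next
    case 3
    have "((\<lambda>h::real. (max 0 h)\<^sup>2 / h) \<longlongrightarrow> 0) (at 0)"
    proof (rule Lim_null_comparison)
      show "((\<lambda>h::real. \<bar>h\<bar>) \<longlongrightarrow> 0) (at 0)" by (rule tendsto_rabs_zero) (rule tendsto_ident_at)
      have "norm ((max 0 h)\<^sup>2 / h) \<le> \<bar>h\<bar>" for h :: real
        by (cases "h > 0") (auto simp: power2_eq_square max_def)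
      then show "\<forall>\<^sub>F h::real in at 0. norm ((max 0 h)\<^sup>2 / h) \<le> \<bar>h\<bar>" by simp
    qed
    then show ?thesis using 3 by (simp add: has_field_derivative_iff)
  qed
qed

lemma ramp_derivative: "(ramp has_real_derivative tent u) (at u)"
proof -
  have s: "((\<lambda>u::real. (max 0 (u - k))\<^sup>2) has_real_derivative 2 * max 0 (u - k)) (at u)" for k
  proof -
    have "((\<lambda>u. u - k) has_real_derivative 1) (at u)" by (auto intro!: derivative_eq_intros)
    from DERIV_chain2[where f = "\<lambda>u. (max 0 u)\<^sup>2" and g = "\<lambda>u. u - k", OF max_power2_derivative this]
    show ?thesis by simp
  qed
  show ?thesis unfolding ramp_def[abs_def] tent_def
    by (rule derivative_eq_intros max_power2_derivative s refl)+ (simp add: algebra_simps)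
qed

lemma ramp_0: "u \<le> 0 \<Longrightarrow> ramp u = 0" by (simp add: ramp_def)

lemma ramp_1: "u \<ge> 1 \<Longrightarrow> ramp u = 1"
  by (simp add: ramp_def max_def power2_eq_square algebra_simps)

lemma tent_nonneg: "0 \<le> tent u"
  by (simp add: tent_def max_def)

lemma tent_0: "u \<le> 0 \<or> u \<ge> 1 \<Longrightarrow> tent u = 0"
  by (auto simp: tent_def max_def)

lemma ramp_bounds: "0 \<le> ramp u" "ramp u \<le> 1"
proof -
  have mono: "ramp u \<le> ramp v" if "u \<le> v" for u v
    by (rule DERIV_nonneg_imp_nondecreasing[OF that]) (use ramp_derivative tent_nonneg in blast)
  show "0 \<le> ramp u" using mono[of "min u 0" u] by (simp add: ramp_0)
  show "ramp u \<le> 1" using mono[of u "max u 1"] by (simp add: ramp_1)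
qed

lemma continuous_on_tent: "continuous_on S tent"
  unfolding tent_def[abs_def] by (intro continuous_intros)

text \<open>A one-sided approximate identity: the kernels live in
  \<open>{p..p + \<epsilon> n}\<close> with mass 1, so continuity of \<open>f\<close> at
  \<open>p\<close> decides.\<close>

lemma tent_average:
  fixes f :: "real \<Rightarrow> 'a::euclidean_space"
  assumes f: "continuous_on {a..b} f" and p: "a \<le> p" and \<epsilon>: "\<And>n. 0 < \<epsilon> n" "\<And>n. p + \<epsilon> n \<le> b" "\<epsilon> \<longlonglongrightarrow> 0"
  shows "(\<lambda>n. integral {a..b} (\<lambda>t. (tent ((t - p) / \<epsilon> n) / \<epsilon> n) *\<^sub>R f t)) \<longlonglongrightarrow> f p"
proof -
  let ?w = "\<lambda>n t. tent ((t - p) / \<epsilon> n) / \<epsilon> n"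
  have ne: "\<epsilon> n \<noteq> 0" for n using \<epsilon>(1)[of n] by simp
  have cont_w: "continuous_on S (?w n)" for S n
    by (intro continuous_intros continuous_on_compose2[OF continuous_on_tent[of UNIV]]) (auto simp: ne)
  have eq: "integral {a..b} (\<lambda>t. ?w n t *\<^sub>R f t) = integral {p..p + \<epsilon> n} (\<lambda>t. ?w n t *\<^sub>R f t)" for n
  proof -
    have z: "?w n t = 0" if "t \<notin> {p..p + \<epsilon> n}" for t
    proof -
      have "(t - p) / \<epsilon> n \<le> 0 \<or> (t - p) / \<epsilon> n \<ge> 1"
        using that \<epsilon>(1)[of n] by (auto simp: divide_nonpos_pos le_divide_eq not_le)
      then show ?thesis using tent_0 by simp
    qed
    have "integral {a..b} (\<lambda>t. ?w n t *\<^sub>R f t) = integral {a..b} (\<lambda>t. if t \<in> {p..p + \<epsilon> n} then ?w n t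
        *\<^sub>R f t else 0)"
      by (rule integral_cong) (use z in auto)
    also have "\<dots> = integral ({p..p + \<epsilon> n} \<inter> {a..b}) (\<lambda>t. ?w n t *\<^sub>R f t)"
      by (rule Henstock_Kurzweil_Integration.integral_restrict_Int)
    also have "{p..p + \<epsilon> n} \<inter> {a..b} = {p..p + \<epsilon> n}" using p \<epsilon>(2)[of n] by auto
    finally show ?thesis .
  qed
  have mass: "(?w n has_integral 1) {p..p + \<epsilon> n}" for n
  proof -
    have "(?w n has_integral ramp ((p + \<epsilon> n - p) / \<epsilon> n) - ramp ((p - p) / \<epsilon> n)) {p..p + \<epsilon> n}"
    proof (rule fundamental_theorem_of_calculus)
      fix t show "((\<lambda>t. ramp ((t - p) / \<epsilon> n)) has_vector_derivative ?w n t) (at t within {p..p + \<epsilon> n})"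
      proof -
        have "((\<lambda>t. (t - p) / \<epsilon> n) has_real_derivative 1 / \<epsilon> n) (at t)"
          by (auto simp: ne intro!: derivative_eq_intros)
        then have "((\<lambda>t. ramp ((t - p) / \<epsilon> n)) has_real_derivative tent ((t - p) / \<epsilon> n) * (1 / \<epsilon> n)) (at t)"
          by (rule DERIV_chain2[OF ramp_derivative])
        then show ?thesis
          by (simp add: has_real_derivative_iff_has_vector_derivative has_vector_derivative_at_within)
      qed
    qed (use \<epsilon>(1)[of n] in simp)
    then show ?thesis using \<epsilon>(1)[of n] by (simp add: ramp_0 ramp_1)
  qed
  show ?thesis
  proof (rule LIMSEQ_I)
    fix e :: real assume e: "e > 0"
    have "p \<in> {a..b}" using p \<epsilon>(1,2)[of 0] by auto
    then obtain d where d: "d > 0" "\<And>t. t \<in> {a..b} \<Longrightarrow> dist t p < d \<Longrightarrow> dist (f t) (f p) < e / 2"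
      using f[unfolded continuous_on_iff, rule_format, of p "e / 2"] e by auto
    have "\<forall>\<^sub>F n in sequentially. \<epsilon> n < d" using \<epsilon>(3) d(1) by (rule order_tendstoD)
    then obtain N where N: "\<And>n. n \<ge> N \<Longrightarrow> \<epsilon> n < d" by (auto simp: eventually_sequentially)
    have "norm (integral {a..b} (\<lambda>t. ?w n t *\<^sub>R f t) - f p) < e" if n: "n \<ge> N" for n
    proof -
      have sub: "{p..p + \<epsilon> n} \<subseteq> {a..b}" using p \<epsilon>(2)[of n] by auto
      have i1: "(\<lambda>t. ?w n t *\<^sub>R f t) integrable_on {p..p + \<epsilon> n}"
        by (intro integrable_continuous_real continuous_intros cont_w continuous_on_subset[OF f sub])
      have i2: "(\<lambda>t. ?w n t *\<^sub>R f p) integrable_on {p..p + \<epsilon> n}"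
        by (intro integrable_continuous_real continuous_intros cont_w)
      have "integral {p..p + \<epsilon> n} (\<lambda>t. ?w n t *\<^sub>R f p) = 1 *\<^sub>R f p"
        by (rule integral_unique[OF has_integral_scaleR_left[OF mass]])
      then have "integral {p..p + \<epsilon> n} (\<lambda>t. ?w n t *\<^sub>R f t) - f p = integral {p..p + \<epsilon> n} (\<lambda>t. ?w n t
          *\<^sub>R f t - ?w n t *\<^sub>R f p)"
        using Henstock_Kurzweil_Integration.integral_diff[OF i1 i2] by simp
      also have "norm \<dots> \<le> integral {p..p + \<epsilon> n} (\<lambda>t. ?w n t * (e / 2))"
      proof (rule integral_norm_bound_integral)
        show "(\<lambda>t. ?w n t *\<^sub>R f t - ?w n t *\<^sub>R f p) integrable_on {p..p + \<epsilon> n}"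
          using Henstock_Kurzweil_Integration.integrable_diff[OF i1 i2] .
        show "(\<lambda>t. ?w n t * (e / 2)) integrable_on {p..p + \<epsilon> n}"
          by (intro integrable_continuous_real continuous_intros cont_w)
        fix t assume t: "t \<in> {p..p + \<epsilon> n}"
        then have "dist (f t) (f p) < e / 2" using sub N[OF n] by (intro d(2)) (auto simp: dist_real_def)
        moreover have "0 \<le> ?w n t" using tent_nonneg \<epsilon>(1)[of n] by (simp add: less_imp_le)
        ultimately have "norm (?w n t *\<^sub>R (f t - f p)) \<le> ?w n t * (e / 2)"
          by (simp only: norm_scaleR abs_of_nonneg dist_norm) (intro mult_left_mono, auto)
        then show "norm (?w n t *\<^sub>R f t - ?w n t *\<^sub>R f p) \<le> ?w n t * (e / 2)"
          by (simp add: scaleR_diff_right)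
      qed
      also have "\<dots> = 1 * (e / 2)" by (rule integral_unique[OF has_integral_mult_left[OF mass]])
      also have "\<dots> < e" using e by simp
      finally show ?thesis by (simp add: eq)
    qed
    then show "\<exists>N. \<forall>n\<ge>N. norm (integral {a..b} (\<lambda>t. ?w n t *\<^sub>R f t) - f p) < e" by blast
  qed
qed

text \<open>The difference of a steep ramp at \<open>c\<close> and one at \<open>d\<close> is an
  admissible test function approximating the indicator of the interval between them. In the limit
  the left side of the weak formula becomes \<open>f c - f d\<close> and the right side minus the
  integral of \<open>g\<close> over this interval. Continuity extends the resulting formula to the
  endpoints.\<close>

lemma W12_absolutely_continuous:
  fixes f :: "real \<Rightarrow> 'a::euclidean_space"
  assumes f: "f \<in> W12 a b" and ab: "a < b"
  obtains g where "g \<in> L2 a b" "\<And>t. t \<in> {a..b} \<Longrightarrow> f t = f a + integral {a..t} g"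
proof -
  have fc: "continuous_on {a..b} f" using f by (simp add: W12_def)
  obtain g where g: "g \<in> L2 a b" and weak: "\<And>\<psi> \<psi>' c d.
        (\<forall>t. (\<psi> has_real_derivative \<psi>' t) (at t)) \<Longrightarrow> continuous_on UNIV \<psi>' \<Longrightarrow>
        a < c \<Longrightarrow> c \<le> d \<Longrightarrow> d < b \<Longrightarrow> (\<forall>t. t \<notin> {c..d} \<longrightarrow> \<psi> t = 0) \<Longrightarrow>
        (LINT t|lebesgue_on {a..b}. \<psi>' t *\<^sub>R f t) = - (LINT t|lebesgue_on {a..b}. \<psi> t *\<^sub>R g t)"
    using f unfolding W12_def by blast
  let ?M = "lebesgue_on {a..b}"
  have diff: "f d - f c = integral {c..d} g" if cd: "a < c" "c \<le> d" "d < b" for c d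
  proof -
    \<comment> \<open>At most half of the room to the right of \<open>d\<close>, so that the
      supports \<open>{c..d + \<epsilon> n}\<close> stay inside the open interval.\<close>
    define \<epsilon> where "\<epsilon> = (\<lambda>n::nat. (b - d) / 2 * (1 / real (Suc n)))"
    have \<epsilon>: "0 < \<epsilon> n" "d + \<epsilon> n < b" for n
    proof -
      show "0 < \<epsilon> n" using cd by (simp add: \<epsilon>_def)
      have "(b - d) / 2 * (1 / real (Suc n)) \<le> (b - d) / 2 * 1" using cd by (intro mult_left_mono) auto
      then have "\<epsilon> n \<le> (b - d) / 2" by (simp add: \<epsilon>_def)
      then show "d + \<epsilon> n < b" using cd by (simp add: field_simps)
    qed
    have "(\<lambda>n. (b - d) / 2 * (1 / real (Suc n))) \<longlonglongrightarrow> (b - d) / 2 * 0"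
      by (intro tendsto_intros LIMSEQ_inverse_real_of_nat[unfolded inverse_eq_divide])
    then have \<epsilon>lim: "\<epsilon> \<longlonglongrightarrow> 0" by (simp add: \<epsilon>_def)
    define \<psi> where "\<psi> = (\<lambda>n t. ramp ((t - c) / \<epsilon> n) - ramp ((t - d) / \<epsilon> n))"
    define \<psi>' where "\<psi>' = (\<lambda>n t. tent ((t - c) / \<epsilon> n) / \<epsilon> n - tent ((t - d) / \<epsilon> n) / \<epsilon> n)"
    have ne: "\<epsilon> n \<noteq> 0" for n using \<epsilon>(1)[of n] by simp
    have cw: "continuous_on S (\<lambda>t. tent ((t - p) / \<epsilon> n) / \<epsilon> n)" for S n p
      by (intro continuous_intros continuous_on_compose2[OF continuous_on_tent[of UNIV]]) (auto simp: ne)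
    have rd: "((\<lambda>t. ramp ((t - p) / \<epsilon> n)) has_real_derivative tent ((t - p) / \<epsilon> n) / \<epsilon> n) (at t)" for p n t
    proof -
      have "((\<lambda>t. (t - p) / \<epsilon> n) has_real_derivative 1 / \<epsilon> n) (at t)"
        by (auto simp: ne intro!: derivative_eq_intros)
      then show ?thesis using DERIV_chain2[OF ramp_derivative] by fastforce
    qed
    have w: "(LINT t|?M. \<psi>' n t *\<^sub>R f t) = - (LINT t|?M. \<psi> n t *\<^sub>R g t)" for n
    proof (rule weak[of _ _ c "d + \<epsilon> n"])
      show "\<forall>t. (\<psi> n has_real_derivative \<psi>' n t) (at t)"
        unfolding \<psi>_def \<psi>'_def by (intro allI DERIV_diff rd)
      show "continuous_on UNIV (\<psi>' n)" unfolding \<psi>'_def by (intro continuous_intros cw)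
      show "\<forall>t. t \<notin> {c..d + \<epsilon> n} \<longrightarrow> \<psi> n t = 0"
      proof (intro allI impI)
        fix t assume "t \<notin> {c..d + \<epsilon> n}"
        then consider "t < c" | "t > d + \<epsilon> n" by fastforce
        then show "\<psi> n t = 0"
        proof cases
          case 1
          then have "(t - c) / \<epsilon> n \<le> 0" "(t - d) / \<epsilon> n \<le> 0" using cd \<epsilon>(1)[of n] by (simp_all add:
              divide_nonpos_pos)
          then show ?thesis by (simp add: \<psi>_def ramp_0)
        next
          case 2
          then have "(t - c) / \<epsilon> n \<ge> 1" "(t - d) / \<epsilon> n \<ge> 1" using cd \<epsilon>(1)[of n] by (simp_all add:
              le_divide_eq)
          then show ?thesis by (simp add: \<psi>_def ramp_1)
        qed
      qed
    qed (use cd \<epsilon>[of n] in auto)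
    have left: "(LINT t|?M. \<psi>' n t *\<^sub>R f t) = integral {a..b} (\<lambda>t. (tent ((t - c) / \<epsilon> n) / \<epsilon> n) *\<^sub>R f t)
        - integral {a..b} (\<lambda>t. (tent ((t - d) / \<epsilon> n) / \<epsilon> n) *\<^sub>R f t)" for n
    proof -
      have "(LINT t|?M. \<psi>' n t *\<^sub>R f t) = integral {a..b} (\<lambda>t. \<psi>' n t *\<^sub>R f t)"
        by (intro lebesgue_integral_eq_integral absolutely_integrable_imp_integrable
            absolutely_integrable_continuous_real)
           (auto simp: \<psi>'_def intro!: continuous_intros cw fc)
      then show ?thesis unfolding \<psi>'_def scaleR_diff_left
        by (simp add: Henstock_Kurzweil_Integration.integral_diff integrable_continuous_real
            continuous_on_scaleR cw fc)
    qed
    have avg: "(\<lambda>n. integral {a..b} (\<lambda>t. (tent ((t - p) / \<epsilon> n) / \<epsilon> n) *\<^sub>R f t)) \<longlonglongrightarrow> f p"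
      if "a \<le> p" "p \<le> d" for p
    proof (rule tent_average[OF fc that(1) \<epsilon>(1) _ \<epsilon>lim])
      show "p + \<epsilon> n \<le> b" for n using \<epsilon>(2)[of n] that by simp
    qed
    have "(\<lambda>n. LINT t|?M. \<psi>' n t *\<^sub>R f t) \<longlonglongrightarrow> f c - f d"
      unfolding left by (rule tendsto_diff[OF avg avg]) (use cd in auto)
    then have "(\<lambda>n. - (LINT t|?M. \<psi> n t *\<^sub>R g t)) \<longlonglongrightarrow> f c - f d" by (simp add: w)
    \<comment> \<open>Dominated by \<open>norm (g t)\<close>, as differences of ramps are at most 1
      in size; a ramp vanishes at its own left end, so the limit is the indicator of the interval
      open at \<open>c\<close>.\<close>
    moreover have "(\<lambda>n. LINT t|?M. \<psi> n t *\<^sub>R g t) \<longlonglongrightarrow> (LINT t|?M. indicat_real {c<..d} t *\<^sub>R g t)"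
    proof (rule integral_dominated_convergence[where w = "\<lambda>t. norm (g t)"])
      have id: "(\<lambda>t. t) \<in> borel_measurable ?M" by (intro measurable_restrict_space1
          measurable_completion) simp
      have gm: "g \<in> borel_measurable ?M" using g by (simp add: L2_def)
      have "indicat_real {c<..d} \<in> borel_measurable ?M"
        using measurable_compose[OF id, of "indicat_real {c<..d}" borel] by simp
      then show "(\<lambda>t. indicat_real {c<..d} t *\<^sub>R g t) \<in> borel_measurable ?M" using gm by simp
      have "continuous_on UNIV (\<psi> n)" for n
        unfolding \<psi>_def by (intro continuous_on_diff continuous_at_imp_continuous_on ballI
            DERIV_isCont[OF rd])
      then show "(\<lambda>t. \<psi> n t *\<^sub>R g t) \<in> borel_measurable ?M" for n
        using measurable_compose[OF id borel_measurable_continuous_onI, of "\<psi> n"] gm by simp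
      show "integrable ?M (\<lambda>t. norm (g t))" using L2_integrable[OF g] by simp
      have "\<bar>\<psi> n t\<bar> \<le> 1" for n t
        using ramp_bounds[of "(t - c) / \<epsilon> n"] ramp_bounds[of "(t - d) / \<epsilon> n"] by (simp add: \<psi>_def
            abs_le_iff)
      then show "AE t in ?M. norm (\<psi> n t *\<^sub>R g t) \<le> norm (g t)" for n
        by (intro AE_I2) (simp add: mult_left_le_one_le)
      show "AE t in ?M. (\<lambda>n. \<psi> n t *\<^sub>R g t) \<longlonglongrightarrow> indicat_real {c<..d} t *\<^sub>R g t"
      proof (intro AE_I2 tendsto_scaleR tendsto_const)
        fix t
        have r: "(\<lambda>n. ramp ((t - p) / \<epsilon> n)) \<longlonglongrightarrow> (if p < t then 1 else 0)" for p
        proof (cases "p < t")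
          case True
          then have "\<forall>\<^sub>F n in sequentially. \<epsilon> n < t - p" by (intro order_tendstoD(2)[OF \<epsilon>lim]) simp
          then have "\<forall>\<^sub>F n in sequentially. 1 = ramp ((t - p) / \<epsilon> n)"
            by eventually_elim (simp add: ramp_1 le_divide_eq \<epsilon>(1))
          then show ?thesis using True by (simp add: Lim_transform_eventually[OF tendsto_const])
        next
          case False
          then have "(t - p) / \<epsilon> n \<le> 0" for n using \<epsilon>(1)[of n] by (simp add: divide_nonpos_pos)
          then show ?thesis using False by (simp add: ramp_0)
        qed
        have "(\<lambda>n. \<psi> n t) \<longlonglongrightarrow> (if c < t then 1 else 0) - (if d < t then 1 else 0)"
          unfolding \<psi>_def by (intro tendsto_diff r)
        moreover have "(if c < t then 1 else 0) - (if d < t then 1 else 0) = indicat_real {c<..d} t"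
          using cd by (auto simp: indicator_def)
        ultimately show "(\<lambda>n. \<psi> n t) \<longlonglongrightarrow> indicat_real {c<..d} t" by simp
      qed
    qed
    ultimately have "f c - f d = - (LINT t|?M. indicat_real {c<..d} t *\<^sub>R g t)"
      by (rule LIMSEQ_unique[OF _ tendsto_minus])
    also have "(LINT t|?M. indicat_real {c<..d} t *\<^sub>R g t) = integral ({c<..d} \<inter> {a..b}) g"
      by (rule integral_indicator_tail[OF g]) simp
    also have "\<dots> = integral {c..d} g"
    proof (rule integral_subset_negligible)
      show "negligible ({c..d} - {c<..d} \<inter> {a..b})"
        by (rule negligible_subset[of "{c}"]) (use cd in auto)
    qed auto
    finally show ?thesis by (simp add: algebra_simps)
  qed
  have gi: "g integrable_on {a..b}" using L2_integrable_on[OF g, of a] by simp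
  define h where "h = (\<lambda>t. f t - integral {a..t} g)"
  have hc: "continuous_on {a..b} h" unfolding h_def
    by (intro continuous_intros fc indefinite_integral_continuous_1 gi)
  have hconst: "h d = h c" if cd: "a < c" "c \<le> d" "d < b" for c d
  proof -
    have "integral {a..c} g + integral {c..d} g = integral {a..d} g"
      using cd by (intro Henstock_Kurzweil_Integration.integral_combine integrable_on_subinterval[OF
          gi]) auto
    then show ?thesis using diff[OF cd] by (simp add: h_def algebra_simps)
  qed
  let ?k = "h ((a + b) / 2)"
  have hk: "h t = ?k" if "t \<in> {a<..<b}" for t
    using hconst[of t "(a + b) / 2"] hconst[of "(a + b) / 2" t] that ab by (cases "t \<le> (a + b) / 2")
        (auto simp: field_simps)
  have hall: "h t = ?k" if "t \<in> {a..b}" for t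
  proof -
    have cl: "closure {a<..<b} = {a..b}" using ab by simp
    show ?thesis
      by (rule continuous_constant_on_closure[of "{a<..<b}" h ?k t, unfolded cl, OF hc hk that])
  qed
  have "f t = f a + integral {a..t} g" if "t \<in> {a..b}" for t
  proof -
    have "h t = h a" using hall[OF that] hall[of a] ab by simp
    then have "f t - integral {a..t} g = f a" by (simp add: h_def)
    then show ?thesis by (simp add: algebra_simps)
  qed
  then show ?thesis using that g by blast
qed

text \<open>As \<open>a\<close> vanishes at \<open>-\<tau>\<close>, it is the primitive of its weak
  derivative from there, the one that \<open>inner_tail_exchange\<close> trades for
  \<open>tail z\<close>. Cauchy-Schwarz then gives \<open>K\<close>, the L2 norm of that
  derivative.\<close>

lemma W12_innerH_weak_bound:
  fixes a :: "('d::finite) path"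
  assumes a: "a \<in> W12 (-\<tau>) 0" "a (-\<tau>) = 0" and \<tau>: "\<tau> > 0"
  obtains K where "K \<ge> 0" "\<And>z. z \<in> L2 (-\<tau>) 0 \<Longrightarrow> \<bar>innerH \<tau> a z\<bar> \<le> K * sqrt (weak_inner \<tau> z z)"
proof -
  obtain g where g: "g \<in> L2 (-\<tau>) 0" "\<And>t. t \<in> {-\<tau>..0} \<Longrightarrow> a t = a (-\<tau>) + integral {-\<tau>..t} g"
    using W12_absolutely_continuous[OF a(1)] \<tau> by auto
  have "\<bar>innerH \<tau> a z\<bar> \<le> sqrt (inner_L2 (-\<tau>) 0 g g) * sqrt (weak_inner \<tau> z z)" if z: "z \<in> L2 (-\<tau>) 0" for z
  proof -
    have t: "tail z \<in> L2 (-\<tau>) 0" by (rule continuous_imp_L2[OF continuous_on_tail[OF z]])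
    have "innerH \<tau> a z = (LINT \<theta>|lebesgue_on {-\<tau>..0}. integral {-\<tau>..\<theta>} g \<bullet> z \<theta>)"
      unfolding innerH_def by (rule Bochner_Integration.integral_cong) (use g(2) a(2) in auto)
    also have "\<dots> = inner_L2 (-\<tau>) 0 g (tail z)"
      unfolding inner_L2_def by (rule inner_tail_exchange[OF g(1) z, symmetric])
    finally have "\<bar>innerH \<tau> a z\<bar> \<le> sqrt (inner_L2 (-\<tau>) 0 g g) * sqrt (inner_L2 (-\<tau>) 0 (tail z) (tail z))"
      using inner_L2_Cauchy_Schwarz[OF g(1) t] by simp
    also have "inner_L2 (-\<tau>) 0 (tail z) (tail z) = weak_inner \<tau> z z"
      unfolding weak_inner_def by (rule inner_L2_eq_integral[OF t t])
    finally show ?thesis .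
  qed
  then show ?thesis using that[of "sqrt (inner_L2 (-\<tau>) 0 g g)"] by (simp add: inner_L2_nonneg)
qed

section \<open>Estimates\<close>

text \<open>Cauchy-Schwarz in each row; the norm of a matrix is the Euclidean norm of its
  entries.\<close>

lemma norm_matrix_vector_mult_le: "norm (A *v x) \<le> norm A * norm x"
  for A :: "real ^ 'n::finite ^ 'm::finite"
proof -
  have "norm (A *v x) = L2_set (\<lambda>i. \<bar>A $ i \<bullet> x\<bar>) UNIV"
    by (simp add: norm_vec_def matrix_vector_mult_def inner_vec_def)
  also have "\<dots> \<le> L2_set (\<lambda>i. norm (A $ i) * norm x) UNIV"
    by (intro L2_set_mono Cauchy_Schwarz_ineq2) auto
  also have "\<dots> = norm A * norm x"
    by (simp add: norm_vec_def L2_set_left_distrib)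
  finally show ?thesis .
qed

lemma tail_lipschitz:
  assumes z: "z \<in> Dspace \<tau>" and R: "\<And>\<theta>. \<theta> \<in> {-\<tau>..0} \<Longrightarrow> norm (z \<theta>) \<le> R" and l: "-\<tau> \<le> l" "l \<le> s" "s \<le> 0"
  shows "norm (tail z l - tail z s) \<le> R * (s - l)"
proof -
  have "integral {l..s} z + integral {s..0} z = integral {l..0} z"
    using l by (intro Henstock_Kurzweil_Integration.integral_combine Dspace_integrable_on[OF z]) auto
  then have "tail z l - tail z s = integral {l..s} z" by (simp add: tail_def algebra_simps)
  then show ?thesis using integral_le_sup_bound[OF Dspace_integrable_on[OF z], of l s R] R l by simp
qed

lemma tail_0: "tail z 0 = 0" by (simp add: tail_def)

lemma tail_sup_bound:
  assumes z: "z \<in> Dspace \<tau>" and R: "\<And>\<theta>. \<theta> \<in> {-\<tau>..0} \<Longrightarrow> norm (z \<theta>) \<le> R" and l: "-\<tau> \<le> l" "l \<le> 0"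
  shows "norm (tail z l) \<le> R * \<tau>"
proof -
  have "R \<ge> 0" using R[of 0] l by (auto intro: order_trans[OF norm_ge_zero])
  then have "R * (0 - l) \<le> R * \<tau>" using l by (intro mult_left_mono) auto
  then show ?thesis using tail_lipschitz[OF z R l(1) l(2) order_refl] by (simp add: tail_0)
qed

text \<open>The primitive is \<open>R\<close>-Lipschitz, so a value of size \<open>m\<close> at
  \<open>l\<close> keeps it above \<open>m / 2\<close> on an interval of length
  \<open>m / (2 * R)\<close>, and the integral of its square there is at least
  \<open>m ^ 3 / (8 * R)\<close>. This converts smallness in the coupling norm into smallness in the
  supremum.\<close>

lemma tail_interpolation:
  assumes z: "z \<in> Dspace \<tau>" and R: "\<And>\<theta>. \<theta> \<in> {-\<tau>..0} \<Longrightarrow> norm (z \<theta>) \<le> R" "R > 0" and l: "-\<tau> \<le> l" "l \<le> 0"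
  shows "norm (tail z l) ^ 3 \<le> 8 * R * weak_inner \<tau> z z"
proof -
  define m where "m = norm (tail z l)"
  define \<delta> where "\<delta> = m / (2 * R)"
  have m0: "m \<ge> 0" by (simp add: m_def)
  have \<delta>0: "\<delta> \<ge> 0" using m0 R by (simp add: \<delta>_def)
  \<comment> \<open>The primitive vanishes at 0, hence that interval fits between \<open>l\<close>
    and 0.\<close>
  have "m \<le> R * (0 - l)" using tail_lipschitz[OF z R(1) l(1) l(2) order_refl] by (simp add: m_def tail_0)
  then have "2 * \<delta> \<le> - l" using R by (simp add: \<delta>_def field_simps)
  then have l\<delta>: "l + \<delta> \<le> 0" using \<delta>0 by simp
  have ge: "m / 2 \<le> norm (tail z s)" if s: "s \<in> {l..l + \<delta>}" for s
  proof -
    have "norm (tail z l - tail z s) \<le> R * (s - l)" using s l l\<delta> by (intro tail_lipschitz[OF z R(1)]) auto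
    also have "\<dots> \<le> R * \<delta>" using s R by (intro mult_left_mono) auto
    also have "\<dots> = m / 2" using R by (simp add: \<delta>_def)
    finally show ?thesis using norm_triangle_ineq2[of "tail z l" "tail z s"] by (simp add: m_def)
  qed
  have zL: "z \<in> L2 (-\<tau>) 0" using Dspace_L2[OF z] .
  have int: "(\<lambda>s. tail z s \<bullet> tail z s) integrable_on {-\<tau>..0}" by (rule tail_inner_integrable[OF zL zL])
  have "m\<^sup>2 / 4 * \<delta> = integral {l..l + \<delta>} (\<lambda>s. m\<^sup>2 / 4)" using \<delta>0 by simp
  also have "\<dots> \<le> integral {l..l + \<delta>} (\<lambda>s. tail z s \<bullet> tail z s)"
  proof (rule integral_le)
    show "(\<lambda>s. tail z s \<bullet> tail z s) integrable_on {l..l + \<delta>}"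
      using int by (rule integrable_on_subinterval) (use l l\<delta> in auto)
    fix s assume "s \<in> {l..l + \<delta>}"
    then have "(m / 2)\<^sup>2 \<le> (norm (tail z s))\<^sup>2" using ge m0 by (intro power_mono) auto
    then show "m\<^sup>2 / 4 \<le> tail z s \<bullet> tail z s" by (simp add: power2_norm_eq_inner power_divide)
  qed auto
  also have "\<dots> \<le> weak_inner \<tau> z z"
    unfolding weak_inner_def
    using int by (intro integral_subset_le integrable_on_subinterval[OF int]) (use l l\<delta> in auto)
  finally have "m\<^sup>2 / 4 * \<delta> \<le> weak_inner \<tau> z z" .
  moreover have "m\<^sup>2 / 4 * \<delta> = m ^ 3 / (8 * R)" by (simp add: \<delta>_def power2_eq_square power3_eq_cube)
  ultimately have "m ^ 3 / (8 * R) \<le> weak_inner \<tau> z z" by simp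
  then have "m ^ 3 \<le> weak_inner \<tau> z z * (8 * R)" using R(2) by (simp only: pos_divide_le_eq)
  then show ?thesis by (simp add: m_def mult.commute)
qed

lemma SUP_tail_le:
  assumes "x \<in> Dspace \<tau>" "y \<in> Dspace \<tau>" "\<tau> \<ge> 0" "\<And>l. l \<in> {-\<tau>..0} \<Longrightarrow> norm (tail (x - y) l) \<le> m"
  shows "(SUP l\<in>{-\<tau>..0}. norm (LINT \<theta>|lebesgue_on {l..0}. x \<theta> - y \<theta>)) \<le> m"
proof (rule cSUP_least)
  fix l assume l: "l \<in> {-\<tau>..0}"
  have "(LINT \<theta>|lebesgue_on {l..0}. (x - y) \<theta>) = tail (x - y) l"
    unfolding tail_def
    by (rule lebesgue_integral_eq_integral[OF L2_integrable[OF Dspace_L2[OF Dspace_diff[OF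
        assms(1,2)]]]]) simp
  then show "norm (LINT \<theta>|lebesgue_on {l..0}. x \<theta> - y \<theta>) \<le> m" using assms(4)[OF l] by (simp add:
      fun_diff_def)
qed (use assms(3) in auto)

subsection \<open>Continuity with respect to the \<open>L\<^sup>1\<close> distance\<close>

text \<open>Chains of extensions converge in this distance but, in the presence of jumps, not
  uniformly. Together with the times and the present values it controls every term of the doubled
  functional.\<close>

definition L1_dist :: "real \<Rightarrow> ('d::finite) path \<Rightarrow> 'd path \<Rightarrow> real" where
  "L1_dist \<tau> x y = integral {-\<tau>..0} (\<lambda>\<theta>. norm (x \<theta> - y \<theta>))"

lemma norm_diff_integrable_on:
  assumes "x \<in> Dspace \<tau>" "y \<in> Dspace \<tau>"
  shows "(\<lambda>\<theta>. norm (x \<theta> - y \<theta>)) integrable_on {l..b}"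
proof -
  have "(\<lambda>\<theta>. norm ((x - y) \<theta>)) integrable_on {l..b}"
    by (rule L2_integrable_on[OF L2_norm[OF Dspace_L2[OF Dspace_diff[OF assms]]] order_refl])
  then show ?thesis by (simp add: fun_diff_def)
qed


lemma tail_diff_le_L1_dist:
  assumes x: "x \<in> Dspace \<tau>" and y: "y \<in> Dspace \<tau>" and l: "l \<in> {-\<tau>..0}"
  shows "norm (tail x l - tail y l) \<le> L1_dist \<tau> x y"
proof -
  have "tail x l - tail y l = integral {l..0} (\<lambda>\<theta>. x \<theta> - y \<theta>)"
    unfolding tail_def
    by (rule Henstock_Kurzweil_Integration.integral_diff[symmetric, OF Dspace_integrable_on[OF x]
        Dspace_integrable_on[OF y]])
  also have "norm \<dots> \<le> integral {l..0} (\<lambda>\<theta>. norm (x \<theta> - y \<theta>))"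
    by (intro integral_norm_bound_integral Henstock_Kurzweil_Integration.integrable_diff
        Dspace_integrable_on[OF x] Dspace_integrable_on[OF y] norm_diff_integrable_on[OF x y]) auto
  also have "\<dots> \<le> L1_dist \<tau> x y"
    unfolding L1_dist_def using l by (intro integral_subset_le norm_diff_integrable_on[OF x y]) auto
  finally show ?thesis .
qed

lemma innerH_diff_le_L1_dist:
  assumes x: "x \<in> Dspace \<tau>" and y: "y \<in> Dspace \<tau>"
    and R: "\<And>\<theta>. \<theta> \<in> {-\<tau>..0} \<Longrightarrow> norm (x \<theta>) \<le> R" "\<And>\<theta>. \<theta> \<in> {-\<tau>..0} \<Longrightarrow> norm (y \<theta>) \<le> R"
  shows "\<bar>innerH \<tau> x x - innerH \<tau> y y\<bar> \<le> 2 * R * L1_dist \<tau> x y"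
proof -
  have i: "(\<lambda>t. z t \<bullet> z t) integrable_on {-\<tau>..0}" if "z \<in> Dspace \<tau>" for z :: "'a path"
    using L2_inner_integrable[OF Dspace_L2[OF that] Dspace_L2[OF that]] by (rule
        integrable_on_lebesgue_on) simp
  have "innerH \<tau> x x - innerH \<tau> y y = integral {-\<tau>..0} (\<lambda>t. x t \<bullet> x t - y t \<bullet> y t)"
    by (simp add: innerH_eq inner_L2_eq_integral Dspace_L2[OF x] Dspace_L2[OF y]
        Henstock_Kurzweil_Integration.integral_diff i x y)
  also have "norm \<dots> \<le> integral {-\<tau>..0} (\<lambda>t. 2 * R * norm (x t - y t))"
  proof (rule integral_norm_bound_integral)
    show "(\<lambda>t. x t \<bullet> x t - y t \<bullet> y t) integrable_on {-\<tau>..0}"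
      by (intro Henstock_Kurzweil_Integration.integrable_diff i x y)
    show "(\<lambda>t. 2 * R * norm (x t - y t)) integrable_on {-\<tau>..0}"
      using integrable_cmul[OF norm_diff_integrable_on[OF x y, of "-\<tau>" 0], of "2 * R"] by simp
    fix t assume t: "t \<in> {-\<tau>..0}"
    have "x t \<bullet> x t - y t \<bullet> y t = (x t + y t) \<bullet> (x t - y t)"
      by (simp add: inner_add_left inner_add_right inner_diff_left inner_diff_right inner_commute)
    then have "norm (x t \<bullet> x t - y t \<bullet> y t) \<le> norm (x t + y t) * norm (x t - y t)"
      using Cauchy_Schwarz_ineq2 by simp
    also have "\<dots> \<le> (R + R) * norm (x t - y t)"
      using R t by (intro mult_right_mono norm_triangle_mono) auto
    finally show "norm (x t \<bullet> x t - y t \<bullet> y t) \<le> 2 * R * norm (x t - y t)" by simp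
  qed
  also have "\<dots> = 2 * R * L1_dist \<tau> x y" by (simp add: L1_dist_def)
  finally show ?thesis by simp
qed

lemma weak_inner_diff_le_L1_dist:
  assumes mem: "x \<in> Dspace \<tau>" "y \<in> Dspace \<tau>" "x' \<in> Dspace \<tau>" "y' \<in> Dspace \<tau>" and \<tau>: "\<tau> > 0"
    and R: "\<And>\<theta> z. z \<in> {x, y, x', y'} \<Longrightarrow> \<theta> \<in> {-\<tau>..0} \<Longrightarrow> norm (z \<theta>) \<le> R"
  shows "\<bar>weak_inner \<tau> (x - y) (x - y) - weak_inner \<tau> (x' - y') (x' - y')\<bar> \<le>
     4 * R * \<tau>\<^sup>2 * (L1_dist \<tau> x x' + L1_dist \<tau> y y')"
proof -
  let ?u = "tail (x - y)" and ?v = "tail (x' - y')"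
  let ?d = "L1_dist \<tau> x x' + L1_dist \<tau> y y'"
  have d: "x - y \<in> Dspace \<tau>" "x' - y' \<in> Dspace \<tau>" using mem Dspace_diff by auto
  have L: "x - y \<in> L2 (-\<tau>) 0" "x' - y' \<in> L2 (-\<tau>) 0" using d Dspace_L2 by auto
  have i: "(\<lambda>t. ?u t \<bullet> ?u t) integrable_on {-\<tau>..0}" "(\<lambda>t. ?v t \<bullet> ?v t) integrable_on {-\<tau>..0}"
    using tail_inner_integrable L by auto
  have "weak_inner \<tau> (x - y) (x - y) - weak_inner \<tau> (x' - y') (x' - y') = integral {-\<tau>..0} (\<lambda>t. ?u t \<bullet>
      ?u t - ?v t \<bullet> ?v t)"
    unfolding weak_inner_def using i by (simp add: Henstock_Kurzweil_Integration.integral_diff)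
  moreover have "norm (integral {-\<tau>..0} (\<lambda>t. ?u t \<bullet> ?u t - ?v t \<bullet> ?v t)) \<le> integral {-\<tau>..0} (\<lambda>t. 4 * R *
      \<tau> * ?d)"
  proof (rule integral_norm_bound_integral)
    show "(\<lambda>t. ?u t \<bullet> ?u t - ?v t \<bullet> ?v t) integrable_on {-\<tau>..0}"
      using i by (rule Henstock_Kurzweil_Integration.integrable_diff)
    fix l assume l: "l \<in> {-\<tau>..0}"
    have bd: "norm (tail z l) \<le> R * \<tau>" if "z \<in> {x, y, x', y'}" for z
      using tail_sup_bound[of z \<tau> R l] mem R[OF that] that l by auto
    have u: "?u l = tail x l - tail y l" and v: "?v l = tail x' l - tail y' l"
      using tail_diff[of x \<tau> y l] tail_diff[of x' \<tau> y' l] mem[THEN Dspace_L2, of "-\<tau>" 0] l by auto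
    have "norm (?u l) \<le> R * \<tau> + R * \<tau>" unfolding u by (intro order_trans[OF norm_triangle_ineq4]
        add_mono bd) auto
    moreover have "norm (?v l) \<le> R * \<tau> + R * \<tau>" unfolding v by (intro order_trans[OF
        norm_triangle_ineq4] add_mono bd) auto
    ultimately have s: "norm (?u l + ?v l) \<le> 4 * R * \<tau>" using norm_triangle_ineq[of "?u l" "?v l"] by simp
    have "?u l - ?v l = (tail x l - tail x' l) - (tail y l - tail y' l)" unfolding u v by simp
    then have df: "norm (?u l - ?v l) \<le> ?d"
      using norm_triangle_ineq4[of "tail x l - tail x' l" "tail y l - tail y' l"]
        tail_diff_le_L1_dist[OF mem(1,3) l] tail_diff_le_L1_dist[OF mem(2,4) l] by simp
    have "?u l \<bullet> ?u l - ?v l \<bullet> ?v l = (?u l + ?v l) \<bullet> (?u l - ?v l)"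
      by (simp add: inner_add_left inner_add_right inner_diff_left inner_diff_right inner_commute)
    then have "norm (?u l \<bullet> ?u l - ?v l \<bullet> ?v l) \<le> norm (?u l + ?v l) * norm (?u l - ?v l)"
      using Cauchy_Schwarz_ineq2[of "?u l + ?v l" "?u l - ?v l"] by simp
    also have "\<dots> \<le> 4 * R * \<tau> * ?d"
      using s df order_trans[OF norm_ge_zero s] by (intro mult_mono) auto
    finally show "norm (?u l \<bullet> ?u l - ?v l \<bullet> ?v l) \<le> 4 * R * \<tau> * ?d" .
  qed auto
  moreover have "integral {-\<tau>..0} (\<lambda>t. 4 * R * \<tau> * ?d) = 4 * R * \<tau>\<^sup>2 * ?d" using \<tau> by (simp add:
      power2_eq_square)
  ultimately show ?thesis by (simp only: real_norm_def)
qed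

subsection \<open>Smoothing a Lipschitz function\<close>

text \<open>The mean over a forward window of length \<open>\<delta> / L\<close> has a difference
  quotient of \<open>b\<close> as its derivative, bounded by the Lipschitz constant whatever the
  window. A test function needs such a C^1 substitute, for \<open>b\<close> itself is only
  Lipschitz.\<close>

lemma Steklov_mean:
  fixes b :: "real \<Rightarrow> 'a::euclidean_space"
  assumes lip: "\<And>s t. s \<in> {0..T} \<Longrightarrow> t \<in> {0..T} \<Longrightarrow> norm (b s - b t) \<le> L * \<bar>s - t\<bar>" and L: "L > 0" and T: "T
      > 0"
    and \<delta>: "\<delta> > 0"
  obtains B B' where "\<And>t. t \<in> {0..T} \<Longrightarrow> (B has_vector_derivative B' t) (at t within {0..T})"
    "continuous_on {0..T} B'" "\<And>t. t \<in> {0..T} \<Longrightarrow> norm (B t - b t) \<le> \<delta>" "\<And>t. t \<in> {0..T} \<Longrightarrow> norm (B' t) \<le> L"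
proof -
  \<comment> \<open>Clipping the argument extends \<open>b\<close> by constants with the same
    Lipschitz constant; the forward window may pass \<open>T\<close>.\<close>
  define e where "e = (\<lambda>r. b (max 0 (min T r)))"
  define h where "h = \<delta> / L"
  have h: "h > 0" using \<delta> L by (simp add: h_def)
  have elip: "norm (e s - e t) \<le> L * \<bar>s - t\<bar>" for s t
  proof -
    have "norm (e s - e t) \<le> L * \<bar>max 0 (min T s) - max 0 (min T t)\<bar>"
      unfolding e_def using T by (intro lip) auto
    also have "\<dots> \<le> L * \<bar>s - t\<bar>" using L by (intro mult_left_mono) auto
    finally show ?thesis .
  qed
  have econt: "continuous_on S e" for S
  proof -
    have "L-lipschitz_on S e"
      by (rule lipschitz_onI) (use elip L in \<open>auto simp: dist_norm dist_real_def\<close>)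
    then show ?thesis by (rule lipschitz_on_continuous_on)
  qed
  have eb: "e t = b t" if "t \<in> {0..T}" for t using that by (simp add: e_def)
  define P where "P = (\<lambda>t. integral {0..t} e)"
  define B where "B = (\<lambda>t. (1 / h) *\<^sub>R (P (t + h) - P t))"
  define B' where "B' = (\<lambda>t. (1 / h) *\<^sub>R (e (t + h) - e t))"
  have Pd: "(P has_vector_derivative e t) (at t within {0..T + h})" if "t \<in> {0..T + h}" for t
    unfolding P_def by (rule integral_has_vector_derivative[OF econt that])
  have "(B has_vector_derivative B' t) (at t within {0..T})" if t: "t \<in> {0..T}" for t
  proof -
    have 1: "(P has_vector_derivative e t) (at t within {0..T})"
      by (rule has_vector_derivative_within_subset[OF Pd]) (use t h in auto)
    have "((\<lambda>t. t + h) has_vector_derivative 1) (at t within {0..T})" by (auto intro!: derivative_eq_intros)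
    moreover have "(P has_vector_derivative e (t + h)) (at (t + h) within (\<lambda>t. t + h) ` {0..T})"
      by (rule has_vector_derivative_within_subset[OF Pd]) (use t h in auto)
    ultimately have "(P \<circ> (\<lambda>t. t + h) has_vector_derivative 1 *\<^sub>R e (t + h)) (at t within {0..T})"
      by (rule vector_diff_chain_within)
    then have 2: "((\<lambda>t. P (t + h)) has_vector_derivative e (t + h)) (at t within {0..T})" by (simp add:
        o_def)
    show ?thesis
      unfolding B_def B'_def
      by (rule bounded_linear.has_vector_derivative[OF bounded_linear_scaleR_right
          has_vector_derivative_diff[OF 2 1]])
  qed
  moreover have "continuous_on {0..T} B'"
    unfolding B'_def by (intro continuous_intros econt continuous_on_compose2[OF econt[of UNIV]]) auto
  moreover have "norm (B' t) \<le> L" for t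
  proof -
    have "norm (B' t) = norm (e (t + h) - e t) / h" using h by (simp add: B'_def)
    also have "\<dots> \<le> L * h / h" using elip[of "t + h" t] h by (intro divide_right_mono) auto
    finally show ?thesis using h by simp
  qed
  moreover have "norm (B t - b t) \<le> \<delta>" if t: "t \<in> {0..T}" for t
  proof -
    have ei: "e integrable_on {c..d}" for c d by (rule integrable_continuous_real[OF econt])
    have "P t + integral {t..t + h} e = P (t + h)"
      unfolding P_def using t h by (intro Henstock_Kurzweil_Integration.integral_combine ei) auto
    then have "P (t + h) - P t = integral {t..t + h} e" by (simp add: algebra_simps)
    then have Bt: "B t = (1 / h) *\<^sub>R integral {t..t + h} e" by (simp add: B_def)
    have "integral {t..t + h} e - h *\<^sub>R e t = integral {t..t + h} (\<lambda>s. e s - e t)"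
    proof -
      have "integral {t..t + h} (\<lambda>s. e s - e t) = integral {t..t + h} e - integral {t..t + h} (\<lambda>s. e t)"
        by (intro Henstock_Kurzweil_Integration.integral_diff ei integrable_const_ivl)
      then show ?thesis using h by simp
    qed
    also have "norm \<dots> \<le> (L * h) * (t + h - t)"
    proof (rule integral_le_sup_bound)
      show "(\<lambda>s. e s - e t) integrable_on {t..t + h}" by (intro integrable_continuous_real
          continuous_intros econt)
      show "norm (e s - e t) \<le> L * h" if "s \<in> {t..t + h}" for s
        using that L by (intro order_trans[OF elip] mult_left_mono) auto
    qed (use h in simp)
    finally have le: "norm (integral {t..t + h} e - h *\<^sub>R e t) \<le> L * h * h" by simp
    have "B t - b t = (1 / h) *\<^sub>R (integral {t..t + h} e - h *\<^sub>R e t)"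
      using h by (simp add: Bt eb[OF t] scaleR_diff_right)
    then have "norm (B t - b t) = norm (integral {t..t + h} e - h *\<^sub>R e t) / h" using h by simp
    also have "\<dots> \<le> L * h * h / h" using le h by (intro divide_right_mono) auto
    also have "\<dots> = \<delta>" using h L by (simp add: h_def)
    finally show ?thesis .
  qed
  ultimately show ?thesis using that by blast
qed

section \<open>Doubling of variables\<close>

text \<open>Pairs of points carry the product order, so the maximum holds in each variable with the
  other one fixed. Continuity is asked only for the convergence that chains of extensions
  produce.\<close>

lemma tensor_maximum:
  fixes f :: "real \<Rightarrow> ('d::finite) path \<Rightarrow> real \<Rightarrow> 'd path \<Rightarrow> real"
  assumes \<tau>: "\<tau> > 0" and Q: "\<And>v. v \<in> closure Q \<Longrightarrow> norm v \<le> R"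
    and bound: "\<And>t x s y. t \<in> {0..T} \<Longrightarrow> s \<in> {0..T} \<Longrightarrow> x \<in> Dbar \<tau> Q \<Longrightarrow> y \<in> Dbar \<tau> Q \<Longrightarrow> f t x s y \<le> K"
    and cont: "\<And>t t' x x' s s' y y'. (\<And>n. t n \<in> {0..T}) \<Longrightarrow> (\<And>n. s n \<in> {0..T}) \<Longrightarrow> t' \<in> {0..T} \<Longrightarrow> s' \<in> {0..T} \<Longrightarrow>
      (\<And>n. x n \<in> Dbar \<tau> Q) \<Longrightarrow> (\<And>n. y n \<in> Dbar \<tau> Q) \<Longrightarrow> x' \<in> Dbar \<tau> Q \<Longrightarrow> y' \<in> Dbar \<tau> Q \<Longrightarrow>
      t \<longlonglongrightarrow> t' \<Longrightarrow> s \<longlonglongrightarrow> s' \<Longrightarrow> (\<lambda>n. x n 0) \<longlonglongrightarrow> x' 0 \<Longrightarrow> (\<lambda>n. y n 0) \<longlonglongrightarrow> y' 0 \<Longrightarrow>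
      (\<lambda>n. L1_dist \<tau> (x n) x') \<longlonglongrightarrow> 0 \<Longrightarrow> (\<lambda>n. L1_dist \<tau> (y n) y') \<longlonglongrightarrow> 0 \<Longrightarrow>
      (\<lambda>n::nat. f (t n) (x n) (s n) (y n)) \<longlonglongrightarrow> f t' x' s' y'"
    and p0: "t0 \<in> {0..T}" "s0 \<in> {0..T}" "x0 \<in> Dbar \<tau> Q" "y0 \<in> Dbar \<tau> Q"
  obtains t x s y where "t \<in> {0..T}" "s \<in> {0..T}" "x \<in> Dbar \<tau> Q" "y \<in> Dbar \<tau> Q" "f t0 x0 s0 y0 \<le> f t x s y"
    "\<And>t' x' s' y'. t' \<in> {0..T} \<Longrightarrow> s' \<in> {0..T} \<Longrightarrow> x' \<in> Dbar \<tau> Q \<Longrightarrow> y' \<in> Dbar \<tau> Q \<Longrightarrow>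
       extends \<tau> t x t' x' \<Longrightarrow> extends \<tau> s y s' y' \<Longrightarrow> f t' x' s' y' \<le> f t x s y"
proof -
  define A where "A = {p :: (real \<times> 'd path) \<times> (real \<times> 'd path). fst (fst p) \<in> {0..T} \<and> snd (fst p) \<in>
      Dbar \<tau> Q \<and>
    fst (snd p) \<in> {0..T} \<and> snd (snd p) \<in> Dbar \<tau> Q}"
  define le where "le = (\<lambda>p q :: (real \<times> 'd path) \<times> (real \<times> 'd path).
    extends \<tau> (fst (fst p)) (snd (fst p)) (fst (fst q)) (snd (fst q)) \<and>
    extends \<tau> (fst (snd p)) (snd (snd p)) (fst (snd q)) (snd (snd q)))"
  define g where "g = (\<lambda>p. f (fst (fst p)) (snd (fst p)) (fst (snd p)) (snd (snd p)))"
  have limit: "\<exists>q\<in>A. \<forall>n::nat. le (p n) q \<and> g (p n) \<le> g q"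
    if pA: "\<And>n. p n \<in> A" and step: "\<And>n. le (p n) (p (Suc n))" and mono: "\<And>n. g (p n) \<le> g (p (Suc n))" for p
  proof -
    define t x s y where "t = (\<lambda>n. fst (fst (p n)))" and "x = (\<lambda>n. snd (fst (p n)))"
      and "s = (\<lambda>n. fst (snd (p n)))" and "y = (\<lambda>n. snd (snd (p n)))"
    have mem: "t n \<in> {0..T}" "s n \<in> {0..T}" "x n \<in> Dbar \<tau> Q" "y n \<in> Dbar \<tau> Q" for n
      using pA[of n] by (auto simp: A_def t_def s_def x_def y_def)
    have ext: "extends \<tau> (t n) (x n) (t (Suc n)) (x (Suc n))" "extends \<tau> (s n) (y n) (s (Suc n)) (y (Suc
        n))" for n
      using step[of n] by (auto simp: le_def t_def s_def x_def y_def)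
    have inc: "incseq t" "incseq s" using ext by (auto simp: incseq_Suc_iff extends_def)
    obtain t' where t': "t \<longlonglongrightarrow> t'" "\<forall>n. t n \<le> t'" using incseq_convergent[OF inc(1), of T] mem by auto
    obtain s' where s': "s \<longlonglongrightarrow> s'" "\<forall>n. s n \<le> s'" using incseq_convergent[OF inc(2), of T] mem by auto
    have "t' \<le> T" by (rule LIMSEQ_le_const2[OF t'(1)]) (use mem in auto)
    then have t'T: "t' \<in> {0..T}" using mem(1)[of 0] t'(2) by (auto intro: order_trans)
    have "s' \<le> T" by (rule LIMSEQ_le_const2[OF s'(1)]) (use mem in auto)
    then have s'T: "s' \<in> {0..T}" using mem(2)[of 0] s'(2) by (auto intro: order_trans)
    have "bounded (closure Q)" unfolding bounded_iff using Q by blast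
    then have "compact (closure Q)" by (simp add: compact_eq_bounded_closed)
    then have cQ: "seq_compact (closure Q \<times> closure Q)"
      by (intro compact_imp_seq_compact compact_Times)
    have in0: "\<forall>n. (x n 0, y n 0) \<in> closure Q \<times> closure Q" using mem(3,4) \<tau> by (auto simp: Dbar_def)
    \<comment> \<open>The histories converge along the chain, the present values need not.
      Compactness of \<open>closure Q\<close> supplies limits along a subsequence, which the limit
      paths take as their values at 0.\<close>
    obtain \<xi>\<eta> r where r: "\<xi>\<eta> \<in> closure Q \<times> closure Q" "strict_mono r" "((\<lambda>n. (x n 0, y n 0)) \<circ> r) \<longlonglongrightarrow> \<xi>\<eta>"
      by (rule seq_compactE[OF cQ in0])
    obtain \<xi> \<eta> where \<xi>\<eta>: "\<xi>\<eta> = (\<xi>, \<eta>)" by (cases \<xi>\<eta>)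
    have \<xi>: "\<xi> \<in> closure Q" "\<eta> \<in> closure Q" using r(1) \<xi>\<eta> by auto
    have lim0: "(\<lambda>n. x (r n) 0) \<longlonglongrightarrow> \<xi>" "(\<lambda>n. y (r n) 0) \<longlonglongrightarrow> \<eta>"
      using tendsto_fst[OF r(3)] tendsto_snd[OF r(3)] by (auto simp: \<xi>\<eta> o_def)
    obtain x' where x': "x' \<in> Dbar \<tau> Q" "x' 0 = \<xi>" "\<And>n. extends \<tau> (t n) (x n) t' x'"
      "(\<lambda>n. integral {-\<tau>..0} (\<lambda>\<theta>. norm (x n \<theta> - x' \<theta>))) \<longlonglongrightarrow> 0"
      using extension_chain_limit[where x = x and t = t and t' = t' and \<xi> = \<xi>, OF \<tau> mem(3) Q ext(1)
          t'(1) \<xi>(1)] by blast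
    obtain y' where y': "y' \<in> Dbar \<tau> Q" "y' 0 = \<eta>" "\<And>n. extends \<tau> (s n) (y n) s' y'"
      "(\<lambda>n. integral {-\<tau>..0} (\<lambda>\<theta>. norm (y n \<theta> - y' \<theta>))) \<longlonglongrightarrow> 0"
      using extension_chain_limit[where x = y and t = s and t' = s' and \<xi> = \<eta>, OF \<tau> mem(4) Q ext(2)
          s'(1) \<xi>(2)] by blast
    have conv: "(\<lambda>n. f (t (r n)) (x (r n)) (s (r n)) (y (r n))) \<longlonglongrightarrow> f t' x' s' y'"
    proof (rule cont)
      show "(\<lambda>n. t (r n)) \<longlonglongrightarrow> t'" "(\<lambda>n. s (r n)) \<longlonglongrightarrow> s'"
        using LIMSEQ_subseq_LIMSEQ[OF t'(1) r(2)] LIMSEQ_subseq_LIMSEQ[OF s'(1) r(2)] by (auto simp: o_def)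
      show "(\<lambda>n. L1_dist \<tau> (x (r n)) x') \<longlonglongrightarrow> 0" "(\<lambda>n. L1_dist \<tau> (y (r n)) y') \<longlonglongrightarrow> 0"
        using LIMSEQ_subseq_LIMSEQ[OF x'(4) r(2)] LIMSEQ_subseq_LIMSEQ[OF y'(4) r(2)] by (auto simp:
            o_def L1_dist_def)
    qed (use mem t'T s'T x' y' lim0 in auto)
    have inc_g: "incseq (\<lambda>n. g (p n))" using mono by (auto simp: incseq_Suc_iff)
    have "g (p n) \<le> f t' x' s' y'" for n
    proof (rule LIMSEQ_le_const[OF conv], intro exI allI impI)
      fix k assume "k \<ge> n"
      then have "n \<le> r k" using seq_suble[OF r(2), of k] by simp
      then have "g (p n) \<le> g (p (r k))" by (rule incseqD[OF inc_g])
      then show "g (p n) \<le> f (t (r k)) (x (r k)) (s (r k)) (y (r k))"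
        by (simp add: g_def t_def s_def x_def y_def)
    qed
    moreover have "((t', x'), (s', y')) \<in> A" using t'T s'T x' y' by (simp add: A_def)
    moreover have "le (p n) ((t', x'), (s', y'))" for n
      using x'(3)[of n] y'(3)[of n] by (simp add: le_def t_def s_def x_def y_def)
    ultimately show ?thesis by (intro bexI[of _ "((t', x'), (s', y'))"]) (auto simp: g_def)
  qed
  have bdd: "bdd_above (g ` A)"
    by (rule bdd_aboveI[of _ K]) (auto simp: g_def A_def intro!: bound)
  have refl: "le p p" if "p \<in> A" for p
    by (simp add: le_def extends_refl)
  have trans: "le p r" if "p \<in> A" "q \<in> A" "r \<in> A" "le p q" "le q r" for p q r
    using that(4,5) extends_trans unfolding le_def by blast
  have start: "((t0, x0), (s0, y0)) \<in> A" using p0 by (simp add: A_def)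
  have "\<exists>q. q \<in> A \<and> g ((t0, x0), (s0, y0)) \<le> g q \<and> (\<forall>r\<in>A. le q r \<longrightarrow> g r \<le> g q)"
  proof (rule ordering_principle[of A le g "((t0, x0), (s0, y0))"])
    show "le p p" if "p \<in> A" for p using refl[OF that] .
    show "le p r" if "p \<in> A" "q \<in> A" "r \<in> A" "le p q" "le q r" for p q r using trans[OF that] .
    show "bdd_above (g ` A)" by (rule bdd)
    show "((t0, x0), (s0, y0)) \<in> A" by (rule start)
    show "\<exists>q\<in>A. \<forall>n::nat. le (p n) q \<and> g (p n) \<le> g q"
      if "\<And>n. p n \<in> A" "\<And>n. le (p n) (p (Suc n))" "\<And>n. g (p n) \<le> g (p (Suc n))" for p
      using limit[of p] that by blast
    fix q assume "q \<in> A" "g ((t0, x0), (s0, y0)) \<le> g q" "\<And>r. r \<in> A \<Longrightarrow> le q r \<Longrightarrow> g r \<le> g q"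
    then show "\<exists>q. q \<in> A \<and> g ((t0, x0), (s0, y0)) \<le> g q \<and> (\<forall>r\<in>A. le q r \<longrightarrow> g r \<le> g q)" by blast
  qed
  then obtain q where q: "q \<in> A" "g ((t0, x0), (s0, y0)) \<le> g q" "\<And>r. r \<in> A \<Longrightarrow> le q r \<Longrightarrow> g r \<le> g q"
    by blast
  show ?thesis
  proof (rule that[of "fst (fst q)" "fst (snd q)" "snd (fst q)" "snd (snd q)"])
    fix t' x' s' y' assume "t' \<in> {0..T}" "s' \<in> {0..T}" "x' \<in> Dbar \<tau> Q" "y' \<in> Dbar \<tau> Q"
      "extends \<tau> (fst (fst q)) (snd (fst q)) t' x'" "extends \<tau> (fst (snd q)) (snd (snd q)) s' y'"
    then show "f t' x' s' y' \<le> f (fst (fst q)) (snd (fst q)) (fst (snd q)) (snd (snd q))"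
      using q(3)[of "((t', x'), (s', y'))"] by (simp add: A_def le_def g_def)
  qed (use q(1,2) in \<open>auto simp: A_def g_def\<close>)
qed

text \<open>When \<open>B = b\<close>, the derivative along the delay dynamics contains no \<open>x (-\<tau>)\<close>, which is what makes
  the discrete delay harmless.\<close>

definition compensated :: "real \<Rightarrow> (real \<Rightarrow> real ^ 'd ^ 'd) \<Rightarrow> real \<Rightarrow> ('d::finite) path \<Rightarrow> real ^ 'd" where
  "compensated \<tau> B t x = x 0 + B t *v tail x (-\<tau>)"

definition growth :: "real \<Rightarrow> ('d::finite) path \<Rightarrow> real" where
  "growth \<tau> x = 1 + (norm (x 0))\<^sup>2 + innerH \<tau> x x"

text \<open>The weight \<open>\<beta>\<close> couples the two states and \<open>\<gamma>\<close> the
  two times; \<open>\<alpha>\<close> confines the points and \<open>\<kappa>\<close> makes the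
  resulting inequality strict.\<close>

definition doubling ::
  "real \<Rightarrow> real \<Rightarrow> (real \<Rightarrow> real ^ 'd ^ 'd) \<Rightarrow> real \<Rightarrow> real \<Rightarrow> real \<Rightarrow> real \<Rightarrow> real \<Rightarrow>
   (real \<Rightarrow> ('d::finite) path \<Rightarrow> real) \<Rightarrow> (real \<Rightarrow> 'd path \<Rightarrow> real) \<Rightarrow> real \<Rightarrow> 'd path \<Rightarrow> real \<Rightarrow> 'd path \<Rightarrow> real"
       where
  "doubling T \<tau> B \<beta> \<gamma> \<alpha> C \<kappa> W V t x s y = W t x - V s y
     - \<beta> * (norm (compensated \<tau> B t x - compensated \<tau> B s y))\<^sup>2 - \<beta> * weak_inner \<tau> (x - y) (x - y) - \<gamma> *
         (t - s)\<^sup>2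
     - \<alpha> * exp (- C * t) * growth \<tau> x - \<alpha> * exp (- C * s) * growth \<tau> y - \<kappa> * (T - t) - \<kappa> * (T - s)"

lemma weak_inner_diff_commute: "weak_inner \<tau> (x - y) (x - y) = weak_inner \<tau> (y - x) (y - x)"
  using weak_inner_scale[of \<tau> "-1" "y - x" "x - y"] weak_inner_scale[of \<tau> "-1" "y - x" "y - x"]
    weak_inner_commute[of \<tau> "x - y" "y - x"] by simp

text \<open>The last bracket does not contain the moving point \<open>(t, x)\<close>. A maximum of
  the doubled functional is thus the touching condition for \<open>W\<close>;
  \<open>doubling_right\<close> does the same for \<open>V\<close>.\<close>

lemma doubling_left:
  "doubling T \<tau> B \<beta> \<gamma> \<alpha> C \<kappa> W V t x s y = W t x - quad_test T \<tau> B \<beta> \<gamma> \<alpha> C \<kappa> (compensated \<tau> B s y) y s t x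
     - (V s y + \<alpha> * exp (- C * s) * growth \<tau> y + \<kappa> * (T - s))"
  by (simp add: doubling_def quad_test_def compensated_def growth_def)

lemma doubling_right:
  "doubling T \<tau> B \<beta> \<gamma> \<alpha> C \<kappa> W V t x s y = - (V s y + quad_test T \<tau> B \<beta> \<gamma> \<alpha> C \<kappa> (compensated \<tau> B t x) x t
      s y)
     + (W t x - \<alpha> * exp (- C * t) * growth \<tau> x - \<kappa> * (T - t))"
  unfolding doubling_def quad_test_def
  by (simp add: compensated_def growth_def norm_minus_commute power2_commute[of t s]
      weak_inner_diff_commute[of \<tau> x y])

text \<open>The continuity hypothesis on paths bounded by \<open>R\<close>, where its linear
  prefactor becomes a constant. An arbitrary bound \<open>m\<close> replaces the supremum, so that
  the L1 distance and the interpolation bound can both be inserted.\<close>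

definition weak_modulus :: "real \<Rightarrow> real \<Rightarrow> real \<Rightarrow> real \<Rightarrow> (real \<Rightarrow> ('d::finite) path \<Rightarrow> real) \<Rightarrow> bool" where
  "weak_modulus T \<tau> R M w \<longleftrightarrow> (\<forall>t\<in>{0..T}. \<forall>s\<in>{0..T}. \<forall>x\<in>Dspace \<tau>. \<forall>y\<in>Dspace \<tau>. \<forall>m.
     (\<forall>\<theta>\<in>{-\<tau>..0}. norm (x \<theta>) \<le> R \<and> norm (y \<theta>) \<le> R \<and> norm (tail x \<theta> - tail y \<theta>) \<le> m) \<longrightarrow>
     \<bar>w t x - w s y\<bar> \<le> M * (norm (x 0 - y 0) + sqrt \<bar>t - s\<bar> + m))"

lemma weak_modulus_tendsto:
  assumes w: "weak_modulus T \<tau> R M w" and Q: "\<And>v. v \<in> closure Q \<Longrightarrow> norm v \<le> R"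
    and t: "\<And>n. t n \<in> {0..T}" "t' \<in> {0..T}" and x: "\<And>n. x n \<in> Dbar \<tau> Q" "x' \<in> Dbar \<tau> Q"
    and lim: "t \<longlonglongrightarrow> t'" "(\<lambda>n. x n 0) \<longlonglongrightarrow> x' 0" "(\<lambda>n. L1_dist \<tau> (x n) x') \<longlonglongrightarrow> 0"
  shows "(\<lambda>n. w (t n) (x n)) \<longlonglongrightarrow> w t' x'"
proof (rule LIM_zero_cancel, rule Lim_null_comparison)
  let ?m = "\<lambda>n. M * (norm (x n 0 - x' 0) + sqrt \<bar>t n - t'\<bar> + L1_dist \<tau> (x n) x')"
  have "?m \<longlonglongrightarrow> M * (norm (x' 0 - x' 0) + sqrt \<bar>t' - t'\<bar> + 0)"
    by (intro tendsto_intros lim)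
  then show "?m \<longlonglongrightarrow> 0" by simp
  have "norm (w (t n) (x n) - w t' x') \<le> ?m n" for n
    using w t x Q tail_diff_le_L1_dist[OF Dbar_Dspace[OF x(1)] Dbar_Dspace[OF x(2)]] Dbar_Dspace[OF
        x(1)[of n]] Dbar_Dspace[OF x(2)]
    unfolding weak_modulus_def by (auto simp: Dbar_def)
  then show "\<forall>\<^sub>F n in sequentially. norm (w (t n) (x n) - w t' x') \<le> ?m n" by simp
qed

section \<open>Continuity of the doubled functional along chains of extensions\<close>

lemma doubling_tendsto:
  assumes W: "weak_modulus T \<tau> R M W" and V: "weak_modulus T \<tau> R M V" and \<tau>: "\<tau> > 0"
    and Q: "\<And>v. v \<in> closure Q \<Longrightarrow> norm v \<le> R" and B: "continuous_on {0..T} B"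
    and t: "\<And>n. t n \<in> {0..T}" "t' \<in> {0..T}" and x: "\<And>n. x n \<in> Dbar \<tau> Q" "x' \<in> Dbar \<tau> Q"
    and limt: "t \<longlonglongrightarrow> t'" "(\<lambda>n. x n 0) \<longlonglongrightarrow> x' 0" "(\<lambda>n. L1_dist \<tau> (x n) x') \<longlonglongrightarrow> 0"
    and s: "\<And>n. s n \<in> {0..T}" "s' \<in> {0..T}" and y: "\<And>n. y n \<in> Dbar \<tau> Q" "y' \<in> Dbar \<tau> Q"
    and lims: "s \<longlonglongrightarrow> s'" "(\<lambda>n. y n 0) \<longlonglongrightarrow> y' 0" "(\<lambda>n. L1_dist \<tau> (y n) y') \<longlonglongrightarrow> 0"
  shows "(\<lambda>n. doubling T \<tau> B \<beta> \<gamma> \<alpha> C \<kappa> W V (t n) (x n) (s n) (y n)) \<longlonglongrightarrow> doubling T \<tau> B \<beta> \<gamma> \<alpha> C \<kappa> W V t' x'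
      s' y'"
proof -
  have bd: "norm (z \<theta>) \<le> R" if "z \<in> Dbar \<tau> Q" "\<theta> \<in> {-\<tau>..0}" for z \<theta> using that Q by (auto simp: Dbar_def)
  have cmp: "(\<lambda>n. compensated \<tau> B (r n) (z n)) \<longlonglongrightarrow> compensated \<tau> B r' z'"
    if r: "\<And>n. r n \<in> {0..T}" "r' \<in> {0..T}" "r \<longlonglongrightarrow> r'" and z: "\<And>n. z n \<in> Dbar \<tau> Q" "z' \<in> Dbar \<tau> Q"
      and l: "(\<lambda>n. z n 0) \<longlonglongrightarrow> z' 0" "(\<lambda>n. L1_dist \<tau> (z n) z') \<longlonglongrightarrow> 0" for r r' z z'
  proof -
    have Bl: "(\<lambda>n. B (r n)) \<longlonglongrightarrow> B r'"
      using continuous_on_tendsto_compose[OF B r(3) r(2)] r(1) by simp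
    have tl: "(\<lambda>n. tail (z n) (-\<tau>)) \<longlonglongrightarrow> tail z' (-\<tau>)"
    proof (rule LIM_zero_cancel, rule Lim_null_comparison[OF _ l(2)])
      show "\<forall>\<^sub>F n in sequentially. norm (tail (z n) (-\<tau>) - tail z' (-\<tau>)) \<le> L1_dist \<tau> (z n) z'"
        using tail_diff_le_L1_dist[OF Dbar_Dspace[OF z(1)] Dbar_Dspace[OF z(2)], of "-\<tau>"] \<tau> by simp
    qed
    have "(\<lambda>n. B (r n) *v tail (z n) (-\<tau>)) \<longlonglongrightarrow> B r' *v tail z' (-\<tau>)"
      unfolding matrix_vector_mult_def by (intro vec_tendstoI) (auto intro!: tendsto_intros Bl tl)
    then show ?thesis unfolding compensated_def by (intro tendsto_add l(1))
  qed
  have gr: "(\<lambda>n. growth \<tau> (z n)) \<longlonglongrightarrow> growth \<tau> z'"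
    if z: "\<And>n. z n \<in> Dbar \<tau> Q" "z' \<in> Dbar \<tau> Q"
      and l: "(\<lambda>n. z n 0) \<longlonglongrightarrow> z' 0" "(\<lambda>n. L1_dist \<tau> (z n) z') \<longlonglongrightarrow> 0" for z z'
  proof -
    have "(\<lambda>n. innerH \<tau> (z n) (z n)) \<longlonglongrightarrow> innerH \<tau> z' z'"
    proof (rule LIM_zero_cancel, rule Lim_null_comparison)
      show "(\<lambda>n. 2 * R * L1_dist \<tau> (z n) z') \<longlonglongrightarrow> 0" using tendsto_mult_left[OF l(2), of "2 * R"] by simp
      show "\<forall>\<^sub>F n in sequentially. norm (innerH \<tau> (z n) (z n) - innerH \<tau> z' z') \<le> 2 * R * L1_dist \<tau> (z
          n) z'"
        using innerH_diff_le_L1_dist[OF Dbar_Dspace[OF z(1)] Dbar_Dspace[OF z(2)] bd[OF z(1)] bd[OF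
            z(2)]] by simp
    qed
    then show ?thesis unfolding growth_def by (intro tendsto_intros l)
  qed
  have wk: "(\<lambda>n. weak_inner \<tau> (x n - y n) (x n - y n)) \<longlonglongrightarrow> weak_inner \<tau> (x' - y') (x' - y')"
  proof (rule LIM_zero_cancel, rule Lim_null_comparison)
    have "(\<lambda>n. 4 * R * \<tau>\<^sup>2 * (L1_dist \<tau> (x n) x' + L1_dist \<tau> (y n) y')) \<longlonglongrightarrow> 4 * R * \<tau>\<^sup>2 * (0 + 0)"
      by (intro tendsto_intros limt lims)
    then show "(\<lambda>n. 4 * R * \<tau>\<^sup>2 * (L1_dist \<tau> (x n) x' + L1_dist \<tau> (y n) y')) \<longlonglongrightarrow> 0" by simp
    have "\<bar>weak_inner \<tau> (x n - y n) (x n - y n) - weak_inner \<tau> (x' - y') (x' - y')\<bar>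
        \<le> 4 * R * \<tau>\<^sup>2 * (L1_dist \<tau> (x n) x' + L1_dist \<tau> (y n) y')" for n
      by (rule weak_inner_diff_le_L1_dist[OF Dbar_Dspace[OF x(1)] Dbar_Dspace[OF y(1)] Dbar_Dspace[OF
          x(2)] Dbar_Dspace[OF y(2)] \<tau>])
         (use bd x y in auto)
    then show "\<forall>\<^sub>F n in sequentially. norm (weak_inner \<tau> (x n - y n) (x n - y n) - weak_inner \<tau> (x' -
        y') (x' - y'))
       \<le> 4 * R * \<tau>\<^sup>2 * (L1_dist \<tau> (x n) x' + L1_dist \<tau> (y n) y')" by simp
  qed
  have Wl: "(\<lambda>n. W (t n) (x n)) \<longlonglongrightarrow> W t' x'" by (rule weak_modulus_tendsto[OF W Q t x limt])
  have Vl: "(\<lambda>n. V (s n) (y n)) \<longlonglongrightarrow> V s' y'" by (rule weak_modulus_tendsto[OF V Q s y lims])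
  have cx: "(\<lambda>n. compensated \<tau> B (t n) (x n)) \<longlonglongrightarrow> compensated \<tau> B t' x'" by (rule cmp[OF t limt(1) x
      limt(2,3)])
  have cy: "(\<lambda>n. compensated \<tau> B (s n) (y n)) \<longlonglongrightarrow> compensated \<tau> B s' y'" by (rule cmp[OF s lims(1) y
      lims(2,3)])
  have gx: "(\<lambda>n. growth \<tau> (x n)) \<longlonglongrightarrow> growth \<tau> x'" by (rule gr[OF x limt(2,3)])
  have gy: "(\<lambda>n. growth \<tau> (y n)) \<longlonglongrightarrow> growth \<tau> y'" by (rule gr[OF y lims(2,3)])
  show ?thesis
    unfolding doubling_def by (intro tendsto_intros Wl Vl cx cy gx gy wk limt(1) lims(1))
qed

text \<open>The sum of the shift derivatives of the coupling, taken once in \<open>x\<close> and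
  once in \<open>y\<close>. Apart from the present values there remains the integral of
  \<open>tail (x - y)\<close> against \<open>x - y\<close>, which
  \<open>integral_tail_inner_self\<close> evaluates; this is the origin of the negative
  square.\<close>

lemma integral_tail_inner_diff:
  assumes x: "x \<in> Dspace \<tau>" and y: "y \<in> Dspace \<tau>"
  shows "2 * integral {-\<tau>..0} (\<lambda>l. tail (x - y) l \<bullet> (x 0 - x l)) + 2 * integral {-\<tau>..0} (\<lambda>l. tail (y -
      x) l \<bullet> (y 0 - y l))
    = 2 * (integral {-\<tau>..0} (tail (x - y)) \<bullet> (x 0 - y 0)) - (norm (tail (x - y) (-\<tau>)))\<^sup>2"
proof -
  let ?z = "x - y"
  have zL: "?z \<in> L2 (-\<tau>) 0" using Dspace_L2[OF Dspace_diff[OF x y]] .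
  have t: "tail ?z \<in> L2 (-\<tau>) 0" by (rule continuous_imp_L2[OF continuous_on_tail[OF zL]])
  have ti: "tail ?z integrable_on {-\<tau>..0}" by (rule integrable_continuous_real[OF continuous_on_tail[OF
      zL]])
  have i: "(\<lambda>l. tail ?z l \<bullet> w l) integrable_on {-\<tau>..0}" if "w \<in> Dspace \<tau>" for w :: "'a path"
    using L2_inner_integrable[OF t Dspace_L2[OF that]] by (rule integrable_on_lebesgue_on) simp
  have ic: "(\<lambda>l. tail ?z l \<bullet> c) integrable_on {-\<tau>..0}" and ec: "integral {-\<tau>..0} (\<lambda>l. tail ?z l \<bullet> c) =
      integral {-\<tau>..0} (tail ?z) \<bullet> c" for c
    using integrable_linear[OF ti bounded_linear_inner_left[of c]] integral_linear[OF ti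
        bounded_linear_inner_left[of c]]
    by (simp_all add: o_def)
  have neg: "tail (y - x) l = - tail ?z l" for l
    using tail_scale[of "-1" ?z l] by simp
  have 1: "integral {-\<tau>..0} (\<lambda>l. tail ?z l \<bullet> (w 0 - w l)) = integral {-\<tau>..0} (tail ?z) \<bullet> w 0 - integral
      {-\<tau>..0} (\<lambda>l. tail ?z l \<bullet> w l)"
    if "w \<in> Dspace \<tau>" for w :: "'a path"
    using Henstock_Kurzweil_Integration.integral_diff[OF ic[of "w 0"] i[OF that]]
    by (simp add: inner_diff_right ec)
  have "integral {-\<tau>..0} (\<lambda>l. tail ?z l \<bullet> x l) - integral {-\<tau>..0} (\<lambda>l. tail ?z l \<bullet> y l) = integral
      {-\<tau>..0} (\<lambda>l. tail ?z l \<bullet> ?z l)"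
    using Henstock_Kurzweil_Integration.integral_diff[OF i[OF x] i[OF y]] by (simp add: inner_diff_right
        fun_diff_def)
  then have 2: "2 * integral {-\<tau>..0} (\<lambda>l. tail ?z l \<bullet> x l) - 2 * integral {-\<tau>..0} (\<lambda>l. tail ?z l \<bullet> y l)
      = (norm (tail ?z (-\<tau>)))\<^sup>2"
    using integral_tail_inner_self[OF zL] by simp
  have "integral {-\<tau>..0} (\<lambda>l. tail (y - x) l \<bullet> (y 0 - y l)) = - integral {-\<tau>..0} (\<lambda>l. tail ?z l \<bullet> (y 0 -
      y l))"
    by (simp add: neg)
  then show ?thesis using 1[OF x] 1[OF y] 2 by (simp add: inner_diff_right)
qed

text \<open>A near-minimizer of \<open>g\<close> is inserted into \<open>f\<close>. The lower bound
  on \<open>f\<close> is essential, since the real infimum of a set unbounded below carries no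
  information.\<close>

lemma Inf_gap:
  fixes f g :: "'u \<Rightarrow> real"
  assumes f: "c1 + (INF u. f u) \<ge> 0" and g: "- c2 + (INF u. g u) \<le> 0" and bdd: "bdd_below (range f)"
    and r: "\<And>u. c1 + c2 + f u - g u \<le> r"
  shows "0 \<le> r"
proof (rule field_le_epsilon)
  fix e :: real assume "e > 0"
  then have "(INF u. g u) < c2 + e" using g by simp
  then obtain u where u: "g u < c2 + e" using cInf_lessD[of "range g" "c2 + e"] by auto
  have "(INF u. f u) \<le> f u" by (rule cINF_lower[OF bdd]) simp
  then show "0 \<le> r + e" using f u r[of u] by linarith
qed

text \<open>The two viscosity inequalities are added. The coupling contributes the gradient
  \<open>2 * \<beta>\<close> times \<open>D\<close> to both test functions, up to sign, so the
  drifts appear as a difference; the time derivatives of the \<open>\<gamma>\<close> term cancel.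
  Only the growth terms enter separately for each point.\<close>

lemma viscosity_doubling:
  fixes F :: "real \<Rightarrow> (real ^ 'd::finite) \<times> real \<Rightarrow> 'u::metric_space \<Rightarrow> real ^ 'd" and x y :: "'d path"
  assumes T: "T > 0" and \<tau>: "\<tau> > 0"
    and W: "viscosity_subsolution T \<tau> a b F q \<phi> W" and V: "viscosity_supersolution T \<tau> a b F q \<phi> V"
    and Q: "open Q" "bounded Q"
    and B: "\<forall>t\<in>{0..T}. (B has_vector_derivative B' t) (at t within {0..T})" and B': "continuous_on
        {0..T} B'"
    and t: "t \<in> {0..<T}" and s: "s \<in> {0..<T}" and x: "x \<in> Dbar \<tau> Q" "x 0 \<in> Q" and y: "y \<in> Dbar \<tau> Q" "y 0
        \<in> Q"
    and maxx: "\<And>t' x'. t' \<in> {t..T} \<Longrightarrow> x' \<in> Dbar \<tau> Q \<Longrightarrow>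
      doubling T \<tau> B \<beta> \<gamma> \<alpha> C \<kappa> W V t' (concat_path \<tau> t x t' x') s y \<le> doubling T \<tau> B \<beta> \<gamma> \<alpha> C \<kappa> W V t x s y"
    and maxy: "\<And>s' y'. s' \<in> {s..T} \<Longrightarrow> y' \<in> Dbar \<tau> Q \<Longrightarrow>
      doubling T \<tau> B \<beta> \<gamma> \<alpha> C \<kappa> W V t x s' (concat_path \<tau> s y s' y') \<le> doubling T \<tau> B \<beta> \<gamma> \<alpha> C \<kappa> W V t x s y"
    and Fb: "\<And>u. norm (F t (x 0, innerH \<tau> a x) u) \<le> KF" and qb: "\<And>u. \<bar>q t (x 0) u\<bar> \<le> Kq"
    and r: "\<And>u. 2 * \<beta> * ((compensated \<tau> B t x - compensated \<tau> B s y) \<bullet>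
         (B' t *v tail x (-\<tau>) - B' s *v tail y (-\<tau>) + B t *v (x 0 - x (-\<tau>)) - B s *v (y 0 - y (-\<tau>))
          + (F t (x 0, innerH \<tau> a x) u + b t *v x (-\<tau>)) - (F s (y 0, innerH \<tau> a y) u + b s *v y (-\<tau>))))
        + \<beta> * (2 * (integral {-\<tau>..0} (tail (x - y)) \<bullet> (x 0 - y 0)) - (norm (tail (x - y) (-\<tau>)))\<^sup>2)
        + \<alpha> * exp (- C * t) * ((norm (x 0))\<^sup>2 - (norm (x (-\<tau>)))\<^sup>2 + 2 * (x 0 \<bullet> (F t (x 0, innerH \<tau> a x)
            u + b t *v x (-\<tau>))) - C * growth \<tau> x)
        + \<alpha> * exp (- C * s) * ((norm (y 0))\<^sup>2 - (norm (y (-\<tau>)))\<^sup>2 + 2 * (y 0 \<bullet> (F s (y 0, innerH \<tau> a y)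
            u + b s *v y (-\<tau>))) - C * growth \<tau> y)
        + (q t (x 0) u - q s (y 0) u) - 2 * \<kappa> \<le> r"
  shows "0 \<le> r"
proof -
  define D where "D = compensated \<tau> B t x - compensated \<tau> B s y"
  define \<psi>1 where "\<psi>1 = quad_test T \<tau> B \<beta> \<gamma> \<alpha> C \<kappa> (compensated \<tau> B s y) y s"
  define \<psi>2 where "\<psi>2 = quad_test T \<tau> B \<beta> \<gamma> \<alpha> C \<kappa> (compensated \<tau> B t x) x t"
  have tT: "t \<in> {0..T}" and sT: "s \<in> {0..T}" using t s by auto
  note xD = Dbar_Dspace[OF x(1)] and yD = Dbar_Dspace[OF y(1)]
  note calc1 = quad_test_calculus[where \<beta> = \<beta> and \<gamma> = \<gamma> and \<alpha> = \<alpha> and C = C and \<kappa> = \<kappa> and s = s and c =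
      "compensated \<tau> B s y",
      OF T \<tau> B B' yD, folded \<psi>1_def]
  note calc2 = quad_test_calculus[where \<beta> = \<beta> and \<gamma> = \<gamma> and \<alpha> = \<alpha> and C = C and \<kappa> = \<kappa> and s = t and c =
      "compensated \<tau> B t x",
      OF T \<tau> B B' xD, folded \<psi>2_def]
  define v1 where "v1 = (\<lambda>u. F t (x 0, innerH \<tau> a x) u + b t *v x (-\<tau>))"
  define v2 where "v2 = (\<lambda>u. F s (y 0, innerH \<tau> a y) u + b s *v y (-\<tau>))"
  define f where "f = (\<lambda>u. (2 * \<beta>) * (D \<bullet> v1 u) + 2 * \<alpha> * exp (- C * t) * (x 0 \<bullet> v1 u) + q t (x 0) u)"
  define g where "g = (\<lambda>u. (2 * \<beta>) * (D \<bullet> v2 u) - 2 * \<alpha> * exp (- C * s) * (y 0 \<bullet> v2 u) + q s (y 0) u)"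
  define c1 where "c1 = time_deriv T \<psi>1 t x + S_op \<tau> (\<psi>1 t) x"
  define c2 where "c2 = time_deriv T \<psi>2 s y + S_op \<tau> (\<psi>2 s) y"
  have Dx: "x 0 + B t *v tail x (-\<tau>) - compensated \<tau> B s y = D" by (simp add: D_def compensated_def)
  have Dy: "y 0 + B s *v tail y (-\<tau>) - compensated \<tau> B t x = - D" by (simp add: D_def compensated_def)
  have f: "c1 + (INF u. f u) \<ge> 0"
  proof -
    have eq: "ereal (W t x - \<psi>1 t x) = (SUP (t', x')\<in>{t..T} \<times> Dbar \<tau> Q.
        ereal (W t' (concat_path \<tau> t x t' x') - \<psi>1 t' (concat_path \<tau> t x t' x')))"
    proof (rule antisym)
      show "ereal (W t x - \<psi>1 t x) \<le> (SUP (t', x')\<in>{t..T} \<times> Dbar \<tau> Q.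
          ereal (W t' (concat_path \<tau> t x t' x') - \<psi>1 t' (concat_path \<tau> t x t' x')))"
        by (rule SUP_upper2[of "(t, x)"]) (use t x concat_path_self[OF xD] in auto)
      show "(SUP (t', x')\<in>{t..T} \<times> Dbar \<tau> Q.
          ereal (W t' (concat_path \<tau> t x t' x') - \<psi>1 t' (concat_path \<tau> t x t' x'))) \<le> ereal (W t x - \<psi>1
              t x)"
        using maxx unfolding doubling_left \<psi>1_def[symmetric] by (auto intro!: SUP_least)
    qed
    have "time_deriv T \<psi>1 t x + S_op \<tau> (\<psi>1 t) x + Hamiltonian \<tau> a b F q t x (grad \<tau> \<psi>1 t x) \<ge> 0"
      using W[unfolded viscosity_subsolution_def, THEN conjunct2, THEN conjunct2, rule_format, of Q \<psi>1 t x]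
        Q calc1(1) t x eq by blast
    moreover have "Hamiltonian \<tau> a b F q t x (grad \<tau> \<psi>1 t x) = (INF u. f u)"
      unfolding Hamiltonian_def using calc1(4)[OF tT xD] by (simp add: Dx f_def v1_def)
    ultimately show ?thesis by (simp add: c1_def)
  qed
  have g: "- c2 + (INF u. g u) \<le> 0"
  proof -
    have eq: "ereal (V s y + \<psi>2 s y) = (INF (s', y')\<in>{s..T} \<times> Dbar \<tau> Q.
        ereal (V s' (concat_path \<tau> s y s' y') + \<psi>2 s' (concat_path \<tau> s y s' y')))"
    proof (rule antisym)
      show "(INF (s', y')\<in>{s..T} \<times> Dbar \<tau> Q.
          ereal (V s' (concat_path \<tau> s y s' y') + \<psi>2 s' (concat_path \<tau> s y s' y'))) \<le> ereal (V s y + \<psi>2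
              s y)"
        by (rule INF_lower2[of "(s, y)"]) (use s y concat_path_self[OF yD] in auto)
      show "ereal (V s y + \<psi>2 s y) \<le> (INF (s', y')\<in>{s..T} \<times> Dbar \<tau> Q.
          ereal (V s' (concat_path \<tau> s y s' y') + \<psi>2 s' (concat_path \<tau> s y s' y')))"
      proof (rule INF_greatest)
        fix p assume "p \<in> {s..T} \<times> Dbar \<tau> Q"
        then show "ereal (V s y + \<psi>2 s y) \<le> (case p of (s', y') \<Rightarrow>
            ereal (V s' (concat_path \<tau> s y s' y') + \<psi>2 s' (concat_path \<tau> s y s' y')))"
          using maxy[of "fst p" "snd p"] unfolding doubling_right \<psi>2_def[symmetric]
          by (auto simp: case_prod_unfold)
      qed
    qed
    have "- time_deriv T \<psi>2 s y - S_op \<tau> (\<psi>2 s) y + Hamiltonian \<tau> a b F q s y (- grad \<tau> \<psi>2 s y) \<le> 0"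
      using V[unfolded viscosity_supersolution_def, THEN conjunct2, THEN conjunct2, rule_format, of Q \<psi>2
          s y]
        Q calc2(1) s y eq by blast
    moreover have "Hamiltonian \<tau> a b F q s y (- grad \<tau> \<psi>2 s y) = (INF u. g u)"
      unfolding Hamiltonian_def using calc2(4)[OF sT yD] by (simp add: Dy g_def v2_def)
    ultimately show ?thesis by (simp add: c2_def)
  qed
  have bdd: "bdd_below (range f)"
  proof (rule bdd_belowI)
    \<comment> \<open>The expression under the infimum is linear in the drift with coefficient
      \<open>?p\<close>, and drift and \<open>q\<close> are bounded at the fixed point.\<close>
    let ?p = "(2 * \<beta>) *\<^sub>R D + (2 * \<alpha> * exp (- C * t)) *\<^sub>R x 0"
    fix z assume "z \<in> range f"
    then obtain u where z: "z = f u" by auto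
    have "f u = ?p \<bullet> v1 u + q t (x 0) u" by (simp add: f_def inner_add_left)
    moreover have "\<bar>?p \<bullet> v1 u\<bar> \<le> norm ?p * (KF + norm (b t *v x (-\<tau>)))"
    proof -
      have "norm (v1 u) \<le> KF + norm (b t *v x (-\<tau>))" unfolding v1_def using Fb[of u] by (intro
          norm_triangle_mono) auto
      then show ?thesis using Cauchy_Schwarz_ineq2[of ?p "v1 u"] mult_left_mono[of "norm (v1 u)" _ "norm
          ?p"] by fastforce
    qed
    ultimately show "- (norm ?p * (KF + norm (b t *v x (-\<tau>)))) - Kq \<le> z" using qb[of u] z by linarith
  qed
  show ?thesis
  proof (rule Inf_gap[OF f g bdd])
    fix u
    have c1: "c1 = 2 * \<beta> * (D \<bullet> (B' t *v tail x (-\<tau>))) + 2 * \<gamma> * (t - s) - \<alpha> * C * exp (- C * t) *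
        growth \<tau> x - \<kappa>
      + 2 * \<beta> * (D \<bullet> (B t *v (x 0 - x (-\<tau>)))) + 2 * \<beta> * integral {-\<tau>..0} (\<lambda>l. tail (x - y) l \<bullet> (x 0 - x l))
      + \<alpha> * exp (- C * t) * ((norm (x 0))\<^sup>2 - (norm (x (-\<tau>)))\<^sup>2)"
      unfolding c1_def calc1(2)[OF tT xD] calc1(3)[OF xD] Dx by (simp add: growth_def)
    have c2: "c2 = 2 * \<beta> * ((- D) \<bullet> (B' s *v tail y (-\<tau>))) + 2 * \<gamma> * (s - t) - \<alpha> * C * exp (- C * s) *
        growth \<tau> y - \<kappa>
      + 2 * \<beta> * ((- D) \<bullet> (B s *v (y 0 - y (-\<tau>)))) + 2 * \<beta> * integral {-\<tau>..0} (\<lambda>l. tail (y - x) l \<bullet> (y 0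
          - y l))
      + \<alpha> * exp (- C * s) * ((norm (y 0))\<^sup>2 - (norm (y (-\<tau>)))\<^sup>2)"
      unfolding c2_def calc2(2)[OF sT yD] calc2(3)[OF yD] Dy by (simp add: growth_def)
    have I: "2 * \<beta> * integral {-\<tau>..0} (\<lambda>l. tail (x - y) l \<bullet> (x 0 - x l)) + 2 * \<beta> * integral {-\<tau>..0} (\<lambda>l.
        tail (y - x) l \<bullet> (y 0 - y l))
      = \<beta> * (2 * (integral {-\<tau>..0} (tail (x - y)) \<bullet> (x 0 - y 0)) - (norm (tail (x - y) (-\<tau>)))\<^sup>2)"
      unfolding integral_tail_inner_diff[OF xD yD, symmetric] by (simp add: algebra_simps)
    have split: "D \<bullet> (B' t *v tail x (-\<tau>) - B' s *v tail y (-\<tau>) + B t *v (x 0 - x (-\<tau>)) - B s *v (y 0 -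
        y (-\<tau>)) + v1 u - v2 u)
      = D \<bullet> (B' t *v tail x (-\<tau>)) - D \<bullet> (B' s *v tail y (-\<tau>)) + D \<bullet> (B t *v (x 0 - x (-\<tau>))) - D \<bullet> (B s
          *v (y 0 - y (-\<tau>)))
        + D \<bullet> v1 u - D \<bullet> v2 u"
      by (simp only: inner_add_right inner_diff_right)
    have "c1 + c2 + f u - g u = 2 * \<beta> * (D \<bullet> (B' t *v tail x (-\<tau>) - B' s *v tail y (-\<tau>) + B t *v (x 0 -
        x (-\<tau>)) - B s *v (y 0 - y (-\<tau>)) + v1 u - v2 u))
        + \<beta> * (2 * (integral {-\<tau>..0} (tail (x - y)) \<bullet> (x 0 - y 0)) - (norm (tail (x - y) (-\<tau>)))\<^sup>2)
        + \<alpha> * exp (- C * t) * ((norm (x 0))\<^sup>2 - (norm (x (-\<tau>)))\<^sup>2 + 2 * (x 0 \<bullet> v1 u) - C * growth \<tau> x)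
        + \<alpha> * exp (- C * s) * ((norm (y 0))\<^sup>2 - (norm (y (-\<tau>)))\<^sup>2 + 2 * (y 0 \<bullet> v2 u) - C * growth \<tau> y)
        + (q t (x 0) u - q s (y 0) u) - 2 * \<kappa>"
      unfolding split I[symmetric] c1 c2 f_def g_def inner_minus_left by (simp only: algebra_simps)
          (simp add: algebra_simps)
    then show "c1 + c2 + f u - g u \<le> r" using r[of u] by (simp only: D_def v1_def v2_def)
  qed
qed

section \<open>Comparison\<close>

text \<open>Here \<open>D\<close>, \<open>n\<close>, \<open>Z\<close>, \<open>X\<close> stand for
  the sizes of the compensated difference, of the path difference in the weak norm, of its total
  integral and of the present difference. Only \<open>D\<close> and \<open>n\<close> are controlled
  at rate \<open>\<beta>\<close>. Every bad term has one of them as a factor, \<open>X\<close> is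
  traded for \<open>D\<close>, \<open>Z\<close> and \<open>\<eta>\<close>, and the products with
  \<open>Z\<close> are absorbed by the negative square.\<close>

lemma coupling_estimate:
  fixes c0 c1 c2 c3 c4 c5 c6 :: real
  assumes c: "c0 \<ge> 0" "c1 \<ge> 0" "c2 \<ge> 0" "c3 \<ge> 0" "c4 \<ge> 0" "c5 \<ge> 0" "c6 \<ge> 0"
  obtains K where "K \<ge> 0" "\<And>\<beta> \<eta> D n Z X. \<beta> \<ge> 0 \<Longrightarrow> \<eta> \<ge> 0 \<Longrightarrow> D \<ge> 0 \<Longrightarrow> n \<ge> 0 \<Longrightarrow> Z \<ge> 0 \<Longrightarrow> X \<ge> 0 \<Longrightarrow>
     X \<le> D + c4 * Z + c6 * \<eta> \<Longrightarrow>
     2 * \<beta> * D * (c0 * Z + c1 * X + c2 * n + c3 * \<eta>) + 2 * \<beta> * c5 * n * X - \<beta> * Z\<^sup>2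
       \<le> K * (\<beta> * (D\<^sup>2 + n\<^sup>2) + \<beta> * \<eta> * (D + n))"
proof -
  \<comment> \<open>These are the coefficients of \<open>P\<^sup>2\<close>, \<open>P * Z\<close> and
    \<open>\<eta> * P\<close> with \<open>P = D + n\<close>, once \<open>X\<close> has been replaced
    by its upper bound.\<close>
  define k1 where "k1 = 2 * c1 + 2 * c2 + 2 * c5"
  define k2 where "k2 = 2 * c0 + 2 * c1 * c4 + 2 * c5 * c4"
  define k3 where "k3 = 2 * c3 + 2 * c1 * c6 + 2 * c5 * c6"
  define K where "K = 2 * k1 + k2\<^sup>2 + k3"
  have k: "k1 \<ge> 0" "k2 \<ge> 0" "k3 \<ge> 0" using c by (auto simp: k1_def k2_def k3_def)
  have "2 * \<beta> * D * (c0 * Z + c1 * X + c2 * n + c3 * \<eta>) + 2 * \<beta> * c5 * n * X - \<beta> * Z\<^sup>2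
       \<le> K * (\<beta> * (D\<^sup>2 + n\<^sup>2) + \<beta> * \<eta> * (D + n))"
    if nn: "\<beta> \<ge> 0" "\<eta> \<ge> 0" "D \<ge> 0" "n \<ge> 0" "Z \<ge> 0" "X \<ge> 0" and X: "X \<le> D + c4 * Z + c6 * \<eta>" for \<beta> \<eta> D n Z X
  proof -
    define P where "P = D + n"
    have P: "P \<ge> 0" "D \<le> P" "n \<le> P" using nn by (auto simp: P_def)
    define Y where "Y = P + c4 * Z + c6 * \<eta>"
    have XY: "X \<le> Y" "Y \<ge> 0" using X P nn c by (auto simp: Y_def)
    have "2 * D * (c0 * Z + c1 * X + c2 * n + c3 * \<eta>) \<le> 2 * P * (c0 * Z + c1 * Y + c2 * P + c3 * \<eta>)"
      using nn c P XY by (intro mult_mono add_mono mult_left_mono) auto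
    moreover have "2 * c5 * n * X \<le> 2 * c5 * P * Y"
      using nn c P XY by (intro mult_mono mult_left_mono) auto
    ultimately have "2 * D * (c0 * Z + c1 * X + c2 * n + c3 * \<eta>) + 2 * c5 * n * X
        \<le> 2 * P * (c0 * Z + c1 * Y + c2 * P + c3 * \<eta>) + 2 * c5 * P * Y" by linarith
    also have "\<dots> = k1 * P\<^sup>2 + k2 * P * Z + k3 * \<eta> * P"
      by (simp add: k1_def k2_def k3_def Y_def power2_eq_square algebra_simps)
    also have "k2 * P * Z \<le> Z\<^sup>2 + (k2 * P)\<^sup>2 / 4"
      using zero_le_power2[of "Z - k2 * P / 2"] by (simp add: power2_eq_square algebra_simps)
    finally have "2 * D * (c0 * Z + c1 * X + c2 * n + c3 * \<eta>) + 2 * c5 * n * X - Z\<^sup>2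
        \<le> (k1 + k2\<^sup>2 / 4) * P\<^sup>2 + k3 * \<eta> * P"
      by (simp add: power_mult_distrib algebra_simps)
    also have "\<dots> \<le> (k1 + k2\<^sup>2 / 4) * (2 * (D\<^sup>2 + n\<^sup>2)) + k3 * \<eta> * P"
    proof -
      have "P\<^sup>2 \<le> 2 * (D\<^sup>2 + n\<^sup>2)"
        using zero_le_power2[of "D - n"] by (simp add: P_def power2_eq_square algebra_simps)
      then show ?thesis using k by (intro add_right_mono mult_left_mono) auto
    qed
    also have "\<dots> \<le> K * (D\<^sup>2 + n\<^sup>2) + K * (\<eta> * P)"
    proof -
      have "(2 * k1 + k2\<^sup>2 / 2) * (D\<^sup>2 + n\<^sup>2) \<le> K * (D\<^sup>2 + n\<^sup>2)"
        using k by (intro mult_right_mono) (auto simp: K_def)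
      moreover have "k3 * (\<eta> * P) \<le> K * (\<eta> * P)"
        using k P nn by (intro mult_right_mono) (auto simp: K_def)
      ultimately show ?thesis by (simp add: algebra_simps)
    qed
    finally have "\<beta> * (2 * D * (c0 * Z + c1 * X + c2 * n + c3 * \<eta>) + 2 * c5 * n * X - Z\<^sup>2)
        \<le> \<beta> * (K * (D\<^sup>2 + n\<^sup>2) + K * (\<eta> * P))"
      using nn by (intro mult_left_mono)
    then show ?thesis by (simp add: P_def algebra_simps)
  qed
  moreover have "K \<ge> 0" using k by (simp add: K_def)
  ultimately show ?thesis using that by blast
qed

text \<open>The assumptions in the form in which the estimates consume them: one Lipschitz and
  growth constant \<open>L\<close> for all data, a bound for \<open>b\<close>, and for
  \<open>a\<close> square integrability with the weak bound derived from its Sobolev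
  regularity.\<close>

locale hjb_comparison =
  fixes T \<tau> L Kb Ka \<Lambda> :: real
    and a :: "('d::finite) path" and b :: "real \<Rightarrow> real ^ 'd ^ 'd"
    and F :: "real \<Rightarrow> (real ^ 'd) \<times> real \<Rightarrow> 'u::metric_space \<Rightarrow> real ^ 'd"
    and q :: "real \<Rightarrow> real ^ 'd \<Rightarrow> 'u \<Rightarrow> real" and \<phi> :: "real ^ 'd \<Rightarrow> real" and \<rho> :: "real \<Rightarrow> real \<Rightarrow> real"
    and W V :: "real \<Rightarrow> 'd path \<Rightarrow> real"
  assumes T: "T > 0" and \<tau>: "\<tau> > 0" and L: "L > 0" and Kb: "Kb \<ge> 0" and Ka: "Ka \<ge> 0" and \<Lambda>: "\<Lambda> > 0"
    and F_growth: "t \<in> {0..T} \<Longrightarrow> norm (F t p u) \<le> L * (1 + norm p)"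
    and F_lip: "t \<in> {0..T} \<Longrightarrow> s \<in> {0..T} \<Longrightarrow> norm (F t p u - F s p' u) \<le> L * (\<bar>s - t\<bar> + norm (p - p'))"
    and b_lip: "t \<in> {0..T} \<Longrightarrow> s \<in> {0..T} \<Longrightarrow> norm (b s - b t) \<le> L * \<bar>s - t\<bar>"
    and b_bound: "t \<in> {0..T} \<Longrightarrow> norm (b t) \<le> Kb"
    and a_L2: "a \<in> L2 (-\<tau>) 0"
    and a_weak: "z \<in> L2 (-\<tau>) 0 \<Longrightarrow> \<bar>innerH \<tau> a z\<bar> \<le> Ka * sqrt (weak_inner \<tau> z z)"
    and q_growth: "t \<in> {0..T} \<Longrightarrow> \<bar>q t v u\<bar> \<le> L * (1 + norm v)"
    and q_lip: "t \<in> {0..T} \<Longrightarrow> s \<in> {0..T} \<Longrightarrow>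
      \<bar>q t v u - q s w u\<bar> \<le> L * norm (v - w) + \<rho> \<bar>s - t\<bar> (max (norm v) (norm w))"
    and phi_lip: "\<bar>\<phi> v - \<phi> w\<bar> \<le> L * norm (v - w)"
    and modulus: "local_modulus \<rho>"
    and sub: "viscosity_subsolution T \<tau> a b F q \<phi> W"
    and super: "viscosity_supersolution T \<tau> a b F q \<phi> V"
    and growth_bound: "t \<in> {0..T} \<Longrightarrow> x \<in> Dspace \<tau> \<Longrightarrow> max \<bar>W t x\<bar> \<bar>V t x\<bar> \<le> \<Lambda> * (1 + norm (x 0) + normH \<tau> x)"
    and weak_bound: "t \<in> {0..T} \<Longrightarrow> s \<in> {0..T} \<Longrightarrow> x \<in> Dspace \<tau> \<Longrightarrow> y \<in> Dspace \<tau> \<Longrightarrow>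
      max \<bar>W t x - W s y\<bar> \<bar>V t x - V s y\<bar> \<le>
           \<Lambda> * (1 + norm (x 0) + normH \<tau> x + norm (y 0) + normH \<tau> y) *
           (norm (x 0 - y 0) + sqrt \<bar>s - t\<bar> +
            (SUP l\<in>{-\<tau>..0}. norm (LINT \<theta>|lebesgue_on {l..0}. x \<theta> - y \<theta>)))"
begin

text \<open>The summand 1 pays for the square of \<open>x 0\<close>, the two with \<open>L\<close>
  for the drift \<open>F\<close>, and \<open>Kb\<^sup>2\<close> for the delay term after Young's
  inequality.\<close>

definition C where "C = 1 + 3 * L + L * normH \<tau> a + Kb\<^sup>2"

lemma C_nonneg: "C \<ge> 0"
  using L Kb by (simp add: C_def normH_nonneg)

lemma growth_eq: "growth \<tau> x = 1 + (norm (x 0))\<^sup>2 + (normH \<tau> x)\<^sup>2"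
  by (simp add: growth_def normH_power2)

lemma growth_ge_1: "growth \<tau> x \<ge> 1"
  by (simp add: growth_eq)

text \<open>The left side is the derivative of \<open>exp (- C * t)\<close> times
  \<open>growth\<close> along the controlled dynamics, divided by the exponential. The square of
  \<open>x (-\<tau>)\<close> lost by the window compensates the delay term, and the rest is at most
  \<open>C\<close> times \<open>growth\<close>.\<close>

lemma dissipation:
  assumes t: "t \<in> {0..T}" and x: "x \<in> Dspace \<tau>"
  shows "(norm (x 0))\<^sup>2 - (norm (x (-\<tau>)))\<^sup>2 + 2 * (x 0 \<bullet> (F t (x 0, innerH \<tau> a x) u + b t *v x (-\<tau>))) -
      C * growth \<tau> x \<le> 0"
proof -
  define p r s where "p = norm (x 0)" and "r = normH \<tau> x" and "s = norm (x (-\<tau>))"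
  define N where "N = normH \<tau> a"
  have nn: "p \<ge> 0" "r \<ge> 0" "s \<ge> 0" "N \<ge> 0" by (auto simp: p_def r_def s_def N_def normH_nonneg)
  have "\<bar>innerH \<tau> a x\<bar> \<le> N * r"
    using inner_L2_Cauchy_Schwarz[OF a_L2 Dspace_L2[OF x]] by (simp add: innerH_eq N_def r_def normH_eq)
  then have "norm (x 0, innerH \<tau> a x) \<le> p + N * r"
    using norm_Pair_le[of "x 0" "innerH \<tau> a x"] by (simp add: p_def)
  then have "L * (1 + norm (x 0, innerH \<tau> a x)) \<le> L * (1 + (p + N * r))"
    using L by (intro mult_left_mono) auto
  then have Fb: "norm (F t (x 0, innerH \<tau> a x) u) \<le> L * (1 + p + N * r)"
    using F_growth[OF t, of "(x 0, innerH \<tau> a x)" u] by (simp add: add.assoc)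
  have "norm (b t *v x (-\<tau>)) \<le> norm (b t) * s" unfolding s_def by (rule norm_matrix_vector_mult_le)
  also have "\<dots> \<le> Kb * s" using b_bound[OF t] nn by (intro mult_right_mono) auto
  finally have bb: "norm (b t *v x (-\<tau>)) \<le> Kb * s" .
  have "x 0 \<bullet> F t (x 0, innerH \<tau> a x) u \<le> p * (L * (1 + p + N * r))"
    using norm_cauchy_schwarz[of "x 0" "F t (x 0, innerH \<tau> a x) u"] mult_left_mono[OF Fb nn(1)] by (simp
        add: p_def)
  moreover have "x 0 \<bullet> (b t *v x (-\<tau>)) \<le> p * (Kb * s)"
    using norm_cauchy_schwarz[of "x 0" "b t *v x (-\<tau>)"] mult_left_mono[OF bb nn(1)] by (simp add: p_def)
  ultimately have "2 * (x 0 \<bullet> (F t (x 0, innerH \<tau> a x) u + b t *v x (-\<tau>))) \<le> 2 * (p * (L * (1 + p + N *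
      r))) + 2 * (p * (Kb * s))"
    by (simp add: inner_add_right)
  \<comment> \<open>Young's inequality is balanced so that \<open>s\<^sup>2\<close> has coefficient
    1, exactly what the window loses.\<close>
  also have "2 * (p * (Kb * s)) \<le> Kb\<^sup>2 * p\<^sup>2 + s\<^sup>2"
    using zero_le_power2[of "Kb * p - s"] by (simp add: power2_eq_square algebra_simps)
  also have "2 * (p * (L * (1 + p + N * r))) \<le> L * (1 + 3 * p\<^sup>2) + L * N * (p\<^sup>2 + r\<^sup>2)"
  proof -
    have "L * (2 * p) \<le> L * (1 + p\<^sup>2)"
      using zero_le_power2[of "p - 1"] L by (intro mult_left_mono) (auto simp: power2_eq_square
          algebra_simps)
    moreover have "L * N * (2 * p * r) \<le> L * N * (p\<^sup>2 + r\<^sup>2)"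
      using zero_le_power2[of "p - r"] L nn by (intro mult_left_mono) (auto simp: power2_eq_square
          algebra_simps)
    ultimately show ?thesis by (simp add: power2_eq_square algebra_simps)
  qed
  also have "L * (1 + 3 * p\<^sup>2) + L * N * (p\<^sup>2 + r\<^sup>2) + (Kb\<^sup>2 * p\<^sup>2 + s\<^sup>2) \<le> (C - 1) * (1 + p\<^sup>2 + r\<^sup>2) + s\<^sup>2"
  proof -
    define G where "G = 1 + p\<^sup>2 + r\<^sup>2"
    have "L * (1 + 3 * p\<^sup>2) \<le> L * (3 * G)"
      using L by (intro mult_left_mono) (auto simp: G_def)
    moreover have "L * N * (p\<^sup>2 + r\<^sup>2) \<le> L * N * G" using L nn by (intro mult_left_mono) (auto simp: G_def)
    moreover have "Kb\<^sup>2 * p\<^sup>2 \<le> Kb\<^sup>2 * G" by (intro mult_left_mono) (auto simp: G_def)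
    moreover have "(C - 1) * G = L * (3 * G) + L * N * G + Kb\<^sup>2 * G"
      by (simp add: C_def N_def algebra_simps)
    ultimately show ?thesis unfolding G_def[symmetric] by linarith
  qed
  finally have "2 * (x 0 \<bullet> (F t (x 0, innerH \<tau> a x) u + b t *v x (-\<tau>))) \<le> (C - 1) * growth \<tau> x + s\<^sup>2"
    by (simp add: growth_eq p_def r_def)
  moreover have "p\<^sup>2 \<le> growth \<tau> x" by (simp add: growth_eq p_def)
  ultimately show ?thesis by (simp add: p_def s_def left_diff_distrib)
qed

lemma normH_le:
  assumes "x \<in> Dspace \<tau>" "\<And>\<theta>. \<theta> \<in> {-\<tau>..0} \<Longrightarrow> norm (x \<theta>) \<le> R"
  shows "normH \<tau> x \<le> sqrt \<tau> * R"
proof -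
  have R: "R \<ge> 0" using assms(2)[of 0] \<tau> by (auto intro: order_trans[OF norm_ge_zero])
  have "normH \<tau> x \<le> sqrt (\<tau> * R\<^sup>2)"
    unfolding normH_def using innerH_le[OF assms] \<tau> by simp
  then show ?thesis using R by (simp add: real_sqrt_mult)
qed

lemma weak_modulus_WV:
  assumes R: "R \<ge> 0"
  defines "M \<equiv> \<Lambda> * (1 + 2 * R + 2 * sqrt \<tau> * R)"
  shows "weak_modulus T \<tau> R M W" "weak_modulus T \<tau> R M V"
proof -
  have *: "max \<bar>W t x - W s y\<bar> \<bar>V t x - V s y\<bar> \<le> M * (norm (x 0 - y 0) + sqrt \<bar>t - s\<bar> + m)"
    if t: "t \<in> {0..T}" and s: "s \<in> {0..T}" and x: "x \<in> Dspace \<tau>" and y: "y \<in> Dspace \<tau>"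
      and h: "\<forall>\<theta>\<in>{-\<tau>..0}. norm (x \<theta>) \<le> R \<and> norm (y \<theta>) \<le> R \<and> norm (tail x \<theta> - tail y \<theta>) \<le> m" for t s x y m
  proof -
    let ?S = "SUP l\<in>{-\<tau>..0}. norm (LINT \<theta>|lebesgue_on {l..0}. x \<theta> - y \<theta>)"
    have S: "?S \<le> m"
    proof (rule SUP_tail_le[OF x y])
      fix l assume l: "l \<in> {-\<tau>..0}"
      have "tail (x - y) l = tail x l - tail y l"
        by (rule tail_diff[of _ \<tau>]) (use l Dspace_L2 x y in auto)
      then show "norm (tail (x - y) l) \<le> m" using h l by simp
    qed (use \<tau> in simp)
    have m0: "0 \<le> m" using h \<tau> by (force intro: order_trans[OF norm_ge_zero])
    have x0: "norm (x 0) \<le> R" "norm (y 0) \<le> R" using h \<tau> by auto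
    have H: "normH \<tau> x \<le> sqrt \<tau> * R" "normH \<tau> y \<le> sqrt \<tau> * R" using normH_le[OF x, of R] normH_le[OF y,
        of R] h by blast+
    have "\<Lambda> * (1 + norm (x 0) + normH \<tau> x + norm (y 0) + normH \<tau> y) * (norm (x 0 - y 0) + sqrt \<bar>s - t\<bar> + ?S)
      \<le> \<Lambda> * (1 + norm (x 0) + normH \<tau> x + norm (y 0) + normH \<tau> y) * (norm (x 0 - y 0) + sqrt \<bar>s - t\<bar> + m)"
      using S \<Lambda> by (intro mult_left_mono) (auto simp: normH_nonneg intro!: add_nonneg_nonneg)
    also have "\<dots> \<le> M * (norm (x 0 - y 0) + sqrt \<bar>s - t\<bar> + m)"
    proof (rule mult_right_mono)
      have "1 + norm (x 0) + normH \<tau> x + norm (y 0) + normH \<tau> y \<le> 1 + 2 * R + 2 * sqrt \<tau> * R"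
        using x0 H by (simp add: algebra_simps)
      then show "\<Lambda> * (1 + norm (x 0) + normH \<tau> x + norm (y 0) + normH \<tau> y) \<le> M"
        unfolding M_def using \<Lambda> by (intro mult_left_mono) auto
    qed (use m0 in auto)
    finally show ?thesis using weak_bound[OF t s x y] by (simp add: abs_minus_commute)
  qed
  show "weak_modulus T \<tau> R M W"
    unfolding weak_modulus_def
  proof (intro ballI allI impI)
    fix t s m and x y :: "'d path" assume "t \<in> {0..T}" "s \<in> {0..T}" "x \<in> Dspace \<tau>" "y \<in> Dspace \<tau>"
      "\<forall>\<theta>\<in>{-\<tau>..0}. norm (x \<theta>) \<le> R \<and> norm (y \<theta>) \<le> R \<and> norm (tail x \<theta> - tail y \<theta>) \<le> m"
    from *[OF this] show "\<bar>W t x - W s y\<bar> \<le> M * (norm (x 0 - y 0) + sqrt \<bar>t - s\<bar> + m)" by simp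
  qed
  show "weak_modulus T \<tau> R M V"
    unfolding weak_modulus_def
  proof (intro ballI allI impI)
    fix t s m and x y :: "'d path" assume "t \<in> {0..T}" "s \<in> {0..T}" "x \<in> Dspace \<tau>" "y \<in> Dspace \<tau>"
      "\<forall>\<theta>\<in>{-\<tau>..0}. norm (x \<theta>) \<le> R \<and> norm (y \<theta>) \<le> R \<and> norm (tail x \<theta> - tail y \<theta>) \<le> m"
    from *[OF this] show "\<bar>V t x - V s y\<bar> \<le> M * (norm (x 0 - y 0) + sqrt \<bar>t - s\<bar> + m)" by simp
  qed
qed

end

lemma weak_inner_zero: "weak_inner \<tau> 0 f = 0"
  using weak_inner_scale[of \<tau> 0 0 f] by simp

section \<open>Estimates at a maximum of the doubled functional\<close>

context hjb_comparison
begin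

lemma doubling_diagonal:
  "doubling T \<tau> B \<beta> \<gamma> \<alpha> C \<kappa> W V t x t x = W t x - V t x - 2 * (\<alpha> * exp (- C * t) * growth \<tau> x) - 2 * (\<kappa>
      * (T - t))"
  by (simp add: doubling_def weak_inner_zero)

lemma doubling_le:
  assumes "\<beta> \<ge> 0" "\<gamma> \<ge> 0" "\<alpha> \<ge> 0" "\<kappa> \<ge> 0" "t \<in> {0..T}" "s \<in> {0..T}" "x \<in> Dspace \<tau>" "y \<in> Dspace \<tau>"
  shows "doubling T \<tau> B \<beta> \<gamma> \<alpha> C \<kappa> W V t x s y \<le> W t x - V s y - \<alpha> * exp (- C * T) * (growth \<tau> x + growth
      \<tau> y)"
proof -
  have e: "\<alpha> * exp (- C * T) * growth \<tau> z \<le> \<alpha> * exp (- C * r) * growth \<tau> z" if "r \<in> {0..T}" for r and z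
      :: "'d path"
    using that assms(3) growth_ge_1[of z] C_nonneg by (intro mult_right_mono mult_left_mono) (auto simp:
        mult_left_mono)
  have "0 \<le> \<beta> * (norm (compensated \<tau> B t x - compensated \<tau> B s y))\<^sup>2" using assms by simp
  moreover have "0 \<le> \<beta> * weak_inner \<tau> (x - y) (x - y)"
    using assms weak_inner_nonneg[OF Dspace_L2[OF Dspace_diff[OF assms(7,8)]]] by simp
  moreover have "0 \<le> \<gamma> * (t - s)\<^sup>2" "0 \<le> \<kappa> * (T - t)" "0 \<le> \<kappa> * (T - s)" using assms by auto
  ultimately show ?thesis unfolding doubling_def distrib_left using e[OF assms(5), of x] e[OF assms(6),
      of y] by linarith
qed

text \<open>Records what is known at a maximum as numerical inequalities, so that the limit can be
  taken without the points: \<open>D\<close>, \<open>n\<close>, \<open>Z\<close>, \<open>X\<close>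
  are as in \<open>coupling_estimate\<close> and \<open>h\<close> is the time gap. The last
  disjunction separates the case of a terminal time, where \<open>\<phi>\<close> decides, from the
  one where both viscosity inequalities apply.\<close>

lemma penalized_maximum:
  assumes R: "R > 0" and \<alpha>: "\<alpha> > 0" and \<kappa>: "\<kappa> > 0" and \<beta>: "\<beta> \<ge> 1" and \<eta>: "0 < \<eta>" "\<eta> \<le> 1" and \<epsilon>: "0 < \<epsilon>"
    and base: "t0 \<in> {0..T}" "x0 \<in> Dbar \<tau> (ball 0 R)" "\<mu> \<le> W t0 x0 - V t0 x0 - 2 * \<alpha> * growth \<tau> x0 - 2 *
        \<kappa> * T" "\<mu> > 0"
    and inner: "\<And>t x s y. t \<in> {0..T} \<Longrightarrow> s \<in> {0..T} \<Longrightarrow> x \<in> Dspace \<tau> \<Longrightarrow> y \<in> Dspace \<tau> \<Longrightarrow>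
      0 < W t x - V s y - \<alpha> * exp (- C * T) * (growth \<tau> x + growth \<tau> y) \<Longrightarrow> norm (x 0) < R \<and> norm (y 0) < R"
  defines "M \<equiv> \<Lambda> * (1 + 2 * R + 2 * sqrt \<tau> * R)"
  shows "\<exists>D n Z X h. 0 \<le> D \<and> 0 \<le> n \<and> 0 \<le> Z \<and> 0 \<le> X \<and> 0 \<le> h \<and> h \<le> \<eta> \<and> X \<le> 2 * R \<and> n\<^sup>2 \<le> 4 * R\<^sup>2 * \<tau> ^ 3 \<and>
     Z \<le> root 3 (16 * R * n\<^sup>2) \<and> X \<le> D + (Kb + 1) * Z + ((L + 2) * R * \<tau>) * \<eta> \<and>
     \<beta> * (D\<^sup>2 + n\<^sup>2) \<le> M * (X + sqrt h + root 3 (16 * R * n\<^sup>2)) + \<epsilon> \<and>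
     (\<mu> \<le> L * X + M * sqrt h \<or>
      2 * \<kappa> \<le> 2 * \<beta> * D * (L * Z + (Kb + 1 + L) * X + (L * Ka) * n + (R * \<tau> + (L + 2) * R + 2 * R + L) * \<eta>)
         + 2 * \<beta> * sqrt \<tau> * n * X - \<beta> * Z\<^sup>2 + L * X + \<rho> \<eta> R)"
proof -
  let ?Q = "ball 0 R :: (real ^ 'd) set"
  have Q: "norm v \<le> R" if "v \<in> closure ?Q" for v using that R by simp
  have M: "M \<ge> 0" unfolding M_def using \<Lambda> R \<tau> by simp
  have WM: "weak_modulus T \<tau> R M W" and VM: "weak_modulus T \<tau> R M V"
    using weak_modulus_WV[of R] R by (auto simp: M_def)
  obtain B B' where B: "\<And>t. t \<in> {0..T} \<Longrightarrow> (B has_vector_derivative B' t) (at t within {0..T})"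
    and B': "continuous_on {0..T} B'" and Bb: "\<And>t. t \<in> {0..T} \<Longrightarrow> norm (B t - b t) \<le> \<eta>"
    and B'L: "\<And>t. t \<in> {0..T} \<Longrightarrow> norm (B' t) \<le> L"
    using Steklov_mean[where b = b and T = T and L = L and \<delta> = \<eta>, OF b_lip L T \<eta>(1)] by blast
  have Bc: "continuous_on {0..T} B" using B by (rule continuous_on_vector_derivative)
  have "uniformly_continuous_on {0..T} B'" by (rule compact_uniformly_continuous[OF B']) simp
  then obtain d where d: "d > 0" "\<And>t s. t \<in> {0..T} \<Longrightarrow> s \<in> {0..T} \<Longrightarrow> dist t s < d \<Longrightarrow> dist (B' t) (B' s) < \<eta>"
    unfolding uniformly_continuous_on_def using \<eta>(1) by metis
  \<comment> \<open>A bound for the total penalty that does not involve \<open>\<gamma>\<close>,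
    from crude estimates in the ball.\<close>
  define K1 where "K1 = M * (2 * R + sqrt T + 2 * R * \<tau>) + \<epsilon>"
  have K1: "K1 > 0" unfolding K1_def using M R T \<tau> \<epsilon> by (intro add_nonneg_pos mult_nonneg_nonneg) auto
  define h0 where "h0 = min \<eta> d / 2"
  have h0: "h0 > 0" "h0 < d" "h0 \<le> \<eta>" using \<eta> d by (auto simp: h0_def)
  \<comment> \<open>With this weight the penalty bound forces \<open>h \<le> h0\<close>, hence
    \<open>h \<le> \<eta>\<close> and a time gap over which \<open>B'\<close> varies by less than
    \<open>\<eta>\<close>.\<close>
  define \<gamma> where "\<gamma> = K1 / h0\<^sup>2"
  have \<gamma>: "\<gamma> > 0" using K1 h0 by (simp add: \<gamma>_def)
  define f where "f = doubling T \<tau> B \<beta> \<gamma> \<alpha> C \<kappa> W V"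
  define K where "K = 2 * (\<Lambda> * (1 + R + sqrt \<tau> * R))"
  have bd: "norm (z \<theta>) \<le> R" if "z \<in> Dbar \<tau> ?Q" "\<theta> \<in> {-\<tau>..0}" for z \<theta> using that Q by (auto simp: Dbar_def)
  have fK: "f t x s y \<le> K" if tx: "t \<in> {0..T}" "s \<in> {0..T}" "x \<in> Dbar \<tau> ?Q" "y \<in> Dbar \<tau> ?Q" for t x s y
  proof -
    have g: "\<Lambda> * (1 + norm (z 0) + normH \<tau> z) \<le> \<Lambda> * (1 + R + sqrt \<tau> * R)" if z: "z \<in> Dbar \<tau> ?Q" for z
      using \<Lambda> normH_le[OF Dbar_Dspace[OF z] bd[OF z]] bd[OF z, of 0] \<tau> by (intro mult_left_mono) auto
    have "0 \<le> \<alpha> * exp (- C * T) * (growth \<tau> x + growth \<tau> y)"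
      using \<alpha> growth_ge_1[of x] growth_ge_1[of y] by simp
    moreover have "f t x s y \<le> W t x - V s y - \<alpha> * exp (- C * T) * (growth \<tau> x + growth \<tau> y)"
      unfolding f_def using \<beta> \<gamma> \<alpha> \<kappa> tx Dbar_Dspace by (intro doubling_le) auto
    moreover have "W t x \<le> \<Lambda> * (1 + R + sqrt \<tau> * R)"
      using growth_bound[OF tx(1) Dbar_Dspace[OF tx(3)]] g[OF tx(3)] by linarith
    moreover have "- V s y \<le> \<Lambda> * (1 + R + sqrt \<tau> * R)"
      using growth_bound[OF tx(2) Dbar_Dspace[OF tx(4)]] g[OF tx(4)] by linarith
    ultimately show ?thesis unfolding K_def by linarith
  qed
  define A where "A = {p :: (real \<times> 'd path) \<times> (real \<times> 'd path). fst (fst p) \<in> {0..T} \<and> snd (fst p) \<in>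
      Dbar \<tau> ?Q \<and>
    fst (snd p) \<in> {0..T} \<and> snd (snd p) \<in> Dbar \<tau> ?Q}"
  define g where "g = (\<lambda>p. f (fst (fst p)) (snd (fst p)) (fst (snd p)) (snd (snd p)))"
  have bddA: "bdd_above (g ` A)" by (rule bdd_aboveI[of _ K]) (auto simp: g_def A_def intro!: fK)
  let ?p0 = "((t0, x0), (t0, x0))"
  have p0A: "?p0 \<in> A" using base by (simp add: A_def)
  have "\<exists>p\<in>A. (SUP p\<in>A. g p) - \<epsilon> < g p"
    using less_cSUP_iff[OF _ bddA, of "(SUP p\<in>A. g p) - \<epsilon>"] p0A \<epsilon> by fastforce
  then obtain p1 where p1: "p1 \<in> A" "(SUP p\<in>A. g p) - \<epsilon> < g p1" by blast
  \<comment> \<open>The starting point has two duties: being near the supremum, for the comparisons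
    with the diagonal, and being no worse than the base point, for positivity of the value.\<close>
  define p2 where "p2 = (if g p1 \<le> g ?p0 then ?p0 else p1)"
  have p2: "p2 \<in> A" "(SUP p\<in>A. g p) - \<epsilon> < g p2" "g ?p0 \<le> g p2" using p1 p0A by (auto simp: p2_def)
  obtain t x s y where tT: "t \<in> {0..T}" and sT: "s \<in> {0..T}" and x: "x \<in> Dbar \<tau> ?Q" and y: "y \<in> Dbar \<tau> ?Q"
    and ge: "g p2 \<le> f t x s y"
    and mx: "\<And>t' x' s' y'. t' \<in> {0..T} \<Longrightarrow> s' \<in> {0..T} \<Longrightarrow> x' \<in> Dbar \<tau> ?Q \<Longrightarrow> y' \<in> Dbar \<tau> ?Q \<Longrightarrow>
       extends \<tau> t x t' x' \<Longrightarrow> extends \<tau> s y s' y' \<Longrightarrow> f t' x' s' y' \<le> f t x s y"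
  proof (rule tensor_maximum[where f = f and T = T and K = K and R = R and Q = ?Q and \<tau> = \<tau> and
        ?t0.0 = "fst (fst p2)" and ?x0.0 = "snd (fst p2)" and ?s0.0 = "fst (snd p2)" and ?y0.0 = "snd
            (snd p2)"])
    show "\<tau> > 0" by (rule \<tau>)
    show "norm v \<le> R" if "v \<in> closure ?Q" for v using Q that .
    show "f t x s y \<le> K" if "t \<in> {0..T}" "s \<in> {0..T}" "x \<in> Dbar \<tau> ?Q" "y \<in> Dbar \<tau> ?Q" for t x s y using
        fK that .
    show "fst (fst p2) \<in> {0..T}" "fst (snd p2) \<in> {0..T}" "snd (fst p2) \<in> Dbar \<tau> ?Q" "snd (snd p2) \<in> Dbar
        \<tau> ?Q"
      using p2(1) by (auto simp: A_def)
    show "(\<lambda>n::nat. f (t n) (x n) (s n) (y n)) \<longlonglongrightarrow> f t' x' s' y'"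
      if "\<And>n. t n \<in> {0..T}" "\<And>n. s n \<in> {0..T}" "t' \<in> {0..T}" "s' \<in> {0..T}"
      "\<And>n. x n \<in> Dbar \<tau> ?Q" "\<And>n. y n \<in> Dbar \<tau> ?Q" "x' \<in> Dbar \<tau> ?Q" "y' \<in> Dbar \<tau> ?Q"
      "t \<longlonglongrightarrow> t'" "s \<longlonglongrightarrow> s'" "(\<lambda>n. x n 0) \<longlonglongrightarrow> x' 0" "(\<lambda>n. y n 0) \<longlonglongrightarrow> y' 0"
      "(\<lambda>n. L1_dist \<tau> (x n) x') \<longlonglongrightarrow> 0" "(\<lambda>n. L1_dist \<tau> (y n) y') \<longlonglongrightarrow> 0" for t t' x x' s s' y y'
      unfolding f_def by (rule doubling_tendsto[OF WM VM \<tau> Q Bc]) (use that in auto)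
  qed (auto simp: g_def)
  note xD = Dbar_Dspace[OF x] and yD = Dbar_Dspace[OF y]
  have near: "f t' x' s' y' \<le> f t x s y + \<epsilon>"
    if "t' \<in> {0..T}" "s' \<in> {0..T}" "x' \<in> Dbar \<tau> ?Q" "y' \<in> Dbar \<tau> ?Q" for t' x' s' y'
  proof -
    have "g ((t', x'), (s', y')) \<le> (SUP p\<in>A. g p)"
      by (rule cSUP_upper[OF _ bddA]) (use that in \<open>simp add: A_def\<close>)
    then show ?thesis using p2(2) ge by (simp add: g_def)
  qed
  have f\<mu>: "\<mu> \<le> f t x s y"
  proof -
    have "\<alpha> * exp (- C * t0) * growth \<tau> x0 \<le> \<alpha> * 1 * growth \<tau> x0"
      using \<alpha> growth_ge_1[of x0] C_nonneg base(1) by (intro mult_right_mono mult_left_mono) auto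
    moreover have "\<kappa> * (T - t0) \<le> \<kappa> * T" using \<kappa> base(1) by (intro mult_left_mono) auto
    ultimately have "\<mu> \<le> g ?p0" using base(3) by (simp add: g_def f_def doubling_diagonal)
    then show ?thesis using p2(3) ge by linarith
  qed
  have f_le: "f t x s y \<le> W t x - V s y - \<alpha> * exp (- C * T) * (growth \<tau> x + growth \<tau> y)"
    unfolding f_def using \<beta> \<gamma> \<alpha> \<kappa> by (intro doubling_le tT sT xD yD) auto
  have int: "norm (x 0) < R" "norm (y 0) < R"
    using inner[OF tT sT xD yD] f_le f\<mu> base(4) by auto
  define z where "z = x - y"
  define D where "D = norm (compensated \<tau> B t x - compensated \<tau> B s y)"
  define N where "N = weak_inner \<tau> z z"
  define n where "n = sqrt N"
  define Z where "Z = norm (tail z (-\<tau>))"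
  define X where "X = norm (x 0 - y 0)"
  define h where "h = \<bar>t - s\<bar>"
  define m where "m = root 3 (16 * R * n\<^sup>2)"
  have zD: "z \<in> Dspace \<tau>" unfolding z_def by (rule Dspace_diff[OF xD yD])
  have z_eq: "z \<theta> = x \<theta> - y \<theta>" for \<theta> by (simp add: z_def)
  have zL: "z \<in> L2 (-\<tau>) 0" by (rule Dspace_L2[OF zD])
  have N0: "N \<ge> 0" unfolding N_def by (rule weak_inner_nonneg[OF zL])
  have n2: "n\<^sup>2 = N" using N0 by (simp add: n_def)
  have nn: "0 \<le> D" "0 \<le> n" "0 \<le> Z" "0 \<le> X" "0 \<le> h" using N0 by (auto simp: D_def n_def Z_def X_def h_def)
  have zb: "norm (z \<theta>) \<le> 2 * R" if "\<theta> \<in> {-\<tau>..0}" for \<theta>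
    using norm_triangle_ineq4[of "x \<theta>" "y \<theta>"] bd[OF x that] bd[OF y that] by (simp add: z_eq)
  \<comment> \<open>The constant 16 is the 8 of the interpolation inequality times the 2 in the
    bound \<open>2 * R\<close> of \<open>z\<close>.\<close>
  have tm: "norm (tail z l) \<le> m" if "l \<in> {-\<tau>..0}" for l
  proof -
    have "norm (tail z l) ^ 3 \<le> 16 * R * n\<^sup>2"
      using tail_interpolation[OF zD zb, of l] R that by (simp add: n2 N_def)
    then have "root 3 (norm (tail z l) ^ 3) \<le> m" unfolding m_def by (intro real_root_le_mono) auto
    then show ?thesis by (simp add: real_root_power_cancel)
  qed
  have Zm: "Z \<le> m" unfolding Z_def using tm[of "-\<tau>"] \<tau> by simp
  have td: "tail z l = tail x l - tail y l" if "l \<in> {-\<tau>..0}" for l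
    unfolding z_def using tail_diff[of x \<tau> y l] Dspace_L2[OF xD, of "-\<tau>" 0] Dspace_L2[OF yD, of "-\<tau>" 0]
        that by simp
  have X2R: "X \<le> 2 * R" unfolding X_def using zb[of 0] \<tau> by (simp add: z_eq)
  have N4: "n\<^sup>2 \<le> 4 * R\<^sup>2 * \<tau> ^ 3"
  proof -
    have "N \<le> \<tau>\<^sup>2 * normH \<tau> z * normH \<tau> z"
      using weak_inner_bound[OF zL zL] \<tau> by (simp add: N_def normH_eq)
    also have "\<dots> = \<tau>\<^sup>2 * innerH \<tau> z z" by (simp add: normH_power2[symmetric] power2_eq_square)
    also have "\<dots> \<le> \<tau>\<^sup>2 * (\<tau> * (2 * R)\<^sup>2)" using innerH_le[OF zD zb] \<tau> by (intro mult_left_mono) auto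
    finally show ?thesis unfolding n2 by (simp add: power2_eq_square power3_eq_cube algebra_simps)
  qed
  have tb: "norm (tail z (-\<tau>)) \<le> R * \<tau>" if "z \<in> Dbar \<tau> ?Q" for z
    by (rule tail_sup_bound[OF Dbar_Dspace[OF that] bd[OF that]]) (use \<tau> in auto)
  \<comment> \<open>Adding the comparisons with the diagonal points over \<open>(t, x)\<close> and
    \<open>(s, y)\<close> bounds twice the penalty: the growth and \<open>\<kappa>\<close> terms
    drop out, and increments of \<open>W\<close> and \<open>V\<close> remain. The free bound
    \<open>m'\<close> is first the crude \<open>2 * R * \<tau>\<close>, to control \<open>h\<close>,
    and later the interpolated \<open>m\<close>.\<close>
  have pen: "\<beta> * (D\<^sup>2 + n\<^sup>2) + \<gamma> * h\<^sup>2 \<le> M * (X + sqrt h + m') + \<epsilon>"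
    if m': "\<And>l. l \<in> {-\<tau>..0} \<Longrightarrow> norm (tail z l) \<le> m'" for m'
  proof -
    have hyp: "\<forall>\<theta>\<in>{-\<tau>..0}. norm (x \<theta>) \<le> R \<and> norm (y \<theta>) \<le> R \<and> norm (tail x \<theta> - tail y \<theta>) \<le> m'"
      using bd[OF x] bd[OF y] m' td by simp
    have "\<bar>W t x - W s y\<bar> \<le> M * (X + sqrt h + m')"
      using WM[unfolded weak_modulus_def, rule_format, OF tT sT xD yD, of m'] hyp by (simp add: X_def h_def)
    moreover have "\<bar>V t x - V s y\<bar> \<le> M * (X + sqrt h + m')"
      using VM[unfolded weak_modulus_def, rule_format, OF tT sT xD yD, of m'] hyp by (simp add: X_def h_def)
    moreover have "f t x t x \<le> f t x s y + \<epsilon>" "f s y s y \<le> f t x s y + \<epsilon>" by (intro near tT sT x y)+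
    moreover have "f t x s y = W t x - V s y - (\<beta> * (D\<^sup>2 + n\<^sup>2) + \<gamma> * h\<^sup>2) - \<alpha> * exp (- C * t) * growth \<tau> x
        - \<alpha> * exp (- C * s) * growth \<tau> y - \<kappa> * (T - t) - \<kappa> * (T - s)"
      by (simp add: f_def doubling_def n2 D_def N_def z_def h_def algebra_simps)
    ultimately show ?thesis unfolding f_def doubling_diagonal by linarith
  qed
  have h_le: "h \<le> h0"
  proof -
    have "\<gamma> * h\<^sup>2 \<le> \<beta> * (D\<^sup>2 + n\<^sup>2) + \<gamma> * h\<^sup>2" using \<beta> by simp
    also have "\<dots> \<le> M * (X + sqrt h + 2 * R * \<tau>) + \<epsilon>"
      by (rule pen) (use tail_sup_bound[OF zD zb] in auto)
    also have "\<dots> \<le> K1"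
    proof -
      have "h \<le> T" using tT sT by (auto simp: h_def)
      then have "X + sqrt h + 2 * R * \<tau> \<le> 2 * R + sqrt T + 2 * R * \<tau>"
        using X2R by (intro add_mono real_sqrt_le_mono) auto
      from mult_left_mono[OF this M] show ?thesis unfolding K1_def by simp
    qed
    finally have "h\<^sup>2 \<le> h0\<^sup>2" using K1 h0 by (simp add: \<gamma>_def field_simps)
    then show ?thesis by (rule power2_le_imp_le) (use h0 in simp)
  qed
  then have h\<eta>: "h \<le> \<eta>" using h0 by simp
  have Bn: "norm (B r) \<le> Kb + 1" if "r \<in> {0..T}" for r
    using norm_triangle_ineq[of "b r" "B r - b r"] b_bound[OF that] Bb[OF that] \<eta>(2) by simp
  \<comment> \<open>Two smoothing errors and one Lipschitz increment over the gap
    \<open>h \<le> \<eta>\<close>.\<close>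
  have Bts: "norm (B t - B s) \<le> (L + 2) * \<eta>"
  proof -
    have "B t - B s = (B t - b t) + (b t - b s) - (B s - b s)" by simp
    then have "norm (B t - B s) \<le> norm (B t - b t) + norm (b t - b s) + norm (B s - b s)"
      using norm_triangle_ineq4[of "(B t - b t) + (b t - b s)" "B s - b s"] norm_triangle_ineq[of "B t -
          b t" "b t - b s"] by simp
    also have "norm (b t - b s) \<le> L * \<eta>"
      using b_lip[OF sT tT] h\<eta> L by (auto simp: h_def intro: order_trans[OF _ mult_left_mono])
    finally show ?thesis using Bb[OF tT] Bb[OF sT] by (simp add: algebra_simps)
  qed
  have mv: "norm (A *v v - A' *v v') \<le> k1 * norm (v - v') + k2 * norm v'" if "norm A \<le> k1" "norm (A -
      A') \<le> k2"
    for A A' :: "real ^ 'd ^ 'd" and v v' k1 k2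
  proof -
    have "A *v v - A' *v v' = A *v (v - v') + (A - A') *v v'"
      by (simp add: matrix_vector_mult_diff_distrib matrix_vector_mult_diff_rdistrib)
    then have "norm (A *v v - A' *v v') \<le> norm (A *v (v - v')) + norm ((A - A') *v v')"
      using norm_triangle_ineq by metis
    also have "\<dots> \<le> norm A * norm (v - v') + norm (A - A') * norm v'"
      by (intro add_mono norm_matrix_vector_mult_le)
    also have "\<dots> \<le> k1 * norm (v - v') + k2 * norm v'" using that by (intro add_mono mult_right_mono) auto
    finally show ?thesis .
  qed
  have Zd: "norm (tail x (-\<tau>) - tail y (-\<tau>)) = Z" using td[of "-\<tau>"] \<tau> by (simp add: Z_def)
  have Xle: "X \<le> D + (Kb + 1) * Z + ((L + 2) * R * \<tau>) * \<eta>"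
  proof -
    have "x 0 - y 0 = (compensated \<tau> B t x - compensated \<tau> B s y) - (B t *v tail x (-\<tau>) - B s *v tail y
        (-\<tau>))"
      by (simp add: compensated_def)
    then have "X \<le> D + norm (B t *v tail x (-\<tau>) - B s *v tail y (-\<tau>))"
      unfolding X_def D_def using norm_triangle_ineq4 by metis
    also have "norm (B t *v tail x (-\<tau>) - B s *v tail y (-\<tau>)) \<le> (Kb + 1) * Z + ((L + 2) * \<eta>) * norm
        (tail y (-\<tau>))"
      using mv[OF Bn[OF tT] Bts, of "tail x (-\<tau>)" "tail y (-\<tau>)"] Zd by simp
    also have "((L + 2) * \<eta>) * norm (tail y (-\<tau>)) \<le> ((L + 2) * \<eta>) * (R * \<tau>)"
      using tb[OF y] L \<eta> by (intro mult_left_mono) auto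
    finally show ?thesis by (simp add: algebra_simps)
  qed
  have main: "\<mu> \<le> L * X + M * sqrt h \<or>
      2 * \<kappa> \<le> 2 * \<beta> * D * (L * Z + (Kb + 1 + L) * X + (L * Ka) * n + (R * \<tau> + (L + 2) * R + 2 * R + L) * \<eta>)
         + 2 * \<beta> * sqrt \<tau> * n * X - \<beta> * Z\<^sup>2 + L * X + \<rho> \<eta> R"
  proof (cases "t = T \<or> s = T")
    case True
    have tval: "W T z \<le> \<phi> (z 0)" "\<phi> (z 0) \<le> V T z" if "z \<in> Dspace \<tau>" for z
      using sub super that by (auto simp: viscosity_subsolution_def viscosity_supersolution_def)
    have TT: "T \<in> {0..T}" using T by simp
    have mod0: "\<bar>w r z - w r' z\<bar> \<le> M * sqrt \<bar>r - r'\<bar>"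
      if "weak_modulus T \<tau> R M w" "r \<in> {0..T}" "r' \<in> {0..T}" "z \<in> Dbar \<tau> ?Q" for w r r' z
      using that(1)[unfolded weak_modulus_def, rule_format, OF that(2,3) Dbar_Dspace[OF that(4)]
          Dbar_Dspace[OF that(4)], of 0]
        bd[OF that(4)] by simp
    \<comment> \<open>If one of the times is \<open>T\<close>, the terminal inequalities apply after
      moving the other time to \<open>T\<close> as well, at a cost of
      \<open>M * sqrt h\<close>.\<close>
    have "W t x - V s y \<le> \<phi> (x 0) - \<phi> (y 0) + M * sqrt h"
      using True
    proof
      assume "t = T"
      then show ?thesis using tval(1)[OF xD] tval(2)[OF yD] mod0[OF VM sT TT y] by (simp add: h_def
          abs_minus_commute)
    next
      assume "s = T"
      then show ?thesis using tval(1)[OF xD] tval(2)[OF yD] mod0[OF WM tT TT x] by (simp add: h_def)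
    qed
    moreover have "\<phi> (x 0) - \<phi> (y 0) \<le> L * X" using phi_lip[of "x 0" "y 0"] by (simp add: X_def)
    moreover have "0 \<le> \<alpha> * exp (- C * T) * (growth \<tau> x + growth \<tau> y)"
      using \<alpha> growth_ge_1[of x] growth_ge_1[of y] by simp
    ultimately show ?thesis using f\<mu> f_le by linarith
  next
    case False
    then have t: "t \<in> {0..<T}" and s: "s \<in> {0..<T}" using tT sT by auto
    let ?RHS = "2 * \<beta> * D * (L * Z + (Kb + 1 + L) * X + (L * Ka) * n + (R * \<tau> + (L + 2) * R + 2 * R + L)
        * \<eta>)
         + 2 * \<beta> * sqrt \<tau> * n * X - \<beta> * Z\<^sup>2 + L * X + \<rho> \<eta> R"
    have "0 \<le> ?RHS - 2 * \<kappa>"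
    proof (rule viscosity_doubling[where T = T and \<tau> = \<tau> and W = W and V = V and Q = ?Q and B = B and B'
        = B' and t = t and s = s
          and x = x and y = y and \<beta> = \<beta> and \<gamma> = \<gamma> and \<alpha> = \<alpha> and C = C and \<kappa> = \<kappa> and a = a and b = b and
              F = F and q = q and \<phi> = \<phi>
          and KF = "L * (1 + norm (x 0, innerH \<tau> a x))" and Kq = "L * (1 + norm (x 0))"])
      show "\<forall>t\<in>{0..T}. (B has_vector_derivative B' t) (at t within {0..T})" using B by blast
      show "doubling T \<tau> B \<beta> \<gamma> \<alpha> C \<kappa> W V t' (concat_path \<tau> t x t' x') s y \<le> doubling T \<tau> B \<beta> \<gamma> \<alpha> C \<kappa> W V
          t x s y"
        if "t' \<in> {t..T}" "x' \<in> Dbar \<tau> ?Q" for t' x'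
        using mx[of t' s "concat_path \<tau> t x t' x'" y] that tT sT x y
        by (simp add: f_def extends_refl extends_concat_path concat_path_Dbar)
      show "doubling T \<tau> B \<beta> \<gamma> \<alpha> C \<kappa> W V t x s' (concat_path \<tau> s y s' y') \<le> doubling T \<tau> B \<beta> \<gamma> \<alpha> C \<kappa> W V
          t x s y"
        if "s' \<in> {s..T}" "y' \<in> Dbar \<tau> ?Q" for s' y'
        using mx[of t s' x "concat_path \<tau> s y s' y'"] that tT sT x y
        by (simp add: f_def extends_refl extends_concat_path concat_path_Dbar)
      show "norm (F t (x 0, innerH \<tau> a x) u) \<le> L * (1 + norm (x 0, innerH \<tau> a x))" for u by (rule
          F_growth[OF tT])
      show "\<bar>q t (x 0) u\<bar> \<le> L * (1 + norm (x 0))" for u by (rule q_growth[OF tT])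
      fix u
      let ?F1 = "F t (x 0, innerH \<tau> a x) u" and ?F2 = "F s (y 0, innerH \<tau> a y) u"
      let ?D = "compensated \<tau> B t x - compensated \<tau> B s y"
      define E1 where "E1 = B' t *v tail x (-\<tau>) - B' s *v tail y (-\<tau>)"
      define E2 where "E2 = B t *v x 0 - B s *v y 0"
      \<comment> \<open>Regrouping the shift term \<open>B t *v (x 0 - x (-\<tau>))\<close> with the
        delay \<open>b t *v x (-\<tau>)\<close> leaves \<open>x (-\<tau>)\<close> with the factor
        \<open>b t - B t\<close> only, of size \<open>\<eta>\<close>. This is where the compensation
        acts.\<close>
      define E3 where "E3 = (b t - B t) *v x (-\<tau>) - (b s - B s) *v y (-\<tau>)"
      define E4 where "E4 = ?F1 - ?F2"
      have E: "B' t *v tail x (-\<tau>) - B' s *v tail y (-\<tau>) + B t *v (x 0 - x (-\<tau>)) - B s *v (y 0 - y (-\<tau>))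
          + (?F1 + b t *v x (-\<tau>)) - (?F2 + b s *v y (-\<tau>)) = E1 + E2 + E3 + E4"
        by (simp add: E1_def E2_def E3_def E4_def matrix_vector_mult_diff_distrib
            matrix_vector_mult_diff_rdistrib)
      have "dist t s < d" using h_le h0 by (simp add: dist_real_def h_def)
      then have dB': "norm (B' t - B' s) \<le> \<eta>" using d(2)[OF tT sT] by (simp add: dist_norm)
      have n1: "norm E1 \<le> L * Z + \<eta> * (R * \<tau>)"
      proof -
        have "\<eta> * norm (tail y (-\<tau>)) \<le> \<eta> * (R * \<tau>)" using tb[OF y] \<eta> by (intro mult_left_mono) auto
        then show ?thesis
          unfolding E1_def using mv[OF B'L[OF tT] dB', of "tail x (-\<tau>)" "tail y (-\<tau>)", unfolded Zd] by
              linarith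
      qed
      have x0R: "norm (z 0) \<le> R" "norm (z (-\<tau>)) \<le> R" if "z \<in> Dbar \<tau> ?Q" for z using bd[OF that] \<tau> by auto
      have n2': "norm E2 \<le> (Kb + 1) * X + ((L + 2) * \<eta>) * R"
      proof -
        have "((L + 2) * \<eta>) * norm (y 0) \<le> ((L + 2) * \<eta>) * R" using x0R(1)[OF y] \<eta> L by (intro
            mult_left_mono) auto
        then show ?thesis
          unfolding E2_def using mv[OF Bn[OF tT] Bts, of "x 0" "y 0", folded X_def] by linarith
      qed
      have n3: "norm E3 \<le> \<eta> * R + \<eta> * R"
      proof -
        have e: "norm ((b r - B r) *v z (-\<tau>)) \<le> \<eta> * R" if "r \<in> {0..T}" "z \<in> Dbar \<tau> ?Q" for r z
          using Bb[OF that(1)] x0R(2)[OF that(2)] \<eta>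
          by (intro order_trans[OF norm_matrix_vector_mult_le] mult_mono) (auto simp: norm_minus_commute)
        show ?thesis unfolding E3_def by (intro order_trans[OF norm_triangle_ineq4] add_mono e tT sT x y)
      qed
      \<comment> \<open>The drift \<open>F\<close> sees the history only through the distributed
        delay, and \<open>a_weak\<close> bounds that difference by the coupling norm.\<close>
      have n4: "norm E4 \<le> L * (\<eta> + X + Ka * n)"
      proof -
        have "z + y = x" by (simp add: z_def)
        then have "innerH \<tau> a x - innerH \<tau> a y = innerH \<tau> a z"
          using inner_L2_add[OF zL Dspace_L2[OF yD] a_L2] by (simp add: innerH_eq inner_L2_commute[of _
              _ a])
        then have "\<bar>innerH \<tau> a x - innerH \<tau> a y\<bar> \<le> Ka * n" using a_weak[OF zL] by (simp add: n_def N_def)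
        then have "norm ((x 0, innerH \<tau> a x) - (y 0, innerH \<tau> a y)) \<le> X + Ka * n"
          using norm_Pair_le[of "x 0 - y 0" "innerH \<tau> a x - innerH \<tau> a y"] by (simp add: X_def)
        then have "L * (\<bar>s - t\<bar> + norm ((x 0, innerH \<tau> a x) - (y 0, innerH \<tau> a y))) \<le> L * (\<eta> + X + Ka * n)"
          using L h\<eta> by (intro mult_left_mono) (auto simp: h_def)
        then show ?thesis unfolding E4_def using F_lip[OF tT sT, of "(x 0, innerH \<tau> a x)" u "(y 0,
            innerH \<tau> a y)"] by linarith
      qed
      have "norm (E1 + E2 + E3 + E4) \<le> norm E1 + norm E2 + norm E3 + norm E4"
        using norm_triangle_ineq[of "E1 + E2 + E3" E4] norm_triangle_ineq[of "E1 + E2" E3]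
            norm_triangle_ineq[of E1 E2] by linarith
      also have "\<dots> \<le> L * Z + (Kb + 1 + L) * X + (L * Ka) * n + (R * \<tau> + (L + 2) * R + 2 * R + L) * \<eta>"
        using n1 n2' n3 n4 by (simp add: algebra_simps)
      finally have En: "norm (E1 + E2 + E3 + E4) \<le> L * Z + (Kb + 1 + L) * X + (L * Ka) * n + (R * \<tau> + (L
          + 2) * R + 2 * R + L) * \<eta>" .
      have T1: "2 * \<beta> * (?D \<bullet> (E1 + E2 + E3 + E4)) \<le>
          2 * \<beta> * D * (L * Z + (Kb + 1 + L) * X + (L * Ka) * n + (R * \<tau> + (L + 2) * R + 2 * R + L) * \<eta>)"
      proof -
        have "?D \<bullet> (E1 + E2 + E3 + E4) \<le> D * norm (E1 + E2 + E3 + E4)" unfolding D_def by (rule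
            norm_cauchy_schwarz)
        also have "\<dots> \<le> D * (L * Z + (Kb + 1 + L) * X + (L * Ka) * n + (R * \<tau> + (L + 2) * R + 2 * R + L)
            * \<eta>)"
          using En nn by (intro mult_left_mono) auto
        finally have "(2 * \<beta>) * (?D \<bullet> (E1 + E2 + E3 + E4)) \<le> (2 * \<beta>) * (D * (L * Z + (Kb + 1 + L) * X +
            (L * Ka) * n + (R * \<tau> + (L + 2) * R + 2 * R + L) * \<eta>))"
          using \<beta> by (intro mult_left_mono) auto
        then show ?thesis by (simp only: mult.assoc)
      qed
      \<comment> \<open>Cauchy-Schwarz in \<open>l\<close> bounds the integral of the primitive by
        \<open>sqrt \<tau> * n\<close>.\<close>
      have T2: "\<beta> * (2 * (integral {-\<tau>..0} (tail z) \<bullet> (x 0 - y 0)) - (norm (tail z (-\<tau>)))\<^sup>2) \<le>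
          2 * \<beta> * sqrt \<tau> * n * X - \<beta> * Z\<^sup>2"
      proof -
        have tc: "continuous_on {-\<tau>..0} (tail z)" by (rule continuous_on_tail[OF zL])
        have tL: "tail z \<in> L2 (-\<tau>) 0" by (rule continuous_imp_L2[OF tc])
        have "norm (integral {-\<tau>..0} (tail z)) \<le> integral {-\<tau>..0} (\<lambda>l. norm (tail z l))"
          by (intro integral_norm_bound_integral integrable_continuous_real continuous_intros tc) auto
        also have "\<dots> \<le> sqrt (0 - - \<tau>) * sqrt (inner_L2 (-\<tau>) 0 (tail z) (tail z))"
          by (rule L1_le_L2[OF tL]) (use \<tau> in simp)
        also have "inner_L2 (-\<tau>) 0 (tail z) (tail z) = N"
          unfolding N_def weak_inner_def by (rule inner_L2_eq_integral[OF tL tL])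
        finally have "norm (integral {-\<tau>..0} (tail z)) \<le> sqrt \<tau> * n" by (simp add: n_def)
        then have "norm (integral {-\<tau>..0} (tail z)) * X \<le> sqrt \<tau> * n * X" using nn by (intro
            mult_right_mono)
        then have "integral {-\<tau>..0} (tail z) \<bullet> (x 0 - y 0) \<le> sqrt \<tau> * n * X"
          using norm_cauchy_schwarz[of "integral {-\<tau>..0} (tail z)" "x 0 - y 0"] by (simp add: X_def)
        then have "\<beta> * (2 * (integral {-\<tau>..0} (tail z) \<bullet> (x 0 - y 0)) - Z\<^sup>2) \<le> \<beta> * (2 * (sqrt \<tau> * n * X)
            - Z\<^sup>2)"
          using \<beta> by (intro mult_left_mono) auto
        then show ?thesis by (simp add: Z_def algebra_simps)
      qed
      \<comment> \<open>Together with \<open>dissipation\<close> this discards both growth terms,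
        for every control.\<close>
      have neg: "\<alpha> * exp c * v \<le> 0" if "v \<le> 0" for c v using that \<alpha> by (simp add: mult_nonneg_nonpos)
      have T5: "q t (x 0) u - q s (y 0) u \<le> L * X + \<rho> \<eta> R"
      proof -
        have "max (norm (x 0)) (norm (y 0)) \<le> R" using x0R x y by simp
        then have "\<rho> \<bar>s - t\<bar> (max (norm (x 0)) (norm (y 0))) \<le> \<rho> \<bar>s - t\<bar> R"
          using modulus R unfolding local_modulus_def by (auto simp: le_max_iff_disj intro!: mono_onD[of
              "{0..}" "\<rho> \<bar>s - t\<bar>"])
        also have "\<dots> \<le> \<rho> \<eta> R"
          using modulus R h\<eta> \<eta> unfolding local_modulus_def
          by (auto simp: h_def abs_minus_commute intro!: mono_onD[of "{0..}" "\<lambda>s. \<rho> s R"])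
        finally show ?thesis using q_lip[OF tT sT, of "x 0" u "y 0"] by (simp add: X_def)
      qed
      show "2 * \<beta> * (?D \<bullet>
         (B' t *v tail x (-\<tau>) - B' s *v tail y (-\<tau>) + B t *v (x 0 - x (-\<tau>)) - B s *v (y 0 - y (-\<tau>))
          + (?F1 + b t *v x (-\<tau>)) - (?F2 + b s *v y (-\<tau>))))
        + \<beta> * (2 * (integral {-\<tau>..0} (tail (x - y)) \<bullet> (x 0 - y 0)) - (norm (tail (x - y) (-\<tau>)))\<^sup>2)
        + \<alpha> * exp (- C * t) * ((norm (x 0))\<^sup>2 - (norm (x (-\<tau>)))\<^sup>2 + 2 * (x 0 \<bullet> (?F1 + b t *v x (-\<tau>))) -
            C * growth \<tau> x)
        + \<alpha> * exp (- C * s) * ((norm (y 0))\<^sup>2 - (norm (y (-\<tau>)))\<^sup>2 + 2 * (y 0 \<bullet> (?F2 + b s *v y (-\<tau>))) -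
            C * growth \<tau> y)
        + (q t (x 0) u - q s (y 0) u) - 2 * \<kappa> \<le> ?RHS - 2 * \<kappa>"
        unfolding E using T1 T2[unfolded z_def] T5 neg[OF dissipation[OF tT xD, of u], of "- C * t"]
            neg[OF dissipation[OF sT yD, of u], of "- C * s"]
        by linarith
    qed (use T \<tau> sub super B' t s x y int in auto)
    then show ?thesis by simp
  qed
  have "\<beta> * (D\<^sup>2 + n\<^sup>2) \<le> M * (X + sqrt h + m) + \<epsilon>"
  proof -
    have "0 \<le> \<gamma> * h\<^sup>2" using \<gamma> by simp
    then show ?thesis using pen[OF tm] by linarith
  qed
  then show ?thesis
    using nn h\<eta> X2R N4 Zm Xle main unfolding m_def by blast
qed

end

section \<open>Choice of the parameters and the limit\<close>

context hjb_comparison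
begin

text \<open>The growth of \<open>W\<close> and \<open>V\<close> is linear and the penalty quadratic.
  The radius depends on \<open>\<alpha>\<close> but on no coupling parameter, so the ball can be
  fixed before \<open>\<beta>\<close>, \<open>\<gamma>\<close> and \<open>\<eta>\<close> are
  chosen.\<close>

lemma maximum_points_bounded:
  assumes \<alpha>: "\<alpha> > 0"
  obtains S where "S \<ge> 0" "\<And>t x s y. t \<in> {0..T} \<Longrightarrow> s \<in> {0..T} \<Longrightarrow> x \<in> Dspace \<tau> \<Longrightarrow> y \<in> Dspace \<tau> \<Longrightarrow>
      0 < W t x - V s y - \<alpha> * exp (- C * T) * (growth \<tau> x + growth \<tau> y) \<Longrightarrow> norm (x 0) < 1 + S \<and> norm (y
          0) < 1 + S"
proof -
  define e where "e = \<alpha> * exp (- C * T)"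
  have e: "e > 0" using \<alpha> by (simp add: e_def)
  \<comment> \<open>Young's inequality spends half of each quadratic term and leaves
    \<open>e * p\<^sup>2 < e * S\<close>.\<close>
  define S where "S = (4 * \<Lambda> + 4 * \<Lambda>\<^sup>2 / e) / e"
  have S: "S \<ge> 0" using e \<Lambda> by (simp add: S_def)
  have young: "\<Lambda> * v \<le> e * v\<^sup>2 / 2 + \<Lambda>\<^sup>2 / e / 2" for v
  proof -
    have "0 \<le> (e * v - \<Lambda>)\<^sup>2 / (2 * e)" using e by simp
    also have "\<dots> = e * v\<^sup>2 / 2 + \<Lambda>\<^sup>2 / e / 2 - \<Lambda> * v" using e by (simp add: power2_eq_square field_simps)
    finally show ?thesis by simp
  qed
  have "norm (x 0) < 1 + S \<and> norm (y 0) < 1 + S"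
    if tx: "t \<in> {0..T}" "s \<in> {0..T}" "x \<in> Dspace \<tau>" "y \<in> Dspace \<tau>" and
      pos: "0 < W t x - V s y - \<alpha> * exp (- C * T) * (growth \<tau> x + growth \<tau> y)" for t x s y
  proof -
    define p r p' r' where "p = norm (x 0)" and "r = normH \<tau> x" and "p' = norm (y 0)" and "r' = normH \<tau> y"
    have "W t x \<le> \<Lambda> * (1 + p + r)" using growth_bound[OF tx(1,3)] by (auto simp: p_def r_def abs_le_iff)
    moreover have "- V s y \<le> \<Lambda> * (1 + p' + r')" using growth_bound[OF tx(2,4)] by (auto simp: p'_def
        r'_def abs_le_iff)
    moreover have "0 < W t x - V s y - e * (2 + p\<^sup>2 + r\<^sup>2 + p'\<^sup>2 + r'\<^sup>2)"
      using pos by (simp add: e_def growth_eq p_def r_def p'_def r'_def algebra_simps)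
    ultimately have "e * (2 + p\<^sup>2 + r\<^sup>2 + p'\<^sup>2 + r'\<^sup>2) < 2 * \<Lambda> + (\<Lambda> * p + \<Lambda> * r + \<Lambda> * p' + \<Lambda> * r')"
      by (simp add: algebra_simps)
    also have "\<dots> \<le> 2 * \<Lambda> + (e * p\<^sup>2 / 2 + e * r\<^sup>2 / 2 + e * p'\<^sup>2 / 2 + e * r'\<^sup>2 / 2) + 2 * (\<Lambda>\<^sup>2 / e)"
      using young[of p] young[of r] young[of p'] young[of r'] by linarith
    finally have "e * p\<^sup>2 / 2 + e * r\<^sup>2 / 2 + e * p'\<^sup>2 / 2 + e * r'\<^sup>2 / 2 + 2 * e < 2 * \<Lambda> + 2 * (\<Lambda>\<^sup>2 / e)"
      by (simp add: algebra_simps)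
    moreover have "0 \<le> e * r\<^sup>2" "0 \<le> e * r'\<^sup>2" "0 \<le> e * p\<^sup>2" "0 \<le> e * p'\<^sup>2" using e by simp_all
    ultimately have b: "e * p\<^sup>2 < 4 * \<Lambda> + 4 * (\<Lambda>\<^sup>2 / e)" "e * p'\<^sup>2 < 4 * \<Lambda> + 4 * (\<Lambda>\<^sup>2 / e)" using e by
        linarith+
    have lt: "v < 1 + S" if "e * v\<^sup>2 < 4 * \<Lambda> + 4 * (\<Lambda>\<^sup>2 / e)" for v
    proof (rule ccontr)
      assume "\<not> v < 1 + S"
      then have "(1 + S)\<^sup>2 \<le> v\<^sup>2" using S by (intro power_mono) auto
      moreover have "S \<le> (1 + S)\<^sup>2" using S by (simp add: power2_eq_square algebra_simps)
      ultimately have "e * S \<le> e * v\<^sup>2" using e by (intro mult_left_mono) auto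
      moreover have "e * S = 4 * \<Lambda> + 4 * (\<Lambda>\<^sup>2 / e)" using e by (simp add: S_def)
      ultimately show False using that by simp
    qed
    show ?thesis using lt[OF b(1)] lt[OF b(2)] by (simp add: p_def p'_def)
  qed
  then show ?thesis using that S by blast
qed

theorem comparison:
  assumes t0: "t0 \<in> {0..T}" and x0: "x0 \<in> Dspace \<tau>"
  shows "W t0 x0 \<le> V t0 x0"
proof (rule ccontr)
  assume "\<not> W t0 x0 \<le> V t0 x0"
  define m0 where "m0 = W t0 x0 - V t0 x0"
  have m0: "m0 > 0" using \<open>\<not> W t0 x0 \<le> V t0 x0\<close> by (simp add: m0_def)
  define G where "G = growth \<tau> x0"
  have G: "G \<ge> 1" unfolding G_def by (rule growth_ge_1)
  \<comment> \<open>Each of the two penalties may consume a quarter of the assumed gap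
    \<open>m0\<close> at the base point, which leaves \<open>\<mu> = m0 / 2\<close>.\<close>
  define \<alpha> where "\<alpha> = m0 / (8 * G)"
  define \<kappa> where "\<kappa> = m0 / (8 * T)"
  define \<mu> where "\<mu> = m0 / 2"
  have pos: "\<alpha> > 0" "\<kappa> > 0" "\<mu> > 0" using m0 G T by (auto simp: \<alpha>_def \<kappa>_def \<mu>_def)
  have base: "\<mu> \<le> W t0 x0 - V t0 x0 - 2 * \<alpha> * growth \<tau> x0 - 2 * \<kappa> * T"
    using G T by (simp add: \<mu>_def \<alpha>_def \<kappa>_def G_def[symmetric] m0_def[symmetric])
  obtain S where S: "S \<ge> 0" "\<And>t x s y. t \<in> {0..T} \<Longrightarrow> s \<in> {0..T} \<Longrightarrow> x \<in> Dspace \<tau> \<Longrightarrow> y \<in> Dspace \<tau> \<Longrightarrow>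
      0 < W t x - V s y - \<alpha> * exp (- C * T) * (growth \<tau> x + growth \<tau> y) \<Longrightarrow> norm (x 0) < 1 + S \<and> norm (y
          0) < 1 + S"
    using maximum_points_bounded[OF pos(1)] by blast
  obtain Rx where Rx: "Rx \<ge> 0" "\<And>\<theta>. norm (x0 \<theta>) \<le> Rx" using Dspace_bound x0 by metis
  \<comment> \<open>Large enough for all positive maximum points, through \<open>1 + S\<close>, and
    for the whole base path, through \<open>Rx\<close>.\<close>
  define R where "R = 1 + S + Rx"
  have R: "R > 0" using S Rx by (simp add: R_def)
  have x0Q: "x0 \<in> Dbar \<tau> (ball 0 R)"
    using x0 R S(1) by (auto simp: Dbar_def R_def intro!: order_trans[OF Rx(2)])
  define M where "M = \<Lambda> * (1 + 2 * R + 2 * sqrt \<tau> * R)"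
  have M: "M \<ge> 0" unfolding M_def using \<Lambda> R \<tau> by simp
  define c3 where "c3 = R * \<tau> + (L + 2) * R + 2 * R + L"
  define c6 where "c6 = (L + 2) * R * \<tau>"
  define m where "m = (\<lambda>n. root 3 (16 * R * n\<^sup>2))"
  define \<beta> where "\<beta> = (\<lambda>k::nat. real (Suc k))"
  \<comment> \<open>Smoothing errors enter with the factor \<open>\<beta> k * \<eta> k\<close>,
    which is \<open>1 / \<beta> k\<close> for this choice.\<close>
  define \<eta> where "\<eta> = (\<lambda>k. (1 / \<beta> k)\<^sup>2)"
  have \<beta>: "\<beta> k \<ge> 1" for k by (simp add: \<beta>_def)
  have \<beta>0: "\<beta> k > 0" for k by (simp add: \<beta>_def)
  have \<eta>: "0 < \<eta> k" "\<eta> k \<le> 1" for k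
    using \<beta>[of k] by (auto simp: \<eta>_def power_le_one)
  define P where "P = (\<lambda>k D n Z X h. 0 \<le> D \<and> 0 \<le> n \<and> 0 \<le> Z \<and> 0 \<le> X \<and> 0 \<le> h \<and> h \<le> \<eta> k \<and> X \<le> 2 * R \<and> n\<^sup>2 \<le>
      4 * R\<^sup>2 * \<tau> ^ 3 \<and>
     Z \<le> m n \<and> X \<le> D + (Kb + 1) * Z + c6 * \<eta> k \<and>
     \<beta> k * (D\<^sup>2 + n\<^sup>2) \<le> M * (X + sqrt h + m n) + 1 / \<beta> k \<and>
     (\<mu> \<le> L * X + M * sqrt h \<or>
      2 * \<kappa> \<le> 2 * \<beta> k * D * (L * Z + (Kb + 1 + L) * X + (L * Ka) * n + c3 * \<eta> k)
         + 2 * \<beta> k * sqrt \<tau> * n * X - \<beta> k * Z\<^sup>2 + L * X + \<rho> (\<eta> k) R))"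
  have "\<exists>D n Z X h. P k D n Z X h" for k
    unfolding P_def m_def M_def c3_def c6_def
  proof (rule penalized_maximum[OF R pos(1,2) \<beta> \<eta> _ t0 x0Q base pos(3)])
    show "0 < 1 / \<beta> k" using \<beta>0[of k] by simp
    show "norm (x 0) < R \<and> norm (y 0) < R"
      if "t \<in> {0..T}" "s \<in> {0..T}" "x \<in> Dspace \<tau>" "y \<in> Dspace \<tau>"
        "0 < W t x - V s y - \<alpha> * exp (- C * T) * (growth \<tau> x + growth \<tau> y)" for t x s y
      using S(2)[OF that] Rx(1) by (simp add: R_def)
  qed
  then have "\<exists>D n Z X h. \<forall>k. P k (D k) (n k) (Z k) (X k) (h k)" by metis
  then obtain D n Z X h where PP: "\<And>k. P k (D k) (n k) (Z k) (X k) (h k)" by blast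
  have nn: "0 \<le> D k" "0 \<le> n k" "0 \<le> Z k" "0 \<le> X k" "0 \<le> h k" and h\<eta>: "h k \<le> \<eta> k" and X2R: "X k \<le> 2 * R"
    and n4: "(n k)\<^sup>2 \<le> 4 * R\<^sup>2 * \<tau> ^ 3" and Zm: "Z k \<le> m (n k)" and Xle: "X k \<le> D k + (Kb + 1) * Z k +
        c6 * \<eta> k"
    and pen: "\<beta> k * ((D k)\<^sup>2 + (n k)\<^sup>2) \<le> M * (X k + sqrt (h k) + m (n k)) + 1 / \<beta> k"
    and alt: "\<mu> \<le> L * X k + M * sqrt (h k) \<or>
      2 * \<kappa> \<le> 2 * \<beta> k * D k * (L * Z k + (Kb + 1 + L) * X k + (L * Ka) * n k + c3 * \<eta> k)
         + 2 * \<beta> k * sqrt \<tau> * n k * X k - \<beta> k * (Z k)\<^sup>2 + L * X k + \<rho> (\<eta> k) R" for k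
    using PP[of k] unfolding P_def by blast+
  have ib: "(\<lambda>k. 1 / \<beta> k) \<longlonglongrightarrow> 0"
    unfolding \<beta>_def using LIMSEQ_inverse_real_of_nat by (simp add: inverse_eq_divide)
  have \<eta>0: "\<eta> \<longlonglongrightarrow> 0" unfolding \<eta>_def using tendsto_power[OF ib, of 2] by simp
  define p where "p = (\<lambda>k. (D k)\<^sup>2 + (n k)\<^sup>2)"
  \<comment> \<open>First round: with everything on the right of \<open>pen\<close> bounded, the
    squares in \<open>p\<close> are of order \<open>1 / \<beta> k\<close>. This alone makes
    \<open>D\<close>, \<open>n\<close>, \<open>Z\<close> and \<open>X\<close> tend to 0.\<close>
  define K1 where "K1 = M * (2 * R + 1 + root 3 (16 * R * (4 * R\<^sup>2 * \<tau> ^ 3))) + 1"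
  have p0: "p k \<ge> 0" for k by (simp add: p_def)
  have ple: "p k \<le> K1 * (1 / \<beta> k)" for k
  proof -
    have "m (n k) \<le> root 3 (16 * R * (4 * R\<^sup>2 * \<tau> ^ 3))"
      unfolding m_def using n4[of k] R by (intro real_root_le_mono mult_left_mono) auto
    moreover have "sqrt (h k) \<le> 1" using h\<eta>[of k] \<eta>(2)[of k] by simp
    ultimately have "M * (X k + sqrt (h k) + m (n k)) \<le> M * (2 * R + 1 + root 3 (16 * R * (4 * R\<^sup>2 * \<tau> ^
        3)))"
      using X2R[of k] M by (intro mult_left_mono add_mono) auto
    moreover have "1 / \<beta> k \<le> 1" using \<beta>[of k] by simp
    ultimately have "\<beta> k * p k \<le> K1" using pen[of k] by (simp add: K1_def p_def)
    then show ?thesis using \<beta>0[of k] by (simp add: field_simps)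
  qed
  have plim: "p \<longlonglongrightarrow> 0"
  proof (rule tendsto_sandwich[OF _ _ tendsto_const])
    show "\<forall>\<^sub>F k in sequentially. 0 \<le> p k" using p0 by simp
    show "\<forall>\<^sub>F k in sequentially. p k \<le> K1 * (1 / \<beta> k)" using ple by simp
    show "(\<lambda>k. K1 * (1 / \<beta> k)) \<longlonglongrightarrow> 0" using tendsto_mult_left[OF ib, of K1] by simp
  qed
  then have sp: "(\<lambda>k. sqrt (p k)) \<longlonglongrightarrow> 0" using tendsto_real_sqrt by fastforce
  have Dlim: "D \<longlonglongrightarrow> 0"
  proof (rule tendsto_sandwich[OF _ _ tendsto_const sp])
    show "\<forall>\<^sub>F k in sequentially. 0 \<le> D k" using nn by simp
    have "D k \<le> sqrt (p k)" for k by (rule real_le_rsqrt) (simp add: p_def)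
    then show "\<forall>\<^sub>F k in sequentially. D k \<le> sqrt (p k)" by simp
  qed
  have nlim: "n \<longlonglongrightarrow> 0"
  proof (rule tendsto_sandwich[OF _ _ tendsto_const sp])
    show "\<forall>\<^sub>F k in sequentially. 0 \<le> n k" using nn by simp
    have "n k \<le> sqrt (p k)" for k by (rule real_le_rsqrt) (simp add: p_def)
    then show "\<forall>\<^sub>F k in sequentially. n k \<le> sqrt (p k)" by simp
  qed
  have "(\<lambda>k. root 3 (16 * R * (n k)\<^sup>2)) \<longlonglongrightarrow> root 3 (16 * R * 0\<^sup>2)"
    by (intro tendsto_intros nlim)
  then have mlim: "(\<lambda>k. m (n k)) \<longlonglongrightarrow> 0" by (simp add: m_def)
  have Zlim: "Z \<longlonglongrightarrow> 0"
    by (rule tendsto_sandwich[OF _ _ tendsto_const mlim]) (use nn Zm in auto)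
  have "(\<lambda>k. D k + (Kb + 1) * Z k + c6 * \<eta> k) \<longlonglongrightarrow> 0 + (Kb + 1) * 0 + c6 * 0"
    by (intro tendsto_intros Dlim Zlim \<eta>0)
  then have "(\<lambda>k. D k + (Kb + 1) * Z k + c6 * \<eta> k) \<longlonglongrightarrow> 0" by simp
  from tendsto_sandwich[OF _ _ tendsto_const this, of X] have Xlim: "X \<longlonglongrightarrow> 0" using nn Xle by simp
  have hlim: "h \<longlonglongrightarrow> 0"
    by (rule tendsto_sandwich[OF _ _ tendsto_const \<eta>0]) (use nn h\<eta> in auto)
  have shlim: "(\<lambda>k. sqrt (h k)) \<longlonglongrightarrow> 0" using tendsto_real_sqrt[OF hlim] by simp
  \<comment> \<open>Second round: the right side of \<open>pen\<close> now tends to 0, so even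
    \<open>\<beta> k * p k\<close> does.\<close>
  have "(\<lambda>k. M * (X k + sqrt (h k) + m (n k)) + 1 / \<beta> k) \<longlonglongrightarrow> M * (0 + 0 + 0) + 0"
    by (intro tendsto_intros Xlim shlim mlim ib)
  then have "(\<lambda>k. M * (X k + sqrt (h k) + m (n k)) + 1 / \<beta> k) \<longlonglongrightarrow> 0" by simp
  from tendsto_sandwich[OF _ _ tendsto_const this, of "\<lambda>k. \<beta> k * p k"]
  have \<beta>p: "(\<lambda>k. \<beta> k * p k) \<longlonglongrightarrow> 0" using pen \<beta>0 p0 by (simp add: p_def less_imp_le)
  have \<rho>lim: "(\<lambda>k. \<rho> (\<eta> k) R) \<longlonglongrightarrow> 0"
  proof -
    have c: "continuous_on ({0..} \<times> {0..}) (\<lambda>(s, r). \<rho> s r)" "\<rho> 0 R = 0"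
      using modulus R by (auto simp: local_modulus_def)
    have "(\<lambda>k. (\<eta> k, R)) \<longlonglongrightarrow> (0, R)" by (intro tendsto_intros \<eta>0)
    from continuous_on_tendsto_compose[OF c(1) this] show ?thesis
      using \<eta>(1) R c(2) by (simp add: less_imp_le)
  qed
  obtain K where K: "K \<ge> 0" "\<And>\<beta> \<eta> D n Z X. \<beta> \<ge> 0 \<Longrightarrow> \<eta> \<ge> 0 \<Longrightarrow> D \<ge> 0 \<Longrightarrow> n \<ge> 0 \<Longrightarrow> Z \<ge> 0 \<Longrightarrow> X \<ge> 0 \<Longrightarrow>
     X \<le> D + (Kb + 1) * Z + c6 * \<eta> \<Longrightarrow>
     2 * \<beta> * D * (L * Z + (Kb + 1 + L) * X + (L * Ka) * n + c3 * \<eta>) + 2 * \<beta> * sqrt \<tau> * n * X - \<beta> * Z\<^sup>2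
       \<le> K * (\<beta> * (D\<^sup>2 + n\<^sup>2) + \<beta> * \<eta> * (D + n))"
    by (rule coupling_estimate[of L "Kb + 1 + L" "L * Ka" c3 "Kb + 1" "sqrt \<tau>" c6])
       (use L Kb Ka R \<tau> in \<open>auto simp: c3_def c6_def\<close>)
  have \<beta>\<eta>: "\<beta> k * \<eta> k = 1 / \<beta> k" for k using \<beta>0[of k] by (simp add: \<eta>_def power2_eq_square field_simps)
  define err where "err = (\<lambda>k. K * (\<beta> k * p k + 1 / \<beta> k * (D k + n k)) + L * X k + \<rho> (\<eta> k) R)"
  have "err \<longlonglongrightarrow> K * (0 + 0 * (0 + 0)) + L * 0 + 0"
    unfolding err_def by (intro tendsto_intros \<beta>p ib Dlim nlim Xlim \<rho>lim)
  then have "\<forall>\<^sub>F k in sequentially. err k < 2 * \<kappa>" by (rule order_tendstoD) (use pos in simp)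
  moreover have "(\<lambda>k. L * X k + M * sqrt (h k)) \<longlonglongrightarrow> L * 0 + M * 0"
    by (intro tendsto_intros Xlim shlim)
  then have "\<forall>\<^sub>F k in sequentially. L * X k + M * sqrt (h k) < \<mu>" by (rule order_tendstoD) (use pos in simp)
  ultimately have "\<forall>\<^sub>F k in sequentially. err k < 2 * \<kappa> \<and> L * X k + M * sqrt (h k) < \<mu>" by
      eventually_elim simp
  then obtain k where k: "err k < 2 * \<kappa>" "L * X k + M * sqrt (h k) < \<mu>"
    using eventually_happens trivial_limit_sequentially by blast
  have "2 * \<beta> k * D k * (L * Z k + (Kb + 1 + L) * X k + (L * Ka) * n k + c3 * \<eta> k)
         + 2 * \<beta> k * sqrt \<tau> * n k * X k - \<beta> k * (Z k)\<^sup>2 \<le> K * (\<beta> k * ((D k)\<^sup>2 + (n k)\<^sup>2) + \<beta> k * \<eta> k *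
             (D k + n k))"
    by (rule K(2)) (use nn Xle \<beta>0[of k] \<eta>(1)[of k] in auto)
  then show False using alt[of k] k unfolding err_def p_def \<beta>\<eta> by linarith
qed

end

section \<open>Reduction of the standing assumptions to common constants\<close>

theorem theorem5p1:
  fixes T \<tau> :: real
    and a :: "real \<Rightarrow> real ^ 'd::finite"
    and b :: "real \<Rightarrow> real ^ 'd ^ 'd"
    and F :: "real \<Rightarrow> (real ^ 'd) \<times> real \<Rightarrow> 'u::metric_space \<Rightarrow> real ^ 'd"
    and q :: "real \<Rightarrow> real ^ 'd \<Rightarrow> 'u \<Rightarrow> real"
    and \<phi> :: "real ^ 'd \<Rightarrow> real"
    and W V :: "real \<Rightarrow> (real \<Rightarrow> real ^ 'd) \<Rightarrow> real"
  assumes "T > 0" and "\<tau> > 0"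
    and "assm_A1 T F" and "assm_A2 T \<tau> a b" and "assm_B1 T q \<phi>" and "assm_B2 T q \<phi>"
    and "viscosity_subsolution T \<tau> a b F q \<phi> W"
    and "viscosity_supersolution T \<tau> a b F q \<phi> V"
    and "\<exists>\<Lambda>>0.
      (\<forall>t\<in>{0..T}. \<forall>x\<in>Dspace \<tau>.
         max \<bar>W t x\<bar> \<bar>V t x\<bar> \<le> \<Lambda> * (1 + norm (x 0) + normH \<tau> x)) \<and>
      (\<forall>t\<in>{0..T}. \<forall>s\<in>{0..T}. \<forall>x\<in>Dspace \<tau>. \<forall>y\<in>Dspace \<tau>.
         max \<bar>W t x - W s y\<bar> \<bar>V t x - V s y\<bar> \<le>
           \<Lambda> * (1 + norm (x 0) + normH \<tau> x + norm (y 0) + normH \<tau> y) *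
           (norm (x 0 - y 0) + sqrt \<bar>s - t\<bar> +
            (SUP l\<in>{-\<tau>..0}. norm (LINT \<theta>|lebesgue_on {l..0}. x \<theta> - y \<theta>))))"
  shows "\<forall>t\<in>{0..T}. \<forall>x\<in>Dspace \<tau>. W t x \<le> V t x"
proof -
  obtain LF where LF: "LF > 0" "\<And>t x u. t \<in> {0..T} \<Longrightarrow> norm (F t x u) \<le> LF * (1 + norm x)"
    "\<And>t s x y u. t \<in> {0..T} \<Longrightarrow> s \<in> {0..T} \<Longrightarrow> norm (F t x u - F s y u) \<le> LF * (\<bar>s - t\<bar> + norm (x - y))"
    using \<open>assm_A1 T F\<close> unfolding assm_A1_def by blast
  obtain Lb where Lb: "Lb > 0" "\<And>t s. t \<in> {0..T} \<Longrightarrow> s \<in> {0..T} \<Longrightarrow> norm (b s - b t) \<le> Lb * \<bar>s - t\<bar>"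
    and a: "a \<in> W12 (-\<tau>) 0" "a (-\<tau>) = 0"
    using \<open>assm_A2 T \<tau> a b\<close> unfolding assm_A2_def by blast
  obtain Lg where Lg: "Lg > 0" "\<And>t x u. t \<in> {0..T} \<Longrightarrow> \<bar>q t x u\<bar> + \<bar>\<phi> x\<bar> \<le> Lg * (1 + norm x)"
    using \<open>assm_B1 T q \<phi>\<close> unfolding assm_B1_def by blast
  obtain Lq \<rho> where Lq: "Lq > 0" and \<rho>: "local_modulus \<rho>"
    and qp: "\<And>t s x y u. t \<in> {0..T} \<Longrightarrow> s \<in> {0..T} \<Longrightarrow>
      \<bar>q t x u - q s y u\<bar> + \<bar>\<phi> x - \<phi> y\<bar> \<le> Lq * norm (x - y) + \<rho> \<bar>s - t\<bar> (max (norm x) (norm y))"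
    using \<open>assm_B2 T q \<phi>\<close> unfolding assm_B2_def by blast
  obtain \<Lambda> where \<Lambda>: "\<Lambda> > 0"
    "\<And>t x. t \<in> {0..T} \<Longrightarrow> x \<in> Dspace \<tau> \<Longrightarrow> max \<bar>W t x\<bar> \<bar>V t x\<bar> \<le> \<Lambda> * (1 + norm (x 0) + normH \<tau> x)"
    "\<And>t s x y. t \<in> {0..T} \<Longrightarrow> s \<in> {0..T} \<Longrightarrow> x \<in> Dspace \<tau> \<Longrightarrow> y \<in> Dspace \<tau> \<Longrightarrow>
       max \<bar>W t x - W s y\<bar> \<bar>V t x - V s y\<bar> \<le>
           \<Lambda> * (1 + norm (x 0) + normH \<tau> x + norm (y 0) + normH \<tau> y) *
           (norm (x 0 - y 0) + sqrt \<bar>s - t\<bar> +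
            (SUP l\<in>{-\<tau>..0}. norm (LINT \<theta>|lebesgue_on {l..0}. x \<theta> - y \<theta>)))"
    using assms(9) by blast
  obtain Ka where Ka: "Ka \<ge> 0" "\<And>z. z \<in> L2 (-\<tau>) 0 \<Longrightarrow> \<bar>innerH \<tau> a z\<bar> \<le> Ka * sqrt (weak_inner \<tau> z z)"
    using W12_innerH_weak_bound[OF a \<open>\<tau> > 0\<close>] by blast
  define L where "L = LF + Lb + Lg + Lq"
  have L: "L > 0" and le: "LF \<le> L" "Lb \<le> L" "Lg \<le> L" "Lq \<le> L" using LF Lb Lg Lq by (auto simp: L_def)
  have scale: "l * v \<le> L * v" if "l \<le> L" "v \<ge> 0" for l v using that by (rule mult_right_mono)
  interpret hjb_comparison T \<tau> L "norm (b 0) + L * T" Ka \<Lambda> a b F q \<phi> \<rho> W V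
  proof
    show "norm (F t p u) \<le> L * (1 + norm p)" if "t \<in> {0..T}" for t p u
      by (rule order_trans[OF LF(2)[OF that] scale[OF le(1)]]) simp
    show "norm (F t p u - F s p' u) \<le> L * (\<bar>s - t\<bar> + norm (p - p'))" if "t \<in> {0..T}" "s \<in> {0..T}" for t
        s p p' u
      using LF(3)[OF that, of p u p'] scale[OF le(1), of "\<bar>s - t\<bar> + norm (p - p')"] by simp
    show bl: "norm (b s - b t) \<le> L * \<bar>s - t\<bar>" if "t \<in> {0..T}" "s \<in> {0..T}" for s t
      using Lb(2)[OF that] scale[OF le(2), of "\<bar>s - t\<bar>"] by simp
    show "norm (b t) \<le> norm (b 0) + L * T" if t: "t \<in> {0..T}" for t
    proof -
      have "norm (b t - b 0) \<le> L * t" using bl[of 0 t] t by simp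
      also have "\<dots> \<le> L * T" using t L by (intro mult_left_mono) auto
      finally show ?thesis using norm_triangle_ineq[of "b 0" "b t - b 0"] by simp
    qed
    show "a \<in> L2 (-\<tau>) 0" using a by (simp add: W12_def)
    show "\<bar>q t v u\<bar> \<le> L * (1 + norm v)" if "t \<in> {0..T}" for t v u
      using Lg(2)[OF that, of v u] scale[OF le(3), of "1 + norm v"] by simp
    show "\<bar>q t v u - q s w u\<bar> \<le> L * norm (v - w) + \<rho> \<bar>s - t\<bar> (max (norm v) (norm w))"
      if "t \<in> {0..T}" "s \<in> {0..T}" for t s v w u
      using qp[OF that, of v u w] scale[OF le(4), of "norm (v - w)"] by simp
    show "\<bar>\<phi> v - \<phi> w\<bar> \<le> L * norm (v - w)" for v w
    proof -
      \<comment> \<open>At equal times the modulus vanishes, so the joint estimate makes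
        \<open>\<phi>\<close> Lipschitz; any control, here \<open>undefined\<close>, may be
        inserted.\<close>
      have "\<rho> 0 (max (norm v) (norm w)) = 0" using \<rho> by (simp add: local_modulus_def le_max_iff_disj)
      then show ?thesis using qp[of 0 0 v undefined w] \<open>T > 0\<close> scale[OF le(4), of "norm (v - w)"] by simp
    qed
  qed (use assms L \<Lambda> Ka \<rho> in auto)
  show ?thesis using comparison by blast
qed

end
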